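(* Let $n\ge 1$, let $R$ be the exterior algebra in $n+1$ indeterminates and let $\mathcal C$ be an Auslander-Reiten component in the Auslander-Reiten quiver of $\operatorname{mod}R$ containing a shift of a linear module of complexity one. Then all indecomposable modules in $\mathcal C$ have self-extensions, i.e. $\operatorname{Ext}^1_R(Y,Y)\neq 0$ for every indecomposable $Y$ in $\mathcal C$.
   Context: $\Bbbk$ is an algebraically closed field and $R=\bigwedge V$ with $\dim_\Bbbk V=n+1$, graded with $V$ in degree $1$. $\operatorname{mod}R$ is the category of finitely generated graded (right) $R$-modules with degree zero homomorphisms; $\operatorname{Ext}^i_R$ denotes the derived functors of this graded $\operatorname{Hom}$, and the Auslander-Reiten quiver is that of this graded category. The graded shift is $M(i)_j=M_{i+j}$. A module with minimal graded free resolution $\cdots\to F^1\to F^0\to M\to0$ is linear if each $F^i$ is generated in degree $i$. A module of complexity one is a non-projective module whose Betti numbers $\operatorname{rank}F^i$ are bounded. *)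

theory Defs
  imports "HOL-Algebra.Generated_Groups" "HOL-Algebra.AbelCoset" "HOL-Algebra.Module"
    "HOL-Computational_Algebra.Polynomial"
begin

section \<open>Graded rings and graded right modules\<close>

definition internal_grading :: "('x, 'z) ring_scheme \<Rightarrow> (int \<Rightarrow> 'x set) \<Rightarrow> bool" where
  "internal_grading A c \<longleftrightarrow>
     (\<forall>i. subgroup (c i) (add_monoid A)) \<and>
     (\<forall>x\<in>carrier A. \<exists>!f. (\<forall>i. f i \<in> c i) \<and> finite {i. f i \<noteq> \<zero>\<^bsub>A\<^esub>} \<and>
        x = (\<Oplus>\<^bsub>A\<^esub>i\<in>{i. f i \<noteq> \<zero>\<^bsub>A\<^esub>}. f i))"

record 'a gring = "'a ring" +
  rcomp :: "int \<Rightarrow> 'a set"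

record ('a, 'm) gmodule = "('a, 'm) module" +
  mcomp :: "int \<Rightarrow> 'm set"

locale graded_ring = ring R for R :: "'a gring" (structure) +
  assumes ring_grading: "internal_grading R (rcomp R)"
    and one_comp: "\<one> \<in> rcomp R 0"
    and mult_comp: "\<lbrakk>a \<in> rcomp R i; b \<in> rcomp R j\<rbrakk> \<Longrightarrow> a \<otimes> b \<in> rcomp R (i + j)"

text \<open>
  The record of modules writes scalars on the left: \<open>a \<odot>\<^bsub>M\<^esub> x\<close> stands for the
  product \<open>x \<cdot> a\<close> of a right module, whence the order of the factors in
  \<open>smult_assoc\<close>. As for the library's modules, the multiplicative part of the record
  \<open>M\<close> carries no information.
\<close>

locale graded_right_module = R?: graded_ring R + M?: abelian_group M
  for R :: "'a gring" (structure) and M :: "('a, 'm) gmodule" (structure) +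
  assumes smult_closed: "\<lbrakk>a \<in> carrier R; x \<in> carrier M\<rbrakk> \<Longrightarrow> a \<odot>\<^bsub>M\<^esub> x \<in> carrier M"
    and smult_l_distr: "\<lbrakk>a \<in> carrier R; b \<in> carrier R; x \<in> carrier M\<rbrakk> \<Longrightarrow>
      (a \<oplus> b) \<odot>\<^bsub>M\<^esub> x = a \<odot>\<^bsub>M\<^esub> x \<oplus>\<^bsub>M\<^esub> b \<odot>\<^bsub>M\<^esub> x"
    and smult_r_distr: "\<lbrakk>a \<in> carrier R; x \<in> carrier M; y \<in> carrier M\<rbrakk> \<Longrightarrow>
      a \<odot>\<^bsub>M\<^esub> (x \<oplus>\<^bsub>M\<^esub> y) = a \<odot>\<^bsub>M\<^esub> x \<oplus>\<^bsub>M\<^esub> a \<odot>\<^bsub>M\<^esub> y"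
    and smult_assoc: "\<lbrakk>a \<in> carrier R; b \<in> carrier R; x \<in> carrier M\<rbrakk> \<Longrightarrow>
      (a \<otimes> b) \<odot>\<^bsub>M\<^esub> x = b \<odot>\<^bsub>M\<^esub> (a \<odot>\<^bsub>M\<^esub> x)"
    and smult_one: "x \<in> carrier M \<Longrightarrow> \<one> \<odot>\<^bsub>M\<^esub> x = x"
    and module_grading: "internal_grading M (mcomp M)"
    and smult_comp: "\<lbrakk>a \<in> rcomp R i; x \<in> mcomp M j\<rbrakk> \<Longrightarrow> a \<odot>\<^bsub>M\<^esub> x \<in> mcomp M (j + i)"

definition shift :: "('a, 'm) gmodule \<Rightarrow> int \<Rightarrow> ('a, 'm) gmodule" where
  "shift M i = M\<lparr>mcomp := \<lambda>j. mcomp M (i + j)\<rparr>"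

text \<open>The additive subgroup \<open>S \<cdot> A\<close> of \<open>M\<close> spanned by the products \<open>x \<cdot> a\<close>.\<close>

definition product_span :: "('a, 'm) gmodule \<Rightarrow> 'm set \<Rightarrow> 'a set \<Rightarrow> 'm set" where
  "product_span M S A = generate (add_monoid M) {a \<odot>\<^bsub>M\<^esub> x |a x. a \<in> A \<and> x \<in> S}"

definition generated_in_degree :: "'a gring \<Rightarrow> ('a, 'm) gmodule \<Rightarrow> int \<Rightarrow> bool" where
  "generated_in_degree R M i \<longleftrightarrow> product_span M (mcomp M i) (carrier R) = carrier M"


section \<open>The category of finitely generated graded modules\<close>

text \<open>
  The objects of \<open>fgmod R\<close> have their elements in a type \<open>'m\<close>, which is arbitrary
  and plays the role of the universe. For \<open>R\<close> the exterior algebra over an algebraically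
  closed field \<open>k\<close>, every finitely generated module is a finite-dimensional vector space over
  the infinite field \<open>k\<close>, so its cardinality is 1 or that of \<open>k\<close>. Hence, as soon as
  \<open>fgmod R\<close> has a nonzero object in \<open>'m\<close>, it has an isomorphic copy of every finitely
  generated graded module, and it is equivalent to the category over any larger universe.
\<close>

definition fgmod :: "'a gring \<Rightarrow> ('a, 'm) gmodule set" where
  "fgmod R = {M. graded_right_module R M \<and>
     (\<exists>S. finite S \<and> S \<subseteq> carrier M \<and> product_span M S (carrier R) = carrier M)}"

text \<open>
  Morphisms of degree zero; extensionality outside the carrier makes equality of morphisms
  coincide with equality of functions.
\<close>

definition ghom :: "'a gring \<Rightarrow> ('a, 'm) gmodule \<Rightarrow> ('a, 'm) gmodule \<Rightarrow> ('m \<Rightarrow> 'm) set" where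
  "ghom R M N = {f \<in> carrier M \<rightarrow>\<^sub>E carrier N.
     (\<forall>x\<in>carrier M. \<forall>y\<in>carrier M. f (x \<oplus>\<^bsub>M\<^esub> y) = f x \<oplus>\<^bsub>N\<^esub> f y) \<and>
     (\<forall>a\<in>carrier R. \<forall>x\<in>carrier M. f (a \<odot>\<^bsub>M\<^esub> x) = a \<odot>\<^bsub>N\<^esub> f x) \<and>
     (\<forall>i. f ` mcomp M i \<subseteq> mcomp N i)}"

definition giso :: "'a gring \<Rightarrow> ('a, 'm) gmodule \<Rightarrow> ('a, 'm) gmodule \<Rightarrow> bool" where
  "giso R M N \<longleftrightarrow> (\<exists>f\<in>ghom R M N. bij_betw f (carrier M) (carrier N))"

definition graded_submodule :: "'a gring \<Rightarrow> ('a, 'm) gmodule \<Rightarrow> 'm set \<Rightarrow> bool" where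
  "graded_submodule R M A \<longleftrightarrow> A \<subseteq> carrier M \<and>
     graded_right_module R (M\<lparr>carrier := A, mcomp := \<lambda>i. A \<inter> mcomp M i\<rparr>)"

definition indecomposable :: "'a gring \<Rightarrow> ('a, 'm) gmodule \<Rightarrow> bool" where
  "indecomposable R M \<longleftrightarrow> carrier M \<noteq> {\<zero>\<^bsub>M\<^esub>} \<and>
     (\<forall>A B. graded_submodule R M A \<and> graded_submodule R M B \<and>
        A \<inter> B = {\<zero>\<^bsub>M\<^esub>} \<and> A <+>\<^bsub>M\<^esub> B = carrier M \<longrightarrow>
        A = {\<zero>\<^bsub>M\<^esub>} \<or> B = {\<zero>\<^bsub>M\<^esub>})"

definition projective :: "'a gring \<Rightarrow> ('a, 'm) gmodule \<Rightarrow> bool" where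
  "projective R P \<longleftrightarrow> P \<in> fgmod R \<and>
     (\<forall>M\<in>fgmod R. \<forall>N\<in>fgmod R. \<forall>g\<in>ghom R M N. \<forall>f\<in>ghom R P N.
        g ` carrier M = carrier N \<longrightarrow>
        (\<exists>h\<in>ghom R P M. \<forall>x\<in>carrier P. g (h x) = f x))"


section \<open>Projective resolutions and Ext\<close>

text \<open>
  \<open>projective_resolution R M P d \<epsilon>\<close>: the complex
  \<open>\<dots> \<rightarrow> P 2 \<rightarrow> P 1 \<rightarrow> P 0 \<rightarrow> M \<rightarrow> 0\<close> with maps \<open>d i : P (i + 1) \<rightarrow> P i\<close>
  and \<open>\<epsilon> : P 0 \<rightarrow> M\<close> is exact and all \<open>P i\<close> are projective.
\<close>

definition projective_resolution ::
  "'a gring \<Rightarrow> ('a, 'm) gmodule \<Rightarrow> (nat \<Rightarrow> ('a, 'm) gmodule) \<Rightarrow> (nat \<Rightarrow> 'm \<Rightarrow> 'm) \<Rightarrow> ('m \<Rightarrow> 'm) \<Rightarrow> bool"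
  where
  "projective_resolution R M P d \<epsilon> \<longleftrightarrow>
     (\<forall>i. projective R (P i)) \<and>
     \<epsilon> \<in> ghom R (P 0) M \<and> (\<forall>i. d i \<in> ghom R (P (Suc i)) (P i)) \<and>
     \<epsilon> ` carrier (P 0) = carrier M \<and>
     d 0 ` carrier (P 1) = a_kernel (P 0) M \<epsilon> \<and>
     (\<forall>i. d (Suc i) ` carrier (P (Suc (Suc i))) = a_kernel (P (Suc i)) (P i) (d i))"

definition Hom_group ::
  "'a gring \<Rightarrow> ('a, 'm) gmodule \<Rightarrow> ('a, 'm) gmodule \<Rightarrow> ('m \<Rightarrow> 'm) monoid" where
  "Hom_group R M N = \<lparr>carrier = ghom R M N,
     monoid.mult = (\<lambda>f g. \<lambda>x\<in>carrier M. f x \<oplus>\<^bsub>N\<^esub> g x),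
     monoid.one = (\<lambda>x\<in>carrier M. \<zero>\<^bsub>N\<^esub>)\<rparr>"

definition coboundary ::
  "(nat \<Rightarrow> ('a, 'm) gmodule) \<Rightarrow> (nat \<Rightarrow> 'm \<Rightarrow> 'm) \<Rightarrow> nat \<Rightarrow> ('m \<Rightarrow> 'm) \<Rightarrow> 'm \<Rightarrow> 'm" where
  "coboundary P d i f = compose (carrier (P (Suc i))) f (d i)"

definition cocycles ::
  "'a gring \<Rightarrow> (nat \<Rightarrow> ('a, 'm) gmodule) \<Rightarrow> (nat \<Rightarrow> 'm \<Rightarrow> 'm) \<Rightarrow> ('a, 'm) gmodule \<Rightarrow> nat \<Rightarrow> ('m \<Rightarrow> 'm) set"
  where
  "cocycles R P d N i =
     kernel (Hom_group R (P i) N) (Hom_group R (P (Suc i)) N) (coboundary P d i)"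

definition coboundaries ::
  "'a gring \<Rightarrow> (nat \<Rightarrow> ('a, 'm) gmodule) \<Rightarrow> (nat \<Rightarrow> 'm \<Rightarrow> 'm) \<Rightarrow> ('a, 'm) gmodule \<Rightarrow> nat \<Rightarrow> ('m \<Rightarrow> 'm) set"
  where
  "coboundaries R P d N i = (case i of
       0 \<Rightarrow> {\<one>\<^bsub>Hom_group R (P 0) N\<^esub>}
     | Suc j \<Rightarrow> coboundary P d j ` carrier (Hom_group R (P j) N))"

text \<open>
  The \<open>i\<close>-th right derived functor of \<open>ghom R (-) N\<close> at \<open>M\<close>: the \<open>i\<close>-th cohomology of
  \<open>Hom (P, N)\<close> for a chosen projective resolution \<open>P\<close> of \<open>M\<close>. Up to isomorphism
  it does not depend on the choice.
\<close>

definition Ext ::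
  "'a gring \<Rightarrow> nat \<Rightarrow> ('a, 'm) gmodule \<Rightarrow> ('a, 'm) gmodule \<Rightarrow> ('m \<Rightarrow> 'm) set monoid" where
  "Ext R i M N =
     (let (P, d, \<epsilon>) = (SOME (P, d, \<epsilon>). projective_resolution R M P d \<epsilon>)
      in (Hom_group R (P i) N)\<lparr>carrier := cocycles R P d N i\<rparr> Mod coboundaries R P d N i)"


section \<open>Minimal graded free resolutions, linearity, complexity one\<close>

definition homogeneous_basis :: "'a gring \<Rightarrow> ('a, 'm) gmodule \<Rightarrow> 'm set \<Rightarrow> bool" where
  "homogeneous_basis R F B \<longleftrightarrow> finite B \<and> B \<subseteq> (\<Union>i. mcomp F i) \<and>
     (\<forall>x\<in>carrier F. \<exists>!r. r \<in> B \<rightarrow>\<^sub>E carrier R \<and> x = (\<Oplus>\<^bsub>F\<^esub>b\<in>B. r b \<odot>\<^bsub>F\<^esub> b))"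

definition graded_free :: "'a gring \<Rightarrow> ('a, 'm) gmodule \<Rightarrow> bool" where
  "graded_free R F \<longleftrightarrow> F \<in> fgmod R \<and> (\<exists>B. homogeneous_basis R F B)"

definition free_rank :: "'a gring \<Rightarrow> ('a, 'm) gmodule \<Rightarrow> nat" where
  "free_rank R F = (THE k. \<exists>B. homogeneous_basis R F B \<and> card B = k)"

text \<open>
  Minimality says that every \<open>d i\<close> has its image in \<open>F i \<cdot> J\<close>, where \<open>J\<close> is the ideal of
  \<open>R\<close> generated by the homogeneous elements of positive degree.
\<close>

definition minimal_free_resolution ::
  "'a gring \<Rightarrow> ('a, 'm) gmodule \<Rightarrow> (nat \<Rightarrow> ('a, 'm) gmodule) \<Rightarrow> (nat \<Rightarrow> 'm \<Rightarrow> 'm) \<Rightarrow> ('m \<Rightarrow> 'm) \<Rightarrow> bool"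
  where
  "minimal_free_resolution R M F d \<epsilon> \<longleftrightarrow>
     (\<forall>i. graded_free R (F i)) \<and>
     \<epsilon> \<in> ghom R (F 0) M \<and> (\<forall>i. d i \<in> ghom R (F (Suc i)) (F i)) \<and>
     \<epsilon> ` carrier (F 0) = carrier M \<and>
     d 0 ` carrier (F 1) = a_kernel (F 0) M \<epsilon> \<and>
     (\<forall>i. d (Suc i) ` carrier (F (Suc (Suc i))) = a_kernel (F (Suc i)) (F i) (d i)) \<and>
     (\<forall>i. d i ` carrier (F (Suc i)) \<subseteq> product_span (F i) (carrier (F i)) (\<Union>j\<in>{1..}. rcomp R j))"

definition linear_module :: "'a gring \<Rightarrow> ('a, 'm) gmodule \<Rightarrow> bool" where
  "linear_module R M \<longleftrightarrow> M \<in> fgmod R \<and>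
     (\<exists>F d \<epsilon>. minimal_free_resolution R M F d \<epsilon> \<and>
        (\<forall>i. generated_in_degree R (F i) (int i)))"

definition complexity_one :: "'a gring \<Rightarrow> ('a, 'm) gmodule \<Rightarrow> bool" where
  "complexity_one R M \<longleftrightarrow> M \<in> fgmod R \<and> \<not> projective R M \<and>
     (\<exists>F d \<epsilon>. minimal_free_resolution R M F d \<epsilon> \<and> (\<exists>c. \<forall>i. free_rank R (F i) \<le> c))"


section \<open>The Auslander-Reiten quiver\<close>

definition split_mono ::
  "'a gring \<Rightarrow> ('a, 'm) gmodule \<Rightarrow> ('a, 'm) gmodule \<Rightarrow> ('m \<Rightarrow> 'm) \<Rightarrow> bool" where
  "split_mono R X Y f \<longleftrightarrow> (\<exists>g\<in>ghom R Y X. \<forall>x\<in>carrier X. g (f x) = x)"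

definition split_epi ::
  "'a gring \<Rightarrow> ('a, 'm) gmodule \<Rightarrow> ('a, 'm) gmodule \<Rightarrow> ('m \<Rightarrow> 'm) \<Rightarrow> bool" where
  "split_epi R X Y f \<longleftrightarrow> (\<exists>g\<in>ghom R Y X. \<forall>y\<in>carrier Y. f (g y) = y)"

definition irreducible_hom ::
  "'a gring \<Rightarrow> ('a, 'm) gmodule \<Rightarrow> ('a, 'm) gmodule \<Rightarrow> ('m \<Rightarrow> 'm) \<Rightarrow> bool" where
  "irreducible_hom R X Y f \<longleftrightarrow>
     f \<in> ghom R X Y \<and> \<not> split_mono R X Y f \<and> \<not> split_epi R X Y f \<and>
     (\<forall>Z\<in>fgmod R. \<forall>h\<in>ghom R X Z. \<forall>g\<in>ghom R Z Y.
        (\<forall>x\<in>carrier X. f x = g (h x)) \<longrightarrow> split_mono R X Z h \<or> split_epi R Z Y g)"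

text \<open>
  The vertices are the isomorphism classes of indecomposable objects of \<open>fgmod R\<close>, the
  arrows come from irreducible morphisms, and a component is the set of vertices of a
  connected component of the underlying unoriented graph. Multiplicities of arrows do not
  matter for the components.
\<close>

definition ar_vertices :: "'a gring \<Rightarrow> ('a, 'm) gmodule set set" where
  "ar_vertices R =
     (let I = {M \<in> fgmod R. indecomposable R M}
      in I // {(M, N). M \<in> I \<and> N \<in> I \<and> giso R M N})"

definition ar_arrows :: "'a gring \<Rightarrow> (('a, 'm) gmodule set \<times> ('a, 'm) gmodule set) set" where
  "ar_arrows R = {(v, w). v \<in> ar_vertices R \<and> w \<in> ar_vertices R \<and>
     (\<exists>X\<in>v. \<exists>Y\<in>w. \<exists>f. irreducible_hom R X Y f)}"

definition ar_components :: "'a gring \<Rightarrow> ('a, 'm) gmodule set set set" where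
  "ar_components R = ar_vertices R // (ar_arrows R \<union> (ar_arrows R)\<inverse>)\<^sup>*"


section \<open>The exterior algebra\<close>

text \<open>
  The exterior algebra on the indeterminates \<open>x\<^sub>0, \<dots>, x\<^sub>n\<close>: an element is the family of its
  coordinates in the basis of monomials \<open>x\<^sub>S = x\<^sub>s\<^sub>1 \<and> \<dots> \<and> x\<^sub>s\<^sub>r\<close>, for
  \<open>S = {s\<^sub>1 < \<dots> < s\<^sub>r} \<subseteq> {0, \<dots>, n}\<close>. For disjoint \<open>S\<close>, \<open>T\<close> the product
  \<open>x\<^sub>S \<and> x\<^sub>T\<close> is \<open>x\<^sub>S\<^sub>\<union>\<^sub>T\<close> up to the sign of the permutation which sorts \<open>S\<close> followed by
  \<open>T\<close>, and otherwise it vanishes.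
\<close>

definition shuffle_sign :: "nat set \<Rightarrow> nat set \<Rightarrow> 'k::field" where
  "shuffle_sign S T = (- 1) ^ card {(s, t). s \<in> S \<and> t \<in> T \<and> t < s}"

definition exterior_algebra :: "nat \<Rightarrow> (nat set \<Rightarrow> 'k::field) gring" where
  "exterior_algebra n =
     (let C = {a. \<forall>S. a S \<noteq> 0 \<longrightarrow> S \<subseteq> {..n}}
      in \<lparr>carrier = C,
          monoid.mult = (\<lambda>a b U. \<Sum>S\<in>Pow U. shuffle_sign S (U - S) * a S * b (U - S)),
          monoid.one = (\<lambda>S. if S = {} then 1 else 0),
          zero = (\<lambda>S. 0),
          add = (\<lambda>a b S. a S + b S),
          rcomp = (\<lambda>j. {a \<in> C. \<forall>S. a S \<noteq> 0 \<longrightarrow> int (card S) = j})\<rparr>)"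

definition indeterminate :: "nat \<Rightarrow> nat set \<Rightarrow> 'k::field" where
  "indeterminate i = (\<lambda>S. if S = {i} then 1 else 0)"

subsection \<open>Basic facts\<close>

lemma exterior_algebra_simps:
  "carrier (exterior_algebra n) = {a. \<forall>S. a S \<noteq> 0 \<longrightarrow> S \<subseteq> {..n}}"
  "a \<otimes>\<^bsub>exterior_algebra n\<^esub> b = (\<lambda>U. \<Sum>S\<in>Pow U. shuffle_sign S (U - S) * a S * b (U - S))"
  "\<one>\<^bsub>exterior_algebra n\<^esub> = (\<lambda>S. if S = {} then 1 else 0)"
  "\<zero>\<^bsub>exterior_algebra n\<^esub> = (\<lambda>S. 0)"
  "a \<oplus>\<^bsub>exterior_algebra n\<^esub> b = (\<lambda>S. a S + b S)"
  "rcomp (exterior_algebra n) j =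
     {a. (\<forall>S. a S \<noteq> 0 \<longrightarrow> S \<subseteq> {..n}) \<and> (\<forall>S. a S \<noteq> 0 \<longrightarrow> int (card S) = j)}"
  by (simp_all add: exterior_algebra_def Let_def)

lemma finite_inversions:
  "finite S \<Longrightarrow> finite T \<Longrightarrow> finite {(s, t). s \<in> S \<and> t \<in> T \<and> t < (s::nat)}"
  by (rule finite_subset[of _ "S \<times> T"]) auto

lemma shuffle_sign_Un_left:
  assumes "finite S" "finite S'" "finite T" "S \<inter> S' = {}"
  shows "shuffle_sign (S \<union> S') T = shuffle_sign S T * (shuffle_sign S' T :: 'k::field)"
proof -
  have "{(s, t). s \<in> S \<union> S' \<and> t \<in> T \<and> t < s} =
    {(s, t). s \<in> S \<and> t \<in> T \<and> t < s} \<union> {(s, t). s \<in> S' \<and> t \<in> T \<and> t < s}" by auto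
  moreover have "{(s, t). s \<in> S \<and> t \<in> T \<and> t < s} \<inter> {(s, t). s \<in> S' \<and> t \<in> T \<and> t < s} = {}"
    using assms(4) by auto
  ultimately show ?thesis
    using assms by (simp add: shuffle_sign_def card_Un_disjoint finite_inversions power_add)
qed

lemma shuffle_sign_Un_right:
  assumes "finite S" "finite T" "finite T'" "T \<inter> T' = {}"
  shows "shuffle_sign S (T \<union> T') = shuffle_sign S T * (shuffle_sign S T' :: 'k::field)"
proof -
  have "{(s, t). s \<in> S \<and> t \<in> T \<union> T' \<and> t < s} =
    {(s, t). s \<in> S \<and> t \<in> T \<and> t < s} \<union> {(s, t). s \<in> S \<and> t \<in> T' \<and> t < s}" by auto
  moreover have "{(s, t). s \<in> S \<and> t \<in> T \<and> t < s} \<inter> {(s, t). s \<in> S \<and> t \<in> T' \<and> t < s} = {}"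
    using assms(4) by auto
  ultimately show ?thesis
    using assms by (simp add: shuffle_sign_def card_Un_disjoint finite_inversions power_add)
qed

lemma shuffle_sign_empty [simp]: "shuffle_sign {} T = 1" "shuffle_sign S {} = 1"
  by (simp_all add: shuffle_sign_def)

lemma exterior_assoc:
  fixes a b c :: "nat set \<Rightarrow> 'k::field"
  shows "(a \<otimes>\<^bsub>exterior_algebra n\<^esub> b) \<otimes>\<^bsub>exterior_algebra n\<^esub> c =
    a \<otimes>\<^bsub>exterior_algebra n\<^esub> (b \<otimes>\<^bsub>exterior_algebra n\<^esub> c)"
proof
  fix U :: "nat set"
  let ?s = "shuffle_sign :: nat set \<Rightarrow> nat set \<Rightarrow> 'k"
  show "((a \<otimes>\<^bsub>exterior_algebra n\<^esub> b) \<otimes>\<^bsub>exterior_algebra n\<^esub> c) U =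
    (a \<otimes>\<^bsub>exterior_algebra n\<^esub> (b \<otimes>\<^bsub>exterior_algebra n\<^esub> c)) U"
  proof (cases "finite U")
    case False
    then show ?thesis by (simp add: exterior_algebra_simps finite_Pow_iff)
  next
    case True
    have fin: "finite S" if "S \<subseteq> U" for S using True that by (rule rev_finite_subset)
    have "(\<Sum>S\<in>Pow U. ?s S (U - S) * (\<Sum>T\<in>Pow S. ?s T (S - T) * a T * b (S - T)) * c (U - S)) =
      (\<Sum>(S, T)\<in>Sigma (Pow U) Pow. ?s S (U - S) * (?s T (S - T) * a T * b (S - T)) * c (U - S))"
      using True by (subst sum.Sigma[symmetric])
        (auto simp: sum_distrib_left sum_distrib_right intro: fin)
    also have "\<dots> = (\<Sum>(T, W)\<in>Sigma (Pow U) (\<lambda>T. Pow (U - T)).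
        ?s T (U - T) * a T * (?s W (U - T - W) * b W * c (U - T - W)))"
    proof (rule sum.reindex_bij_witness[where i = "\<lambda>(T, W). (T \<union> W, T)" and j = "\<lambda>(S, T). (T, S - T)"],
        goal_cases)
      case (5 p)
      then obtain S T where p: "p = (S, T)" "T \<subseteq> S" "S \<subseteq> U" by auto
      let ?W = "S - T" and ?X = "U - S"
      have e: "T \<union> ?W = S" "U - T = ?W \<union> ?X" "U - T - ?W = ?X" using p by auto
      have f: "finite T" "finite ?W" "finite ?X" using p by (auto intro: fin)
      have "?s S ?X = ?s T ?X * ?s ?W ?X"
        using shuffle_sign_Un_left[of T ?W ?X] f e(1) by auto
      moreover have "?s T (U - T) = ?s T ?W * ?s T ?X"
        unfolding e(2) using p f by (intro shuffle_sign_Un_right) auto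
      ultimately show ?case by (simp add: p(1) e(3) mult_ac)
    qed auto
    also have "\<dots> = (\<Sum>T\<in>Pow U. ?s T (U - T) * a T *
        (\<Sum>W\<in>Pow (U - T). ?s W (U - T - W) * b W * c (U - T - W)))"
      using True by (subst sum.Sigma[symmetric]) (auto simp: sum_distrib_left)
    finally show ?thesis by (simp add: exterior_algebra_simps)
  qed
qed

lemma exterior_mult_closed:
  fixes a b :: "nat set \<Rightarrow> 'k::field"
  assumes "a \<in> rcomp (exterior_algebra n) i" "b \<in> rcomp (exterior_algebra n) j"
  shows "a \<otimes>\<^bsub>exterior_algebra n\<^esub> b \<in> rcomp (exterior_algebra n) (i + j)"
proof -
  have "U \<subseteq> {..n} \<and> int (card U) = i + j"
    if U: "(\<Sum>S\<in>Pow U. shuffle_sign S (U - S) * a S * b (U - S)) \<noteq> 0" for U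
  proof -
    from sum.not_neutral_contains_not_neutral[OF U] obtain S where S: "S \<subseteq> U" "a S \<noteq> 0" "b (U - S) \<noteq> 0"
      by auto
    then have *: "S \<subseteq> {..n}" "U - S \<subseteq> {..n}" "int (card S) = i" "int (card (U - S)) = j"
      using assms by (auto simp: exterior_algebra_simps)
    have U': "U = S \<union> (U - S)" using S by auto
    have "finite S" "finite (U - S)" using * by (auto intro: finite_subset)
    then have "card U = card S + card (U - S)"
      by (subst U', subst card_Un_disjoint) auto
    then show ?thesis using * U' by auto
  qed
  then show ?thesis by (simp add: exterior_algebra_simps)
qed

lemma ring_exterior_algebra: "ring (exterior_algebra n :: (nat set \<Rightarrow> 'k::field) gring)"
proof (rule ringI)
  let ?R = "exterior_algebra n :: (nat set \<Rightarrow> 'k) gring"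
  show "abelian_group ?R"
  proof (rule abelian_groupI)
    fix x assume "x \<in> carrier ?R"
    then show "\<exists>y\<in>carrier ?R. y \<oplus>\<^bsub>?R\<^esub> x = \<zero>\<^bsub>?R\<^esub>"
      by (intro bexI[of _ "\<lambda>S. - x S"]) (auto simp: exterior_algebra_simps)
  next
    fix x y assume xy: "x \<in> carrier ?R" "y \<in> carrier ?R"
    have "S \<subseteq> {..n}" if "x S + y S \<noteq> 0" for S
    proof -
      have "x S \<noteq> 0 \<or> y S \<noteq> 0" using that by auto
      then show ?thesis using xy by (auto simp: exterior_algebra_simps)
    qed
    then show "x \<oplus>\<^bsub>?R\<^esub> y \<in> carrier ?R" by (simp add: exterior_algebra_simps)
  qed (simp_all add: exterior_algebra_simps fun_eq_iff add_ac)
  show "monoid ?R"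
  proof (rule monoidI)
    fix x y assume xy: "x \<in> carrier ?R" "y \<in> carrier ?R"
    have "U \<subseteq> {..n}" if U: "(\<Sum>S\<in>Pow U. shuffle_sign S (U - S) * x S * y (U - S)) \<noteq> 0" for U
    proof -
      from sum.not_neutral_contains_not_neutral[OF U] obtain S where "S \<subseteq> U" "x S \<noteq> 0" "y (U - S) \<noteq> 0"
        by auto
      then have "S \<subseteq> {..n}" "U - S \<subseteq> {..n}" using xy by (auto simp: exterior_algebra_simps)
      then show ?thesis by auto
    qed
    then show "x \<otimes>\<^bsub>?R\<^esub> y \<in> carrier ?R" by (simp add: exterior_algebra_simps)
  next
    fix x assume x: "x \<in> carrier ?R"
    have inf: "x U = 0" if "infinite U" for U
      using x that finite_subset by (fastforce simp: exterior_algebra_simps)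
    have "(\<Sum>S\<in>Pow U. shuffle_sign S (U - S) * (if S = {} then 1 else 0) * x (U - S)) = x U" for U
    proof (cases "finite U")
      case True
      then have "(\<Sum>S\<in>Pow U. shuffle_sign S (U - S) * (if S = {} then 1 else 0) * x (U - S)) =
        (\<Sum>S\<in>{{}}. shuffle_sign S (U - S) * (if S = {} then 1 else 0) * x (U - S))"
        by (intro sum.mono_neutral_right) auto
      then show ?thesis by simp
    qed (simp add: inf)
    then show "\<one>\<^bsub>?R\<^esub> \<otimes>\<^bsub>?R\<^esub> x = x" by (simp add: exterior_algebra_simps)
    have "(\<Sum>S\<in>Pow U. shuffle_sign S (U - S) * x S * (if U - S = {} then 1 else 0)) = x U" for U
    proof (cases "finite U")
      case True
      then have "(\<Sum>S\<in>Pow U. shuffle_sign S (U - S) * x S * (if U - S = {} then 1 else 0)) =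
        (\<Sum>S\<in>{U}. shuffle_sign S (U - S) * x S * (if U - S = {} then 1 else 0))"
        by (intro sum.mono_neutral_right) auto
      then show ?thesis by simp
    qed (simp add: inf)
    then show "x \<otimes>\<^bsub>?R\<^esub> \<one>\<^bsub>?R\<^esub> = x" by (simp add: exterior_algebra_simps del: Diff_eq_empty_iff)
  qed (simp_all only: exterior_assoc, simp add: exterior_algebra_simps)
qed (simp_all add: exterior_algebra_simps fun_eq_iff sum.distrib algebra_simps)

lemma exterior_finsum:
  fixes f :: "'i \<Rightarrow> nat set \<Rightarrow> 'k::field"
  assumes "finite I" "\<And>i. i \<in> I \<Longrightarrow> f i \<in> carrier (exterior_algebra n)"
  shows "(\<Oplus>\<^bsub>exterior_algebra n\<^esub>i\<in>I. f i) = (\<lambda>S. \<Sum>i\<in>I. f i S)"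
proof -
  interpret ring "exterior_algebra n :: (nat set \<Rightarrow> 'k) gring" by (rule ring_exterior_algebra)
  show ?thesis using assms
    by (induction I rule: finite_induct)
      (auto simp: finsum_insert Pi_def, auto simp: exterior_algebra_simps)
qed

lemma graded_ring_exterior_algebra:
  "graded_ring (exterior_algebra n :: (nat set \<Rightarrow> 'k::field) gring)"
proof -
  let ?R = "exterior_algebra n :: (nat set \<Rightarrow> 'k) gring"
  interpret ring ?R by (rule ring_exterior_algebra)
  have sub: "subgroup (rcomp ?R i) (add_monoid ?R)" for i
  proof (rule group.subgroupI)
    show "group (add_monoid ?R)" by (rule add.is_group)
    fix a assume a: "a \<in> rcomp ?R i"
    then have "a \<in> carrier ?R" "(\<lambda>S. - a S) \<in> carrier ?R" by (auto simp: exterior_algebra_simps)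
    then have "\<ominus>\<^bsub>?R\<^esub> a = (\<lambda>S. - a S)"
      by (intro minus_equality) (auto simp: exterior_algebra_simps)
    then have "inv\<^bsub>add_monoid ?R\<^esub> a = (\<lambda>S. - a S)" by (simp only: a_inv_def)
    then show "inv\<^bsub>add_monoid ?R\<^esub> a \<in> rcomp ?R i"
      using a by (simp only:) (simp add: exterior_algebra_simps)
  next
    have "(\<lambda>S. 0) \<in> rcomp ?R i" by (simp add: exterior_algebra_simps)
    then show "rcomp ?R i \<noteq> {}" by blast
  next
    fix a b assume ab: "a \<in> rcomp ?R i" "b \<in> rcomp ?R i"
    have "S \<subseteq> {..n} \<and> int (card S) = i" if "a S + b S \<noteq> 0" for S
    proof -
      have "a S \<noteq> 0 \<or> b S \<noteq> 0" using that by auto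
      then show ?thesis using ab by (auto simp: exterior_algebra_simps)
    qed
    then show "a \<otimes>\<^bsub>add_monoid ?R\<^esub> b \<in> rcomp ?R i"
      by (simp add: exterior_algebra_simps)
  qed (auto simp: exterior_algebra_simps)
  have "\<exists>!f. (\<forall>i. f i \<in> rcomp ?R i) \<and> finite {i. f i \<noteq> \<zero>\<^bsub>?R\<^esub>} \<and>
        a = (\<Oplus>\<^bsub>?R\<^esub>i\<in>{i. f i \<noteq> \<zero>\<^bsub>?R\<^esub>}. f i)" if a: "a \<in> carrier ?R" for a
  proof -
    let ?g = "\<lambda>i S. if int (card S) = i then a S else 0"
    have eval: "(\<Oplus>\<^bsub>?R\<^esub>i\<in>{i. f i \<noteq> \<zero>\<^bsub>?R\<^esub>}. f i) = (\<lambda>S. f (int (card S)) S)"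
      if f: "\<forall>i. f i \<in> rcomp ?R i" "finite {i. f i \<noteq> \<zero>\<^bsub>?R\<^esub>}" for f
    proof
      fix S
      let ?I = "{i. f i \<noteq> \<zero>\<^bsub>?R\<^esub>}"
      have "(\<Oplus>\<^bsub>?R\<^esub>i\<in>?I. f i) S = (\<Sum>i\<in>?I. f i S)"
        using f by (subst exterior_finsum) (auto simp: exterior_algebra_simps)
      also have "\<dots> = (\<Sum>i\<in>?I \<union> {int (card S)}. f i S)"
        using f(2) by (intro sum.mono_neutral_left) (auto simp: exterior_algebra_simps)
      also have "\<dots> = (\<Sum>i\<in>{int (card S)}. f i S)"
        using f by (intro sum.mono_neutral_right) (auto simp: exterior_algebra_simps)
      finally show "(\<Oplus>\<^bsub>?R\<^esub>i\<in>?I. f i) S = f (int (card S)) S" by simp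
    qed
    have g1: "\<forall>i. ?g i \<in> rcomp ?R i" using a by (auto simp: exterior_algebra_simps)
    have g2: "finite {i. ?g i \<noteq> \<zero>\<^bsub>?R\<^esub>}"
    proof (rule finite_subset)
      show "{i. ?g i \<noteq> \<zero>\<^bsub>?R\<^esub>} \<subseteq> (\<lambda>S. int (card S)) ` Pow {..n}"
        using a by (auto simp: exterior_algebra_simps fun_eq_iff split: if_splits)
    qed simp
    show ?thesis
    proof (rule ex1I[of _ ?g])
      show "(\<forall>i. ?g i \<in> rcomp ?R i) \<and> finite {i. ?g i \<noteq> \<zero>\<^bsub>?R\<^esub>} \<and>
        a = (\<Oplus>\<^bsub>?R\<^esub>i\<in>{i. ?g i \<noteq> \<zero>\<^bsub>?R\<^esub>}. ?g i)"
        using g1 g2 eval[OF g1 g2] by simp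
    next
      fix f assume f: "(\<forall>i. f i \<in> rcomp ?R i) \<and> finite {i. f i \<noteq> \<zero>\<^bsub>?R\<^esub>} \<and>
        a = (\<Oplus>\<^bsub>?R\<^esub>i\<in>{i. f i \<noteq> \<zero>\<^bsub>?R\<^esub>}. f i)"
      then have aS: "a S = f (int (card S)) S" for S using eval[of f] by simp
      have "f i S = ?g i S" for i S
        using f aS[of S] by (auto simp: exterior_algebra_simps)
      then show "f = ?g" by (simp add: fun_eq_iff)
    qed
  qed
  then have "internal_grading ?R (rcomp ?R)" using sub by (simp add: internal_grading_def)
  moreover have "\<one>\<^bsub>?R\<^esub> \<in> rcomp ?R 0" by (simp add: exterior_algebra_simps)
  ultimately show ?thesis
    by unfold_locales (use exterior_mult_closed in auto)
qed

lemma exterior_indeterminates: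
  fixes n :: nat
  defines "R \<equiv> exterior_algebra n :: (nat set \<Rightarrow> 'k::field) gring"
  assumes "i \<le> n" "j \<le> n"
  shows "indeterminate i \<in> rcomp R 1"
    and "indeterminate i \<otimes>\<^bsub>R\<^esub> indeterminate i = \<zero>\<^bsub>R\<^esub>"
    and "indeterminate i \<otimes>\<^bsub>R\<^esub> indeterminate j = \<ominus>\<^bsub>R\<^esub> (indeterminate j \<otimes>\<^bsub>R\<^esub> indeterminate i)"
    and "i < j \<Longrightarrow> indeterminate i \<otimes>\<^bsub>R\<^esub> indeterminate j = (\<lambda>S. if S = {i, j} then 1 else 0)"
proof -
  interpret ring R unfolding R_def by (rule ring_exterior_algebra)
  have deg: "indeterminate l \<in> rcomp R 1" if "l \<le> n" for l
    using that by (simp add: R_def exterior_algebra_simps indeterminate_def)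
  then show "indeterminate i \<in> rcomp R 1" using assms by simp
  have prod: "(indeterminate p \<otimes>\<^bsub>R\<^esub> indeterminate q) U =
    (if p \<noteq> q \<and> U = {p, q} then shuffle_sign {p} {q} else 0)" for p q U
  proof (cases "finite U")
    case True
    have "(indeterminate p \<otimes>\<^bsub>R\<^esub> indeterminate q) U =
      (\<Sum>S\<in>Pow U. if S = {p} \<and> U - {p} = {q} then shuffle_sign {p} {q} else 0)"
      by (auto simp: R_def exterior_algebra_simps indeterminate_def intro!: sum.cong)
    also have "\<dots> = (\<Sum>S\<in>Pow U \<inter> {{p}}. if U - {p} = {q} then shuffle_sign {p} {q} else 0)"
      using True by (intro sum.mono_neutral_cong_right) auto
    also have "\<dots> = (if p \<in> U \<and> U - {p} = {q} then shuffle_sign {p} {q} else 0)"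
      by (cases "p \<in> U") (auto simp: Int_absorb1)
    also have "(p \<in> U \<and> U - {p} = {q}) = (p \<noteq> q \<and> U = {p, q})" by auto
    finally show ?thesis .
  next
    case False
    then show ?thesis by (auto simp: R_def exterior_algebra_simps finite_Pow_iff)
  qed
  show "indeterminate i \<otimes>\<^bsub>R\<^esub> indeterminate i = \<zero>\<^bsub>R\<^esub>"
    by (rule ext, subst prod) (simp add: R_def exterior_algebra_simps)
  have sgn: "shuffle_sign {p} {q} = (if q < p then - 1 else 1 :: 'k)" for p q
  proof -
    have "{(s, t). s \<in> {p} \<and> t \<in> {q} \<and> t < s} = (if q < p then {(p, q)} else {})" by auto
    then show ?thesis by (simp add: shuffle_sign_def)
  qed
  show "i < j \<Longrightarrow> indeterminate i \<otimes>\<^bsub>R\<^esub> indeterminate j = (\<lambda>S. if S = {i, j} then 1 else 0)"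
    by (rule ext, subst prod) (simp add: sgn)
  have cl: "indeterminate l \<in> carrier R" if "l \<le> n" for l
    using deg[OF that] by (simp add: R_def exterior_algebra_simps)
  have "indeterminate i \<otimes>\<^bsub>R\<^esub> indeterminate j \<oplus>\<^bsub>R\<^esub> indeterminate j \<otimes>\<^bsub>R\<^esub> indeterminate i = \<zero>\<^bsub>R\<^esub>"
  proof
    fix U
    have "(indeterminate i \<otimes>\<^bsub>R\<^esub> indeterminate j) U + (indeterminate j \<otimes>\<^bsub>R\<^esub> indeterminate i) U = 0"
      by (subst (1 2) prod) (auto simp: sgn insert_commute)
    then show "(indeterminate i \<otimes>\<^bsub>R\<^esub> indeterminate j \<oplus>\<^bsub>R\<^esub> indeterminate j \<otimes>\<^bsub>R\<^esub> indeterminate i) U = \<zero>\<^bsub>R\<^esub> U"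
      by (simp add: R_def exterior_algebra_simps(4,5))
  qed
  then show "indeterminate i \<otimes>\<^bsub>R\<^esub> indeterminate j = \<ominus>\<^bsub>R\<^esub> (indeterminate j \<otimes>\<^bsub>R\<^esub> indeterminate i)"
    using cl assms by (metis add.inv_equality m_closed minus_equality)
qed

end

theory Submission
  imports Defs "HOL-Computational_Algebra.Formal_Power_Series" "HOL-Library.Nat_Bijection"
begin

text \<open>
  Finite-dimensional graded modules are described by tuples of anticommuting matrices of square zero.
  For a vector \<open>w\<close> of coefficients call a module \<open>w\<close>-exact (\<open>exv\<close>) if multiplication by the linear
  form \<open>w\<close> is an exact differential on it. A resolution by free modules of bounded rank makes \<open>L\<close>
  \<open>w\<close>-exact for some \<open>w \<noteq> 0\<close>, and being \<open>w\<close>-exact without being free passes along irreducible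
  morphisms in both directions, hence to the whole component. If \<open>Y\<close> had no self-extensions, its
  deformations along linear changes of the variables would be trivial over formal power series, so
  that exactness of \<open>Y\<close> at one \<open>w\<close> would spread to all nonzero linear forms; over an algebraically
  closed field such a module is free (Dade's lemma), a contradiction.
\<close>

text \<open>The hard point is to carry exactness across an irreducible \<open>f\<close> from X to Y,
  where only the factorization property of \<open>f\<close> is available and a useful factorization
  has to be manufactured. Degree-one cohomology classes of the exterior algebra, that is linear
  forms \<open>z\<close> on V, supply it. Let C be the middle term of the extension with class
  \<open>z f\<close> (up to sign). The pullback of \<open>z\<close> to C is a class with values in X
  that dies under \<open>f\<close>, so \<open>f\<close> extends over the middle term of this
  pullback. That middle term need not be exact, since C contains Y; therefore C is first tensored
  with End X, which is exact where X is. A partial trace along evaluation shows that nothing is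
  lost: a splitting over C tensor End X descends to C. The trace of evaluation has coefficient one,
  with no factor dim X, so the characteristic is arbitrary. A usable \<open>z\<close> is one that
  does not annihilate X, and it exists because X is not free: freeness is encoded as annihilation by
  all coordinate forms. Free neighbours must be excluded by a separate argument, since otherwise
  \<open>z\<close> would run out along the component.\<close>

section \<open>The ring of row- and column-finite matrices\<close>

typedef (overloaded) 'k mtx = "{M :: nat \<Rightarrow> nat \<Rightarrow> 'k::zero.
    (\<forall>i. finite {j. M i j \<noteq> 0}) \<and> (\<forall>j. finite {i. M i j \<noteq> 0})}"
  morphisms ent mtx
  by (rule exI[of _ "\<lambda>_ _. 0"]) simp

setup_lifting type_definition_mtx

lemma mtx_eqI: "(\<And>i j. ent A i j = ent B i j) \<Longrightarrow> A = B"
  by (metis ent_inject ext)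

lemma ent_mtx:
  assumes "\<And>i. finite {j. M i j \<noteq> 0}" "\<And>j. finite {i. M i j \<noteq> 0}"
  shows "ent (mtx M) = M"
  using assms by (simp add: mtx_inverse)

lemma finite_row: "finite {j. ent A i j \<noteq> 0}" and finite_col: "finite {i. ent A i j \<noteq> 0}"
  using ent[of A] by auto

lift_definition tpose :: "'k::zero mtx \<Rightarrow> 'k mtx" is "\<lambda>M i j. M j i" by auto

lemma ent_transp [simp]: "ent (tpose A) i j = ent A j i"
  by transfer simp

lemma transp_transp [simp]: "tpose (tpose A) = A"
  by (rule mtx_eqI) simp

text \<open>Matrices of every size share this one ring, so ring simplification applies to all maps
  between all modules. Sources and targets are tracked by predicates, and the identity of a module
  is an idempotent of the ring instead of 1. Finite rows and columns make products defined and
  transposition total.\<close>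

instantiation mtx :: (field) ring_1
begin

lift_definition zero_mtx :: "'a mtx" is "\<lambda>_ _. 0" by simp
lift_definition one_mtx :: "'a mtx" is "\<lambda>i j. if i = j then 1 else 0" by simp
lift_definition plus_mtx :: "'a mtx \<Rightarrow> 'a mtx \<Rightarrow> 'a mtx" is "\<lambda>A B i j. A i j + B i j"
proof -
  fix A B :: "nat \<Rightarrow> nat \<Rightarrow> 'a" and i j
  assume a: "(\<forall>i. finite {j. A i j \<noteq> 0}) \<and> (\<forall>j. finite {i. A i j \<noteq> 0})"
    "(\<forall>i. finite {j. B i j \<noteq> 0}) \<and> (\<forall>j. finite {i. B i j \<noteq> 0})"
  have "finite {j. A i j + B i j \<noteq> 0}" for i
    by (rule finite_subset[of _ "{j. A i j \<noteq> 0} \<union> {j. B i j \<noteq> 0}"]) (use a in auto)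
  moreover have "finite {i. A i j + B i j \<noteq> 0}" for j
    by (rule finite_subset[of _ "{i. A i j \<noteq> 0} \<union> {i. B i j \<noteq> 0}"]) (use a in auto)
  ultimately show "(\<forall>i. finite {j. A i j + B i j \<noteq> 0}) \<and> (\<forall>j. finite {i. A i j + B i j \<noteq> 0})"
    by blast
qed
lift_definition uminus_mtx :: "'a mtx \<Rightarrow> 'a mtx" is "\<lambda>A i j. - A i j" by simp
lift_definition minus_mtx :: "'a mtx \<Rightarrow> 'a mtx \<Rightarrow> 'a mtx" is "\<lambda>A B i j. A i j - B i j"
proof -
  fix A B :: "nat \<Rightarrow> nat \<Rightarrow> 'a" and i j
  assume a: "(\<forall>i. finite {j. A i j \<noteq> 0}) \<and> (\<forall>j. finite {i. A i j \<noteq> 0})"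
    "(\<forall>i. finite {j. B i j \<noteq> 0}) \<and> (\<forall>j. finite {i. B i j \<noteq> 0})"
  have "finite {j. A i j - B i j \<noteq> 0}" for i
    by (rule finite_subset[of _ "{j. A i j \<noteq> 0} \<union> {j. B i j \<noteq> 0}"]) (use a in auto)
  moreover have "finite {i. A i j - B i j \<noteq> 0}" for j
    by (rule finite_subset[of _ "{i. A i j \<noteq> 0} \<union> {i. B i j \<noteq> 0}"]) (use a in auto)
  ultimately show "(\<forall>i. finite {j. A i j - B i j \<noteq> 0}) \<and> (\<forall>j. finite {i. A i j - B i j \<noteq> 0})"
    by blast
qed
lift_definition times_mtx :: "'a mtx \<Rightarrow> 'a mtx \<Rightarrow> 'a mtx" is
  "\<lambda>A B i j. \<Sum>l | A i l \<noteq> 0. A i l * B l j"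
proof -
  fix A B :: "nat \<Rightarrow> nat \<Rightarrow> 'a" and i j
  assume a: "(\<forall>i. finite {j. A i j \<noteq> 0}) \<and> (\<forall>j. finite {i. A i j \<noteq> 0})"
    "(\<forall>i. finite {j. B i j \<noteq> 0}) \<and> (\<forall>j. finite {i. B i j \<noteq> 0})"
  have nz: "\<exists>l. A i l \<noteq> 0 \<and> B l j \<noteq> 0" if "(\<Sum>l | A i l \<noteq> 0. A i l * B l j) \<noteq> 0" for i j
    using sum.not_neutral_contains_not_neutral[OF that] by auto
  have "finite {j. (\<Sum>l | A i l \<noteq> 0. A i l * B l j) \<noteq> 0}" for i
    by (rule finite_subset[of _ "\<Union>l\<in>{l. A i l \<noteq> 0}. {j. B l j \<noteq> 0}"]) (use a in \<open>auto dest!: nz\<close>)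
  moreover have "finite {i. (\<Sum>l | A i l \<noteq> 0. A i l * B l j) \<noteq> 0}" for j
    by (rule finite_subset[of _ "\<Union>l\<in>{l. B l j \<noteq> 0}. {i. A i l \<noteq> 0}"]) (use a in \<open>auto dest!: nz\<close>)
  ultimately show "(\<forall>i. finite {j. (\<Sum>l | A i l \<noteq> 0. A i l * B l j) \<noteq> 0}) \<and>
      (\<forall>j. finite {i. (\<Sum>l | A i l \<noteq> 0. A i l * B l j) \<noteq> 0})"
    by blast
qed

text \<open>Any finite set that catches the nonzero products may serve as range of summation; later
  entry computations choose it to fit the shape of the factors.\<close>

lemma ent_times_gen:
  assumes "finite L" "{l. ent A i l \<noteq> 0 \<and> ent B l j \<noteq> 0} \<subseteq> L"
  shows "ent (A * B :: 'a mtx) i j = (\<Sum>l\<in>L. ent A i l * ent B l j)"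
proof -
  have "ent (A * B) i j = (\<Sum>l | ent A i l \<noteq> 0. ent A i l * ent B l j)" by transfer simp
  also have "\<dots> = (\<Sum>l\<in>{l. ent A i l \<noteq> 0} \<union> L. ent A i l * ent B l j)"
    using assms(1) finite_row[of A i] by (intro sum.mono_neutral_left) auto
  also have "\<dots> = (\<Sum>l\<in>L. ent A i l * ent B l j)"
    using assms finite_row[of A i] by (intro sum.mono_neutral_right) auto
  finally show ?thesis .
qed

instance
proof
  fix a b c :: "'a mtx"
  show "a + b + c = a + (b + c)" "a + b = b + a" "0 + a = a" "- a + a = 0" "a - b = a + - b"
    by (transfer; simp add: fun_eq_iff)+
  show "(0::'a mtx) \<noteq> 1"
  proof
    assume "(0::'a mtx) = 1"
    then have "ent (0::'a mtx) 0 0 = ent 1 0 0" by simp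
    then show False by transfer simp
  qed
  show "1 * a = a"
  proof (rule mtx_eqI)
    fix i j show "ent (1 * a) i j = ent a i j"
      by (subst ent_times_gen[of "{i}"]) (auto simp: one_mtx.rep_eq)
  qed
  show "a * 1 = a"
  proof (rule mtx_eqI)
    fix i j show "ent (a * 1) i j = ent a i j"
      by (subst ent_times_gen[of "{j}"]) (auto simp: one_mtx.rep_eq)
  qed
  show "(a + b) * c = a * c + b * c"
  proof (rule mtx_eqI)
    fix i j
    let ?L = "{l. ent c l j \<noteq> 0}"
    show "ent ((a + b) * c) i j = ent (a * c + b * c) i j"
      by (simp add: plus_mtx.rep_eq ent_times_gen[OF finite_col[of c j], of _ i c]
          sum.distrib algebra_simps subset_iff)
  qed
  show "a * (b + c) = a * b + a * c"
  proof (rule mtx_eqI)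
    fix i j
    let ?L = "{l. ent a i l \<noteq> 0}"
    show "ent (a * (b + c)) i j = ent (a * b + a * c) i j"
      by (simp add: plus_mtx.rep_eq ent_times_gen[OF finite_row[of a i], of a i]
          sum.distrib algebra_simps subset_iff)
  qed
  show "a * b * c = a * (b * c)"
  proof (rule mtx_eqI)
    fix i j
    let ?L = "{l. ent a i l \<noteq> 0}" and ?M = "{m. ent c m j \<noteq> 0}"
    have "ent (a * b * c) i j = (\<Sum>m\<in>?M. (\<Sum>l\<in>?L. ent a i l * ent b l m) * ent c m j)"
      by (subst ent_times_gen[of ?M])
        (auto simp: finite_col ent_times_gen[OF finite_row[of a i], of a i] subset_iff intro!: sum.cong)
    also have "\<dots> = (\<Sum>l\<in>?L. \<Sum>m\<in>?M. ent a i l * (ent b l m * ent c m j))"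
      by (subst sum.swap) (simp add: sum_distrib_right mult.assoc)
    also have "\<dots> = ent (a * (b * c)) i j"
      by (subst ent_times_gen[of ?L])
        (auto simp: finite_row ent_times_gen[OF finite_col[of c j], of _ _ c] subset_iff sum_distrib_left
          intro!: sum.cong)
    finally show "ent (a * b * c) i j = ent (a * (b * c)) i j" .
  qed
qed

end

lemma ent_simps [simp]: "ent 0 i j = 0" "ent (A + B) i j = ent A i j + ent B i j"
  "ent (A - B) i j = ent A i j - ent B i j" "ent (- A) i j = - ent A i j"
  by (simp_all add: zero_mtx.rep_eq plus_mtx.rep_eq minus_mtx.rep_eq uminus_mtx.rep_eq)

lemma ent_one: "ent 1 i j = (if i = j then 1 else 0)"
  by (simp add: one_mtx.rep_eq)

lemma ent_sum [simp]: "ent (\<Sum>x\<in>A. F x) i j = (\<Sum>x\<in>A. ent (F x) i j)"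
  by (induction A rule: infinite_finite_induct) auto

lift_definition scl :: "'k::field \<Rightarrow> 'k mtx \<Rightarrow> 'k mtx" is "\<lambda>c A i j. c * A i j"
  by (auto intro: rev_finite_subset)

lemma ent_scl [simp]: "ent (scl c A) i j = c * ent A i j"
  by (simp add: scl.rep_eq)

lemma scl_mult_left [simp]: "scl c A * B = scl c (A * B)"
proof (rule mtx_eqI)
  fix i j show "ent (scl c A * B) i j = ent (scl c (A * B)) i j"
    by (simp, subst (1 2) ent_times_gen[of "{l. ent A i l \<noteq> 0}"])
      (auto simp: finite_row sum_distrib_left mult.assoc)
qed

lemma scl_mult_right [simp]: "A * scl c B = scl c (A * B)"
proof (rule mtx_eqI)
  fix i j show "ent (A * scl c B) i j = ent (scl c (A * B)) i j"
    by (simp, subst (1 2) ent_times_gen[of "{l. ent A i l \<noteq> 0}"])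
      (auto simp: finite_row sum_distrib_left mult_ac)
qed

lemma scl_simps [simp]: "scl 0 A = 0" "scl 1 A = A" "scl c 0 = 0" "scl c (scl d A) = scl (c * d) A"
  "scl (- c) A = - scl c A" "scl c (- A) = - scl c A"
  by (auto intro!: mtx_eqI)

lemma scl_add: "scl c (A + B) = scl c A + scl c B" and scl_diff: "scl c (A - B) = scl c A - scl c B"
  and scl_add_left: "scl (c + d) A = scl c A + scl d A"
  and scl_diff_left: "scl (c - d) A = scl c A - scl d A"
  by (auto intro!: mtx_eqI simp: algebra_simps)

lemma scl_sum: "scl c (\<Sum>x\<in>A. F x) = (\<Sum>x\<in>A. scl c (F x))"
  by (induction A rule: infinite_finite_induct) (auto simp: scl_add)

lemma scl_sum_left: "scl (\<Sum>x\<in>A. c x) F = (\<Sum>x\<in>A. scl (c x) F)"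
  by (induction A rule: infinite_finite_induct) (auto simp: scl_add_left)

lemma scl_eq_0_iff [simp]: "scl c A = 0 \<longleftrightarrow> c = 0 \<or> A = 0"
proof
  assume a: "scl c A = 0"
  have "c * ent A i j = 0" for i j using arg_cong[OF a, of "\<lambda>M. ent M i j"] by simp
  then show "c = 0 \<or> A = 0" by (auto intro!: mtx_eqI)
qed auto

lemma transp_mult: "tpose (A * B :: 'k::field mtx) = tpose B * tpose A"
proof (rule mtx_eqI)
  fix i j show "ent (tpose (A * B)) i j = ent (tpose B * tpose A) i j"
    by (simp, subst (1 2) ent_times_gen[of "{l. ent A j l \<noteq> 0}"]) (auto simp: finite_row mult.commute)
qed

lemma transp_simps: "tpose (0::'k::field mtx) = 0" "tpose (A + B :: 'k mtx) = tpose A + tpose B"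
  "tpose (A - B :: 'k mtx) = tpose A - tpose B" "tpose (- A :: 'k mtx) = - tpose A"
  "tpose (scl c A) = scl c (tpose A)" "tpose (\<Sum>x\<in>S. F x :: 'k mtx) = (\<Sum>x\<in>S. tpose (F x))"
  by (auto intro!: mtx_eqI)

lemma transp_eq_iff: "tpose A = tpose B \<longleftrightarrow> A = B"
  by (metis transp_transp)

definition unit :: "nat \<Rightarrow> nat \<Rightarrow> 'k::field mtx" where
  "unit p q = mtx (\<lambda>i j. if i = p \<and> j = q then 1 else 0)"

lemma ent_unit: "ent (unit p q) i j = (if i = p \<and> j = q then 1 else 0)"
  unfolding unit_def
  by (subst ent_mtx) (auto intro: finite_subset[of _ "{q}"] finite_subset[of _ "{p}"])

lemma ent_mult_unit: "ent (A * unit p q :: 'k::field mtx) i j = (if j = q then ent A i p else 0)"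
  by (subst ent_times_gen[of "{p}"]) (auto simp: ent_unit)

lemma ent_unit_mult: "ent (unit p q * A :: 'k::field mtx) i j = (if i = p then ent A q j else 0)"
  by (subst ent_times_gen[of "{q}"]) (auto simp: ent_unit)

lemma unit_mult_unit: "unit p q * unit r s = (if q = r then unit p s else (0::'k::field mtx))"
  by (rule mtx_eqI) (auto simp: ent_unit_mult, auto simp: ent_unit)

lemma unit_neq_0 [simp]: "unit p q \<noteq> (0::'k::field mtx)"
proof
  assume "unit p q = (0::'k mtx)"
  then have "ent (unit p q :: 'k mtx) p q = ent 0 p q" by simp
  then show False by (simp add: ent_unit)
qed

definition dmat :: "nat set \<Rightarrow> (nat \<Rightarrow> 'k::field) \<Rightarrow> 'k mtx" where
  "dmat I c = mtx (\<lambda>i j. if i = j \<and> i \<in> I then c i else 0)"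

lemma ent_dmat: "ent (dmat I c) i j = (if i = j \<and> i \<in> I then c i else 0)"
  unfolding dmat_def by (subst ent_mtx) (auto intro: rev_finite_subset[of "{_}"])

lemma ent_dmat_mult: "ent (dmat I c * A) i j = (if i \<in> I then c i * ent A i j else 0)"
  by (subst ent_times_gen[of "{i}"]) (auto simp: ent_dmat)

lemma ent_mult_dmat: "ent (A * dmat I c) i j = (if j \<in> I then c j * ent A i j else 0)"
  by (subst ent_times_gen[of "{j}"]) (auto simp: ent_dmat)

text \<open>The second factor of the Kronecker product carries the outer index.\<close>

definition kron :: "'k::field mtx \<Rightarrow> 'k mtx \<Rightarrow> 'k mtx" (infixr "\<otimes>\<^sub>k" 72) where
  "A \<otimes>\<^sub>k M = mtx (\<lambda>p q. ent M (fst (prod_decode p)) (fst (prod_decode q)) *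
       ent A (snd (prod_decode p)) (snd (prod_decode q)))"

lemma ent_kron: "ent (A \<otimes>\<^sub>k M) p q = ent M (fst (prod_decode p)) (fst (prod_decode q)) *
       ent A (snd (prod_decode p)) (snd (prod_decode q))"
proof -
  have "finite {q. ent M a (fst (prod_decode q)) * ent A b (snd (prod_decode q)) \<noteq> 0}" for a b
    by (rule finite_subset[of _ "prod_encode ` ({j. ent M a j \<noteq> 0} \<times> {j. ent A b j \<noteq> 0})"])
      (auto simp: finite_row image_iff, metis prod.collapse prod_decode_inverse)
  moreover have "finite {q. ent M (fst (prod_decode q)) a * ent A (snd (prod_decode q)) b \<noteq> 0}" for a b
    by (rule finite_subset[of _ "prod_encode ` ({j. ent M j a \<noteq> 0} \<times> {j. ent A j b \<noteq> 0})"])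
      (auto simp: finite_col image_iff, metis prod.collapse prod_decode_inverse)
  ultimately show ?thesis unfolding kron_def by (subst ent_mtx) auto
qed

lemma kron_mult: "(A \<otimes>\<^sub>k M) * (B \<otimes>\<^sub>k N) = (A * B) \<otimes>\<^sub>k (M * N)"
proof (rule mtx_eqI)
  fix p q
  obtain a b where p: "p = prod_encode (a, b)" by (metis prod.collapse prod_decode_inverse)
  obtain c d where q: "q = prod_encode (c, d)" by (metis prod.collapse prod_decode_inverse)
  let ?L = "{l. ent M a l \<noteq> 0}" and ?K = "{l. ent A b l \<noteq> 0}"
  have "ent ((A \<otimes>\<^sub>k M) * (B \<otimes>\<^sub>k N)) p q =
      (\<Sum>l\<in>prod_encode ` (?L \<times> ?K). ent (A \<otimes>\<^sub>k M) p l * ent (B \<otimes>\<^sub>k N) l q)"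
    by (rule ent_times_gen)
      (auto simp: finite_row ent_kron p image_iff, metis prod.collapse prod_decode_inverse)
  also have "\<dots> = (\<Sum>(x, y)\<in>?L \<times> ?K. ent M a x * ent N x c * (ent A b y * ent B y d))"
    by (subst sum.reindex) (auto simp: inj_prod_encode ent_kron p q mult_ac
        intro!: sum.cong)
  also have "\<dots> = ent (M * N) a c * ent (A * B) b d"
    by (subst ent_times_gen[of ?L M], simp add: finite_row, blast,
        subst ent_times_gen[of ?K A], simp add: finite_row, blast)
      (simp add: sum_product sum.cartesian_product)
  also have "\<dots> = ent ((A * B) \<otimes>\<^sub>k (M * N)) p q"
    by (simp add: ent_kron p q)
  finally show "ent ((A \<otimes>\<^sub>k M) * (B \<otimes>\<^sub>k N)) p q = ent ((A * B) \<otimes>\<^sub>k (M * N)) p q" .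
qed

lemma kron_simps: "0 \<otimes>\<^sub>k M = 0" "A \<otimes>\<^sub>k 0 = 0" "(A + B) \<otimes>\<^sub>k M = A \<otimes>\<^sub>k M + B \<otimes>\<^sub>k M"
  "A \<otimes>\<^sub>k (M + N) = A \<otimes>\<^sub>k M + A \<otimes>\<^sub>k N" "(- A) \<otimes>\<^sub>k M = - (A \<otimes>\<^sub>k M)" "A \<otimes>\<^sub>k (- M) = - (A \<otimes>\<^sub>k M)"
  "(A - B) \<otimes>\<^sub>k M = A \<otimes>\<^sub>k M - B \<otimes>\<^sub>k M" "A \<otimes>\<^sub>k (M - N) = A \<otimes>\<^sub>k M - A \<otimes>\<^sub>k N"
  "scl c A \<otimes>\<^sub>k M = scl c (A \<otimes>\<^sub>k M)" "A \<otimes>\<^sub>k scl c M = scl c (A \<otimes>\<^sub>k M)"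
  by (auto intro!: mtx_eqI simp: ent_kron algebra_simps)

lemma kron_sum: "(\<Sum>x\<in>S. F x) \<otimes>\<^sub>k M = (\<Sum>x\<in>S. F x \<otimes>\<^sub>k M)"
  "A \<otimes>\<^sub>k (\<Sum>x\<in>S. G x) = (\<Sum>x\<in>S. A \<otimes>\<^sub>k G x)"
  by (induction S rule: infinite_finite_induct) (auto simp: kron_simps)

section \<open>Block inclusions and projections\<close>

text \<open>Pairing splits the index set nat into infinitely many disjoint copies of itself, so
  direct sums and tensor products stay inside the same matrix type.\<close>

definition incl :: "nat \<Rightarrow> 'k::field mtx" where
  "incl e = mtx (\<lambda>p q. if p = prod_encode (e, q) then 1 else 0)"

lemma ent_incl: "ent (incl e) p q = (if p = prod_encode (e, q) then 1 else 0)"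
proof -
  have "finite {q. p = prod_encode (e, q)}" for p
    by (rule finite_subset[of _ "{snd (prod_decode p)}"]) auto
  then show ?thesis unfolding incl_def by (subst ent_mtx) auto
qed

abbreviation proj :: "nat \<Rightarrow> 'k::field mtx" where "proj e \<equiv> tpose (incl e)"

lemma ent_mult_incl: "ent (A * incl e) i j = ent A i (prod_encode (e, j))"
  by (subst ent_times_gen[of "{prod_encode (e, j)}"]) (auto simp: ent_incl)

lemma ent_proj_mult: "ent (proj e * A) i j = ent A (prod_encode (e, i)) j"
  by (subst ent_times_gen[of "{prod_encode (e, i)}"]) (auto simp: ent_incl)

lemma proj_incl: "proj e * incl e' = (if e = e' then 1 else 0)"
  by (rule mtx_eqI) (simp add: ent_proj_mult ent_incl ent_one)

section \<open>Graded modules in coordinates and homogeneous maps\<close>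

text \<open>The fields hold the labels of a homogeneous basis, the degrees of the basis vectors, and
  the matrices of the indeterminates.\<close>

record (overloaded) 'k mm =
  ix :: "nat set"
  dg :: "nat \<Rightarrow> int"
  ac :: "nat \<Rightarrow> 'k mtx"

text \<open>This predicate replaces typing. Besides the degree it fixes the support, so that
  \<open>idm X\<close> and \<open>idm Y\<close> act as identities on F and equality of maps is
  equality of matrices.\<close>

definition dhom :: "int \<Rightarrow> 'k::field mm \<Rightarrow> 'k mm \<Rightarrow> 'k mtx \<Rightarrow> bool" where
  "dhom d X Y F \<longleftrightarrow> (\<forall>i j. ent F i j \<noteq> 0 \<longrightarrow> i \<in> ix Y \<and> j \<in> ix X \<and> dg Y i = dg X j + d)"

definition idm :: "'k::field mm \<Rightarrow> 'k mtx" where "idm X = dmat (ix X) (\<lambda>_. 1)"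

definition sgn_of :: "int \<Rightarrow> 'k::field" where "sgn_of d = (if even d then 1 else - 1)"

text \<open>The parity operator. It anticommutes with maps of odd degree and carries the Koszul
  signs of tensor products and duals.\<close>

definition sgm :: "'k::field mm \<Rightarrow> 'k mtx" where "sgm X = dmat (ix X) (\<lambda>i. sgn_of (dg X i))"

lemma mult_eq_assoc: "a * b = c \<Longrightarrow> a * (b * z) = c * (z :: 'a::semigroup_mult)"
  by (simp add: mult.assoc[symmetric])

lemma ent_mult_nz:
  assumes "ent (A * B :: 'k::field mtx) i j \<noteq> 0"
  obtains l where "ent A i l \<noteq> 0" "ent B l j \<noteq> 0"
proof -
  have "(\<Sum>l\<in>{l. ent A i l \<noteq> 0}. ent A i l * ent B l j) \<noteq> 0"
    using assms by (subst (asm) ent_times_gen[of "{l. ent A i l \<noteq> 0}"]) (auto simp: finite_row)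
  from sum.not_neutral_contains_not_neutral[OF this] that show thesis by auto
qed

lemma dhomD: "dhom d X Y F \<Longrightarrow> ent F i j \<noteq> 0 \<Longrightarrow> i \<in> ix Y \<and> j \<in> ix X \<and> dg Y i = dg X j + d"
  by (simp add: dhom_def)

lemma dhom_out: "dhom d X Y F \<Longrightarrow> i \<notin> ix Y \<or> j \<notin> ix X \<or> dg Y i \<noteq> dg X j + d \<Longrightarrow> ent F i j = 0"
  by (auto simp: dhom_def)

lemma idm_mult_dhom [simp]: "dhom d X Y F \<Longrightarrow> idm Y * F = F"
  by (rule mtx_eqI) (auto simp: idm_def ent_dmat_mult dhom_def)

lemma dhom_mult_idm [simp]: "dhom d X Y F \<Longrightarrow> F * idm X = F"
  by (rule mtx_eqI) (auto simp: idm_def ent_mult_dmat dhom_def)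

lemma dhom_mult: "dhom d Y Z G \<Longrightarrow> dhom e X Y F \<Longrightarrow> c = d + e \<Longrightarrow> dhom c X Z (G * F)"
  unfolding dhom_def
proof (intro allI impI)
  fix i j
  assume a: "\<forall>i j. ent G i j \<noteq> 0 \<longrightarrow> i \<in> ix Z \<and> j \<in> ix Y \<and> dg Z i = dg Y j + d"
    "\<forall>i j. ent F i j \<noteq> 0 \<longrightarrow> i \<in> ix Y \<and> j \<in> ix X \<and> dg Y i = dg X j + e" "c = d + e"
    and "ent (G * F) i j \<noteq> 0"
  then obtain l where "ent G i l \<noteq> 0" "ent F l j \<noteq> 0" by (auto elim: ent_mult_nz)
  with a show "i \<in> ix Z \<and> j \<in> ix X \<and> dg Z i = dg X j + c" by fastforce
qed

lemma dhom_0 [simp]: "dhom d X Y 0"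
  by (simp add: dhom_def)

lemma dhom_add: "dhom d X Y F \<Longrightarrow> dhom d X Y G \<Longrightarrow> dhom d X Y (F + G)"
  unfolding dhom_def by (metis add.right_neutral ent_simps(2))

lemma dhom_uminus: "dhom d X Y F \<Longrightarrow> dhom d X Y (- F)"
  by (simp add: dhom_def)

lemma dhom_diff: "dhom d X Y F \<Longrightarrow> dhom d X Y G \<Longrightarrow> dhom d X Y (F - G)"
  using dhom_add[OF _ dhom_uminus, of d X Y F G] by simp

lemma dhom_scl: "dhom d X Y F \<Longrightarrow> dhom d X Y (scl c F)"
  by (auto simp: dhom_def)

lemma dhom_sum: "(\<And>x. x \<in> S \<Longrightarrow> dhom d X Y (F x)) \<Longrightarrow> dhom d X Y (\<Sum>x\<in>S. F x)"
  by (induction S rule: infinite_finite_induct) (auto intro: dhom_add)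

lemma dhom_idm: "dhom 0 X X (idm X)"
  by (auto simp: dhom_def idm_def ent_dmat split: if_splits)

lemma dhom_unit: "i \<in> ix Y \<Longrightarrow> j \<in> ix X \<Longrightarrow> dg Y i = dg X j + d \<Longrightarrow> dhom d X Y (unit i j)"
  by (auto simp: dhom_def ent_unit split: if_splits)

lemma dhom_power: "dhom 0 X X F \<Longrightarrow> dhom 0 X X (F ^ m * idm X)"
  by (induction m) (auto intro: dhom_idm dhom_mult simp: mult.assoc)

lemma dhom_sgm: "dhom 0 X X (sgm X)"
  by (auto simp: dhom_def sgm_def ent_dmat split: if_splits)

lemma sgn_of_simps: "sgn_of (a + b) = sgn_of a * (sgn_of b :: 'k::field)" "sgn_of (- a) = (sgn_of a :: 'k)"
  "sgn_of 1 = (- 1 :: 'k)" "sgn_of 0 = (1 :: 'k)" "sgn_of a * sgn_of a = (1 :: 'k)"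
  by (auto simp: sgn_of_def)

lemma sgm_mult_dhom: "dhom d X Y F \<Longrightarrow> sgm Y * F = scl (sgn_of d) (F * sgm X)"
proof (rule mtx_eqI)
  fix i j assume d: "dhom d X Y F"
  show "ent (sgm Y * F) i j = ent (scl (sgn_of d) (F * sgm X)) i j"
  proof (cases "ent F i j = 0")
    case False
    with dhomD[OF d this] show ?thesis
      by (simp add: sgm_def ent_dmat_mult ent_mult_dmat sgn_of_simps mult_ac)
  qed (simp add: sgm_def ent_dmat_mult ent_mult_dmat)
qed

lemma sgm_sgm: "sgm X * sgm X = idm X"
  by (rule mtx_eqI) (auto simp: sgm_def idm_def ent_dmat_mult ent_dmat sgn_of_simps)

lemma ent_idm: "ent (idm X) i j = (if i = j \<and> i \<in> ix X then 1 else 0)"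
  by (simp add: idm_def ent_dmat)

lemma ent_sgm: "ent (sgm X) i j = (if i = j \<and> i \<in> ix X then sgn_of (dg X i) else 0)"
  by (simp add: sgm_def ent_dmat)

lemma idm_eq_0_iff: "idm X = 0 \<longleftrightarrow> ix X = {}"
proof
  assume a: "idm X = 0"
  have "i \<notin> ix X" for i using arg_cong[OF a, of "\<lambda>M. ent M i i"] by (auto simp: ent_idm split: if_splits)
  then show "ix X = {}" by auto
qed (auto intro!: mtx_eqI simp: ent_idm)

lemma idm_idm [simp]: "idm X * idm X = idm X"
  using dhom_idm by (rule idm_mult_dhom)

section \<open>Modules over the exterior algebra as tuples of anticommuting matrices\<close>

text \<open>The squares are required to vanish separately because anticommutation does not imply
  this in characteristic two.\<close>

definition mmod :: "nat \<Rightarrow> 'k::field mm \<Rightarrow> bool" where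
  "mmod n X \<longleftrightarrow> finite (ix X) \<and> (\<forall>a\<le>n. dhom 1 X X (ac X a)) \<and>
     (\<forall>a\<le>n. \<forall>b\<le>n. ac X a * ac X b + ac X b * ac X a = 0) \<and> (\<forall>a\<le>n. ac X a * ac X a = 0)"

definition mmor :: "nat \<Rightarrow> 'k::field mm \<Rightarrow> 'k mm \<Rightarrow> 'k mtx \<Rightarrow> bool" where
  "mmor n X Y F \<longleftrightarrow> dhom 0 X Y F \<and> (\<forall>a\<le>n. F * ac X a = ac Y a * F)"

definition av :: "nat \<Rightarrow> (nat \<Rightarrow> 'k::field) \<Rightarrow> 'k mm \<Rightarrow> 'k mtx" where
  "av n w X = (\<Sum>a\<le>n. scl (w a) (ac X a))"

text \<open>Over a field, exactness of the differential is the existence of a contracting homotopy.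
  The homotopy form passes to transposes, tensor products and summands by explicit formulas.\<close>

definition exv :: "nat \<Rightarrow> (nat \<Rightarrow> 'k::field) \<Rightarrow> 'k mm \<Rightarrow> bool" where
  "exv n w X \<longleftrightarrow> (\<exists>h. dhom (- 1) X X h \<and> av n w X * h + h * av n w X = idm X)"

text \<open>The scalars \<open>z a\<close> form a class in Ext^1 of the residue field. It acts on X
  through the extension of a shift of X by X whose cocycle is \<open>z a\<close> times the identity,
  and \<open>h\<close> is a splitting of that extension. So the predicate says that the class
  annihilates X.\<close>

definition kil :: "nat \<Rightarrow> (nat \<Rightarrow> 'k::field) \<Rightarrow> 'k mm \<Rightarrow> bool" where
  "kil n z X \<longleftrightarrow> (\<exists>h. dhom (- 1) X X h \<and> (\<forall>a\<le>n. ac X a * h + h * ac X a = scl (z a) (idm X)))"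

text \<open>Freeness in cohomological form: every coordinate class annihilates X, and the splittings
  behave like contractions with the dual variables. Modules with a homogeneous basis over the
  algebra have this property (\<open>free_basis_rep\<close>), and it implies projectivity
  (\<open>ffree_projective\<close>).\<close>

definition ffree :: "nat \<Rightarrow> 'k::field mm \<Rightarrow> bool" where
  "ffree n X \<longleftrightarrow> (\<forall>b\<le>n. kil n (\<lambda>a. if a = b then 1 else 0) X)"

definition indec :: "nat \<Rightarrow> 'k::field mm \<Rightarrow> bool" where
  "indec n X \<longleftrightarrow> ix X \<noteq> {} \<and> (\<forall>p. mmor n X X p \<and> p * p = p \<longrightarrow> p = 0 \<or> p = idm X)"

definition mirr :: "nat \<Rightarrow> 'k::field mm \<Rightarrow> 'k mm \<Rightarrow> 'k mtx \<Rightarrow> bool" where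
  "mirr n X Y f \<longleftrightarrow> mmor n X Y f \<and> \<not> (\<exists>g. mmor n Y X g \<and> g * f = idm X) \<and>
     \<not> (\<exists>g. mmor n Y X g \<and> f * g = idm Y) \<and>
     (\<forall>Z h g. mmod n Z \<and> mmor n X Z h \<and> mmor n Z Y g \<and> f = g * h \<longrightarrow>
        (\<exists>r. mmor n Z X r \<and> r * h = idm X) \<or> (\<exists>s. mmor n Y Z s \<and> g * s = idm Y))"

lemma mmodD: assumes "mmod n X"
  shows "finite (ix X)" "a \<le> n \<Longrightarrow> dhom 1 X X (ac X a)" "a \<le> n \<Longrightarrow> ac X a * ac X a = 0"
    "a \<le> n \<Longrightarrow> b \<le> n \<Longrightarrow> ac X a * ac X b = - (ac X b * ac X a)"
  using assms by (auto simp: mmod_def eq_neg_iff_add_eq_0)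

lemma mmorD: "mmor n X Y F \<Longrightarrow> dhom 0 X Y F" "mmor n X Y F \<Longrightarrow> a \<le> n \<Longrightarrow> F * ac X a = ac Y a * F"
  by (auto simp: mmor_def)

lemma mmor_mult: "mmor n Y Z G \<Longrightarrow> mmor n X Y F \<Longrightarrow> mmor n X Z (G * F)"
  unfolding mmor_def
proof (intro conjI allI impI, goal_cases)
  case 1 then show ?case by (auto intro: dhom_mult)
next
  case (2 a)
  then have "F * ac X a = ac Y a * F" "G * ac Y a = ac Z a * G" by auto
  then show ?case by (metis mult.assoc)
qed

lemma mmor_idm: "mmod n X \<Longrightarrow> mmor n X X (idm X)"
  using idm_mult_dhom dhom_mult_idm mmodD(2)[of n X] by (fastforce simp: mmor_def dhom_idm)

lemma mmor_add: "mmor n X Y F \<Longrightarrow> mmor n X Y G \<Longrightarrow> mmor n X Y (F + G)"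
  by (auto simp: mmor_def dhom_add algebra_simps)

lemma mmor_diff: "mmor n X Y F \<Longrightarrow> mmor n X Y G \<Longrightarrow> mmor n X Y (F - G)"
  by (auto simp: mmor_def dhom_diff algebra_simps)

lemma mmor_0: "mmor n X Y 0"
  by (auto simp: mmor_def)

lemma mmor_sum: "(\<And>x. x \<in> S \<Longrightarrow> mmor n X Y (F x)) \<Longrightarrow> mmor n X Y (\<Sum>x\<in>S. F x)"
  by (induction S rule: infinite_finite_induct) (auto intro: mmor_add mmor_0)

lemma mmor_power: "mmod n X \<Longrightarrow> mmor n X X F \<Longrightarrow> mmor n X X (F ^ m * idm X)"
  by (induction m) (auto intro: mmor_idm mmor_mult simp: mult.assoc)

lemma dhom_av: "mmod n X \<Longrightarrow> dhom 1 X X (av n w X)"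
  unfolding av_def by (intro dhom_sum dhom_scl) (auto dest: mmodD)

lemma mmor_av: "mmor n X Y F \<Longrightarrow> F * av n w X = av n w Y * F"
  by (auto simp: av_def sum_distrib_left sum_distrib_right mmorD intro!: sum.cong)

lemma av_ac_anti: "mmod n X \<Longrightarrow> a \<le> n \<Longrightarrow> av n w X * ac X a = - (ac X a * av n w X)"
  by (auto simp: av_def sum_distrib_left sum_distrib_right mmodD(4)[of n X _ a] sum_negf[symmetric]
      intro!: sum.cong)

lemma av_anti: "mmod n X \<Longrightarrow> av n w X * av n w' X = - (av n w' X * av n w X)"
  unfolding av_def[of n w'] by (auto simp: sum_distrib_left sum_distrib_right av_ac_anti sum_negf[symmetric]
      intro!: sum.cong)

lemma av_square: assumes "mmod n X" shows "av n w X * av n w X = 0"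
proof -
  \<comment> \<open>Induction over partial sums, since the identity v v = - v v from anticommutation
    is empty in characteristic two.\<close>
  have "(\<Sum>a<m. scl (w a) (ac X a)) * (\<Sum>a<m. scl (w a) (ac X a)) = 0" if "m \<le> Suc n" for m
    using that
  proof (induction m)
    case (Suc m)
    let ?S = "\<Sum>a<m. scl (w a) (ac X a)"
    have "?S * ac X m = - (ac X m * ?S)"
      using Suc.prems by (auto simp: sum_distrib_left sum_distrib_right mmodD(4)[OF assms, of _ m]
          sum_negf[symmetric] intro!: sum.cong)
    with Suc mmodD(3)[OF assms, of m] show ?case
      by (simp add: distrib_left distrib_right)
  qed simp
  from this[of "Suc n"] show ?thesis by (simp add: av_def lessThan_Suc_atMost)
qed

section \<open>Linear dependence and Fitting's lemma\<close>

text \<open>Elimination of one coordinate: a vector with nonzero \<open>s\<close>-entry is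
  subtracted from the others in suitable multiples, which removes one vector and one
  coordinate.\<close>

lemma dependent_family:
  fixes f :: "'i \<Rightarrow> 's \<Rightarrow> 'k::field"
  assumes "finite S" "finite I" "card S < card I"
  shows "\<exists>c. (\<exists>i\<in>I. c i \<noteq> 0) \<and> (\<forall>s\<in>S. (\<Sum>i\<in>I. c i * f i s) = 0)"
  using assms
proof (induction S arbitrary: I f rule: finite_induct)
  case empty
  then obtain i where "i \<in> I" by fastforce
  then show ?case by (intro exI[of _ "\<lambda>_. 1"]) auto
next
  case (insert s S)
  show ?case
  proof (cases "\<forall>i\<in>I. f i s = 0")
    case True
    with insert.IH[of I f] insert.prems insert.hyps show ?thesis by auto
  next
    case False
    then obtain i0 where i0: "i0 \<in> I" "f i0 s \<noteq> 0" by auto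
    let ?I = "I - {i0}"
    define g where "g i t = f i t - f i s / f i0 s * f i0 t" for i t
    have "card S < card ?I" using insert i0 by simp
    from insert.IH[OF _ this, of g] insert.prems obtain c
      where c: "\<exists>i\<in>?I. c i \<noteq> 0" "\<forall>t\<in>S. (\<Sum>i\<in>?I. c i * g i t) = 0" by auto
    define c' where "c' i = (if i = i0 then - (\<Sum>i\<in>?I. c i * f i s / f i0 s) else c i)" for i
    have sum: "(\<Sum>i\<in>I. c' i * f i t) = (\<Sum>i\<in>?I. c i * g i t)" for t
    proof -
      have "(\<Sum>i\<in>I. c' i * f i t) = c' i0 * f i0 t + (\<Sum>i\<in>?I. c' i * f i t)"
        using insert.prems i0 by (simp add: sum.remove)
      also have "(\<Sum>i\<in>?I. c' i * f i t) = (\<Sum>i\<in>?I. c i * f i t)"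
        by (rule sum.cong) (auto simp: c'_def)
      also have "c' i0 * f i0 t + \<dots> = (\<Sum>i\<in>?I. c i * g i t)"
        by (simp add: c'_def g_def algebra_simps sum_subtractf sum_distrib_right sum_distrib_left)
      finally show ?thesis .
    qed
    have "g i s = 0" for i using i0 by (simp add: g_def)
    then have "\<forall>t\<in>insert s S. (\<Sum>i\<in>I. c' i * f i t) = 0" using c(2) by (auto simp: sum)
    moreover have "\<exists>i\<in>I. c' i \<noteq> 0" using c(1) by (auto simp: c'_def)
    ultimately show ?thesis by blast
  qed
qed

lemma dependent_matrices:
  fixes F :: "nat \<Rightarrow> 'k::field mtx"
  assumes "finite I" "finite J" "card I * card J < N"
    and "\<And>l i j. l < N \<Longrightarrow> ent (F l) i j \<noteq> 0 \<Longrightarrow> i \<in> I \<and> j \<in> J"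
  shows "\<exists>c. (\<exists>l<N. c l \<noteq> 0) \<and> (\<Sum>l<N. scl (c l) (F l)) = 0"
proof -
  have "\<exists>c. (\<exists>l\<in>{..<N}. c l \<noteq> 0) \<and>
      (\<forall>s\<in>I \<times> J. (\<Sum>l<N. c l * ent (F l) (fst s) (snd s)) = 0)"
    using assms(1-3) by (intro dependent_family) (auto simp: card_cartesian_product)
  then obtain c where c: "\<exists>l\<in>{..<N}. c l \<noteq> 0"
    "\<And>i j. i \<in> I \<Longrightarrow> j \<in> J \<Longrightarrow> (\<Sum>l<N. c l * ent (F l) i j) = 0" by force
  have "(\<Sum>l<N. scl (c l) (F l)) = 0"
  proof (rule mtx_eqI)
    fix i j
    show "ent (\<Sum>l<N. scl (c l) (F l)) i j = ent 0 i j"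
    proof (cases "(i, j) \<in> I \<times> J")
      case True then show ?thesis using c(2)[of i j] by simp
    next
      case False
      then have "ent (F l) i j = 0" if "l < N" for l using assms(4)[OF that, of i j] by blast
      then show ?thesis by simp
    qed
  qed
  with c(1) show ?thesis by auto
qed

lemma algebraic:
  assumes "finite (ix X)" "dhom 0 X X F"
  shows "\<exists>N c. (\<exists>l<N. c l \<noteq> 0) \<and> (\<Sum>l<N. scl (c l) (F ^ l * idm X)) = 0"
proof -
  have "\<exists>c. (\<exists>l<card (ix X) * card (ix X) + 1. c l \<noteq> 0) \<and>
      (\<Sum>l<card (ix X) * card (ix X) + 1. scl (c l) (F ^ l * idm X)) = 0"
    using assms(1) dhomD[OF dhom_power[OF assms(2)]] by (intro dependent_matrices[of "ix X" "ix X"]) auto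
  then show ?thesis by blast
qed

lemma power_comm: "A * B = B * A \<Longrightarrow> A ^ m * B = B * (A::'a::monoid_mult) ^ m"
  by (rule power_commuting_commutes)

text \<open>Dividing an annihilating polynomial of F by its lowest nonzero term exhibits F^m as
  F^(m+1) times a polynomial \<chi> in F. Being a polynomial in F, \<chi> commutes with every
  homogeneous map that commutes with F; if F is a morphism, so is \<chi>.\<close>

lemma pi_regular:
  assumes "finite (ix X)" "dhom 0 X X F"
  shows "\<exists>m \<chi>. F ^ m * idm X = F ^ m * (F * \<chi>) \<and> dhom 0 X X \<chi> \<and>
     (\<forall>d G. dhom d X X G \<and> G * F = F * G \<longrightarrow> G * \<chi> = \<chi> * G)"
proof -
  obtain N c where c: "\<exists>l<N. c l \<noteq> 0" "(\<Sum>l<N. scl (c l) (F ^ l * idm X)) = 0"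
    using algebraic[OF assms] by blast
  define m where "m = (LEAST l. l < N \<and> c l \<noteq> 0)"
  have m: "m < N" "c m \<noteq> 0" using LeastI_ex[of "\<lambda>l. l < N \<and> c l \<noteq> 0"] c(1) by (auto simp: m_def)
  have lt: "c l = 0" if "l < m" for l using not_less_Least[of l "\<lambda>l. l < N \<and> c l \<noteq> 0"] that m by (auto simp: m_def)
  define \<chi> where "\<chi> = (\<Sum>l\<in>{m<..<N}. scl (- c l / c m) (F ^ (l - m - 1) * idm X))"
  have "0 = (\<Sum>l<N. scl (c l) (F ^ l * idm X))" using c by simp
  also have "\<dots> = (\<Sum>l\<in>insert m {m<..<N}. scl (c l) (F ^ l * idm X))"
  proof (rule sum.mono_neutral_right)
    show "\<forall>l\<in>{..<N} - insert m {m<..<N}. scl (c l) (F ^ l * idm X) = 0"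
    proof
      fix l assume "l \<in> {..<N} - insert m {m<..<N}"
      then have "l < m" by auto
      from lt[OF this] show "scl (c l) (F ^ l * idm X) = 0" by simp
    qed
  qed (use m(1) in auto)
  also have "\<dots> = scl (c m) (F ^ m * idm X) + (\<Sum>l\<in>{m<..<N}. scl (c l) (F ^ l * idm X))" by simp
  also have "(\<Sum>l\<in>{m<..<N}. scl (c l) (F ^ l * idm X)) = - scl (c m) (F ^ m * (F * \<chi>))"
  proof -
    have "F ^ m * (F * (F ^ (l - m - 1) * idm X)) = F ^ l * idm X" if "l \<in> {m<..<N}" for l
    proof -
      have "F ^ l = F ^ (m + (1 + (l - m - 1)))" using that by simp
      then show ?thesis by (simp only: power_add power_one_right mult.assoc)
    qed
    then have "F ^ m * (F * \<chi>) = (\<Sum>l\<in>{m<..<N}. scl (- c l / c m) (F ^ l * idm X))"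
      by (auto simp: \<chi>_def sum_distrib_left intro!: sum.cong)
    then show ?thesis using m(2) by (simp add: scl_sum sum_negf[symmetric])
  qed
  finally have "scl (c m) (F ^ m * idm X - F ^ m * (F * \<chi>)) = 0" by (simp add: scl_diff)
  then have "F ^ m * idm X = F ^ m * (F * \<chi>)" using m by simp
  moreover have "dhom 0 X X \<chi>" unfolding \<chi>_def by (intro dhom_sum dhom_scl dhom_power assms)
  moreover have "G * \<chi> = \<chi> * G" if G: "dhom d X X G" "G * F = F * G" for d G
  proof -
    have "G * (F ^ l * idm X) = F ^ l * idm X * G" for l
    proof -
      have "G * F ^ l = F ^ l * G" using power_comm[OF G(2)[symmetric], of l] by simp
      then have "G * (F ^ l * idm X) = F ^ l * (G * idm X)" by (metis mult.assoc)
      also have "G * idm X = idm X * G" using G(1) by simp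
      finally show ?thesis by (simp only: mult.assoc)
    qed
    then show ?thesis by (auto simp: \<chi>_def sum_distrib_left sum_distrib_right intro!: sum.cong)
  qed
  ultimately show ?thesis by blast
qed

lemma power_mult_comm: "A * B = B * (A::'a::monoid_mult) \<Longrightarrow> (A * B) ^ m = A ^ m * B ^ m"
proof (induction m)
  case (Suc m)
  have "A * B * (A ^ m * B ^ m) = A * (B * A ^ m) * B ^ m" by (simp add: mult.assoc)
  also have "B * A ^ m = A ^ m * B" using power_comm[OF Suc.prems, of m] by simp
  finally show ?case using Suc by (simp add: mult.assoc)
qed simp

text \<open>With \<chi> from \<open>pi_regular\<close>, the map e = (F \<chi>)^m is an idempotent
  morphism and F^m e = F^m, so e projects onto the stable part of F. Indecomposability leaves e = 0,
  when F is nilpotent, and e = 1, when F is invertible.\<close>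

lemma fitting:
  assumes X: "mmod n X" "indec n X" and F: "mmor n X X F"
  shows "(\<exists>G. mmor n X X G \<and> F * G = idm X \<and> G * F = idm X) \<or> (\<exists>m. F ^ m * idm X = 0)"
proof -
  note dF = mmorD(1)[OF F]
  obtain m \<chi> where m: "F ^ m * idm X = F ^ m * (F * \<chi>)" and \<chi>: "dhom 0 X X \<chi>"
    and com: "\<And>d G. dhom d X X G \<Longrightarrow> G * F = F * G \<Longrightarrow> G * \<chi> = \<chi> * G"
    using pi_regular[OF mmodD(1)[OF X(1)] dF] by blast
  have "\<chi> * ac X a = ac X a * \<chi>" if "a \<le> n" for a
    using com[OF mmodD(2)[OF X(1) that]] mmorD(2)[OF F that] by simp
  then have \<chi>m: "mmor n X X \<chi>" using \<chi> by (auto simp: mmor_def)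
  have F\<chi>: "F * \<chi> = \<chi> * F" using com[OF dF] by simp
  define u where "u = F * \<chi>"
  have u: "mmor n X X u" unfolding u_def by (rule mmor_mult[OF F \<chi>m])
  have Au: "F ^ m * idm X * u ^ k * idm X = F ^ m * idm X" for k
  proof (induction k)
    case (Suc k)
    have iu: "idm X * (u * Z) = u * Z" for Z using mmorD(1)[OF u] by (intro mult_eq_assoc) simp
    have "F ^ m * idm X * u ^ Suc k * idm X = (F ^ m * u) * (u ^ k * idm X)"
      by (simp add: mult.assoc iu)
    also have "F ^ m * u = F ^ m * idm X" using m by (simp add: u_def)
    finally show ?case using Suc by (simp add: mult.assoc)
  qed (simp add: mult.assoc)
  define e where "e = u ^ m * idm X"
  have em: "mmor n X X e" unfolding e_def by (rule mmor_power[OF X(1) u])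
  have e1: "e = \<chi> ^ m * (F ^ m * idm X)"
    using power_mult_comm[of \<chi> F m] F\<chi> by (simp add: e_def u_def mult.assoc)
  have "e * e = \<chi> ^ m * (F ^ m * idm X * u ^ m * idm X)" by (subst e1) (simp add: e_def mult.assoc)
  also have "\<dots> = e" by (simp only: Au e1)
  finally have "e = 0 \<or> e = idm X" using X(2) em by (auto simp: indec_def)
  then show ?thesis
  proof
    assume "e = 0"
    then have "F ^ m * idm X = 0" using Au[of m] by (simp add: e_def mult.assoc)
    then show ?thesis by blast
  next
    assume e: "e = idm X"
    have "\<exists>G. mmor n X X G \<and> F * G = idm X \<and> G * F = idm X"
    proof (cases m)
      case 0
      then show ?thesis using m \<chi>m F\<chi> by (intro exI[of _ \<chi>]) auto
    next
      case (Suc k)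
      have c1: "F * (u ^ k * idm X) = u ^ k * idm X * F"
      proof -
        have "F * u = u * F" by (metis u_def F\<chi> mult.assoc)
        then have "F * u ^ k = u ^ k * F" using power_comm[of u F k] by simp
        then have "F * (u ^ k * idm X) = u ^ k * (F * idm X)" by (metis mult.assoc)
        also have "F * idm X = idm X * F" using dF by simp
        finally show ?thesis by (simp only: mult.assoc)
      qed
      have "F * (\<chi> * (u ^ k * idm X)) = idm X" using e by (simp add: e_def Suc u_def mult.assoc)
      moreover have "\<chi> * (u ^ k * idm X) * F = F * (\<chi> * (u ^ k * idm X))"
        using c1 F\<chi> by (metis mult.assoc)
      ultimately show ?thesis
        by (intro exI[of _ "\<chi> * (u ^ k * idm X)"]) (auto intro: mmor_mult mmor_power X(1) u \<chi>m)
    qed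
    then show ?thesis ..
  qed
qed

text \<open>If F is not invertible it is nilpotent by \<open>fitting\<close>, and the finite
  geometric series inverts \<open>idm X - F\<close>.\<close>

lemma local_end:
  assumes X: "mmod n X" "indec n X" and F: "mmor n X X F"
  obtains G where "mmor n X X G" "F * G = idm X" "G * F = idm X"
  | G where "mmor n X X G" "(idm X - F) * G = idm X" "G * (idm X - F) = idm X"
proof -
  consider "\<exists>G. mmor n X X G \<and> F * G = idm X \<and> G * F = idm X" | m where "F ^ m * idm X = 0"
    using fitting[OF assms] by blast
  then show thesis
  proof cases
    case 1 with that(1) show thesis by blast
  next
    case 2
    note dF = mmorD(1)[OF F]
    define G where "G k = (\<Sum>l<k. F ^ l * idm X)" for k
    have "F * (F ^ l * idm X) = F ^ l * idm X * F" for l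
    proof -
      have "F * (F ^ l * idm X) = F ^ l * (F * idm X)" by (metis mult.assoc power_commutes)
      also have "F * idm X = idm X * F" using dF by simp
      finally show ?thesis by (simp only: mult.assoc)
    qed
    then have GF: "F * G k = G k * F" for k
      by (auto simp: G_def sum_distrib_left sum_distrib_right intro!: sum.cong)
    have G: "mmor n X X (G k)" for k unfolding G_def by (intro mmor_sum mmor_power X(1) F)
    have G0: "G 0 = 0" and GS: "G (Suc k) = G k + F ^ k * idm X" for k by (simp_all add: G_def)
    have "G k - F * G k = idm X - F ^ k * idm X" for k
    proof (induction k)
      case (Suc k)
      have "G (Suc k) - F * G (Suc k) = (G k - F * G k) + F ^ k * idm X - F ^ Suc k * idm X"
        by (simp add: GS algebra_simps)
      with Suc show ?case by simp
    qed (simp add: G0)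
    with 2 have "G m - F * G m = idm X" by simp
    with that(2)[OF G[of m]] GF[of m] mmorD(1)[OF G[of m]] show thesis by (simp add: algebra_simps)
  qed
qed

section \<open>Extensions, shifts and tensor products\<close>

text \<open>Block 0 is the submodule M, block 1 the quotient N, and \<phi> is the off-diagonal part
  of the action: a cocycle for Ext^1(N, M).\<close>

definition extm :: "'k::field mm \<Rightarrow> 'k mm \<Rightarrow> (nat \<Rightarrow> 'k mtx) \<Rightarrow> 'k mm" where
  "extm M N \<phi> = \<lparr>ix = prod_encode ` ({0} \<times> ix M \<union> {1} \<times> ix N),
     dg = (\<lambda>p. if fst (prod_decode p) = 0 then dg M (snd (prod_decode p)) else dg N (snd (prod_decode p))),
     ac = (\<lambda>a. incl 0 * ac M a * proj 0 + incl 0 * \<phi> a * proj 1 + incl 1 * ac N a * proj 1)\<rparr>"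

lemma proj_incl_simps [simp]:
  "proj e * incl e = 1" "e \<noteq> e' \<Longrightarrow> proj e * incl e' = 0"
  "proj e * (incl e * Z) = Z" "e \<noteq> e' \<Longrightarrow> proj e * (incl e' * Z) = 0"
proof -
  show 1: "proj e * incl e = 1" by (simp add: proj_incl)
  show 2: "e \<noteq> e' \<Longrightarrow> proj e * incl e' = 0" by (simp add: proj_incl)
  show "proj e * (incl e * Z) = Z" unfolding mult.assoc[symmetric] 1 by simp
  show "e \<noteq> e' \<Longrightarrow> proj e * (incl e' * Z) = 0" unfolding mult.assoc[symmetric] by (simp add: 2)
qed

lemma ent_incl_mult: "ent (incl e * A) p q =
    (if fst (prod_decode p) = e then ent A (snd (prod_decode p)) q else 0)"
proof (cases "fst (prod_decode p) = e")
  case True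
  then have "p = prod_encode (e, snd (prod_decode p))" by (metis prod.collapse prod_decode_inverse)
  then show ?thesis using True
    by (subst ent_times_gen[of "{snd (prod_decode p)}"]) (auto simp: ent_incl, metis prod_encode_inverse snd_conv)
next
  case False
  then show ?thesis by (subst ent_times_gen[of "{}"]) (auto simp: ent_incl)
qed

lemma ent_mult_proj: "ent (A * proj e) p q =
    (if fst (prod_decode q) = e then ent A p (snd (prod_decode q)) else 0)"
proof -
  have "A * proj e = tpose (incl e * tpose A)" by (simp add: transp_mult)
  then show ?thesis by (simp only: ent_transp ent_incl_mult)
qed

lemma ix_extm: "p \<in> ix (extm M N \<phi>) \<longleftrightarrow> (fst (prod_decode p) = 0 \<and> snd (prod_decode p) \<in> ix M) \<or>
    (fst (prod_decode p) = 1 \<and> snd (prod_decode p) \<in> ix N)"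
proof -
  obtain e i where "p = prod_encode (e, i)" by (metis prod.collapse prod_decode_inverse)
  then show ?thesis by (auto simp: extm_def image_iff prod_encode_eq)
qed

lemma idm_extm: "idm (extm M N \<phi>) = incl 0 * idm M * proj 0 + incl 1 * idm N * proj 1"
proof (rule mtx_eqI)
  fix p q
  obtain e i where p: "p = prod_encode (e, i)" by (metis prod.collapse prod_decode_inverse)
  obtain e' i' where q: "q = prod_encode (e', i')" by (metis prod.collapse prod_decode_inverse)
  show "ent (idm (extm M N \<phi>)) p q = ent (incl 0 * idm M * proj 0 + incl 1 * idm N * proj 1) p q"
    by (auto simp: p q ent_idm ix_extm ent_mult_proj ent_incl_mult mult.assoc prod_encode_eq)
qed

lemma dhom_extm:
  "dhom d K M F \<Longrightarrow> dhom d K (extm M N \<phi>) (incl 0 * F)"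
  "dhom d K N F \<Longrightarrow> dhom d K (extm M N \<phi>) (incl 1 * F)"
  "dhom d M K F \<Longrightarrow> dhom d (extm M N \<phi>) K (F * proj 0)"
  "dhom d N K F \<Longrightarrow> dhom d (extm M N \<phi>) K (F * proj 1)"
  "dhom d (extm M N \<phi>) K G \<Longrightarrow> dhom d M K (G * incl 0)"
  "dhom d (extm M N \<phi>) K G \<Longrightarrow> dhom d N K (G * incl 1)"
  "dhom d K (extm M N \<phi>) G \<Longrightarrow> dhom d K M (proj 0 * G)"
  "dhom d K (extm M N \<phi>) G \<Longrightarrow> dhom d K N (proj 1 * G)"
proof -
  let ?E = "extm M N \<phi>"
  have i0: "dhom 0 M ?E (incl 0 * idm M)" and i1: "dhom 0 N ?E (incl 1 * idm N)"
    by (auto simp: dhom_def ix_extm ent_incl_mult ent_idm split: if_splits) (auto simp: extm_def)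
  have p0: "dhom 0 ?E M (idm M * proj 0)" and p1: "dhom 0 ?E N (idm N * proj 1)"
    by (auto simp: dhom_def ix_extm ent_mult_proj ent_idm split: if_splits) (auto simp: extm_def)
  show "dhom d K M F \<Longrightarrow> dhom d K ?E (incl 0 * F)"
    using dhom_mult[OF i0, of d K F d] by (simp add: mult.assoc)
  show "dhom d K N F \<Longrightarrow> dhom d K ?E (incl 1 * F)"
    using dhom_mult[OF i1, of d K F d] by (simp add: mult.assoc)
  show "dhom d M K F \<Longrightarrow> dhom d ?E K (F * proj 0)"
    using dhom_mult[OF _ p0, of d K F d] by (simp add: mult.assoc[symmetric])
  show "dhom d N K F \<Longrightarrow> dhom d ?E K (F * proj 1)"
    using dhom_mult[OF _ p1, of d K F d] by (simp add: mult.assoc[symmetric])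
  have e: "idm ?E * incl 0 = incl 0 * idm M" "idm ?E * incl 1 = incl 1 * idm N"
    "proj 0 * idm ?E = idm M * proj 0" "proj 1 * idm ?E = idm N * proj 1"
    by (simp_all add: idm_extm distrib_left distrib_right mult.assoc)
  show "dhom d K M (proj 0 * G)" if G: "dhom d K ?E G"
  proof -
    have "proj 0 * G = idm M * proj 0 * G" using e(3) idm_mult_dhom[OF G] by (metis mult.assoc)
    with dhom_mult[OF p0 G, of d] show ?thesis by simp
  qed
  show "dhom d K N (proj 1 * G)" if G: "dhom d K ?E G"
  proof -
    have "proj 1 * G = idm N * proj 1 * G" using e(4) idm_mult_dhom[OF G] by (metis mult.assoc)
    with dhom_mult[OF p1 G, of d] show ?thesis by simp
  qed
  show "dhom d M K (G * incl 0)" if G: "dhom d ?E K G"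
  proof -
    have "G * incl 0 = G * (incl 0 * idm M)" using e(1) dhom_mult_idm[OF G] by (metis mult.assoc)
    with dhom_mult[OF G i0, of d] show ?thesis by simp
  qed
  show "dhom d N K (G * incl 1)" if G: "dhom d ?E K G"
  proof -
    have "G * incl 1 = G * (incl 1 * idm N)" using e(2) dhom_mult_idm[OF G] by (metis mult.assoc)
    with dhom_mult[OF G i1, of d] show ?thesis by simp
  qed
qed

lemma ac_extm: "ac (extm M N \<phi>) a = incl 0 * (ac M a * proj 0) + incl 0 * (\<phi> a * proj 1) + incl 1 * (ac N a * proj 1)"
  by (simp add: extm_def mult.assoc)

text \<open>The off-diagonal block of a product of two variables is
  \<open>ac M a * \<phi> b + \<phi> a * ac N b\<close>. The last two hypotheses are the cocycle
  identities, once more with the squares apart.\<close>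

lemma mmod_extm:
  assumes "mmod n M" "mmod n N" "\<And>a. a \<le> n \<Longrightarrow> dhom 1 N M (\<phi> a)"
    and "\<And>a b. a \<le> n \<Longrightarrow> b \<le> n \<Longrightarrow> ac M a * \<phi> b + \<phi> a * ac N b + (ac M b * \<phi> a + \<phi> b * ac N a) = 0"
    and "\<And>a. a \<le> n \<Longrightarrow> ac M a * \<phi> a + \<phi> a * ac N a = 0"
  shows "mmod n (extm M N \<phi>)"
  unfolding mmod_def
proof (intro conjI allI impI)
  show "finite (ix (extm M N \<phi>))" using assms(1,2) by (simp add: extm_def mmod_def)
  fix a assume a: "a \<le> n"
  show "dhom 1 (extm M N \<phi>) (extm M N \<phi>) (ac (extm M N \<phi>) a)" unfolding ac_extm
    using a assms(3) mmodD(2)[OF assms(1)] mmodD(2)[OF assms(2)] by (intro dhom_add dhom_extm) auto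
  have gen: "ac (extm M N \<phi>) a * ac (extm M N \<phi>) b = incl 0 * (ac M a * ac M b) * proj 0 +
     incl 0 * (ac M a * \<phi> b + \<phi> a * ac N b) * proj 1 + incl 1 * (ac N a * ac N b) * proj 1" for a b
    by (simp add: ac_extm algebra_simps)
  show "ac (extm M N \<phi>) a * ac (extm M N \<phi>) a = 0"
    using mmodD(3)[OF assms(1) a] mmodD(3)[OF assms(2) a] assms(5)[OF a] by (simp add: gen)
  fix b assume b: "b \<le> n"
  have "ac (extm M N \<phi>) a * ac (extm M N \<phi>) b + ac (extm M N \<phi>) b * ac (extm M N \<phi>) a =
     incl 0 * (ac M a * ac M b + ac M b * ac M a) * proj 0 +
     incl 0 * (ac M a * \<phi> b + \<phi> a * ac N b + (ac M b * \<phi> a + \<phi> b * ac N a)) * proj 1 +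
     incl 1 * (ac N a * ac N b + ac N b * ac N a) * proj 1"
    unfolding gen by (simp add: algebra_simps)
  then show "ac (extm M N \<phi>) a * ac (extm M N \<phi>) b + ac (extm M N \<phi>) b * ac (extm M N \<phi>) a = 0"
    using assms(4)[OF a b] mmodD(4)[OF assms(1) a b] mmodD(4)[OF assms(2) a b] by simp
qed

text \<open>The sign in the action turns a morphism multiplied by scalars \<open>z a\<close> into a
  cocycle on \<open>shm X\<close>: in the identities of \<open>mmod_extm\<close> the two commuting
  products then occur with opposite signs.\<close>

definition shm :: "'k::field mm \<Rightarrow> 'k mm" where
  "shm X = X\<lparr>dg := \<lambda>i. dg X i - 1, ac := \<lambda>a. - ac X a\<rparr>"

lemma shm_simps [simp]: "ix (shm X) = ix X" "dg (shm X) i = dg X i - 1" "ac (shm X) a = - ac X a"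
  by (simp_all add: shm_def)

lemma idm_shm [simp]: "idm (shm X) = idm X" by (simp add: idm_def)

lemma dhom_shm: "dhom d K (shm X) F \<longleftrightarrow> dhom (d + 1) K X F" "dhom d (shm X) K F \<longleftrightarrow> dhom (d - 1) X K F"
  by (auto simp: dhom_def algebra_simps)

lemma mmod_shm: "mmod n X \<Longrightarrow> mmod n (shm X)"
  by (auto simp: mmod_def dhom_shm dhom_uminus)

text \<open>The diagonal action of the exterior algebra as a graded Hopf algebra with primitive
  variables; the Koszul sign sits on the inner factor C.\<close>

definition tens :: "'k::field mm \<Rightarrow> 'k mm \<Rightarrow> 'k mm" where
  "tens C E = \<lparr>ix = prod_encode ` (ix E \<times> ix C),
     dg = (\<lambda>p. dg C (snd (prod_decode p)) + dg E (fst (prod_decode p))),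
     ac = (\<lambda>a. ac C a \<otimes>\<^sub>k idm E + sgm C \<otimes>\<^sub>k ac E a)\<rparr>"

lemma ix_tens: "p \<in> ix (tens C E) \<longleftrightarrow> fst (prod_decode p) \<in> ix E \<and> snd (prod_decode p) \<in> ix C"
proof -
  obtain e i where "p = prod_encode (e, i)" by (metis prod.collapse prod_decode_inverse)
  then show ?thesis by (auto simp: tens_def image_iff prod_encode_eq)
qed

lemma dhom_tens: "dhom d C C' A \<Longrightarrow> dhom e E E' M \<Longrightarrow> c = d + e \<Longrightarrow>
    dhom c (tens C E) (tens C' E') (A \<otimes>\<^sub>k M)"
  by (auto simp: dhom_def ix_tens ent_kron) (auto simp: tens_def)

lemma idm_tens: "idm (tens C E) = idm C \<otimes>\<^sub>k idm E"
proof (rule mtx_eqI)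
  fix p q
  obtain e i where p: "p = prod_encode (e, i)" by (metis prod.collapse prod_decode_inverse)
  obtain e' i' where q: "q = prod_encode (e', i')" by (metis prod.collapse prod_decode_inverse)
  show "ent (idm (tens C E)) p q = ent (idm C \<otimes>\<^sub>k idm E) p q"
    by (auto simp: p q ent_idm ix_tens ent_kron prod_encode_eq)
qed

lemma sgm_ac: "dhom 1 X X F \<Longrightarrow> F * sgm X = - (sgm X * F)"
  by (simp add: sgm_mult_dhom[of 1 X X F] sgn_of_simps)

lemma mmod_tens:
  assumes "mmod n C" "mmod n E" shows "mmod n (tens C E)"
proof -
  have ac: "ac (tens C E) a = ac C a \<otimes>\<^sub>k idm E + sgm C \<otimes>\<^sub>k ac E a" for a by (simp add: tens_def)
  note C = mmodD[OF assms(1)] and E = mmodD[OF assms(2)]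
  have gen: "ac (tens C E) a * ac (tens C E) b = (ac C a * ac C b) \<otimes>\<^sub>k idm E +
      (sgm C * ac C b) \<otimes>\<^sub>k ac E a - (sgm C * ac C a) \<otimes>\<^sub>k ac E b + idm C \<otimes>\<^sub>k (ac E a * ac E b)"
    if "a \<le> n" "b \<le> n" for a b
    unfolding ac using C(2)[OF that(1)] C(2)[OF that(2)] E(2)[OF that(1)] E(2)[OF that(2)]
    by (simp add: distrib_left distrib_right kron_mult sgm_sgm sgm_ac[OF C(2)[OF that(1)]] kron_simps)
  have "finite (ix (tens C E))" using C(1) E(1) by (simp add: tens_def)
  moreover have "dhom 1 (tens C E) (tens C E) (ac (tens C E) a)" if "a \<le> n" for a
    unfolding ac using C(2)[OF that] E(2)[OF that]
    by (intro dhom_add) (auto intro: dhom_tens dhom_idm dhom_sgm)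
  moreover have "ac (tens C E) a * ac (tens C E) a = 0" if "a \<le> n" for a
    using gen[OF that that] C(3)[OF that] E(3)[OF that] by (simp add: kron_simps)
  moreover have "ac (tens C E) a * ac (tens C E) b + ac (tens C E) b * ac (tens C E) a = 0"
    if "a \<le> n" "b \<le> n" for a b
    using gen[OF that] gen[OF that(2,1)] C(4)[OF that] E(4)[OF that] by (simp add: kron_simps)
  ultimately show ?thesis by (auto simp: mmod_def)
qed

lemma av_tens: "av n w (tens C E) = av n w C \<otimes>\<^sub>k idm E + sgm C \<otimes>\<^sub>k av n w E"
  by (simp add: av_def tens_def kron_sum kron_simps scl_add sum.distrib)

text \<open>The homotopy is \<open>sgm C\<close> tensor h. The parity operator anticommutes with the
  differential of C, so the contribution of C cancels and only the homotopy identity of E is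
  left.\<close>

lemma exv_tens:
  assumes "mmod n C" "mmod n E" "exv n w E" shows "exv n w (tens C E)"
proof -
  obtain h where h: "dhom (- 1) E E h" "av n w E * h + h * av n w E = idm E"
    using assms(3) by (auto simp: exv_def)
  have "dhom (- 1) (tens C E) (tens C E) (sgm C \<otimes>\<^sub>k h)" by (rule dhom_tens[OF dhom_sgm h(1)]) simp
  moreover have "av n w (tens C E) * (sgm C \<otimes>\<^sub>k h) + (sgm C \<otimes>\<^sub>k h) * av n w (tens C E) =
      idm C \<otimes>\<^sub>k (av n w E * h + h * av n w E)"
    using h(1) dhom_av[OF assms(1), of w]
    by (simp add: av_tens distrib_left distrib_right kron_mult sgm_sgm sgm_ac[OF dhom_av[OF assms(1)]] kron_simps)
  ultimately show ?thesis unfolding exv_def idm_tens h(2) by blast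
qed

section \<open>The partial trace\<close>

text \<open>The signs are those for which evaluation on \<open>tens (dualm X) X\<close> is a
  morphism. The unsigned transpose \<open>tpm\<close> further down serves the passage to opposite
  arrows.\<close>

definition dualm :: "'k::field mm \<Rightarrow> 'k mm" where
  "dualm X = \<lparr>ix = ix X, dg = (\<lambda>i. - dg X i), ac = (\<lambda>a. - (tpose (ac X a) * sgm X))\<rparr>"

lemma dhom_transp: "ix X' = ix X \<Longrightarrow> ix Y' = ix Y \<Longrightarrow> dg X' = (\<lambda>i. - dg X i) \<Longrightarrow> dg Y' = (\<lambda>i. - dg Y i) \<Longrightarrow>
    dhom d X Y F \<Longrightarrow> dhom d Y' X' (tpose F)"
  by (auto simp: dhom_def)

lemma mmod_dualm: assumes "mmod n X" shows "mmod n (dualm X)"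
proof -
  note X = mmodD[OF assms]
  have s: "sgm (dualm X) = sgm X"
    by (rule mtx_eqI) (auto simp: ent_sgm dualm_def sgn_of_simps)
  have d: "dhom 1 (dualm X) (dualm X) (tpose (ac X a))" if "a \<le> n" for a
    by (rule dhom_transp[OF _ _ _ _ X(2)[OF that]]) (auto simp: dualm_def)
  have i: "idm (dualm X) = idm X" by (simp add: idm_def dualm_def)
  have sg: "tpose (ac X a) * sgm X = - (sgm X * tpose (ac X a))" if "a \<le> n" for a
    using sgm_ac[OF d[OF that]] by (simp add: s)
  have gen: "ac (dualm X) a * ac (dualm X) b = - (tpose (ac X b * ac X a))" if "a \<le> n" "b \<le> n" for a b
  proof -
    have "ac (dualm X) a * ac (dualm X) b = tpose (ac X a) * (sgm X * (tpose (ac X b) * sgm X))"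
      by (simp add: dualm_def mult.assoc)
    also have "\<dots> = - (tpose (ac X a) * (tpose (ac X b) * (sgm X * sgm X)))"
    proof -
      let ?T = "tpose (ac X b)"
      have "sgm X * (?T * sgm X) = (sgm X * ?T) * sgm X" by (simp only: mult.assoc)
      also have "sgm X * ?T = - (?T * sgm X)" using sg[OF that(2)] by simp
      finally have "sgm X * (?T * sgm X) = - (?T * (sgm X * sgm X))"
        by (simp only: mult_minus_left mult.assoc)
      then show ?thesis by simp
    qed
    also have "tpose (ac X b) * (sgm X * sgm X) = tpose (ac X b)"
      using d[OF that(2)] by (simp add: sgm_sgm i[symmetric])
    finally show ?thesis by (simp add: transp_mult)
  qed
  show ?thesis unfolding mmod_def
  proof (intro conjI allI impI)
    show "finite (ix (dualm X))" using X(1) by (simp add: dualm_def)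
    fix a assume a: "a \<le> n"
    have "dhom 1 (dualm X) (dualm X) (tpose (ac X a) * sgm (dualm X))"
      by (rule dhom_mult[OF d[OF a] dhom_sgm]) simp
    then show "dhom 1 (dualm X) (dualm X) (ac (dualm X) a)"
      by (simp add: s) (simp add: dualm_def dhom_uminus)
    show "ac (dualm X) a * ac (dualm X) a = 0" using gen[OF a a] X(3)[OF a] by (simp add: transp_simps)
    fix b assume b: "b \<le> n"
    show "ac (dualm X) a * ac (dualm X) b + ac (dualm X) b * ac (dualm X) a = 0"
      unfolding gen[OF a b] gen[OF b a] using X(4)[OF a b] by (simp add: transp_simps)
  qed
qed

abbreviation endm :: "'k::field mm \<Rightarrow> 'k mm" where "endm X \<equiv> tens (dualm X) X"

text \<open>The identity of C tensored with evaluation of the dual of X on X; of all blocks only the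
  diagonal ones contribute.\<close>

definition evm :: "'k::field mm \<Rightarrow> 'k mm \<Rightarrow> 'k mtx" where
  "evm C X = (\<Sum>j\<in>ix X. idm C * proj (prod_encode (j, j)))"

lemma ent_evm: assumes "finite (ix X)"
  shows "ent (evm C X) i q = (if i \<in> ix C \<and> (\<exists>j\<in>ix X. q = prod_encode (prod_encode (j, j), i)) then 1 else 0)"
proof -
  have "ent (evm C X) i q = (\<Sum>j\<in>ix X. if i \<in> ix C \<and> q = prod_encode (prod_encode (j, j), i) then 1 else 0)"
    unfolding evm_def by (auto simp: ent_mult_proj ent_idm intro!: sum.cong)
      (metis prod.collapse prod_decode_inverse)+
  also have "\<dots> = (if i \<in> ix C \<and> (\<exists>j\<in>ix X. q = prod_encode (prod_encode (j, j), i)) then 1 else 0)"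
  proof (cases "\<exists>j\<in>ix X. q = prod_encode (prod_encode (j, j), i)")
    case True
    then obtain j where j: "j \<in> ix X" "q = prod_encode (prod_encode (j, j), i)" by auto
    have "(\<Sum>j'\<in>ix X. if i \<in> ix C \<and> q = prod_encode (prod_encode (j', j'), i) then 1 else 0 :: 'a) =
        (\<Sum>j'\<in>ix X. if j' = j then if i \<in> ix C then 1 else 0 else 0)"
      by (rule sum.cong) (auto simp: j)
    then show ?thesis using j(1) assms True by simp
  next
    case False
    then show ?thesis by (auto intro!: sum.neutral)
  qed
  finally show ?thesis .
qed

lemma dhom_evm: assumes "finite (ix X)" shows "dhom 0 (tens C (endm X)) C (evm C X)"
  by (auto simp: dhom_def ent_evm[OF assms] ix_tens split: if_splits) (auto simp: tens_def dualm_def)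

text \<open>The coordinates of a matrix on \<open>tens C (endm X)\<close> are indexed by triples; \<open>tri l j i\<close> stands
  for the basis vector \<open>c\<^sub>i \<otimes> e\<^sub>j\<^sup>* \<otimes> e\<^sub>l\<close>.\<close>

abbreviation tri :: "nat \<Rightarrow> nat \<Rightarrow> nat \<Rightarrow> nat" where
  "tri l j i \<equiv> prod_encode (prod_encode (l, j), i)"

lemma ent_ac_tri:
  "ent (ac (tens C (endm X)) a) (tri l' j' i') (tri l j i) =
     (if l' = l \<and> l \<in> ix X \<and> j' = j \<and> j \<in> ix X then ent (ac C a) i' i else 0) +
     ent (sgm C) i' i * ((if l' = l \<and> l \<in> ix X then - (ent (ac X a) j j' * ent (sgm X) j j) else 0) +
       ent (ac X a) l' l * (if j' = j \<and> j \<in> ix X then sgn_of (dg X j) else 0))"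
proof -
  have t: "ent (tpose (ac X a) * sgm X) j' j = ent (ac X a) j j' * ent (sgm X) j j"
    by (simp add: sgm_def ent_mult_dmat ent_dmat)
  have sg: "ent (sgm (dualm X)) j' j = (if j' = j \<and> j \<in> ix X then sgn_of (dg X j) else 0)"
    by (simp add: ent_sgm dualm_def sgn_of_simps) blast
  have "ent (ac (endm X) a) (prod_encode (l', j')) (prod_encode (l, j)) =
      ent (idm X) l' l * ent (ac (dualm X) a) j' j + ent (ac X a) l' l * ent (sgm (dualm X)) j' j"
    by (simp add: tens_def ent_kron)
  also have "\<dots> = (if l' = l \<and> l \<in> ix X then - (ent (ac X a) j j' * ent (sgm X) j j) else 0) +
       ent (ac X a) l' l * (if j' = j \<and> j \<in> ix X then sgn_of (dg X j) else 0)"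
    unfolding sg by (auto simp: ent_idm dualm_def t)
  finally have e: "ent (ac (endm X) a) (prod_encode (l', j')) (prod_encode (l, j)) = \<dots>" .
  have i: "ent (idm (endm X)) (prod_encode (l', j')) (prod_encode (l, j)) =
      (if l' = l \<and> l \<in> ix X \<and> j' = j \<and> j \<in> ix X then 1 else 0)"
    by (auto simp: ent_idm ix_tens dualm_def prod_encode_eq)
  have "ent (ac (tens C (endm X)) a) (tri l' j' i') (tri l j i) =
     ent (idm (endm X)) (prod_encode (l', j')) (prod_encode (l, j)) * ent (ac C a) i' i +
     ent (ac (endm X) a) (prod_encode (l', j')) (prod_encode (l, j)) * ent (sgm C) i' i"
    by (simp add: tens_def[of C] ent_kron)
  then show ?thesis unfolding e i by (simp add: mult.commute)
qed

text \<open>After evaluation, the action on the dual factor and the action on X contribute the same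
  entry of \<open>ac X a\<close> with opposite signs, so the action on C alone remains.\<close>

lemma mmor_evm:
  assumes C: "mmod n C" and X: "mmod n X"
  shows "mmor n (tens C (endm X)) C (evm C X)"
  unfolding mmor_def
proof (intro conjI allI impI)
  note fX = mmodD(1)[OF X]
  show "dhom 0 (tens C (endm X)) C (evm C X)" by (rule dhom_evm[OF fX])
  fix a assume a: "a \<le> n"
  have dX: "ent (ac X a) i j = 0" if "i \<notin> ix X \<or> j \<notin> ix X" for i j
    using dhomD[OF mmodD(2)[OF X a], of i j] that by blast
  have dC: "ent (ac C a) i j = 0" if "i \<notin> ix C \<or> j \<notin> ix C" for i j
    using dhomD[OF mmodD(2)[OF C a], of i j] that by blast
  show "evm C X * ac (tens C (endm X)) a = ac C a * evm C X"
  proof (rule mtx_eqI)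
    fix i' q
    obtain l j i where q: "q = tri l j i" by (metis prod.collapse prod_decode_inverse)
    have "ent (evm C X * ac (tens C (endm X)) a) i' q =
        (\<Sum>p\<in>(\<lambda>m. tri m m i') ` ix X. ent (evm C X) i' p * ent (ac (tens C (endm X)) a) p q)"
      by (rule ent_times_gen) (auto simp: fX ent_evm split: if_splits)
    also have "\<dots> = (\<Sum>m\<in>ix X. (if i' \<in> ix C then 1 else 0) * ent (ac (tens C (endm X)) a) (tri m m i') q)"
      by (subst sum.reindex) (auto simp: inj_on_def ent_evm fX intro!: sum.cong)
    also have "\<dots> = (\<Sum>m\<in>ix X. (if l = m then if l = j then ent (ac C a) i' i else 0 else 0) -
        (if l = m then ent (sgm C) i' i * (ent (ac X a) j l * ent (sgm X) j j) else 0) +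
        (if j = m then ent (sgm C) i' i * (ent (ac X a) j l * ent (sgm X) j j) else 0))"
      by (rule sum.cong) (auto simp: q ent_ac_tri ent_sgm dC algebra_simps)
    also have "\<dots> = (if l = j \<and> l \<in> ix X then ent (ac C a) i' i else 0)"
      using fX dX by (auto simp: sum.distrib sum_subtractf)
    also have "\<dots> = ent (ac C a * evm C X) i' q"
      by (subst ent_times_gen[of "{i}"]) (auto simp: q ent_evm fX dC)
    finally show "ent (evm C X * ac (tens C (endm X)) a) i' q = ent (ac C a * evm C X) i' q" .
  qed
qed

text \<open>Up to signs, the partial trace over \<open>X\<close> turns a map \<open>C \<otimes> X\<^sup>* \<otimes> X \<rightarrow> X\<close> into a map \<open>C \<rightarrow> X\<close>.\<close>

definition ptr :: "'k::field mm \<Rightarrow> 'k mtx \<Rightarrow> 'k mtx" where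
  "ptr X t = (\<Sum>j\<in>ix X. \<Sum>l\<in>ix X. scl (sgn_of (dg X j) * sgn_of (dg X l))
     (unit j l * t * incl (prod_encode (l, j))))"

lemma ent_ptr: assumes "finite (ix X)"
  shows "ent (ptr X t) j q = (if j \<in> ix X then
     \<Sum>l\<in>ix X. sgn_of (dg X j) * sgn_of (dg X l) * ent t l (tri l j q) else 0)"
proof -
  have "ent (ptr X t) j q = (\<Sum>j'\<in>ix X. if j' = j then
      (\<Sum>l\<in>ix X. sgn_of (dg X j) * sgn_of (dg X l) * ent t l (tri l j q)) else 0)"
    unfolding ptr_def by (auto simp: mult.assoc ent_unit_mult ent_mult_incl intro!: sum.cong)
  then show ?thesis using assms by simp
qed

text \<open>For fixed c in C and a functional \<xi>, the map t yields an endomorphism of X; its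
  signed trace, as a function of \<xi>, is a vector of X. If t is evaluation followed by \<phi>,
  that endomorphism is x \<mapsto> \<xi>(x) \<phi>(c) with trace \<xi>(\<phi>(c)), so \<phi> itself
  comes back with coefficient one. The second claim therefore lets a splitting of the class pulled
  back along evaluation descend to C.\<close>

lemma ptr:
  assumes X: "mmod n X" and C: "mmod n C" and t: "dhom 0 (tens C (endm X)) X t"
  shows "dhom 0 C X (ptr X t)"
    and "\<lbrakk>a \<le> n; dhom 1 C X \<phi>; t * ac (tens C (endm X)) a + \<phi> * evm C X = ac X a * t\<rbrakk> \<Longrightarrow>
       ptr X t * ac C a + \<phi> = ac X a * ptr X t"
proof -
  note fX = mmodD(1)[OF X] and fC = mmodD(1)[OF C]
  let ?\<sigma> = "\<lambda>j. sgn_of (dg X j) :: 'a"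
  have T: "l' \<in> ix X \<and> l \<in> ix X \<and> j \<in> ix X \<and> q \<in> ix C \<and> dg X l' = dg C q - dg X j + dg X l"
    if "ent t l' (tri l j q) \<noteq> 0" for l' l j q
    using dhomD[OF t that] by (auto simp: ix_tens) (auto simp: tens_def dualm_def)
  show d: "dhom 0 C X (ptr X t)"
    unfolding dhom_def
  proof (intro allI impI)
    fix j q assume "ent (ptr X t) j q \<noteq> 0"
    then have j: "j \<in> ix X" and "(\<Sum>l\<in>ix X. ?\<sigma> j * ?\<sigma> l * ent t l (tri l j q)) \<noteq> 0"
      by (auto simp: ent_ptr[OF fX] split: if_splits)
    from sum.not_neutral_contains_not_neutral[OF this(2)] obtain l where "ent t l (tri l j q) \<noteq> 0" by auto
    from T[OF this] j show "j \<in> ix X \<and> q \<in> ix C \<and> dg X j = dg C q + 0" by auto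
  qed
  assume a: "a \<le> n" and \<phi>: "dhom 1 C X \<phi>" and eq: "t * ac (tens C (endm X)) a + \<phi> * evm C X = ac X a * t"
  let ?A = "ent (ac X a)"
  have dX: "i \<in> ix X \<and> j \<in> ix X \<and> dg X i = dg X j + 1" if "?A i j \<noteq> 0" for i j
    using dhomD[OF mmodD(2)[OF X a] that] .
  have dC: "i \<in> ix C \<and> j \<in> ix C \<and> dg C i = dg C j + 1" if "ent (ac C a) i j \<noteq> 0" for i j
    using dhomD[OF mmodD(2)[OF C a] that] .
  show "ptr X t * ac C a + \<phi> = ac X a * ptr X t"
  proof (rule mtx_eqI)
    fix j q
    show "ent (ptr X t * ac C a + \<phi>) j q = ent (ac X a * ptr X t) j q"
    proof (cases "j \<in> ix X \<and> q \<in> ix C")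
      case False
      have "ent (ptr X t * ac C a) j q = 0" "ent \<phi> j q = 0" "ent (ac X a * ptr X t) j q = 0"
        using dhom_out[OF dhom_mult[OF d mmodD(2)[OF C a]], of 1] dhom_out[OF \<phi>]
          dhom_out[OF dhom_mult[OF mmodD(2)[OF X a] d], of 1] False by auto
      then show ?thesis by simp
    next
      case True
      then have j: "j \<in> ix X" and q: "q \<in> ix C" by auto
      \<comment> \<open>The four sources of the entry at \<open>(l, tri l j q)\<close>: the action
        on C gives A, on the dual factor U, on the factor X of the source W, and on the target
        G.\<close>
      define A where "A l = (\<Sum>i\<in>ix C. ent t l (tri l j i) * ent (ac C a) i q)" for l
      define U where "U l = (\<Sum>j'\<in>ix X. ?A j j' * ent t l (tri l j' q))" for l
      define W where "W l = (\<Sum>l'\<in>ix X. ?A l' l * ent t l (tri l' j q))" for l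
      define G where "G l = (\<Sum>l'\<in>ix X. ?A l l' * ent t l' (tri l j q))" for l
      let ?s = "sgn_of (dg C q) :: 'a"
      have key: "A l - ?\<sigma> j * ?s * U l + ?\<sigma> j * ?s * W l + (if l = j then ent \<phi> l q else 0) = G l"
        if l: "l \<in> ix X" for l
      proof -
        let ?f = "\<lambda>p. ent t l p * ent (ac (tens C (endm X)) a) p (tri l j q)"
        have "ent (t * ac (tens C (endm X)) a) l (tri l j q) = (\<Sum>p\<in>ix (tens C (endm X)). ?f p)"
          by (rule ent_times_gen) (use dhomD[OF t] mmodD(1)[OF mmod_tens[OF C mmod_tens[OF mmod_dualm[OF X] X]]] in auto)
        also have "\<dots> = (\<Sum>(l', j', i)\<in>ix X \<times> ix X \<times> ix C. ?f (tri l' j' i))"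
          by (rule sum.reindex_bij_witness[of _ "\<lambda>(l', j', i). tri l' j' i"
                "\<lambda>p. (fst (prod_decode (fst (prod_decode p))), snd (prod_decode (fst (prod_decode p))), snd (prod_decode p))"])
            (auto simp: ix_tens dualm_def)
        also have "\<dots> = (\<Sum>l'\<in>ix X. \<Sum>j'\<in>ix X. \<Sum>i\<in>ix C. ?f (tri l' j' i))"
          by (simp add: sum.cartesian_product)
        also have "\<dots> = (\<Sum>l'\<in>ix X. \<Sum>j'\<in>ix X. 
             (if l = l' then if j = j' then A l else 0 else 0)
             - (if l = l' then ?\<sigma> j * ?s * (?A j j' * ent t l (tri l j' q)) else 0)
             + (if j = j' then ?\<sigma> j * ?s * (?A l' l * ent t l (tri l' j q)) else 0))"
        proof (intro sum.cong refl)
          fix l' j' assume l': "l' \<in> ix X" and j': "j' \<in> ix X"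
          have "(\<Sum>i\<in>ix C. ?f (tri l' j' i)) = (\<Sum>i\<in>ix C. 
             (if l = l' then if j = j' then ent t l (tri l j i) * ent (ac C a) i q else 0 else 0)
             + (if q = i then 
             (- (if l = l' then ?\<sigma> j * ?s * (?A j j' * ent t l (tri l j' q)) else 0)
             + (if j = j' then ?\<sigma> j * ?s * (?A l' l * ent t l (tri l' j q)) else 0)) else 0))"
            using j l q by (intro sum.cong) (auto simp: ent_ac_tri ent_sgm algebra_simps)
          also have "\<dots> = (if l = l' then if j = j' then A l else 0 else 0)
             - (if l = l' then ?\<sigma> j * ?s * (?A j j' * ent t l (tri l j' q)) else 0)
             + (if j = j' then ?\<sigma> j * ?s * (?A l' l * ent t l (tri l' j q)) else 0)"
            using q fC by (simp add: sum.distrib A_def)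
          finally show "(\<Sum>i\<in>ix C. ?f (tri l' j' i)) = \<dots>" .
        qed
        also have "\<dots> = A l - ?\<sigma> j * ?s * U l + ?\<sigma> j * ?s * W l"
        proof -
          have "(\<Sum>l'\<in>ix X. \<Sum>j'\<in>ix X. if l = l' then f j' else 0) = (\<Sum>j'\<in>ix X. f j')" for f :: "nat \<Rightarrow> 'a"
            using l fX by (subst sum.swap) simp
          moreover have "(\<Sum>l'\<in>ix X. \<Sum>j'\<in>ix X. if j = j' then f l' else 0) = (\<Sum>l'\<in>ix X. f l')" for f :: "nat \<Rightarrow> 'a"
            using j fX by simp
          ultimately show ?thesis using j fX
            by (simp add: sum.distrib sum_subtractf U_def W_def sum_distrib_left)
        qed
        finally have 1: "ent (t * ac (tens C (endm X)) a) l (tri l j q) = A l - ?\<sigma> j * ?s * U l + ?\<sigma> j * ?s * W l" .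
        have 2: "ent (\<phi> * evm C X) l (tri l j q) = (if l = j then ent \<phi> l q else 0)"
          using q l j by (subst ent_times_gen[of "{q}"]) (auto simp: ent_evm[OF fX])
        have 3: "ent (ac X a * t) l (tri l j q) = G l"
          unfolding G_def by (rule ent_times_gen[OF fX]) (use dX in auto)
        show ?thesis using arg_cong[OF eq, of "\<lambda>M. ent M l (tri l j q)"] 1 2 3 by simp
      qed
      have "ent (ptr X t * ac C a) j q = (\<Sum>i\<in>ix C. ent (ptr X t) j i * ent (ac C a) i q)"
        by (rule ent_times_gen[OF fC]) (use dC in auto)
      also have "\<dots> = (\<Sum>l\<in>ix X. ?\<sigma> j * ?\<sigma> l * A l)"
        unfolding A_def using j
        by (simp add: ent_ptr[OF fX] sum_distrib_left sum_distrib_right mult.assoc) (rule sum.swap)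
      also have "\<dots> = (\<Sum>l\<in>ix X. ?\<sigma> j * ?\<sigma> l * G l) + (\<Sum>l\<in>ix X. ?\<sigma> l * ?s * U l)
          - (\<Sum>l\<in>ix X. ?\<sigma> l * ?s * W l) - ent \<phi> j q"
      proof -
        have "?\<sigma> j * ?\<sigma> l * A l = ?\<sigma> j * ?\<sigma> l * G l + ?\<sigma> l * ?s * U l - ?\<sigma> l * ?s * W l
           - (if j = l then ent \<phi> j q else 0)" if "l \<in> ix X" for l
        proof -
          have A: "A l = G l + ?\<sigma> j * ?s * U l - ?\<sigma> j * ?s * W l - (if l = j then ent \<phi> l q else 0)"
            using key[OF that] by (simp add: algebra_simps)
          have s: "?\<sigma> j * (?\<sigma> j * z) = z" for z by (simp add: mult.assoc[symmetric] sgn_of_simps)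
          show ?thesis unfolding A by (auto simp: algebra_simps s sgn_of_simps)
        qed
        then show ?thesis using j fX by (simp add: sum.distrib sum_subtractf)
      qed
      \<comment> \<open>Cyclicity of the trace: with the signs included, the action on the last
        tensor factor and the action on the target have the same trace, and the two cancel.\<close>
      also have "(\<Sum>l\<in>ix X. ?\<sigma> l * ?s * W l) = (\<Sum>l\<in>ix X. ?\<sigma> j * ?\<sigma> l * G l)"
      proof -
        have "(\<Sum>l\<in>ix X. ?\<sigma> l * ?s * W l) =
            (\<Sum>l\<in>ix X. \<Sum>l'\<in>ix X. ?\<sigma> l * ?s * (?A l' l * ent t l (tri l' j q)))"
          by (simp add: W_def sum_distrib_left)
        also have "\<dots> = (\<Sum>l\<in>ix X. \<Sum>l'\<in>ix X. ?\<sigma> j * ?\<sigma> l' * (?A l' l * ent t l (tri l' j q)))"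
        proof (intro sum.cong refl)
          fix l l'
          show "?\<sigma> l * ?s * (?A l' l * ent t l (tri l' j q)) = ?\<sigma> j * ?\<sigma> l' * (?A l' l * ent t l (tri l' j q))"
          proof (cases "?A l' l * ent t l (tri l' j q) = 0")
            case False
            then have "dg X l' = dg X l + 1" "dg X l = dg C q - dg X j + dg X l'"
              using dX[of l' l] T[of l l' j q] by auto
            then have "dg X j = dg C q + 1" "dg X l' = dg X l + 1" by auto
            then show ?thesis by (simp add: sgn_of_simps)
          qed simp
        qed
        also have "\<dots> = (\<Sum>l'\<in>ix X. ?\<sigma> j * ?\<sigma> l' * G l')"
          by (subst sum.swap) (simp add: G_def sum_distrib_left)
        finally show ?thesis .
      qed
      \<comment> \<open>The remaining term, the action on the dual factor, is the action on the
        vector of X that the trace defines.\<close>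
      also have "(\<Sum>l\<in>ix X. ?\<sigma> l * ?s * U l) = ent (ac X a * ptr X t) j q"
      proof -
        have "(\<Sum>l\<in>ix X. ?\<sigma> l * ?s * U l) =
            (\<Sum>l\<in>ix X. \<Sum>j'\<in>ix X. ?\<sigma> l * ?s * (?A j j' * ent t l (tri l j' q)))"
          by (simp add: U_def sum_distrib_left)
        also have "\<dots> = (\<Sum>l\<in>ix X. \<Sum>j'\<in>ix X. ?A j j' * (?\<sigma> j' * ?\<sigma> l * ent t l (tri l j' q)))"
        proof (intro sum.cong refl)
          fix l j'
          show "?\<sigma> l * ?s * (?A j j' * ent t l (tri l j' q)) = ?A j j' * (?\<sigma> j' * ?\<sigma> l * ent t l (tri l j' q))"
          proof (cases "ent t l (tri l j' q) = 0")
            case False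
            then have "dg C q = dg X j'" using T[of l l j' q] by auto
            then show ?thesis by (simp add: mult_ac)
          qed simp
        qed
        also have "\<dots> = (\<Sum>j'\<in>ix X. ?A j j' * ent (ptr X t) j' q)"
          by (subst sum.swap) (simp add: ent_ptr[OF fX] sum_distrib_left)
        also have "\<dots> = ent (ac X a * ptr X t) j q"
          by (rule ent_times_gen[symmetric, OF fX]) (use dX in auto)
        finally show ?thesis .
      qed
      finally show ?thesis by simp
    qed
  qed
qed

section \<open>Irreducible morphisms preserve exactness\<close>

lemma mirrD:
  assumes "mirr n X Y f"
  shows "mmor n X Y f" "mmor n Y X g \<Longrightarrow> g * f \<noteq> idm X" "mmor n Y X g \<Longrightarrow> f * g \<noteq> idm Y"
    "mmod n Z \<Longrightarrow> mmor n X Z h \<Longrightarrow> mmor n Z Y g \<Longrightarrow> f = g * h \<Longrightarrow>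
        (\<exists>r. mmor n Z X r \<and> r * h = idm X) \<or> (\<exists>s. mmor n Y Z s \<and> g * s = idm Y)"
  using assms by (auto simp: mirr_def)

text \<open>C is the extension of \<open>shm X\<close> by Y with class minus \<open>z f\<close>, and
  \<phi> is the pullback of \<open>z\<close> to C. Pulling \<phi> back further along evaluation from
  Q = C tensor End X gives an extension P of Q by X, and \<open>f\<close> factors through P. If X
  splits off P, the partial trace splits \<phi> over C already; this says that \<open>z\<close>
  annihilates X up to the factor \<open>\<tau>1 * f\<close>, which is not invertible because
  \<open>f\<close> does not split, and locality yields a contradiction. If P \<rightarrow> Y splits,
  then Y is a summand of P, an extension of the exact module Q by the exact module X.\<close>

theorem exv_forward:
  assumes X: "mmod n X" "indec n X" and Y: "mmod n Y" and f: "mirr n X Y f"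
    and nk: "\<not> kil n z X" and ex: "exv n w X"
  shows "exv n w Y"
proof -
  note fm = mirrD(1)[OF f]
  note df = mmorD(1)[OF fm] and fa = mmorD(2)[OF fm]
  define C where "C = extm Y (shm X) (\<lambda>a. - scl (z a) f)"
  have acC: "ac C a = incl 0 * (ac Y a * proj 0) - incl 0 * (scl (z a) f * proj 1) - incl 1 * (ac X a * proj 1)" for a
    by (simp add: C_def ac_extm)
  have mC: "mmod n C" unfolding C_def
  proof (rule mmod_extm[OF Y mmod_shm[OF X(1)]])
    show "dhom 1 (shm X) Y (- scl (z a) f)" for a using df by (simp add: dhom_shm dhom_uminus dhom_scl)
  qed (simp_all add: fa algebra_simps)
  have p1C: "proj 1 * ac C a = - (ac X a * proj 1)" for a
    by (simp add: acC algebra_simps)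
  have p0C: "proj 0 * ac C a = ac Y a * proj 0 - scl (z a) (f * proj 1)" for a
    by (simp add: acC algebra_simps)
  define \<phi> :: "nat \<Rightarrow> 'a mtx" where "\<phi> a = scl (z a) (idm X * proj 1)" for a
  have d\<phi>: "dhom 1 C X (\<phi> a)" for a unfolding \<phi>_def C_def
    by (intro dhom_scl dhom_extm) (simp add: dhom_shm dhom_idm)
  have \<phi>C: "\<phi> a * ac C b = - scl (z a) (ac X b * proj 1)" if "b \<le> n" for a b
  proof -
    have "\<phi> a * ac C b = scl (z a) (idm X * (proj 1 * ac C b))" by (simp add: \<phi>_def mult.assoc)
    also have "\<dots> = - scl (z a) ((idm X * ac X b) * proj 1)"
      unfolding p1C by (simp only: mult_minus_right scl_simps mult.assoc)
    finally show ?thesis using mmodD(2)[OF X(1) that] by simp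
  qed
  have X\<phi>: "ac X b * \<phi> a = scl (z a) (ac X b * proj 1)" if "b \<le> n" for a b
    using mmodD(2)[OF X(1) that] by (simp add: \<phi>_def mult.assoc[symmetric])
  define Q where "Q = tens C (endm X)"
  have mE: "mmod n (endm X)" by (intro mmod_tens mmod_dualm X)
  have mQ: "mmod n Q" unfolding Q_def by (intro mmod_tens mC mE)
  have exQ: "exv n w Q" unfolding Q_def
    by (intro exv_tens mC mE mmod_dualm X ex)
  define ev where "ev = evm C X"
  have mev: "mmor n Q C ev" unfolding Q_def ev_def by (rule mmor_evm[OF mC X(1)])
  note dev = mmorD(1)[OF mev] and evQ = mmorD(2)[OF mev]
  define P where "P = extm X Q (\<lambda>a. \<phi> a * ev)"
  have acP: "ac P a = incl 0 * (ac X a * proj 0) + incl 0 * (\<phi> a * (ev * proj 1)) + incl 1 * (ac Q a * proj 1)" for a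
    by (simp add: P_def ac_extm mult.assoc)
  have d\<phi>ev: "dhom 1 Q X (\<phi> a * ev)" for a by (rule dhom_mult[OF d\<phi> dev]) simp
  have mP: "mmod n P" unfolding P_def
  proof (rule mmod_extm[OF X(1) mQ d\<phi>ev])
    have e: "ac X a * (\<phi> b * ev) + \<phi> a * ev * ac Q b = (ac X a * \<phi> b + \<phi> a * ac C b) * ev"
      if "a \<le> n" "b \<le> n" for a b
      using evQ[OF that(2)] by (simp add: algebra_simps)
    fix a b assume ab: "a \<le> n" "b \<le> n"
    show "ac X a * (\<phi> b * ev) + \<phi> a * ev * ac Q b + (ac X b * (\<phi> a * ev) + \<phi> b * ev * ac Q a) = 0"
      unfolding e[OF ab] e[OF ab(2,1)] by (simp add: X\<phi> \<phi>C ab algebra_simps)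
    show "ac X a * (\<phi> a * ev) + \<phi> a * ev * ac Q a = 0"
      unfolding e[OF ab(1,1)] by (simp add: X\<phi> \<phi>C ab)
  qed
  define h where "h = incl 0 * idm X"
  have mh: "mmor n X P h" unfolding mmor_def
  proof (intro conjI allI impI)
    show "dhom 0 X P h" unfolding h_def P_def by (intro dhom_extm dhom_idm)
    fix a assume "a \<le> n"
    then have "idm X * ac X a = ac X a" "ac X a * idm X = ac X a"
      by (rule idm_mult_dhom[OF mmodD(2)[OF X(1)]], rule dhom_mult_idm[OF mmodD(2)[OF X(1)]])
    then show "h * ac X a = ac P a * h"
      by (simp add: h_def acP mult.assoc distrib_right)
  qed
  \<comment> \<open>On X this is \<open>f\<close>, on Q it is the Y-coordinate of evaluation. The
    twist \<phi> of P cancels the twist of C, which is why C was built with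
    \<open>- scl (z a) f\<close>.\<close>
  define g where "g = f * proj 0 + idm Y * proj 0 * ev * proj 1"
  have dp0: "dhom 0 C Y (idm Y * proj 0)" unfolding C_def by (intro dhom_extm dhom_idm)
  have dp1: "dhom 0 C (shm X) (idm X * proj 1)" unfolding C_def
    by (intro dhom_extm) (simp add: dhom_shm dhom_idm)
  have mg: "mmor n P Y g" unfolding mmor_def
  proof (intro conjI allI impI)
    show "dhom 0 P Y g" unfolding g_def P_def
      by (intro dhom_add dhom_extm df dhom_mult[OF dp0 dev]) simp
    fix a assume a: "a \<le> n"
    have "g * ac P a = f * (ac X a * proj 0) + f * (\<phi> a * (ev * proj 1)) + idm Y * (proj 0 * ((ev * ac Q a) * proj 1))"
      by (simp add: g_def acP algebra_simps)
    also have "proj 0 * ((ev * ac Q a) * proj 1) = (proj 0 * ac C a) * (ev * proj 1)"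
      using evQ[OF a] by (simp add: mult.assoc)
    also have "\<dots> = ac Y a * (proj 0 * (ev * proj 1)) - scl (z a) (f * (proj 1 * (ev * proj 1)))"
      by (simp add: p0C algebra_simps)
    also have "idm Y * \<dots> = (idm Y * ac Y a) * (proj 0 * (ev * proj 1)) - scl (z a) ((idm Y * f) * (proj 1 * (ev * proj 1)))"
      by (simp add: right_diff_distrib mult.assoc)
    also have "f * (\<phi> a * (ev * proj 1)) = scl (z a) ((f * idm X) * (proj 1 * (ev * proj 1)))"
      by (simp add: \<phi>_def mult.assoc)
    also have "f * (ac X a * proj 0) = ac Y a * (f * proj 0)" using fa[OF a] by (simp add: mult.assoc[symmetric])
    finally have "g * ac P a = ac Y a * (f * proj 0) + ac Y a * (proj 0 * (ev * proj 1))"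
      using mmodD(2)[OF Y a] df by simp
    also have "\<dots> = ac Y a * g"
    proof -
      have "ac Y a * (idm Y * proj 0 * ev * proj 1) = (ac Y a * idm Y) * (proj 0 * (ev * proj 1))"
        by (simp only: mult.assoc)
      then show ?thesis using mmodD(2)[OF Y a] by (simp add: g_def distrib_left)
    qed
    finally show "g * ac P a = ac Y a * g" .
  qed
  have "f = g * h" using df by (simp add: g_def h_def distrib_right mult.assoc)
  from mirrD(4)[OF f mP mh mg this]
  show ?thesis
  proof (elim disjE exE conjE)
    fix r assume r: "mmor n P X r" "r * h = idm X"
    \<comment> \<open>The retraction restricted to Q is no morphism, since Q is only a quotient of
      P; its defect is exactly \<open>\<phi> a * ev\<close>, as \<open>ptr\<close> expects.\<close>
    define t where "t = r * incl 1"
    have dt: "dhom 0 Q X t" using mmorD(1)[OF r(1)] unfolding t_def P_def by (intro dhom_extm)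
    define \<tau> where "\<tau> = ptr X t"
    have teq: "t * ac Q a + \<phi> a * ev = ac X a * t" if a: "a \<le> n" for a
    proof -
      have "ac X a * t = (r * ac P a) * incl 1" using mmorD(2)[OF r(1) a] by (simp add: t_def mult.assoc)
      also have "\<dots> = r * (incl 0 * (\<phi> a * ev)) + t * ac Q a"
        by (simp add: acP t_def algebra_simps)
      also have "r * (incl 0 * (\<phi> a * ev)) = r * (incl 0 * (idm X * (\<phi> a * ev)))"
        using d\<phi>ev[of a] by simp
      also have "\<dots> = r * h * (\<phi> a * ev)" by (simp add: h_def mult.assoc)
      also have "\<dots> = \<phi> a * ev" using r(2) d\<phi>ev[of a] by simp
      finally show ?thesis by simp
    qed
    have d\<tau>: "dhom 0 C X \<tau>" unfolding \<tau>_def by (rule ptr(1)[OF X(1) mC dt[unfolded Q_def]])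
    have \<tau>eq: "\<tau> * ac C a + \<phi> a = ac X a * \<tau>" if "a \<le> n" for a
      unfolding \<tau>_def by (rule ptr(2)[OF X(1) mC dt[unfolded Q_def] that d\<phi> teq[OF that, unfolded Q_def ev_def]])
    define \<tau>1 where "\<tau>1 = \<tau> * incl 0"
    define \<tau>2 where "\<tau>2 = \<tau> * incl 1"
    have d1: "dhom 0 Y X \<tau>1" using d\<tau> unfolding \<tau>1_def C_def by (rule dhom_extm)
    have d2: "dhom (- 1) X X \<tau>2"
    proof -
      have "dhom 0 (shm X) X \<tau>2" using d\<tau> unfolding \<tau>2_def C_def by (rule dhom_extm)
      then show ?thesis by (simp add: dhom_shm)
    qed
    have e1: "\<tau>1 * ac Y a = ac X a * \<tau>1" if "a \<le> n" for a
    proof -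
      have "ac X a * \<tau>1 = (\<tau> * ac C a + \<phi> a) * incl 0" using \<tau>eq[OF that] by (simp add: \<tau>1_def mult.assoc)
      also have "\<dots> = \<tau>1 * ac Y a" by (simp add: acC \<phi>_def \<tau>1_def algebra_simps)
      finally show ?thesis by simp
    qed
    have m1: "mmor n Y X \<tau>1" using d1 e1 by (simp add: mmor_def)
    have e2: "ac X a * \<tau>2 + \<tau>2 * ac X a = scl (z a) (idm X - \<tau>1 * f)" if "a \<le> n" for a
    proof -
      have "ac X a * \<tau>2 = (\<tau> * ac C a + \<phi> a) * incl 1" using \<tau>eq[OF that] by (simp add: \<tau>2_def mult.assoc)
      also have "\<dots> = - scl (z a) (\<tau>1 * f) - \<tau>2 * ac X a + scl (z a) (idm X)"
        by (simp add: acC \<phi>_def \<tau>1_def \<tau>2_def algebra_simps)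
      finally show ?thesis by (simp add: scl_diff)
    qed
    \<comment> \<open>An inverse of \<open>\<tau>1 * f\<close> would make \<open>f\<close> a split
      monomorphism. Hence \<open>idm X - \<tau>1 * f\<close> has an inverse, and composing
      \<open>\<tau>2\<close> with it gives the homotopy by which \<open>z\<close> kills X.\<close>
    have mf: "mmor n X X (\<tau>1 * f)" by (rule mmor_mult[OF m1 fm])
    show "exv n w Y"
    proof (rule local_end[OF X mf])
      fix G assume G: "mmor n X X G" "G * (\<tau>1 * f) = idm X"
      then show ?thesis using mirrD(2)[OF f mmor_mult[OF G(1) m1]] by (simp add: mult.assoc)
    next
      fix G assume G: "mmor n X X G" "(idm X - \<tau>1 * f) * G = idm X"
      have "dhom (- 1) X X (\<tau>2 * G)" by (rule dhom_mult[OF d2 mmorD(1)[OF G(1)]]) simp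
      moreover have "ac X a * (\<tau>2 * G) + (\<tau>2 * G) * ac X a = scl (z a) (idm X)" if "a \<le> n" for a
      proof -
        have "ac X a * (\<tau>2 * G) + (\<tau>2 * G) * ac X a = (ac X a * \<tau>2 + \<tau>2 * ac X a) * G"
          using mmorD(2)[OF G(1) that] by (simp add: algebra_simps)
        then show ?thesis using e2[OF that] G(2) by simp
      qed
      ultimately have "kil n z X" by (auto simp: kil_def)
      with nk show ?thesis by simp
    qed
  next
    fix s assume s: "mmor n Y P s" "g * s = idm Y"
    obtain hX where hX: "dhom (- 1) X X hX" "av n w X * hX + hX * av n w X = idm X"
      using ex by (auto simp: exv_def)
    obtain hQ where hQ: "dhom (- 1) Q Q hQ" "av n w Q * hQ + hQ * av n w Q = idm Q"
      using exQ by (auto simp: exv_def)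
    let ?v = "av n w Y" and ?x = "av n w X"
    \<comment> \<open>The value of the linear form \<open>z\<close> at \<open>w\<close>: all that
      the differential for \<open>w\<close> sees of the twists by \<open>z\<close>.\<close>
    define \<zeta> where "\<zeta> = (\<Sum>a\<le>n. w a * z a)"
    define a0 where "a0 = proj 0 * s"
    define s' where "s' = proj 1 * s"
    have da0: "dhom 0 Y X a0" using mmorD(1)[OF s(1)] unfolding a0_def P_def by (rule dhom_extm)
    have ds': "dhom 0 Y Q s'" using mmorD(1)[OF s(1)] unfolding s'_def P_def by (rule dhom_extm)
    have avP: "av n w P = incl 0 * (?x * proj 0) + scl \<zeta> (incl 0 * (idm X * (proj 1 * (ev * proj 1)))) + incl 1 * (av n w Q * proj 1)"
      by (simp add: av_def acP \<phi>_def sum_distrib_left sum_distrib_right \<zeta>_def scl_add sum.distrib scl_sum_left mult.assoc)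
    have p0v: "proj 0 * av n w C = ?v * proj 0 - scl \<zeta> (f * proj 1)"
      by (simp add: av_def sum_distrib_left sum_distrib_right p0C \<zeta>_def scl_diff sum_subtractf scl_sum_left)
    have p1v: "proj 1 * av n w C = - (?x * proj 1)"
      by (simp add: av_def sum_distrib_left sum_distrib_right p1C sum_negf del: One_nat_def)
    have sv: "s * ?v = av n w P * s" by (rule mmor_av[OF s(1)])
    have s'v: "s' * ?v = av n w Q * s'"
      by (simp add: s'_def mult.assoc sv) (simp add: avP algebra_simps)
    define W where "W = ev * s'"
    define W1 where "W1 = proj 0 * W"
    define W2 where "W2 = idm X * proj 1 * W"
    have dW: "dhom 0 Y C W" unfolding W_def by (rule dhom_mult[OF dev ds']) simp
    have a0v: "a0 * ?v = ?x * a0 + scl \<zeta> W2"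
      by (simp add: a0_def mult.assoc sv) (simp add: avP W2_def W_def s'_def algebra_simps)
    \<comment> \<open>The homotopy of Q transported to C along evaluation. Its X-coordinate corrects
      \<open>a0\<close> to the chain map \<open>u\<close>; its Y-coordinate is the part of the
      homotopy on Y that does not pass through X.\<close>
    define H where "H = ev * hQ * s'"
    have dH: "dhom (- 1) Y C H" unfolding H_def by (rule dhom_mult[OF dhom_mult[OF dev hQ(1)] ds']) auto
    have Heq: "av n w C * H + H * ?v = W"
    proof -
      have "av n w C * H = (ev * av n w Q) * hQ * s'"
        using mmor_av[OF mev, of w] by (simp add: H_def mult.assoc)
      moreover have "H * ?v = ev * hQ * (av n w Q * s')" using s'v by (simp add: H_def mult.assoc)
      ultimately have "av n w C * H + H * ?v = ev * (av n w Q * hQ + hQ * av n w Q) * s'"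
        by (simp add: algebra_simps)
      then show ?thesis using hQ(2) dev by (simp add: W_def)
    qed
    define H1 where "H1 = proj 0 * H"
    define H2 where "H2 = idm X * proj 1 * H"
    have dH1: "dhom (- 1) Y Y H1" using dH unfolding H1_def C_def by (rule dhom_extm)
    have dH2: "dhom 0 Y X H2"
    proof -
      have "dhom (- 1) Y (shm X) H2" unfolding H2_def by (rule dhom_mult[OF dp1 dH]) simp
      then show ?thesis by (simp add: dhom_shm)
    qed
    have p1H: "idm X * (proj 1 * H) = H2" by (simp add: H2_def mult.assoc)
    have eq1: "?v * H1 - scl \<zeta> (f * H2) + H1 * ?v = W1"
    proof -
      have "W1 = proj 0 * (av n w C * H + H * ?v)" unfolding Heq W1_def ..
      also have "\<dots> = proj 0 * av n w C * H + proj 0 * H * ?v" by (simp only: distrib_left mult.assoc)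
      also have "\<dots> = ?v * H1 - scl \<zeta> (f * (proj 1 * H)) + H1 * ?v"
        unfolding p0v H1_def by (simp only: left_diff_distrib scl_mult_left mult.assoc)
      also have "f * (proj 1 * H) = f * H2" using df by (simp add: H2_def mult.assoc[symmetric])
      finally show ?thesis by simp
    qed
    have eq2: "H2 * ?v - ?x * H2 = W2"
    proof -
      have "W2 = idm X * proj 1 * (av n w C * H + H * ?v)" unfolding Heq W2_def ..
      also have "\<dots> = idm X * (proj 1 * av n w C * H) + H2 * ?v"
        unfolding H2_def by (simp only: distrib_left mult.assoc)
      also have "idm X * (proj 1 * av n w C * H) = - ((idm X * ?x) * (proj 1 * H))"
        by (simp add: p1v mult.assoc del: One_nat_def)
      also have "(idm X * ?x) * (proj 1 * H) = ?x * H2"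
      proof -
        have "idm X * ?x = ?x * idm X" using dhom_av[OF X(1), of w] by simp
        then show ?thesis by (simp only: mult.assoc p1H)
      qed
      finally show ?thesis by simp
    qed
    have eq3: "f * a0 + W1 = idm Y"
    proof -
      have "idm Y = f * a0 + idm Y * W1" using s(2)
        by (simp add: g_def a0_def W1_def W_def s'_def distrib_right mult.assoc)
      also have "idm Y * W1 = W1"
        using dhom_extm(7)[OF dW[unfolded C_def]] by (simp add: W1_def)
      finally show ?thesis by simp
    qed
    define u where "u = a0 - scl \<zeta> H2"
    have uv: "u * ?v = ?x * u"
    proof -
      have "H2 * ?v = W2 + ?x * H2" using eq2 by (simp add: algebra_simps)
      then show ?thesis using a0v by (simp add: u_def left_diff_distrib right_diff_distrib scl_add)
    qed
    have main: "idm Y = f * u + (?v * H1 + H1 * ?v)"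
      using eq1 eq3 by (simp add: u_def right_diff_distrib algebra_simps)
    define hY where "hY = f * hX * u + H1"
    have du: "dhom 0 Y X u" unfolding u_def by (rule dhom_diff[OF da0 dhom_scl[OF dH2]])
    have "dhom (- 1) Y Y (f * hX * u)" by (rule dhom_mult[OF dhom_mult[OF df hX(1) refl] du]) simp
    then have "dhom (- 1) Y Y hY" unfolding hY_def by (rule dhom_add[OF _ dH1])
    moreover have "?v * hY + hY * ?v = idm Y"
    proof -
      have "?v * (f * hX * u) = f * (?x * hX) * u" using mmor_av[OF fm, of w] by (simp add: mult.assoc[symmetric])
      moreover have "f * hX * u * ?v = f * (hX * ?x) * u" using uv by (simp add: mult.assoc)
      ultimately have "?v * (f * hX * u) + f * hX * u * ?v = f * (?x * hX + hX * ?x) * u"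
        by (simp add: distrib_left distrib_right)
      also have "\<dots> = f * u" using hX(2) df by simp
      finally show ?thesis using main by (simp add: hY_def algebra_simps)
    qed
    ultimately show "exv n w Y" by (auto simp: exv_def)
  qed
qed

section \<open>Duality\<close>

text \<open>Transposition reverses products, but anticommutation and vanishing squares are symmetric
  conditions, so the plain transpose is again a module of the same kind. This turns an arrow X
  \<rightarrow> Y into one from the dual of Y to the dual of X.\<close>

definition tpm :: "'k::field mm \<Rightarrow> 'k mm" where
  "tpm X = \<lparr>ix = ix X, dg = (\<lambda>i. - dg X i), ac = (\<lambda>a. tpose (ac X a))\<rparr>"

lemma tpm_simps [simp]: "ix (tpm X) = ix X" "dg (tpm X) i = - dg X i" "ac (tpm X) a = tpose (ac X a)"
  "tpm (tpm X) = X"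
  by (simp_all add: tpm_def)

lemma idm_tpm [simp]: "idm (tpm X) = idm X" "tpose (idm X) = idm X"
  by (auto simp: idm_def intro!: mtx_eqI simp: ent_dmat)

lemma dhom_tpm: "dhom d X Y F \<Longrightarrow> dhom d (tpm Y) (tpm X) (tpose F)"
  by (auto simp: dhom_def)

lemma mmod_tpm: "mmod n X \<Longrightarrow> mmod n (tpm X)"
  unfolding mmod_def
  by (auto simp: dhom_tpm transp_mult[symmetric] transp_simps(2)[symmetric] transp_simps(1) add.commute)

lemma mmor_tpm: "mmor n X Y F \<Longrightarrow> mmor n (tpm Y) (tpm X) (tpose F)"
  by (auto simp: mmor_def dhom_tpm transp_mult[symmetric])

lemma av_tpm: "av n w (tpm X) = tpose (av n w X)"
  by (simp add: av_def transp_simps)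

lemma tpose_anti: "A * B + B * A = C \<Longrightarrow> tpose A * tpose B + tpose B * tpose A = (tpose C :: 'k::field mtx)"
  by (drule sym) (simp add: transp_simps transp_mult add.commute)

lemma exv_tpm: assumes "exv n w X" shows "exv n w (tpm X)"
proof -
  obtain h where h: "dhom (- 1) X X h" "av n w X * h + h * av n w X = idm X"
    using assms by (auto simp: exv_def)
  show ?thesis unfolding exv_def av_tpm
    using dhom_tpm[OF h(1)] tpose_anti[OF h(2)] by (intro exI[of _ "tpose h"]) simp
qed

lemma kil_tpm: assumes "kil n z X" shows "kil n z (tpm X)"
proof -
  obtain h where h: "dhom (- 1) X X h" "\<forall>a\<le>n. ac X a * h + h * ac X a = scl (z a) (idm X)"
    using assms by (auto simp: kil_def)
  have "tpose (ac X a) * tpose h + tpose h * tpose (ac X a) = scl (z a) (idm X)" if "a \<le> n" for a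
    using tpose_anti[of "ac X a" h] h(2) that by (simp add: transp_simps)
  then show ?thesis unfolding kil_def
    using dhom_tpm[OF h(1)] by (intro exI[of _ "tpose h"]) simp
qed

lemma indec_tpm: assumes "indec n X" shows "indec n (tpm X)"
  unfolding indec_def
proof (intro conjI allI impI)
  show "ix (tpm X) \<noteq> {}" using assms by (simp add: indec_def)
  fix p assume "mmor n (tpm X) (tpm X) p \<and> p * p = p"
  then have "mmor n X X (tpose p)" "tpose p * tpose p = tpose p"
    using mmor_tpm[of n "tpm X" "tpm X" p] by (simp_all add: transp_mult[symmetric])
  with assms have "tpose p = 0 \<or> tpose p = idm X" by (auto simp: indec_def)
  then have "tpose (tpose p) = tpose 0 \<or> tpose (tpose p) = tpose (idm X)" by metis
  then show "p = 0 \<or> p = idm (tpm X)" by (simp add: transp_simps)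
qed

lemma mirr_tpm: assumes "mirr n X Y f" shows "mirr n (tpm Y) (tpm X) (tpose f)"
  unfolding mirr_def
proof (intro conjI allI impI notI; (elim exE conjE)?)
  show "mmor n (tpm Y) (tpm X) (tpose f)" by (rule mmor_tpm[OF mirrD(1)[OF assms]])
next
  fix g assume g: "mmor n (tpm X) (tpm Y) g" "g * tpose f = idm (tpm Y)"
  have "f * tpose g = idm Y" using arg_cong[OF g(2), of tpose] by (simp add: transp_mult)
  moreover have "mmor n Y X (tpose g)" using mmor_tpm[OF g(1)] by simp
  ultimately show False using mirrD(3)[OF assms] by blast
next
  fix g assume g: "mmor n (tpm X) (tpm Y) g" "tpose f * g = idm (tpm X)"
  have "tpose g * f = idm X" using arg_cong[OF g(2), of tpose] by (simp add: transp_mult)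
  moreover have "mmor n Y X (tpose g)" using mmor_tpm[OF g(1)] by simp
  ultimately show False using mirrD(2)[OF assms] by blast
next
  fix Z h g assume a: "mmod n Z" "mmor n (tpm Y) Z h" "mmor n Z (tpm X) g" "tpose f = g * h"
  have "f = tpose h * tpose g" using arg_cong[OF a(4), of tpose] by (simp add: transp_mult)
  moreover have "mmor n X (tpm Z) (tpose g)" "mmor n (tpm Z) Y (tpose h)"
    using mmor_tpm[OF a(2)] mmor_tpm[OF a(3)] by simp_all
  ultimately have "(\<exists>r. mmor n (tpm Z) X r \<and> r * tpose g = idm X) \<or>
      (\<exists>s. mmor n Y (tpm Z) s \<and> tpose h * s = idm Y)"
    using mirrD(4)[OF assms mmod_tpm[OF a(1)]] by blast
  then show "(\<exists>r. mmor n Z (tpm Y) r \<and> r * h = idm (tpm Y)) \<or> (\<exists>s. mmor n (tpm X) Z s \<and> g * s = idm (tpm X))"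
  proof (elim disjE exE conjE)
    fix r assume r: "mmor n (tpm Z) X r" "r * tpose g = idm X"
    have "g * tpose r = idm X" using arg_cong[OF r(2), of tpose] by (simp add: transp_mult)
    moreover have "mmor n (tpm X) Z (tpose r)" using mmor_tpm[OF r(1)] by simp
    ultimately show ?thesis by auto
  next
    fix s assume s: "mmor n Y (tpm Z) s" "tpose h * s = idm Y"
    have "tpose s * h = idm Y" using arg_cong[OF s(2), of tpose] by (simp add: transp_mult)
    moreover have "mmor n Z (tpm Y) (tpose s)" using mmor_tpm[OF s(1)] by simp
    ultimately show ?thesis by auto
  qed
qed

theorem exv_backward:
  assumes "mmod n X" "mmod n Y" "indec n Y" "mirr n X Y f" "\<not> kil n z Y" "exv n w Y"
  shows "exv n w X"
proof -
  have "\<not> kil n z (tpm Y)" using kil_tpm[of n z "tpm Y"] assms(5) by auto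
  from exv_forward[OF mmod_tpm[OF assms(2)] indec_tpm[OF assms(3)] mmod_tpm[OF assms(1)]
      mirr_tpm[OF assms(4)] this exv_tpm[OF assms(6)]]
  show ?thesis using exv_tpm[of n w "tpm X"] by simp
qed

section \<open>Free modules\<close>

definition dsys :: "nat \<Rightarrow> 'k::field mm \<Rightarrow> (nat \<Rightarrow> 'k mtx) \<Rightarrow> bool" where
  "dsys n Y H \<longleftrightarrow> (\<forall>b\<le>n. dhom (- 1) Y Y (H b) \<and>
     (\<forall>a\<le>n. ac Y a * H b + H b * ac Y a = (if a = b then idm Y else 0)))"

lemma dsysD: "dsys n Y H \<Longrightarrow> b \<le> n \<Longrightarrow> dhom (- 1) Y Y (H b)"
  "dsys n Y H \<Longrightarrow> b \<le> n \<Longrightarrow> ac Y b * H b + H b * ac Y b = idm Y"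
  "dsys n Y H \<Longrightarrow> b \<le> n \<Longrightarrow> a \<le> n \<Longrightarrow> a \<noteq> b \<Longrightarrow> ac Y a * H b = - (H b * ac Y a)"
  by (auto simp: dsys_def eq_neg_iff_add_eq_0)

lemma ffree_dsys: "ffree n Y \<longleftrightarrow> (\<exists>H. dsys n Y H)"
proof
  assume "ffree n Y"
  then have "\<forall>b. \<exists>h. b \<le> n \<longrightarrow> dhom (- 1) Y Y h \<and>
      (\<forall>a\<le>n. ac Y a * h + h * ac Y a = scl (if a = b then 1 else 0) (idm Y))"
    by (auto simp: ffree_def kil_def)
  from choice[OF this] obtain H where "\<forall>b\<le>n. dhom (- 1) Y Y (H b) \<and>
      (\<forall>a\<le>n. ac Y a * H b + H b * ac Y a = scl (if a = b then 1 else 0) (idm Y))" by blast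
  then have "dsys n Y H" by (auto simp: dsys_def)
  then show "\<exists>H. dsys n Y H" by blast
next
  assume "\<exists>H. dsys n Y H"
  then obtain H where H: "dsys n Y H" ..
  show "ffree n Y" unfolding ffree_def kil_def
  proof (intro allI impI)
    fix b assume "b \<le> n"
    then show "\<exists>h. dhom (- 1) Y Y h \<and> (\<forall>a\<le>n. ac Y a * h + h * ac Y a = scl (if a = b then 1 else 0) (idm Y))"
      using H by (intro exI[of _ "H b"]) (auto simp: dsys_def)
  qed
qed

lemma dsys_av: assumes "dsys n Y H" "b \<le> n"
  shows "av n w Y * H b + H b * av n w Y = scl (w b) (idm Y)"
proof -
  have "av n w Y * H b + H b * av n w Y = (\<Sum>a\<le>n. scl (w a) (ac Y a * H b + H b * ac Y a))"
    by (simp add: av_def sum_distrib_left sum_distrib_right scl_add sum.distrib)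
  also have "\<dots> = (\<Sum>a\<le>n. if a = b then scl (w a) (idm Y) else 0)"
    using assms by (intro sum.cong) (auto simp: dsys_def)
  finally show ?thesis using assms(2) by simp
qed

text \<open>A relative trace, which turns a map that is only linear into a morphism when the source is
  free.\<close>

primrec avg :: "'k::field mm \<Rightarrow> 'k mm \<Rightarrow> (nat \<Rightarrow> 'k mtx) \<Rightarrow> 'k mtx \<Rightarrow> nat \<Rightarrow> 'k mtx" where
  "avg N Y H s 0 = s"
| "avg N Y H s (Suc a) = ac N a * avg N Y H s a * H a + avg N Y H s a * H a * ac Y a"

lemma avg_dhom:
  assumes "mmod n N" "mmod n Y" "dsys n Y H" "dhom 0 Y N s"
  shows "a \<le> Suc n \<Longrightarrow> dhom 0 Y N (avg N Y H s a)"
proof (induction a)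
  case (Suc a)
  then have a: "a \<le> n" and d: "dhom 0 Y N (avg N Y H s a)" by auto
  show ?case unfolding avg.simps
    by (intro dhom_add dhom_mult[OF dhom_mult[OF mmodD(2)[OF assms(1) a] d] dsysD(1)[OF assms(3) a]]
        dhom_mult[OF dhom_mult[OF d dsysD(1)[OF assms(3) a]] mmodD(2)[OF assms(2) a]]) auto
qed (use assms in simp)

text \<open>Stage \<open>a\<close> is a boundary in direction \<open>a\<close>: both products of x_a
  with it equal x_a s H_a x_a because x_a squares to zero. An earlier variable passes through with
  two sign changes, so commutation already achieved is kept.\<close>

lemma avg_comm:
  assumes "mmod n N" "mmod n Y" "dsys n Y H" "dhom 0 Y N s"
  shows "a \<le> Suc n \<Longrightarrow> b < a \<Longrightarrow> avg N Y H s a * ac Y b = ac N b * avg N Y H s a"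
proof (induction a)
  case (Suc a)
  then have a: "a \<le> n" and b: "b \<le> n" by auto
  let ?s = "avg N Y H s a"
  show ?case
  proof (cases "b = a")
    case True
    have "?s * H a * ac Y a * ac Y a = 0" using mmodD(3)[OF assms(2) a] by (simp add: mult.assoc)
    moreover have "ac N a * (ac N a * ?s * H a) = 0"
      using mmodD(3)[OF assms(1) a] by (simp add: mult.assoc[symmetric])
    ultimately show ?thesis by (simp add: True distrib_left distrib_right mult.assoc)
  next
    case False
    with Suc have IH: "?s * ac Y b = ac N b * ?s" by simp
    have H: "H a * ac Y b = - (ac Y b * H a)" using dsysD(3)[OF assms(3) a b] False by simp
    have 1: "ac N a * ?s * H a * ac Y b = ac N b * (ac N a * ?s * H a)"
    proof -
      have "ac N a * ?s * H a * ac Y b = ac N a * ?s * (H a * ac Y b)" by (simp only: mult.assoc)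
      also have "\<dots> = - (ac N a * (?s * ac Y b) * H a)" unfolding H by (simp only: mult.assoc mult_minus_right)
      also have "\<dots> = - ((ac N a * ac N b) * ?s * H a)" unfolding IH by (simp only: mult.assoc)
      also have "\<dots> = ac N b * (ac N a * ?s * H a)"
        unfolding mmodD(4)[OF assms(1) a b] by (simp only: mult.assoc mult_minus_left minus_minus)
      finally show ?thesis .
    qed
    have 2: "?s * H a * ac Y a * ac Y b = ac N b * (?s * H a * ac Y a)"
    proof -
      have "?s * H a * ac Y a * ac Y b = ?s * H a * (ac Y a * ac Y b)" by (simp only: mult.assoc)
      also have "\<dots> = - (?s * (H a * ac Y b) * ac Y a)"
        unfolding mmodD(4)[OF assms(2) a b] by (simp only: mult.assoc mult_minus_right)
      also have "\<dots> = (?s * ac Y b) * H a * ac Y a"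
        unfolding H by (simp only: mult.assoc mult_minus_right mult_minus_left minus_minus)
      also have "\<dots> = ac N b * (?s * H a * ac Y a)" unfolding IH by (simp only: mult.assoc)
      finally show ?thesis .
    qed
    show ?thesis by (simp only: avg.simps distrib_left distrib_right 1 2)
  qed
qed simp

lemma avg_mmor:
  assumes "mmod n N" "mmod n Y" "dsys n Y H" "dhom 0 Y N s"
  shows "mmor n Y N (avg N Y H s (Suc n))"
  unfolding mmor_def using avg_dhom[OF assms order.refl] avg_comm[OF assms order.refl]
  by (simp del: avg.simps)

lemma avg_natural:
  assumes "mmor n N N' f" shows "a \<le> Suc n \<Longrightarrow> f * avg N Y H s a = avg N' Y H (f * s) a"
proof (induction a)
  case (Suc a)
  have "f * (ac N a * avg N Y H s a * H a) = ac N' a * (f * avg N Y H s a) * H a"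
    using mmorD(2)[OF assms, of a] Suc.prems by (simp add: mult.assoc[symmetric])
  moreover have "f * (avg N Y H s a * H a * ac Y a) = (f * avg N Y H s a) * H a * ac Y a"
    by (simp only: mult.assoc)
  ultimately show ?case using Suc by (simp add: distrib_left)
qed simp

lemma avg_0: "avg N Y H 0 a = 0"
  by (induction a) auto

text \<open>On a morphism each stage is composition with x_a H_a + H_a x_a, which is the
  identity.\<close>

lemma avg_self:
  assumes "dsys n Y H" "mmor n Y N f" shows "a \<le> Suc n \<Longrightarrow> avg N Y H f a = f"
proof (induction a)
  case (Suc a)
  then have a: "a \<le> n" by simp
  have "ac N a * f * H a + f * H a * ac Y a = f * (ac Y a * H a + H a * ac Y a)"
    using mmorD(2)[OF assms(2) a] by (simp add: distrib_left mult.assoc[symmetric])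
  then show ?case using Suc dsysD(2)[OF assms(1) a] mmorD(1)[OF assms(2)] by simp
qed simp

text \<open>A vector killed by all contractions is a free generator: there H_a x_a acts as the
  identity, so every stage keeps the value of s. Together with \<open>avg_mmor\<close> this extends
  prescribed values on generators to a morphism.\<close>

lemma avg_fix:
  assumes "mmod n Y" "dsys n Y H" "dhom 0 Y N s" "mmod n N" "\<And>b. b \<le> n \<Longrightarrow> H b * E = 0" "idm Y * E = E"
  shows "a \<le> Suc n \<Longrightarrow> avg N Y H s a * E = s * E"
proof (induction a)
  case (Suc a)
  then have a: "a \<le> n" by simp
  let ?s = "avg N Y H s a"
  have "H a * (ac Y a * E) = E"
  proof -
    have "E = (ac Y a * H a + H a * ac Y a) * E" using dsysD(2)[OF assms(2) a] assms(6) by simp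
    also have "\<dots> = H a * (ac Y a * E)" using assms(5)[OF a] by (simp add: distrib_right mult.assoc)
    finally show ?thesis by simp
  qed
  then show ?case using Suc assms(5)[OF a] by (simp add: distrib_right mult.assoc)
qed simp

section \<open>Free modules are not adjacent to modules with an exact direction\<close>

text \<open>A map into an indecomposable free Y that reaches the generator splits. Otherwise it
  lands in the radical, and irreducibility makes X a summand of the radical with a retraction r. Let
  v and x be multiplication by \<open>w\<close> on Y and X. The vector obtained by applying r v to
  the generator is a cocycle of X; it has a primitive in the degree of the generator, where
  \<open>f\<close> vanishes, so it is zero. Then r v = 0 on Y, and a contraction of v on Y forces x
  = 0, which is incompatible with exactness of X \<noteq> 0.\<close>

lemma free_not_adjacent:
  assumes X: "mmod n X" "indec n X" and Y: "mmod n Y" "indec n Y" and f: "mirr n X Y f"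
    and ex: "exv n w X" and w: "a0 \<le> n" "w a0 \<noteq> 0" and free: "ffree n Y"
  shows False
proof -
  note fm = mirrD(1)[OF f]
  note df = mmorD(1)[OF fm]
  obtain H where H: "dsys n Y H" using free by (auto simp: ffree_dsys)
  note fY = mmodD(1)[OF Y(1)] and acY = mmodD(2)[OF Y(1)]
  have ne: "ix Y \<noteq> {}" using Y(2) by (simp add: indec_def)
  \<comment> \<open>A basis vector of least degree is killed by all contractions, since they lower
    degrees, and so can serve as free generator.\<close>
  define j0 where "j0 = Min (dg Y ` ix Y)"
  have "j0 \<in> dg Y ` ix Y" unfolding j0_def using fY ne by simp
  then obtain i0 where i0: "i0 \<in> ix Y" "dg Y i0 = j0" by auto
  have min: "j0 \<le> dg Y i" if "i \<in> ix Y" for i unfolding j0_def using fY that by simp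
  define E :: "'a mtx" where "E = unit i0 i0"
  have dE: "dhom 0 Y Y E" unfolding E_def by (rule dhom_unit) (use i0 in auto)
  have HE: "H b * E = 0" if "b \<le> n" for b
  proof (rule mtx_eqI)
    fix i j
    have "ent (H b) i i0 = 0" using dhomD[OF dsysD(1)[OF H that], of i i0] min[of i] i0 by force
    then show "ent (H b * E) i j = ent 0 i j" by (simp add: E_def ent_mult_unit)
  qed
  have Uac: "unit i i * ac Y a = 0" if "a \<le> n" "dg Y i = j0" for a i
  proof (rule mtx_eqI)
    fix p q
    have "ent (ac Y a) i q = 0" using dhomD[OF acY[OF that(1)], of i q] min[of q] that(2) by force
    then show "ent (unit i i * ac Y a) p q = ent 0 p q" by (simp add: ent_unit_mult)
  qed
  \<comment> \<open>This endomorphism fixes the chosen generator, hence is not nilpotent and by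
    Fitting invertible. In degree \<open>j0\<close> its image is spanned by that generator alone, so
    there is no other basis vector of this degree.\<close>
  define p where "p = avg Y Y H E (Suc n)"
  have mp: "mmor n Y Y p" unfolding p_def by (rule avg_mmor[OF Y(1) Y(1) H dE])
  have "p * E = E * E" unfolding p_def
    by (rule avg_fix[OF Y(1) H dE Y(1) HE idm_mult_dhom[OF dE] order.refl])
  then have pE: "p * E = E" by (simp add: E_def unit_mult_unit)
  have "p ^ m * E = E" for m by (induction m) (simp_all add: pE mult.assoc del: power_Suc add: power_Suc2)
  then have "p ^ m * idm Y \<noteq> 0" for m
  proof -
    have "p ^ m * idm Y * E = E" using \<open>p ^ m * E = E\<close> idm_mult_dhom[OF dE] by (simp add: mult.assoc)
    then show ?thesis by (auto simp: E_def)
  qed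
  with fitting[OF Y mp] obtain G where G: "mmor n Y Y G" "p * G = idm Y" "G * p = idm Y" by blast
  have uniq: "i = i0" if iY: "i \<in> ix Y" "dg Y i = j0" for i
  proof (rule ccontr)
    assume "i \<noteq> i0"
    have Ua: "unit i i * avg Y Y H E a = 0" if "a \<le> Suc n" for a
      using that
    proof (induction a)
      case 0 show ?case using \<open>i \<noteq> i0\<close> by (simp add: E_def unit_mult_unit)
    next
      case (Suc a)
      then have "unit i i * ac Y a = 0" "unit i i * avg Y Y H E a = 0" using Uac[OF _ iY(2), of a] by simp_all
      then show ?case by (simp add: distrib_left mult.assoc[symmetric])
    qed
    have "unit i i * p * G = 0" unfolding p_def Ua[OF order.refl] by simp
    then have "unit i i * idm Y = 0" using G(2) by (simp add: mult.assoc)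
    moreover have "unit i i * idm Y = unit i i"
      by (rule dhom_mult_idm[of 0 Y Y]) (rule dhom_unit, use iY in auto)
    ultimately show False by simp
  qed
  show False
  proof (cases "E * f = 0")
    case False
    have "\<exists>c. ent f i0 c \<noteq> 0"
    proof (rule ccontr)
      assume "\<not> ?thesis"
      then have "E * f = 0" by (intro mtx_eqI) (auto simp: E_def ent_unit_mult)
      with False show False by simp
    qed
    then obtain c where c: "ent f i0 c \<noteq> 0" by blast
    have cX: "c \<in> ix X" "dg Y i0 = dg X c" using dhomD[OF df c] by auto
    \<comment> \<open>A rank one map sending the generator to a preimage under \<open>f\<close>.
      Averaging makes it a morphism that is a section of \<open>f\<close> up to the automorphism
      p.\<close>
    define u where "u = scl (1 / ent f i0 c) (unit c i0)"
    have du: "dhom 0 Y X u" unfolding u_def by (intro dhom_scl dhom_unit) (use cX i0 in auto)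
    have fu: "f * u = E"
    proof (rule mtx_eqI)
      fix i j
      show "ent (f * u) i j = ent E i j"
      proof (cases "i = i0")
        case True
        then show ?thesis using c by (simp add: u_def ent_mult_unit E_def ent_unit)
      next
        case False
        have "ent f i c = 0"
        proof (rule ccontr)
          assume "ent f i c \<noteq> 0"
          from dhomD[OF df this] have "i \<in> ix Y" "dg Y i = j0" using cX i0 by auto
          from uniq[OF this] False show False by simp
        qed
        then show ?thesis using False by (simp add: u_def ent_mult_unit E_def ent_unit)
      qed
    qed
    have ms: "mmor n Y X (avg X Y H u (Suc n))" by (rule avg_mmor[OF X(1) Y(1) H du])
    have "f * avg X Y H u (Suc n) = p" unfolding p_def avg_natural[OF fm order.refl] fu ..
    then have "f * (avg X Y H u (Suc n) * G) = idm Y" using G(2) by (simp only: mult.assoc[symmetric])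
    with mirrD(3)[OF f mmor_mult[OF ms G(1)]] show False by blast
  next
    case True
    define q where "q = idm Y - E"
    \<comment> \<open>The radical of Y, obtained by leaving out the generator;
      \<open>E * f = 0\<close> says that \<open>f\<close> lands in it.\<close>
    define Z where "Z = Y\<lparr>ix := ix Y - {i0}, ac := \<lambda>a. ac Y a * q\<rparr>"
    have iZ: "idm Z = q"
      by (rule mtx_eqI) (auto simp: Z_def q_def ent_idm E_def ent_unit i0)
    have qY: "q * F = F" if "E * F = 0" "idm Y * F = F" for F using that by (simp add: q_def left_diff_distrib)
    have Ex: "E * ac Y a = 0" if "a \<le> n" for a unfolding E_def using Uac[OF that i0(2)] .
    have qx: "q * ac Y a = ac Y a" if "a \<le> n" for a
      by (rule qY[OF Ex[OF that]]) (use acY[OF that] in simp)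
    have qq: "q * q = q" using iZ idm_idm[of Z] by simp
    have qf: "q * f = f" by (rule qY[OF True]) (use df in simp)
    have dZ: "dhom d Y Y F \<Longrightarrow> q * F = F \<Longrightarrow> F * q = F \<Longrightarrow> dhom d Z Z F" for d F
    proof -
      assume a: "dhom d Y Y F" "q * F = F" "F * q = F"
      have E0: "E * F = 0" "F * E = 0" using a(2,3) a(1) by (simp_all add: q_def left_diff_distrib right_diff_distrib)
      have "ent F i0 j = 0" "ent F j i0 = 0" for j
        using arg_cong[OF E0(1), of "\<lambda>M. ent M i0 j"] arg_cong[OF E0(2), of "\<lambda>M. ent M j i0"]
        by (simp_all add: E_def ent_unit_mult ent_mult_unit)
      with a(1) show ?thesis by (auto simp: dhom_def Z_def)
    qed
    have mZ: "mmod n Z" unfolding mmod_def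
    proof (intro conjI allI impI)
      show "finite (ix Z)" using fY by (simp add: Z_def)
      fix a assume a: "a \<le> n"
      have acZ: "ac Z a = ac Y a * q" for a by (simp add: Z_def)
      have dq: "dhom 0 Y Y q" unfolding q_def by (intro dhom_diff dhom_idm dE)
      show "dhom 1 Z Z (ac Z a)" unfolding acZ
        by (rule dZ[OF dhom_mult[OF acY[OF a] dq]]) (simp_all add: mult.assoc[symmetric] qx[OF a], simp add: mult.assoc qq)
      have gen: "ac Z a * ac Z b = ac Y a * ac Y b * q" if "b \<le> n" for a b
      proof -
        have "ac Z a * ac Z b = ac Y a * (q * ac Y b) * q" by (simp add: acZ mult.assoc)
        then show ?thesis using qx[OF that] by simp
      qed
      show "ac Z a * ac Z a = 0" using gen[OF a] mmodD(3)[OF Y(1) a] by simp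
      fix b assume b: "b \<le> n"
      show "ac Z a * ac Z b + ac Z b * ac Z a = 0"
        unfolding gen[OF a] gen[OF b] using mmodD(4)[OF Y(1) a b] by (simp add: distrib_right[symmetric])
    qed
    have mq: "mmor n Z Y q" unfolding mmor_def
    proof (intro conjI allI impI)
      show "dhom 0 Z Y q" using dhom_idm[of Z] unfolding iZ by (auto simp: dhom_def Z_def)
      fix a assume "a \<le> n"
      then show "q * ac Z a = ac Y a * q" using qx by (simp add: Z_def mult.assoc[symmetric])
    qed
    have mfZ: "mmor n X Z f" unfolding mmor_def
    proof (intro conjI allI impI)
      have "ent f i0 j = 0" for j
        using arg_cong[OF True, of "\<lambda>M. ent M i0 j"] by (simp add: E_def ent_unit_mult)
      then show "dhom 0 X Z f" using df by (auto simp: dhom_def Z_def)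
      fix a assume "a \<le> n"
      then show "f * ac X a = ac Z a * f" using mmorD(2)[OF fm] qf by (simp add: Z_def mult.assoc)
    qed
    from mirrD(4)[OF f mZ mfZ mq qf[symmetric]] show False
    proof (elim disjE exE conjE)
      fix s assume qs: "q * s = idm Y"
      have Eq: "E * q = 0" using dhom_mult_idm[OF dE] by (simp add: q_def right_diff_distrib E_def unit_mult_unit)
      have "E * (q * s) = 0" by (simp only: mult.assoc[symmetric] Eq mult_zero_left)
      then have "E * idm Y = 0" by (simp only: qs)
      then show False using dhom_mult_idm[OF dE] by (simp add: E_def)
    next
      fix r assume r: "mmor n Z X r" "r * f = idm X"
      let ?v = "av n w Y" and ?x = "av n w X"
      have rx: "r * ac Y a * q = ac X a * r" if "a \<le> n" for a
        using mmorD(2)[OF r(1) that] by (simp add: Z_def mult.assoc)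
      have qv: "q * ?v = ?v" by (simp add: av_def sum_distrib_left qx)
      have rv: "r * ?v * q = ?x * r"
        by (simp add: av_def sum_distrib_left sum_distrib_right rx)
      obtain h where h: "dhom (- 1) X X h" "?x * h + h * ?x = idm X" using ex by (auto simp: exv_def)
      \<comment> \<open>Since r is a morphism on Z only, the projection \<open>q\<close> appears in
        \<open>rx\<close> and \<open>rv\<close>; it disappears here because v maps Y into Z.\<close>
      define k where "k = r * ?v * E"
      have dr: "dhom 0 Y X r" using mmorD(1)[OF r(1)] by (auto simp: dhom_def Z_def)
      have dv: "dhom 1 Y Y ?v" by (rule dhom_av[OF Y(1)])
      have dk: "dhom 1 Y X k" unfolding k_def by (intro dhom_mult[OF dhom_mult[OF dr dv] dE]) auto
      have vv: "?v * (?v * F) = 0" for F using av_square[OF Y(1), of w] by (simp add: mult.assoc[symmetric])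
      have "?x * k = (?x * r) * (?v * E)" by (simp only: k_def mult.assoc)
      also have "\<dots> = (r * ?v * q) * (?v * E)" unfolding rv ..
      also have "\<dots> = r * (?v * ((q * ?v) * E))" by (simp only: mult.assoc)
      also have "\<dots> = 0" by (simp add: qv vv)
      finally have xk: "?x * k = 0" .
      have khk: "k = ?x * (h * k)"
      proof -
        have "k = (?x * h + h * ?x) * k" using h(2) dk by simp
        also have "\<dots> = ?x * (h * k)" using xk by (simp add: distrib_right mult.assoc)
        finally show ?thesis .
      qed
      have "f * (h * k) = E * (f * (h * k))"
      proof (rule mtx_eqI)
        fix i j
        have d: "dhom 0 Y Y (f * (h * k))" by (intro dhom_mult[OF df] dhom_mult[OF h(1) dk]) auto
        have c: "f * (h * k) * E = f * (h * k)" by (simp add: k_def mult.assoc E_def unit_mult_unit)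
        have "i = i0" if nz: "ent (f * (h * k)) i j \<noteq> 0"
        proof -
          have "ent (f * (h * k) * E) i j \<noteq> 0" using nz c by simp
          then have "j = i0" by (simp add: E_def ent_mult_unit split: if_splits)
          then have "i \<in> ix Y" "dg Y i = j0" using dhomD[OF d nz] i0 by auto
          then show ?thesis by (rule uniq)
        qed
        then show "ent (f * (h * k)) i j = ent (E * (f * (h * k))) i j"
          by (cases "i = i0") (auto simp: E_def ent_unit_mult)
      qed
      also have "\<dots> = 0" using True by (simp add: mult.assoc[symmetric])
      finally have "r * f * (h * k) = 0" by (simp add: mult.assoc)
      then have "h * k = 0" using r(2) dhom_mult[OF h(1) dk, of 0] by simp
      then have k0: "r * ?v * E = 0" using khk by (simp add: k_def)
      have rva: "r * ?v * avg Y Y H E a = 0" if "a \<le> Suc n" for a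
        using that
      proof (induction a)
        case (Suc a)
        then have a: "a \<le> n" and IH: "r * ?v * avg Y Y H E a = 0" by auto
        let ?s = "avg Y Y H E a"
        have "r * ?v * (ac Y a * ?s * H a) = r * (?v * ac Y a) * ?s * H a" by (simp only: mult.assoc)
        also have "\<dots> = - (r * ac Y a * ((q * ?v) * ?s * H a))"
          unfolding av_ac_anti[OF Y(1) a] qv by (simp only: mult.assoc mult_minus_left mult_minus_right)
        also have "\<dots> = - ((r * ac Y a * q) * (?v * ?s * H a))" by (simp only: mult.assoc)
        also have "\<dots> = - (ac X a * (r * ?v * ?s) * H a)" unfolding rx[OF a] by (simp only: mult.assoc)
        finally have "r * ?v * (ac Y a * ?s * H a) = 0" using IH by simp
        moreover have "r * ?v * (?s * H a * ac Y a) = 0" using IH by (simp add: mult.assoc[symmetric])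
        ultimately show ?case by (simp add: distrib_left)
      qed (simp add: k0)
      have "r * ?v * p * G = 0" unfolding p_def rva[OF order.refl] by simp
      then have "r * ?v * idm Y = 0" using G(2) by (simp add: mult.assoc)
      then have rv0: "r * ?v = 0" using dhom_mult[OF dr dv, of 1] by simp
      \<comment> \<open>A contraction of the linear form on Y: dividing by the nonzero coordinate
        \<open>w a0\<close> normalizes the contraction with that variable.\<close>
      define h' where "h' = scl (1 / w a0) (H a0)"
      have vh': "?v * h' + h' * ?v = idm Y"
        using arg_cong[OF dsys_av[OF H w(1), of w], of "scl (1 / w a0)"] w(2) by (simp add: h'_def scl_add)
      have "idm X = r * (?v * h' + h' * ?v) * f" unfolding vh' using r(2) dhom_mult_idm[OF dr] by simp
      also have "\<dots> = (r * ?v) * h' * f + r * h' * (?v * f)" by (simp only: distrib_left distrib_right mult.assoc)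
      also have "\<dots> = r * h' * f * ?x" using rv0 mmor_av[OF fm, of w] by (simp add: mult.assoc)
      finally have iX: "idm X = r * h' * f * ?x" .
      have "?x = idm X * ?x" using dhom_av[OF X(1), of w] by simp
      also have "\<dots> = r * h' * f * (?x * ?x)" by (subst iX) (simp only: mult.assoc)
      finally have "?x = 0" using av_square[OF X(1), of w] by simp
      then have "idm X = 0" using h(2) by simp
      with X(2) show False by (simp add: idm_eq_0_iff indec_def)
    qed
  qed
qed

section \<open>Modules exact in every direction are free\<close>

definition indep :: "nat \<Rightarrow> (nat \<Rightarrow> nat \<Rightarrow> 'k::field) \<Rightarrow> nat \<Rightarrow> bool" where
  "indep n ws m \<longleftrightarrow> (\<forall>c. (\<forall>a\<le>n. (\<Sum>i<m. c i * ws i a) = 0) \<longrightarrow> (\<forall>i<m. c i = 0))"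

definition dualsys :: "nat \<Rightarrow> 'k::field mm \<Rightarrow> (nat \<Rightarrow> nat \<Rightarrow> 'k) \<Rightarrow> nat \<Rightarrow> (nat \<Rightarrow> 'k mtx) \<Rightarrow> bool" where
  "dualsys n Y ws m H \<longleftrightarrow> (\<forall>j<m. dhom (- 1) Y Y (H j) \<and>
     (\<forall>i<m. av n (ws i) Y * H j + H j * av n (ws i) Y = (if i = j then idm Y else 0)))"

lemma dualsysD: "dualsys n Y ws m H \<Longrightarrow> j < m \<Longrightarrow> dhom (- 1) Y Y (H j)"
  "dualsys n Y ws m H \<Longrightarrow> j < m \<Longrightarrow> i < m \<Longrightarrow>
     av n (ws i) Y * H j + H j * av n (ws i) Y = (if i = j then idm Y else 0)"
  by (auto simp: dualsys_def)

text \<open>An exchange of forms. K is null for the forms of the system and has value \<phi> at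
  \<open>w\<close>; the result is null at \<open>w\<close> and has value \<phi> at the j-th form
  alone. It is minus the commutator of v with \<open>H j * K\<close>: an anticommutator with the
  i-th form meets \<open>H j\<close> and leaves \<phi> only for i = j, and the one with v vanishes
  because v squares to zero.\<close>

lemma dualsys_transfer:
  assumes Y: "mmod n Y" and H: "dualsys n Y ws m H" and K: "dhom (- 1) Y Y K"
    and van: "\<And>i. i < m \<Longrightarrow> av n (ws i) Y * K + K * av n (ws i) Y = 0"
    and \<phi>: "av n w Y * K + K * av n w Y = \<phi>" and j: "j < m"
  obtains k where "dhom (- 1) Y Y k"
    "\<And>i. i < m \<Longrightarrow> av n (ws i) Y * k + k * av n (ws i) Y = (if i = j then \<phi> else 0)"
    "av n w Y * k + k * av n w Y = 0"
proof -
  let ?v = "av n w Y" and ?V = "\<lambda>i. av n (ws i) Y"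
  define k where "k = H j * K * ?v - ?v * H j * K"
  have dv: "dhom 1 Y Y ?v" by (rule dhom_av[OF Y])
  note dH = dualsysD(1)[OF H j]
  have "dhom (- 1) Y Y (H j * K * ?v)" "dhom (- 1) Y Y (?v * H j * K)"
    by (rule dhom_mult[OF dhom_mult[OF dH K refl] dv], simp)
      (rule dhom_mult[OF dhom_mult[OF dv dH refl] K], simp)
  then have 1: "dhom (- 1) Y Y k" unfolding k_def by (rule dhom_diff)
  have 2: "?V i * k + k * ?V i = (if i = j then \<phi> else 0)" if i: "i < m" for i
  proof -
    let ?d = "if i = j then idm Y else 0"
    have e1: "?V i * H j = ?d - H j * ?V i" using dualsysD(2)[OF H j i] by (metis add_diff_cancel_right')
    have e2: "?V i * K = - (K * ?V i)" using van[OF i] by (simp add: eq_neg_iff_add_eq_0)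
    have e3: "?V i * ?v = - (?v * ?V i)" by (rule av_anti[OF Y])
    have "?V i * (H j * K * ?v) = (?V i * H j) * K * ?v" by (simp only: mult.assoc)
    also have "\<dots> = ?d * K * ?v - H j * (?V i * K) * ?v" unfolding e1 by (simp only: left_diff_distrib mult.assoc)
    also have "H j * (?V i * K) * ?v = - (H j * K * (?V i * ?v))" unfolding e2
      by (simp only: mult_minus_right mult_minus_left mult.assoc)
    also have "\<dots> = H j * K * ?v * ?V i" unfolding e3 by (simp only: mult_minus_right minus_minus mult.assoc)
    finally have f1: "?V i * (H j * K * ?v) = ?d * K * ?v - H j * K * ?v * ?V i" .
    have "?V i * (?v * H j * K) = (?V i * ?v) * H j * K" by (simp only: mult.assoc)
    also have "\<dots> = - (?v * (?V i * H j) * K)" unfolding e3 by (simp only: mult_minus_left mult.assoc)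
    also have "\<dots> = - (?v * ?d * K - ?v * H j * (?V i * K))" unfolding e1
      by (simp only: left_diff_distrib right_diff_distrib mult.assoc)
    also have "\<dots> = - (?v * ?d * K) - ?v * H j * K * ?V i" unfolding e2
      by (simp only: mult_minus_right minus_diff_eq mult.assoc) simp
    finally have f2: "?V i * (?v * H j * K) = - (?v * ?d * K) - ?v * H j * K * ?V i" .
    have "?V i * k + k * ?V i = ?d * K * ?v + ?v * ?d * K"
      unfolding k_def right_diff_distrib left_diff_distrib f1 f2 by simp
    also have "\<dots> = (if i = j then \<phi> else 0)"
      using idm_mult_dhom[OF K] dhom_mult_idm[OF dv] \<phi> by (simp add: add.commute)
    finally show ?thesis .
  qed
  have vv: "?v * (?v * F) = 0" "F * ?v * ?v = 0" for F
    using av_square[OF Y, of w] by (simp_all add: mult.assoc[symmetric], simp add: mult.assoc)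
  have "?v * k + k * ?v = ?v * H j * K * ?v - ?v * (?v * (H j * K)) + (H j * K * ?v * ?v - ?v * H j * K * ?v)"
    unfolding k_def by (simp only: right_diff_distrib left_diff_distrib mult.assoc)
  then have 3: "?v * k + k * ?v = 0" by (simp add: vv)
  show thesis by (rule that[OF 1 2 3])
qed

lemma av_lin: "av n (\<lambda>a. x a + c * y a) Y = av n x Y + scl c (av n y Y)"
  by (simp add: av_def scl_add_left sum.distrib scl_sum)

definition pev :: "'k::field mm \<Rightarrow> 'k mtx \<Rightarrow> 'k poly \<Rightarrow> 'k mtx" where
  "pev Y F p = (\<Sum>i\<le>degree p. scl (coeff p i) (F ^ i * idm Y))"

lemma pev_bound: "degree p \<le> N \<Longrightarrow> pev Y F p = (\<Sum>i\<le>N. scl (coeff p i) (F ^ i * idm Y))"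
  unfolding pev_def by (rule sum.mono_neutral_left) (auto simp: coeff_eq_0)

lemma pev_linear_factor:
  "pev Y F ([:- r, 1:] * q) = F * pev Y F q - scl r (pev Y F q)"
proof -
  let ?N = "Suc (degree q)"
  have "degree ([:- r, 1:] * q) \<le> ?N" using degree_mult_le[of "[:- r, 1:]" q] by simp
  then have "pev Y F ([:- r, 1:] * q) = (\<Sum>i\<le>?N. scl (coeff ([:- r, 1:] * q) i) (F ^ i * idm Y))"
    by (rule pev_bound)
  also have "\<dots> = (\<Sum>i\<le>?N. scl (coeff (pCons 0 q) i) (F ^ i * idm Y)) - (\<Sum>i\<le>?N. scl (r * coeff q i) (F ^ i * idm Y))"
    by (simp add: scl_diff_left scl_add_left sum_subtractf sum_negf del: sum.atMost_Suc)
  also have "(\<Sum>i\<le>?N. scl (coeff (pCons 0 q) i) (F ^ i * idm Y)) = F * pev Y F q"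
    unfolding pev_def by (subst sum.atMost_Suc_shift) (simp add: sum_distrib_left mult.assoc)
  also have "(\<Sum>i\<le>?N. scl (r * coeff q i) (F ^ i * idm Y)) = scl r (pev Y F q)"
    using pev_bound[of q ?N Y F] by (simp add: scl_sum del: sum.atMost_Suc)
  finally show ?thesis .
qed

text \<open>Induction on the number of forms. \<open>N \<theta>\<close> asks for a homotopy that is
  null for the old forms and has value \<theta> at the new form v. Applying the induction hypothesis
  to the family with V_0 replaced by v + r V_0 allows a passage from \<open>N\<close> at (\<psi> -
  r) \<theta> to \<open>N \<theta>\<close>. An annihilating polynomial of \<psi> splits into linear
  factors, so \<open>N 0\<close> leads down to \<open>N (idm Y)\<close>; this is where algebraic
  closedness enters.\<close>

theorem dual_system_exists:
  fixes Y :: "'k::alg_closed_field mm"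
  assumes Y: "mmod n Y" and all: "\<And>w. (\<exists>a\<le>n. w a \<noteq> 0) \<Longrightarrow> exv n w Y"
  shows "indep n ws m \<Longrightarrow> \<exists>H. dualsys n Y ws m H"
proof (induction m arbitrary: ws)
  case 0
  then show ?case by (simp add: dualsys_def)
next
  case (Suc m)
  have ind: "indep n ws m" unfolding indep_def
  proof (intro allI impI)
    fix c i assume c: "\<forall>a\<le>n. (\<Sum>i<m. c i * ws i a) = 0" and i: "i < m"
    let ?c = "\<lambda>i. if i < m then c i else 0"
    have "\<forall>a\<le>n. (\<Sum>i<Suc m. ?c i * ws i a) = 0" using c by simp
    with Suc.prems have "\<forall>i<Suc m. ?c i = 0" unfolding indep_def by (elim allE[of _ ?c]) blast
    from this[rule_format, of i] show "c i = 0" using i by simp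
  qed
  from Suc.IH[OF this] obtain H where H: "dualsys n Y ws m H" by blast
  let ?v = "av n (ws m) Y" and ?V = "\<lambda>i. av n (ws i) Y"
  define N where "N \<theta> \<longleftrightarrow> (\<exists>K. dhom (- 1) Y Y K \<and> (\<forall>i<m. ?V i * K + K * ?V i = 0) \<and> ?v * K + K * ?v = \<theta>)" for \<theta>
  have dv: "dhom 1 Y Y (av n w Y)" for w by (rule dhom_av[OF Y])
  have "N (idm Y)"
  proof (cases "m = 0")
    case True
    have "\<exists>a\<le>n. ws 0 a \<noteq> 0"
    proof (rule ccontr)
      assume "\<not> ?thesis"
      then have "\<forall>a\<le>n. (\<Sum>i<Suc m. 1 * ws i a) = 0" using True by simp
      with Suc.prems have "\<forall>i<Suc m. (1::'k) = 0" unfolding indep_def by (elim allE[of _ "\<lambda>_. 1"]) blast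
      from this[rule_format, of 0] show False by simp
    qed
    from all[OF this] show ?thesis using True by (auto simp: N_def exv_def)
  next
    case False
    then have m: "0 < m" by simp
    \<comment> \<open>The failure of the old contraction \<open>H 0\<close> to be null for the new
      form. It commutes with all the forms involved, so its powers may be handled like
      scalars.\<close>
    define \<psi> where "\<psi> = - (?v * H 0 + H 0 * ?v)"
    note H0 = dualsysD[OF H m]
    have d\<psi>: "dhom 0 Y Y \<psi>" unfolding \<psi>_def
      by (intro dhom_uminus dhom_add dhom_mult[OF dv H0(1)] dhom_mult[OF H0(1) dv]) auto
    have V\<psi>: "?V i * \<psi> = \<psi> * ?V i" if i: "i < m" for i
    proof -
      let ?d = "if i = 0 then idm Y else 0"
      have e1: "?V i * H 0 = ?d - H 0 * ?V i" using H0(2)[OF i] by (metis add_diff_cancel_right')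
      have e3: "?V i * ?v = - (?v * ?V i)" by (rule av_anti[OF Y])
      have "?V i * (?v * H 0) = - (?v * (?V i * H 0))" by (simp only: mult.assoc[symmetric] e3 mult_minus_left)
      also have "\<dots> = - (?v * ?d) + ?v * H 0 * ?V i"
        unfolding e1 by (simp only: right_diff_distrib mult.assoc) simp
      finally have 1: "?V i * (?v * H 0) = - (?v * ?d) + ?v * H 0 * ?V i" .
      have "?V i * (H 0 * ?v) = (?V i * H 0) * ?v" by (simp only: mult.assoc)
      also have "\<dots> = ?d * ?v - H 0 * (?V i * ?v)" unfolding e1 by (simp only: left_diff_distrib mult.assoc)
      also have "\<dots> = ?d * ?v + H 0 * ?v * ?V i" unfolding e3 by (simp add: mult.assoc)
      finally have 2: "?V i * (H 0 * ?v) = ?d * ?v + H 0 * ?v * ?V i" .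
      have "?d * ?v = ?v * ?d" using idm_mult_dhom[OF dv] dhom_mult_idm[OF dv] by simp
      then have "?V i * (?v * H 0 + H 0 * ?v) = (?v * H 0 + H 0 * ?v) * ?V i"
        unfolding distrib_left distrib_right 1 2 by simp
      then show ?thesis unfolding \<psi>_def by (simp only: mult_minus_left mult_minus_right)
    qed
    have v\<psi>: "?v * \<psi> = \<psi> * ?v"
    proof -
      have "?v * (?v * F) = 0" "F * ?v * ?v = 0" for F
        using av_square[OF Y, of "ws m"] by (simp_all add: mult.assoc[symmetric], simp add: mult.assoc)
      then show ?thesis using av_square[OF Y, of "ws m"] by (simp add: \<psi>_def algebra_simps)
    qed
    define En where "En \<theta> \<longleftrightarrow> dhom 0 Y Y \<theta> \<and> (\<forall>i<m. ?V i * \<theta> = \<theta> * ?V i) \<and> ?v * \<theta> = \<theta> * ?v" for \<theta>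
    have En_mult: "En (\<psi> * \<theta>)" if "En \<theta>" for \<theta>
      unfolding En_def
    proof (intro conjI allI impI)
      show "dhom 0 Y Y (\<psi> * \<theta>)" using dhom_mult[OF d\<psi>] that by (simp add: En_def)
      have "?v * (\<psi> * \<theta>) = \<psi> * (?v * \<theta>)" by (simp only: mult.assoc[symmetric] v\<psi>)
      then show "?v * (\<psi> * \<theta>) = \<psi> * \<theta> * ?v" using that by (simp add: En_def mult.assoc)
      fix i assume i: "i < m"
      have "?V i * (\<psi> * \<theta>) = \<psi> * (?V i * \<theta>)" by (simp only: mult.assoc[symmetric] V\<psi>[OF i])
      then show "?V i * (\<psi> * \<theta>) = \<psi> * \<theta> * ?V i" using that i by (simp add: En_def mult.assoc)
    qed
    have En_scl: "En (scl c \<theta>)" if "En \<theta>" for c \<theta> using that by (simp add: En_def dhom_scl)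
    have En_sum: "En (\<Sum>x\<in>S. F x)" if "\<And>x. x \<in> S \<Longrightarrow> En (F x)" for S :: "nat set" and F
      using that by (auto simp: En_def dhom_sum sum_distrib_left sum_distrib_right intro!: sum.cong dhom_sum)
    have En_idm: "En (idm Y)" unfolding En_def using idm_mult_dhom[OF dv] dhom_mult_idm[OF dv] by (simp add: dhom_idm)
    have En_pow: "En (\<psi> ^ l * idm Y)" for l
      by (induction l) (auto simp: En_idm mult.assoc intro: En_mult)
    have En_pev: "En (pev Y \<psi> q)" for q unfolding pev_def by (intro En_sum En_scl En_pow)
    have step: "N \<theta>" if \<theta>: "En \<theta>" and Nt: "N (\<psi> * \<theta> - scl r \<theta>)" for \<theta> r
    proof -
      obtain K0 where K0: "dhom (- 1) Y Y K0" "\<And>i. i < m \<Longrightarrow> ?V i * K0 + K0 * ?V i = 0"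
        "?v * K0 + K0 * ?v = \<psi> * \<theta> - scl r \<theta>" using Nt by (auto simp: N_def)
      \<comment> \<open>Adding \<open>H 0 * \<theta>\<close> contributes - \<psi> \<theta> at v and
        \<theta> at V_0. The values at v and V_0 become - r \<theta> and \<theta>, hence K is null
        for v + r V_0.\<close>
      define K where "K = K0 + H 0 * \<theta>"
      have d\<theta>: "dhom 0 Y Y \<theta>" using \<theta> by (simp add: En_def)
      have dK: "dhom (- 1) Y Y K" unfolding K_def by (intro dhom_add K0(1) dhom_mult[OF H0(1) d\<theta>]) simp
      have VK: "?V i * K + K * ?V i = (if i = 0 then \<theta> else 0)" if i: "i < m" for i
      proof -
        have "\<theta> * ?V i = ?V i * \<theta>" using \<theta> i by (simp add: En_def)
        then have "?V i * K + K * ?V i = (?V i * K0 + K0 * ?V i) + (?V i * H 0 + H 0 * ?V i) * \<theta>"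
          by (simp add: K_def distrib_left distrib_right mult.assoc)
        then show ?thesis using K0(2)[OF i] H0(2)[OF i] idm_mult_dhom[OF d\<theta>] by simp
      qed
      have vK: "?v * K + K * ?v = - scl r \<theta>"
      proof -
        have "\<theta> * ?v = ?v * \<theta>" using \<theta> by (simp add: En_def)
        then have "?v * K + K * ?v = (?v * K0 + K0 * ?v) + (?v * H 0 + H 0 * ?v) * \<theta>"
          by (simp add: K_def distrib_left distrib_right mult.assoc)
        then show ?thesis unfolding K0(3) by (simp add: \<psi>_def algebra_simps)
      qed
      \<comment> \<open>The family still has m independent members, so the induction hypothesis
        provides contractions; the exchange lemma then moves the value \<theta> from V_0 to the new
        first member, which is v up to a multiple of V_0.\<close>
      define ws' where "ws' i = (if i = 0 then (\<lambda>a. ws m a + r * ws 0 a) else ws i)" for i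
      have "indep n ws' m" unfolding indep_def
      proof (intro allI impI)
        fix c i assume c: "\<forall>a\<le>n. (\<Sum>i<m. c i * ws' i a) = 0" and i: "i < m"
        define c' where "c' i = (if i = m then c 0 else if i = 0 then c 0 * r else c i)" for i
        have "(\<Sum>i<Suc m. c' i * ws i a) = (\<Sum>i<m. c i * ws' i a)" for a
        proof -
          have s: "{..<m} = insert 0 {0<..<m}" using m by auto
          have "(\<Sum>i\<in>{0<..<m}. c' i * ws i a) = (\<Sum>i\<in>{0<..<m}. c i * ws' i a)"
            by (rule sum.cong) (auto simp: c'_def ws'_def)
          then show ?thesis using m unfolding sum.lessThan_Suc s
            by (simp add: c'_def ws'_def algebra_simps)
        qed
        with c have "\<forall>a\<le>n. (\<Sum>i<Suc m. c' i * ws i a) = 0" by simp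
        with Suc.prems have z: "\<forall>i<Suc m. c' i = 0" by (simp add: indep_def)
        show "c i = 0"
        proof (cases "i = 0")
          case True
          with z[rule_format, of m] show ?thesis by (simp add: c'_def)
        next
          case False
          with z[rule_format, of i] i show ?thesis by (simp add: c'_def)
        qed
      qed
      from Suc.IH[OF this] obtain H' where H': "dualsys n Y ws' m H'" by blast
      have V'K: "av n (ws' i) Y * K + K * av n (ws' i) Y = 0" if "i < m" for i
      proof (cases "i = 0")
        case True
        have "av n (ws' 0) Y = ?v + scl r (?V 0)" by (simp add: ws'_def av_lin)
        then have "av n (ws' 0) Y * K + K * av n (ws' 0) Y = (?v * K + K * ?v) + scl r (?V 0 * K + K * ?V 0)"
          by (simp add: distrib_left distrib_right scl_add)
        then show ?thesis using vK VK[OF m] True by simp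
      next
        case False
        then show ?thesis using VK[OF that] by (simp add: ws'_def)
      qed
      have V0K: "?V 0 * K + K * ?V 0 = \<theta>" using VK[OF m] by simp
      obtain k where k: "dhom (- 1) Y Y k"
        "\<And>i. i < m \<Longrightarrow> av n (ws' i) Y * k + k * av n (ws' i) Y = (if i = 0 then \<theta> else 0)"
        "?V 0 * k + k * ?V 0 = 0"
        using dualsys_transfer[OF Y H' dK V'K V0K m] by blast
      have "?v * k + k * ?v = \<theta>"
      proof -
        have "av n (ws' 0) Y = ?v + scl r (?V 0)" by (simp add: ws'_def av_lin)
        then have "av n (ws' 0) Y * k + k * av n (ws' 0) Y = (?v * k + k * ?v) + scl r (?V 0 * k + k * ?V 0)"
          by (simp add: distrib_left distrib_right scl_add)
        then show ?thesis using k(2)[OF m] k(3) by simp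
      qed
      moreover have "?V i * k + k * ?V i = 0" if "i < m" for i
        using k(2)[OF that] k(3) by (cases "i = 0") (simp_all add: ws'_def)
      ultimately show "N \<theta>" using k(1) by (auto simp: N_def)
    qed
    \<comment> \<open>Each root r of p removes one linear factor by \<open>step\<close>, until a
      nonzero constant is left.\<close>
    have poly: "p \<noteq> 0 \<Longrightarrow> N (pev Y \<psi> p) \<Longrightarrow> N (idm Y)" for p
    proof (induction "degree p" arbitrary: p rule: less_induct)
      case less
      show ?case
      proof (cases "degree p = 0")
        case True
        then have c: "coeff p 0 \<noteq> 0" using less.prems(1) leading_coeff_neq_0[of p] by simp
        have "pev Y \<psi> p = scl (coeff p 0) (idm Y)" using True by (simp add: pev_def)
        with less.prems(2) obtain K where K: "dhom (- 1) Y Y K" "\<And>i. i < m \<Longrightarrow> ?V i * K + K * ?V i = 0"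
          "?v * K + K * ?v = scl (coeff p 0) (idm Y)" by (auto simp: N_def)
        let ?c = "1 / coeff p 0"
        have "?V i * scl ?c K + scl ?c K * ?V i = 0" if "i < m" for i
          using K(2)[OF that] by (simp add: scl_add[symmetric])
        moreover have "?v * scl ?c K + scl ?c K * ?v = idm Y"
          using K(3) c by (simp add: scl_add[symmetric])
        ultimately show ?thesis using dhom_scl[OF K(1), of ?c] unfolding N_def by blast
      next
        case False
        then obtain r where "poly p r = 0" using alg_closed_imp_poly_has_root[of p] by auto
        then obtain q where q: "p = [:- r, 1:] * q" by (auto simp: poly_eq_0_iff_dvd)
        then have q0: "q \<noteq> 0" using less.prems(1) by auto
        have "degree p = Suc (degree q)" unfolding q using q0 by (subst degree_mult_eq) auto
        moreover have "N (pev Y \<psi> q)"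
          by (rule step[OF En_pev]) (use less.prems(2) in \<open>simp add: q pev_linear_factor[symmetric] del: mult_pCons_left\<close>)
        ultimately show ?thesis using less.hyps[of q] q0 by simp
      qed
    qed
    obtain M c where c: "\<exists>l<M. c l \<noteq> 0" "(\<Sum>l<M. scl (c l) (\<psi> ^ l * idm Y)) = 0"
      using algebraic[OF mmodD(1)[OF Y] d\<psi>] by blast
    define p where "p = (\<Sum>l<M. monom (c l) l)"
    have cp: "coeff p i = (if i < M then c i else 0)" for i
      by (simp add: p_def coeff_sum)
    have "p \<noteq> 0" using c(1) cp by (metis coeff_0)
    moreover have "pev Y \<psi> p = 0"
    proof -
      have "degree p \<le> M" by (rule degree_le) (simp add: cp)
      then have "pev Y \<psi> p = (\<Sum>i\<le>M. scl (coeff p i) (\<psi> ^ i * idm Y))" by (rule pev_bound)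
      also have "\<dots> = (\<Sum>i<M. scl (c i) (\<psi> ^ i * idm Y))"
        by (simp add: lessThan_Suc_atMost[symmetric] cp del: sum.atMost_Suc)
      finally show ?thesis using c(2) by simp
    qed
    moreover have "N 0" unfolding N_def by (intro exI[of _ 0]) simp
    ultimately show ?thesis using poly by metis
  qed
  then obtain K where K: "dhom (- 1) Y Y K" "\<And>i. i < m \<Longrightarrow> ?V i * K + K * ?V i = 0"
    "?v * K + K * ?v = idm Y" by (auto simp: N_def)
  have "\<exists>k. j < m \<longrightarrow> dhom (- 1) Y Y k \<and> (\<forall>i<m. ?V i * k + k * ?V i = (if i = j then idm Y else 0)) \<and>
      ?v * k + k * ?v = 0" for j
    using dualsys_transfer[OF Y H K] by metis
  then obtain k where k: "\<And>j. j < m \<Longrightarrow> dhom (- 1) Y Y (k j) \<and>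
      (\<forall>i<m. ?V i * k j + k j * ?V i = (if i = j then idm Y else 0)) \<and> ?v * k j + k j * ?v = 0" by metis
  have "dualsys n Y ws (Suc m) (\<lambda>j. if j = m then K else k j)"
    unfolding dualsys_def using K k by (auto simp: less_Suc_eq)
  then show ?case by blast
qed

theorem exact_imp_free:
  fixes Y :: "'k::alg_closed_field mm"
  assumes Y: "mmod n Y" and all: "\<And>w. (\<exists>a\<le>n. w a \<noteq> 0) \<Longrightarrow> exv n w Y"
  shows "ffree n Y"
proof -
  let ?ws = "\<lambda>i a. if a = i then 1 else 0 :: 'k"
  have "indep n ?ws (Suc n)" unfolding indep_def
  proof (intro allI impI)
    fix c :: "nat \<Rightarrow> 'k" and i
    assume "\<forall>a\<le>n. (\<Sum>i<Suc n. c i * ?ws i a) = 0" "i < Suc n"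
    then have "(\<Sum>j<Suc n. if i = j then c j else 0) = 0"
      by (simp add: if_distrib[of "(*) _"] cong: if_cong del: sum.lessThan_Suc)
    then show "c i = 0" using \<open>i < Suc n\<close> by (simp del: sum.lessThan_Suc)
  qed
  from dual_system_exists[OF Y all this] obtain H where H: "dualsys n Y ?ws (Suc n) H" by blast
  have "av n (?ws i) Y = ac Y i" if "i \<le> n" for i
  proof -
    have "av n (?ws i) Y = (\<Sum>a\<le>n. if a = i then ac Y a else 0)"
      unfolding av_def by (rule sum.cong) auto
    then show ?thesis using that by simp
  qed
  then have "dsys n Y H" using H unfolding dsys_def dualsys_def by (auto simp: less_Suc_eq_le)
  then show ?thesis by (auto simp: ffree_dsys)
qed

unbundle fps_syntax

section \<open>Rigid modules\<close>

lemma comm_left: "a * b = b * a \<Longrightarrow> a * (b * z) = b * (a * (z :: 'a::semigroup_mult))"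
  by (simp add: mult.assoc[symmetric])

text \<open>The homogeneous part of a matrix. It turns solutions of linear equations found without
  regard to degrees into homogeneous ones.\<close>

definition hpart :: "int \<Rightarrow> 'k::field mm \<Rightarrow> 'k mm \<Rightarrow> 'k mtx \<Rightarrow> 'k mtx" where
  "hpart d X Y F = mtx (\<lambda>i j. if i \<in> ix Y \<and> j \<in> ix X \<and> dg Y i = dg X j + d then ent F i j else 0)"

lemma ent_hpart: "ent (hpart d X Y F) i j =
    (if i \<in> ix Y \<and> j \<in> ix X \<and> dg Y i = dg X j + d then ent F i j else 0)"
  unfolding hpart_def
  by (subst ent_mtx) (auto intro: finite_subset[OF _ finite_row[of F]] finite_subset[OF _ finite_col[of F]])

lemma dhom_hpart: "dhom d X Y (hpart d X Y F)"
  by (auto simp: dhom_def ent_hpart split: if_splits)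

lemma hpart_mult_left: assumes "dhom d Y Z G"
  shows "hpart (d + e) X Z (G * F) = G * hpart e X Y F"
proof (rule mtx_eqI)
  fix i j
  have a: "ent (G * F) i j = (\<Sum>l | ent G i l \<noteq> 0. ent G i l * ent F l j)"
    by (rule ent_times_gen) (auto simp: finite_row)
  have b: "ent (G * hpart e X Y F) i j = (\<Sum>l | ent G i l \<noteq> 0. ent G i l * ent (hpart e X Y F) l j)"
    by (rule ent_times_gen) (auto simp: finite_row)
  show "ent (hpart (d + e) X Z (G * F)) i j = ent (G * hpart e X Y F) i j"
  proof (cases "i \<in> ix Z \<and> j \<in> ix X \<and> dg Z i = dg X j + (d + e)")
    case True
    have "ent F l j = ent (hpart e X Y F) l j" if "ent G i l \<noteq> 0" for l
      using dhomD[OF assms that] True by (auto simp: ent_hpart)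
    then show ?thesis unfolding b using True by (auto simp: ent_hpart a intro!: sum.cong)
  next
    case False
    have "ent (hpart e X Y F) l j = 0" if "ent G i l \<noteq> 0" for l
      using dhomD[OF assms that] False by (auto simp: ent_hpart)
    then show ?thesis unfolding b using False by (auto simp: ent_hpart intro!: sum.neutral)
  qed
qed

lemma hpart_mult_right: assumes "dhom d W X G"
  shows "hpart (d + e) W Z (F * G) = hpart e X Z F * G"
proof -
  have h: "tpose (hpart c A B M) = hpart c (tpm B) (tpm A) (tpose M)" for c A B and M :: "'a mtx"
    by (rule mtx_eqI) (auto simp: ent_hpart)
  have "tpose (hpart (d + e) W Z (F * G)) = tpose (hpart e X Z F * G)"
    unfolding h transp_mult using hpart_mult_left[OF dhom_tpm[OF assms]] by simp
  then show ?thesis by (simp only: transp_eq_iff)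
qed

lemma hpart_id: "dhom d X Y F \<Longrightarrow> hpart d X Y F = F"
  by (rule mtx_eqI) (auto simp: ent_hpart dhom_def)

lemma exvI: assumes X: "mmod n X" and k: "av n w X * k + k * av n w X = idm X"
  shows "exv n w X"
proof -
  note d = dhom_av[OF X, of w]
  have add: "hpart 0 X X (A + B) = hpart 0 X X A + hpart 0 X X B" for A B :: "'a mtx"
    by (rule mtx_eqI) (auto simp: ent_hpart)
  have "idm X = hpart 0 X X (av n w X * k) + hpart 0 X X (k * av n w X)"
    using hpart_id[OF dhom_idm[of X]] by (simp add: add[symmetric] k)
  also have "\<dots> = av n w X * hpart (- 1) X X k + hpart (- 1) X X k * av n w X"
    using hpart_mult_left[OF d, of "- 1" X k] hpart_mult_right[OF d, of "- 1" X k] by simp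
  finally show ?thesis unfolding exv_def using dhom_hpart by metis
qed

text \<open>Vanishing of those self-extensions whose cocycle anticommutes with every variable in
  each component separately, which is stronger than the cocycle identity. The deformations
  considered next produce cocycles of this kind only.\<close>

definition rigid :: "nat \<Rightarrow> 'k::field mm \<Rightarrow> bool" where
  "rigid n Y \<longleftrightarrow> (\<forall>\<phi>. (\<forall>a\<le>n. dhom 1 Y Y (\<phi> a)) \<and> (\<forall>a\<le>n. \<forall>b\<le>n. ac Y a * \<phi> b + \<phi> b * ac Y a = 0) \<longrightarrow>
     (\<exists>D. dhom 0 Y Y D \<and> (\<forall>a\<le>n. D * ac Y a - ac Y a * D = \<phi> a)))"

text \<open>The vector \<open>w\<close> is deformed along the line \<open>w + s v\<^sub>0\<close>. Rigidity trivialises the deformation over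
  formal power series, so that the contracting homotopy of \<open>w + s v\<^sub>0\<close> over the Laurent series can be
  transported to \<open>w\<close>; clearing denominators and comparing coefficients gives one for \<open>w\<close> itself.\<close>

theorem rigid_exv:
  fixes Y :: "'k::field mm"
  assumes Y: "mmod n Y" and rig: "rigid n Y" and ex: "exv n w0 Y" and w: "a0 \<le> n" "w a0 \<noteq> 0"
  shows "exv n w Y"
proof -
  let ?u = "av n w0 Y" and ?v = "av n w Y"
  \<comment> \<open>A linear form with value 1 at \<open>w\<close>: the substitution x_a \<mapsto>
    x_a + s \<nu>_a u then moves v to v + s u.\<close>
  define \<nu> where "\<nu> a = (if a = a0 then 1 / w a0 else 0)" for a
  have \<nu>: "(\<Sum>a\<le>n. w a * \<nu> a) = 1"
  proof -
    have "(\<Sum>a\<le>n. w a * \<nu> a) = (\<Sum>a\<le>n. if a = a0 then 1 else 0)"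
      using w(2) by (intro sum.cong) (auto simp: \<nu>_def)
    then show ?thesis using w(1) by simp
  qed
  have dv: "dhom 1 Y Y (av n w Y)" for w by (rule dhom_av[OF Y])
  have v00: "?u * (?u * F) = 0" for F using av_square[OF Y, of w0] by (simp add: mult.assoc[symmetric])
  \<comment> \<open>The invariant of the recursion: u kills the commutators of D with the variables.
    This is what makes the next obstruction \<nu>_a u D anticommute with all variables, and it
    persists because u squares to zero.\<close>
  define P where "P j D \<longleftrightarrow> dhom 0 Y Y D \<and> (\<forall>a\<le>n. ?u * (D * ac Y a - ac Y a * D) = 0) \<and>
      (j = 0 \<longrightarrow> D = idm Y)" for j :: nat and D
  have "\<exists>D. \<forall>j. P j (D j) \<and> (\<forall>a\<le>n. D (Suc j) * ac Y a - ac Y a * D (Suc j) = scl (\<nu> a) (?u * D j))"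
  proof (rule dependent_nat_choice)
    have "P 0 (idm Y)" unfolding P_def
      using idm_mult_dhom[OF mmodD(2)[OF Y]] dhom_mult_idm[OF mmodD(2)[OF Y]] by (simp add: dhom_idm)
    then show "\<exists>D. P 0 D" ..
  next
    fix D j assume D: "P j D"
    then have dD: "dhom 0 Y Y D" by (simp add: P_def)
    have "\<exists>D'. dhom 0 Y Y D' \<and> (\<forall>a\<le>n. D' * ac Y a - ac Y a * D' = scl (\<nu> a) (?u * D))"
    proof (rule rig[unfolded rigid_def, rule_format], intro conjI allI impI)
      show "dhom 1 Y Y (scl (\<nu> a) (?u * D))" for a by (intro dhom_scl dhom_mult[OF dv dD]) simp
      fix a b assume a: "a \<le> n"
      have "?u * (D * ac Y a) = ?u * (ac Y a * D)" using D a by (simp add: P_def right_diff_distrib)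
      moreover have "?u * (ac Y a * D) = - (ac Y a * (?u * D))"
        by (simp only: mult.assoc[symmetric] av_ac_anti[OF Y a] mult_minus_left)
      ultimately show "ac Y a * scl (\<nu> b) (?u * D) + scl (\<nu> b) (?u * D) * ac Y a = 0"
        by (simp add: mult.assoc)
    qed
    then obtain D' where D': "dhom 0 Y Y D'" "\<forall>a\<le>n. D' * ac Y a - ac Y a * D' = scl (\<nu> a) (?u * D)" by blast
    then have "P (Suc j) D'" by (simp add: P_def v00)
    with D' show "\<exists>D'. P (Suc j) D' \<and> (\<forall>a\<le>n. D' * ac Y a - ac Y a * D' = scl (\<nu> a) (?u * D))" by blast
  qed
  then obtain D where PD: "\<And>j. P j (D j)"
    and Dx: "\<And>j a. a \<le> n \<Longrightarrow> D (Suc j) * ac Y a - ac Y a * D (Suc j) = scl (\<nu> a) (?u * D j)" by blast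
  have dD: "dhom 0 Y Y (D j)" for j using PD[of j] by (simp add: P_def)
  have D0: "D 0 = idm Y" using PD[of 0] by (simp add: P_def)
  have Dv: "D (Suc j) * ?v = ?v * D (Suc j) + ?u * D j" for j
  proof -
    have "D (Suc j) * ?v - ?v * D (Suc j) = (\<Sum>a\<le>n. scl (w a) (D (Suc j) * ac Y a - ac Y a * D (Suc j)))"
      by (simp add: av_def[of n w] sum_distrib_left sum_distrib_right scl_diff sum_subtractf)
    also have "\<dots> = (\<Sum>a\<le>n. scl (w a * \<nu> a) (?u * D j))" by (rule sum.cong) (simp_all add: Dx)
    also have "\<dots> = ?u * D j" by (simp add: scl_sum_left[symmetric] \<nu>)
    finally show ?thesis by (simp add: algebra_simps)
  qed
  obtain h where h: "dhom (- 1) Y Y h" "?u * h + h * ?u = idm Y" using ex by (auto simp: exv_def)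
  \<comment> \<open>If h contracts u, then it satisfies U h + h U = s - \<tau> for the deformed
    differential U = v + s u. So h contracts U as soon as s - \<tau> is inverted.\<close>
  define \<tau> where "\<tau> = - (?v * h + h * ?v)"
  have d\<tau>: "dhom 0 Y Y \<tau>" unfolding \<tau>_def
    by (intro dhom_uminus dhom_add dhom_mult[OF dv h(1)] dhom_mult[OF h(1) dv]) auto
  let ?C = "fps_const :: 'k mtx \<Rightarrow> 'k mtx fps" and ?X = "fps_X :: 'k mtx fps"
  let ?e = "?C (idm Y)" and ?T = "?C \<tau>" and ?h = "?C h"
  have Xc: "F * (?X * G) = ?X * (F * G)" for F G :: "'k mtx fps"
  proof -
    have "F * (?X * G) = (F * ?X) * G" by (simp only: mult.assoc)
    also have "F * ?X = ?X * F" by (rule fps_mult_fps_X_commute[symmetric])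
    finally show ?thesis by (simp only: mult.assoc)
  qed
  have ee: "?e * ?e = ?e" by (simp only: fps_const_mult idm_idm)
  define \<Phi> where "\<Phi> = Abs_fps D"
  \<comment> \<open>The identity on the complement of Y is added so that the constant term is 1 and
    the series is invertible over the full matrix ring.\<close>
  define \<Phi>' where "\<Phi>' = \<Phi> + (1 - ?e)"
  define U where "U = ?C ?v + ?X * ?C ?u"
  have e\<Phi>: "?e * \<Phi> = \<Phi>" "\<Phi> * ?e = \<Phi>"
    using idm_mult_dhom[OF dD] dhom_mult_idm[OF dD] by (auto simp: \<Phi>_def fps_eq_iff)
  have eU: "?e * U = U" "U * ?e = U"
  proof -
    have "?e * ?C ?v = ?C ?v" "?e * ?C ?u = ?C ?u" "?C ?v * ?e = ?C ?v" "?C ?u * ?e = ?C ?u"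
      using idm_mult_dhom[OF dv] dhom_mult_idm[OF dv] by (simp_all only: fps_const_mult)
    then show "?e * U = U" "U * ?e = U" by (simp_all add: U_def distrib_left distrib_right Xc mult.assoc del: fps_const_mult)
  qed
  have \<Phi>U: "\<Phi> * ?C ?v = U * \<Phi>"
  proof (rule fps_ext)
    fix j
    have "(U * \<Phi>) $ j = ?v * D j + (?X * (?C ?u * \<Phi>)) $ j"
      by (simp add: U_def distrib_right mult.assoc \<Phi>_def)
    then show "(\<Phi> * ?C ?v) $ j = (U * \<Phi>) $ j"
      using idm_mult_dhom[OF dv] dhom_mult_idm[OF dv] by (cases j) (simp_all add: \<Phi>_def D0 Dv)
  qed
  have e\<Phi>': "?e * \<Phi>' = \<Phi>' * ?e"
    by (simp add: \<Phi>'_def distrib_left distrib_right right_diff_distrib left_diff_distrib e\<Phi> ee del: fps_const_mult)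
  have \<Phi>'U: "\<Phi>' * ?C ?v = U * \<Phi>'"
  proof -
    have "?e * ?C ?v = ?C ?v" using idm_mult_dhom[OF dv] by (simp only: fps_const_mult)
    then show ?thesis
      by (simp add: \<Phi>'_def distrib_left distrib_right right_diff_distrib left_diff_distrib \<Phi>U eU del: fps_const_mult)
  qed
  have "\<Phi>' $ 0 = 1" by (simp add: \<Phi>'_def \<Phi>_def D0)
  then obtain \<Psi> where \<Psi>: "\<Psi> * \<Phi>' = 1" "\<Phi>' * \<Psi> = 1"
    using fps_left_inverse'[of 1 \<Phi>' 1] fps_right_inverse[of \<Phi>' 1] fps_right_inverse'[of 1 \<Phi>' 1]
      fps_left_inverse[of 1 \<Phi>'] fps_left_inverse_eq_fps_right_inverse[of 1 \<Phi>' 1] by (metis mult_1)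
  have v\<Psi>: "?C ?v * \<Psi> = \<Psi> * U"
  proof -
    have "?C ?v * \<Psi> = (\<Psi> * \<Phi>') * ?C ?v * \<Psi>" using \<Psi> by simp
    also have "\<dots> = \<Psi> * (\<Phi>' * ?C ?v) * \<Psi>" by (simp only: mult.assoc)
    also have "\<dots> = \<Psi> * U * (\<Phi>' * \<Psi>)" unfolding \<Phi>'U by (simp only: mult.assoc)
    finally show ?thesis using \<Psi> by simp
  qed
  have UU: "U * U = 0"
  proof -
    have "?C ?v * ?C ?v = 0" "?C ?u * ?C ?u = 0" "?C ?u * ?C ?v + ?C ?v * ?C ?u = 0"
      using av_square[OF Y] av_anti[OF Y, of w0 w] by simp_all
    then show ?thesis
      by (simp add: U_def distrib_left distrib_right Xc mult.assoc del: fps_const_mult)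
        (simp add: distrib_left[symmetric] add.commute del: fps_const_mult fps_const_add)
  qed
  have Uh: "U * ?h + ?h * U = ?X * ?e - ?T"
  proof -
    have "U * ?h + ?h * U = ?C (?v * h + h * ?v) + ?X * ?C (?u * h + h * ?u)"
      by (simp add: U_def distrib_left distrib_right Xc mult.assoc flip: fps_const_add)
    then show ?thesis unfolding h(2) \<tau>_def by (simp add: add.commute)
  qed
  have XT: "?X * ?e - ?T = ?e * (?X - ?T)"
    using idm_mult_dhom[OF d\<tau>] by (simp add: right_diff_distrib fps_mult_fps_X_commute)
  have UT: "U * ?T = ?T * U"
  proof -
    have "U * (U * ?h + ?h * U) = (U * ?h + ?h * U) * U"
      using UU by (simp add: distrib_left distrib_right mult.assoc) (simp add: mult.assoc[symmetric])
    then have "U * (?X * ?e - ?T) = (?X * ?e - ?T) * U" unfolding Uh .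
    moreover have "U * (?X * ?e) = ?X * ?e * U" by (simp add: Xc eU mult.assoc)
    ultimately show ?thesis by (simp add: right_diff_distrib left_diff_distrib)
  qed
  obtain N c where c: "\<exists>l<N. c l \<noteq> 0" "(\<Sum>l<N. scl (c l) (\<tau> ^ l * idm Y)) = 0"
    using algebraic[OF mmodD(1)[OF Y] d\<tau>] by blast
  \<comment> \<open>\<open>G i\<close> is the quotient of s^i - \<tau>^i by s - \<tau>. Summed with
    the coefficients of an annihilating polynomial p of \<tau> it gives A with (s - \<tau>) A =
    p(s), which replaces the inverse of s - \<tau>.\<close>
  define G where "G = rec_nat 0 (\<lambda>i g. ?X * g + ?C (\<tau> ^ i * idm Y))"
  have G0: "G 0 = 0" and GS: "G (Suc i) = ?X * G i + ?C (\<tau> ^ i * idm Y)" for i by (simp_all add: G_def)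
  have GX: "(?X - ?T) * G i = ?X ^ i * ?e - ?C (\<tau> ^ i * idm Y)" for i
  proof (induction i)
    case (Suc i)
    have "(?X - ?T) * G (Suc i) = ?X * ((?X - ?T) * G i) + (?X - ?T) * ?C (\<tau> ^ i * idm Y)"
      by (simp only: GS distrib_left Xc)
    also have "\<dots> = ?X ^ Suc i * ?e - ?C (\<tau> ^ Suc i * idm Y)"
      unfolding Suc by (simp add: right_diff_distrib left_diff_distrib mult.assoc)
    finally show ?case .
  qed (simp add: G0)
  have UG: "U * G i = G i * U" for i
  proof (induction i)
    case (Suc i)
    have "U * ?C (\<tau> ^ i * idm Y) = ?C (\<tau> ^ i * idm Y) * U" for i
    proof (induction i)
      case (Suc i)
      have s: "?C (\<tau> ^ Suc i * idm Y) = ?T * ?C (\<tau> ^ i * idm Y)" by (simp add: mult.assoc)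
      have "U * ?C (\<tau> ^ Suc i * idm Y) = (U * ?T) * ?C (\<tau> ^ i * idm Y)" unfolding s by (simp only: mult.assoc)
      also have "\<dots> = ?T * (?C (\<tau> ^ i * idm Y) * U)" unfolding UT Suc[symmetric] by (simp only: mult.assoc)
      finally show ?case unfolding s by (simp only: mult.assoc)
    qed (simp add: eU)
    then show ?case using Suc by (simp only: GS distrib_left distrib_right Xc mult.assoc)
  qed (simp add: G0)
  let ?c = "\<lambda>l. ?C (scl (c l) 1)"
  have cc: "?c l * F = F * ?c l" for l F by (rule fps_ext) simp
  define A where "A = (\<Sum>l<N. ?c l * G l)"
  have UA: "U * A = A * U"
  proof -
    have "U * (?c l * G l) = ?c l * G l * U" for l
    proof -
      have "U * (?c l * G l) = ?c l * (U * G l)" by (rule comm_left[OF cc[symmetric]])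
      then show ?thesis by (simp only: mult.assoc UG)
    qed
    then show ?thesis by (simp only: A_def sum_distrib_left sum_distrib_right)
  qed
  define pp where "pp = (\<Sum>l<N. ?c l * ?X ^ l)"
  have XA: "(?X - ?T) * A = pp * ?e"
  proof -
    have "(?X - ?T) * (?c l * G l) = ?c l * ?X ^ l * ?e - ?C (scl (c l) (\<tau> ^ l * idm Y))" for l
    proof -
      have "(?X - ?T) * (?c l * G l) = ?c l * ((?X - ?T) * G l)"
        by (rule comm_left[OF cc[symmetric]])
      then show ?thesis unfolding GX by (simp add: right_diff_distrib mult.assoc)
    qed
    then have "(?X - ?T) * A = pp * ?e - (\<Sum>l<N. ?C (scl (c l) (\<tau> ^ l * idm Y)))"
      by (simp only: A_def pp_def sum_distrib_left sum_distrib_right sum_subtractf)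
    also have "(\<Sum>l<N. ?C (scl (c l) (\<tau> ^ l * idm Y))) = ?C (\<Sum>l<N. scl (c l) (\<tau> ^ l * idm Y))"
      by (rule fps_ext) (simp add: fps_sum_nth)
    finally show ?thesis unfolding c(2) by simp
  qed
  have ppc: "pp * F = F * pp" for F
  proof -
    have X: "?X ^ l * F = F * ?X ^ l" for l
    proof (induction l)
      case (Suc l)
      have "?X ^ Suc l * F = ?X * (F * ?X ^ l)" by (simp only: power_Suc mult.assoc Suc)
      then show ?case by (simp only: power_Suc Xc)
    qed simp
    have "?c l * ?X ^ l * F = F * (?c l * ?X ^ l)" for l
    proof -
      have "?c l * ?X ^ l * F = ?c l * (F * ?X ^ l)" by (simp only: mult.assoc X)
      also have "\<dots> = F * (?c l * ?X ^ l)" by (rule comm_left[OF cc])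
      finally show ?thesis .
    qed
    then show ?thesis by (simp only: pp_def sum_distrib_left sum_distrib_right)
  qed
  have epp: "?e * (pp * ?e) = pp * ?e" using comm_left[OF ppc[symmetric], of ?e ?e] by (simp only: ee)
  define K where "K = \<Psi> * ?h * A * \<Phi>'"
  have "?C ?v * K + K * ?C ?v = pp * ?e"
  proof -
    have "?C ?v * K = (?C ?v * \<Psi>) * ?h * A * \<Phi>'" by (simp only: K_def mult.assoc)
    moreover have "K * ?C ?v = \<Psi> * ?h * (A * U) * \<Phi>'" by (simp only: K_def mult.assoc \<Phi>'U)
    ultimately have "?C ?v * K + K * ?C ?v = \<Psi> * ((U * ?h + ?h * U) * A) * \<Phi>'"
      by (simp only: v\<Psi> UA[symmetric] distrib_left distrib_right mult.assoc)
    also have "(U * ?h + ?h * U) * A = pp * ?e" unfolding Uh XT by (simp only: mult.assoc XA epp)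
    also have "\<Psi> * (pp * ?e) * \<Phi>' = pp * (\<Psi> * (?e * \<Phi>'))"
      by (simp only: mult.assoc comm_left[OF ppc[symmetric], of \<Psi>])
    also have "\<dots> = pp * (\<Psi> * \<Phi>') * ?e" by (simp only: mult.assoc e\<Phi>')
    finally show ?thesis using \<Psi> by simp
  qed
  \<comment> \<open>Neither v nor the coefficients of p involve s, so the homotopy equation may be
    read at s^m, and any nonzero coefficient of p will do.\<close>
  moreover obtain m where m: "m < N" "c m \<noteq> 0" using c(1) by blast
  moreover have "(pp * ?e) $ m = scl (c m) (idm Y)"
  proof -
    have "(?c l * ?X ^ l) $ m = (if l = m then scl (c m) 1 else 0)" for l by (simp add: fps_X_power_nth)
    then have "pp $ m = scl (c m) 1" using m(1) by (simp add: pp_def fps_sum_nth)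
    then show ?thesis by simp
  qed
  ultimately have "?v * K $ m + K $ m * ?v = scl (c m) (idm Y)"
    using arg_cong[of _ _ "\<lambda>F. F $ m"] by (metis fps_add_nth fps_mult_left_const_nth fps_mult_right_const_nth)
  then have "?v * scl (1 / c m) (K $ m) + scl (1 / c m) (K $ m) * ?v = idm Y"
    using m(2) by (simp add: scl_add[symmetric])
  then show ?thesis by (rule exvI[OF Y])
qed

section \<open>Resolutions of bounded rank\<close>

text \<open>Over a finite field, 1 plus the product of all X - x would have no root.\<close>

lemma infinite_alg_closed: "infinite (UNIV :: 'k::alg_closed_field set)"
proof
  assume fin: "finite (UNIV :: 'k set)"
  define q :: "'k poly" where "q = (\<Prod>x\<in>UNIV. [:- x, 1:])"
  have q0: "poly q x = 0" for x using fin by (auto simp: q_def poly_prod intro!: prod_zero)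
  have "q \<noteq> 0" using fin by (simp add: q_def)
  have d: "degree q > 0"
  proof (rule ccontr)
    assume "\<not> ?thesis"
    then obtain c where "q = [:c:]" by (auto elim: degree_eq_zeroE)
    with q0[of 0] \<open>q \<noteq> 0\<close> show False by simp
  qed
  then have "degree (q + 1) > 0" by (subst degree_add_eq_left) auto
  then obtain x where "poly (q + 1) x = 0" using alg_closed_imp_poly_has_root by blast
  then show False using q0[of x] by simp
qed

text \<open>\<open>G 1, G 2, \<dots>\<close> is a resolution of \<open>G 0\<close>. Contracting a free module with the dual of the variable
  \<open>b\<close> is a homotopy, whose commutator with the differential lowers the resolution degree by one. The
  words of length \<open>D\<close> in two of these operators are linearly dependent for large \<open>D\<close>, while on the
  homology with respect to a vector \<open>w\<close> they act by the monomials of degree \<open>D\<close> in the coordinates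
  of \<open>w\<close>.\<close>

theorem resolution_exv:
  fixes G :: "nat \<Rightarrow> 'k::field mm"
  assumes n: "1 \<le> n" and G: "\<And>k. mmod n (G k)" and \<delta>: "\<And>k. mmor n (G (Suc k)) (G k) (\<delta> k)"
    and \<delta>\<delta>: "\<And>k. \<delta> k * \<delta> (Suc k) = 0"
    and onto: "\<exists>\<sigma>. dhom 0 (G 0) (G 1) \<sigma> \<and> \<delta> 0 * \<sigma> = idm (G 0)"
    and exact: "\<And>k q K. dhom q (G 0) (G (Suc k)) K \<Longrightarrow> \<delta> k * K = 0 \<Longrightarrow>
        \<exists>K'. dhom q (G 0) (G (Suc (Suc k))) K' \<and> K = \<delta> (Suc k) * K'"
    and H: "\<And>k. dsys n (G (Suc k)) (H k)" and bound: "\<And>k. card (ix (G (Suc k))) \<le> M"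
    and inf: "infinite (UNIV :: 'k set)"
  shows "\<exists>w. (\<exists>a\<le>n. w a \<noteq> 0) \<and> exv n w (G 0)"
proof -
  \<comment> \<open>Contractions anticommute with the variables up to a scalar multiple of the
    identity, and this scalar cancels in the commutator. So C respects the module structures up to
    sign and represents the coordinate class \<open>b\<close> on the resolution.\<close>
  define C where "C k b = H k b * \<delta> (Suc k) - \<delta> (Suc k) * H (Suc k) b" for k b
  note d\<delta> = mmorD(1)[OF \<delta>]
  have dC: "dhom (- 1) (G (Suc (Suc k))) (G (Suc k)) (C k b)" if "b \<le> n" for k b
    unfolding C_def by (intro dhom_diff dhom_mult[OF dsysD(1)[OF H that] d\<delta>] dhom_mult[OF d\<delta> dsysD(1)[OF H that]]) auto
  have Cx: "C k b * ac (G (Suc (Suc k))) a = - (ac (G (Suc k)) a * C k b)" if a: "a \<le> n" and b: "b \<le> n" for k a b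
  proof -
    let ?x = "ac (G (Suc k)) a" and ?y = "ac (G (Suc (Suc k))) a" and ?d = "\<delta> (Suc k)"
    have dy: "?d * ?y = ?x * ?d" by (rule mmorD(2)[OF \<delta> a])
    have s1: "?x * H k b + H k b * ?x = (if a = b then idm (G (Suc k)) else 0)"
      and s2: "?y * H (Suc k) b + H (Suc k) b * ?y = (if a = b then idm (G (Suc (Suc k))) else 0)"
      using H a b by (auto simp: dsys_def)
    have "C k b * ?y + ?x * C k b = H k b * (?d * ?y) - ?d * H (Suc k) b * ?y + (?x * H k b * ?d - (?x * ?d) * H (Suc k) b)"
      unfolding C_def by (simp only: left_diff_distrib right_diff_distrib mult.assoc)
    also have "\<dots> = (?x * H k b + H k b * ?x) * ?d - ?d * (?y * H (Suc k) b + H (Suc k) b * ?y)"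
    proof -
      have "H k b * (?d * ?y) = H k b * ?x * ?d" unfolding dy by (simp only: mult.assoc)
      moreover have "(?x * ?d) * H (Suc k) b = ?d * (?y * H (Suc k) b)" unfolding dy[symmetric] by (simp only: mult.assoc)
      ultimately show ?thesis by (simp only: distrib_left distrib_right mult.assoc) simp
    qed
    also have "\<dots> = 0" unfolding s1 s2 using idm_mult_dhom[OF d\<delta>] dhom_mult_idm[OF d\<delta>] by simp
    finally show ?thesis by (simp add: eq_neg_iff_add_eq_0)
  qed
  have C\<delta>: "C k b * \<delta> (Suc (Suc k)) = - (\<delta> (Suc k) * C (Suc k) b)" for k b
  proof -
    have "C k b * \<delta> (Suc (Suc k)) = H k b * (\<delta> (Suc k) * \<delta> (Suc (Suc k))) - \<delta> (Suc k) * (H (Suc k) b * \<delta> (Suc (Suc k)))"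
      unfolding C_def by (simp only: left_diff_distrib mult.assoc)
    moreover have "\<delta> (Suc k) * C (Suc k) b = \<delta> (Suc k) * (H (Suc k) b * \<delta> (Suc (Suc k))) - (\<delta> (Suc k) * \<delta> (Suc (Suc k))) * H (Suc (Suc k)) b"
      unfolding C_def by (simp only: right_diff_distrib mult.assoc)
    ultimately show ?thesis by (simp add: \<delta>\<delta>)
  qed
  define W where "W \<beta> = rec_nat (idm (G 1)) (\<lambda>k Z. Z * C k (\<beta> k))" for \<beta>
  have W0: "W \<beta> 0 = idm (G 1)" and WS: "W \<beta> (Suc k) = W \<beta> k * C k (\<beta> k)" for \<beta> k by (simp_all add: W_def)
  have dW: "dhom (- int k) (G (Suc k)) (G 1) (W \<beta> k)" if "\<And>i. \<beta> i \<le> n" for \<beta> k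
  proof (induction k)
    case (Suc k)
    show ?case unfolding WS by (rule dhom_mult[OF Suc dC]) (use that in auto)
  qed (simp add: W0 dhom_idm)
  \<comment> \<open>Hence \<open>\<delta> 0 * W \<beta> k\<close> is a cocycle of degree k with
    values in \<open>G 0\<close>: the class of the word \<beta> applied to the identity.\<close>
  have E: "\<delta> 0 * W \<beta> k * \<delta> (Suc k) = 0" for \<beta> k
  proof (induction k)
    case 0
    then show ?case using dhom_mult_idm[OF d\<delta>[of 0]] by (simp add: W0 \<delta>\<delta>)
  next
    case (Suc k)
    have "\<delta> 0 * W \<beta> (Suc k) * \<delta> (Suc (Suc k)) = \<delta> 0 * W \<beta> k * (C k (\<beta> k) * \<delta> (Suc (Suc k)))"
      by (simp only: WS mult.assoc)
    also have "\<dots> = - (\<delta> 0 * W \<beta> k * \<delta> (Suc k) * C (Suc k) (\<beta> k))"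
      unfolding C\<delta> by (simp only: mult_minus_right mult.assoc)
    finally show ?case using Suc by simp
  qed
  let ?v = "\<lambda>w k. av n w (G k)"
  have Cv: "C k b * ?v w (Suc (Suc k)) = - (?v w (Suc k) * C k b)" if b: "b \<le> n" for k b w
    using Cx[OF _ b] by (auto simp: av_def sum_distrib_left sum_distrib_right sum_negf[symmetric] intro!: sum.cong)
  have Wv: "W \<beta> k * ?v w (Suc k) = scl ((- 1) ^ k) (?v w 1 * W \<beta> k)" if b: "\<And>i. \<beta> i \<le> n" for \<beta> k w
  proof (induction k)
    case 0
    show ?case using idm_mult_dhom[OF dhom_av[OF G]] dhom_mult_idm[OF dhom_av[OF G]] by (simp add: W0)
  next
    case (Suc k)
    have "W \<beta> (Suc k) * ?v w (Suc (Suc k)) = - (W \<beta> k * ?v w (Suc k) * C k (\<beta> k))"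
      unfolding WS mult.assoc Cv[OF b] by (simp only: mult_minus_right mult.assoc)
    then show ?case unfolding Suc by (simp add: WS mult.assoc)
  qed
  \<comment> \<open>A comparison over the subalgebra generated by the linear form \<open>w\<close>:
    \<sigma> 0 is a linear section, and each next map lifts the failure of the previous one to
    commute with the form up to sign.\<close>
  have \<sigma>_ex: "\<exists>\<sigma>. \<delta> 0 * \<sigma> 0 = idm (G 0) \<and> (\<forall>k. ?v w (Suc k) * \<sigma> k - scl ((- 1) ^ k) (\<sigma> k * ?v w 0) = \<delta> (Suc k) * \<sigma> (Suc k))
      \<and> (\<forall>k. dhom (int k) (G 0) (G (Suc k)) (\<sigma> k))" for w
  proof -
    define P where "P k \<sigma> \<longleftrightarrow> dhom (int k) (G 0) (G (Suc k)) \<sigma> \<and>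
       \<delta> k * (?v w (Suc k) * \<sigma> - scl ((- 1) ^ k) (\<sigma> * ?v w 0)) = 0 \<and> (k = 0 \<longrightarrow> \<delta> 0 * \<sigma> = idm (G 0))" for k \<sigma>
    have dv: "dhom 1 (G k) (G k) (?v w k)" for k by (rule dhom_av[OF G])
    have "\<exists>\<sigma>. \<forall>k. P k (\<sigma> k) \<and> ?v w (Suc k) * \<sigma> k - scl ((- 1) ^ k) (\<sigma> k * ?v w 0) = \<delta> (Suc k) * \<sigma> (Suc k)"
    proof (rule dependent_nat_choice)
      obtain \<sigma> where s: "dhom 0 (G 0) (G 1) \<sigma>" "\<delta> 0 * \<sigma> = idm (G 0)" using onto by blast
      have "\<delta> 0 * (?v w 1 * \<sigma> - \<sigma> * ?v w 0) = (\<delta> 0 * ?v w 1) * \<sigma> - (\<delta> 0 * \<sigma>) * ?v w 0"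
        by (simp only: right_diff_distrib mult.assoc)
      also have "\<delta> 0 * ?v w 1 = ?v w 0 * \<delta> 0" using mmor_av[OF \<delta>[of 0], of w] by simp
      also have "?v w 0 * \<delta> 0 * \<sigma> = ?v w 0" using s(2) dhom_mult_idm[OF dv[of 0]] by (simp add: mult.assoc)
      also have "(\<delta> 0 * \<sigma>) * ?v w 0 = ?v w 0" using s(2) idm_mult_dhom[OF dv[of 0]] by simp
      finally have "P 0 \<sigma>" using s by (simp add: P_def)
      then show "\<exists>\<sigma>. P 0 \<sigma>" ..
    next
      fix \<sigma> k assume P: "P k \<sigma>"
      let ?K = "?v w (Suc k) * \<sigma> - scl ((- 1) ^ k) (\<sigma> * ?v w 0)"
      have d\<sigma>: "dhom (int k) (G 0) (G (Suc k)) \<sigma>" using P by (simp add: P_def)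
      have "dhom (int (Suc k)) (G 0) (G (Suc k)) ?K"
        by (intro dhom_diff dhom_scl dhom_mult[OF dv d\<sigma>] dhom_mult[OF d\<sigma> dv]) auto
      from exact[OF this] P obtain \<sigma>' where s: "dhom (int (Suc k)) (G 0) (G (Suc (Suc k))) \<sigma>'" "?K = \<delta> (Suc k) * \<sigma>'"
        by (auto simp: P_def)
      have "\<delta> (Suc k) * (?v w (Suc (Suc k)) * \<sigma>' - scl ((- 1) ^ Suc k) (\<sigma>' * ?v w 0)) =
          (\<delta> (Suc k) * ?v w (Suc (Suc k))) * \<sigma>' - scl ((- 1) ^ Suc k) ((\<delta> (Suc k) * \<sigma>') * ?v w 0)"
        by (simp only: right_diff_distrib scl_mult_right mult.assoc)
      also have "\<dots> = ?v w (Suc k) * ?K - scl ((- 1) ^ Suc k) (?K * ?v w 0)"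
        using mmor_av[OF \<delta>[of "Suc k"], of w] s(2) by (simp add: mult.assoc)
      also have "\<dots> = 0"
        using av_square[OF G[of "Suc k"], of w] av_square[OF G[of 0], of w]
        by (simp add: right_diff_distrib left_diff_distrib mult.assoc scl_diff)
          (simp add: mult.assoc[symmetric])
      finally have "P (Suc k) \<sigma>'" using s(1) by (simp add: P_def)
      with s(2) show "\<exists>\<sigma>'. P (Suc k) \<sigma>' \<and> ?K = \<delta> (Suc k) * \<sigma>'" by blast
    qed
    then show ?thesis by (auto simp: P_def)
  qed
  \<comment> \<open>Restricted to the form \<open>w\<close>, the class of a word becomes the product
    of the values of its letters, up to a null-homotopic map. The induction adds one letter, whose
    value comes from \<open>dsys_av\<close>.\<close>
  have key: "\<exists>\<kappa>. \<delta> 0 * W \<beta> k * \<sigma> k = scl (\<Prod>i<k. w (\<beta> i)) (idm (G 0)) + (?v w 0 * \<kappa> + \<kappa> * ?v w 0)"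
    if b: "\<And>i. \<beta> i \<le> n" and s0: "\<delta> 0 * \<sigma> 0 = idm (G 0)"
      and s: "\<And>k. ?v w (Suc k) * \<sigma> k - scl ((- 1) ^ k) (\<sigma> k * ?v w 0) = \<delta> (Suc k) * \<sigma> (Suc k)"
      and d\<sigma>: "\<And>k. dhom (int k) (G 0) (G (Suc k)) (\<sigma> k)" for \<beta> k w \<sigma>
  proof (induction k)
    case 0
    show ?case using s0 dhom_mult_idm[OF d\<delta>[of 0]] by (intro exI[of _ 0]) (simp add: W0)
  next
    case (Suc k)
    then obtain \<kappa> where \<kappa>: "\<delta> 0 * W \<beta> k * \<sigma> k = scl (\<Prod>i<k. w (\<beta> i)) (idm (G 0)) + (?v w 0 * \<kappa> + \<kappa> * ?v w 0)" by blast
    let ?h = "H k (\<beta> k)" and ?h' = "H (Suc k) (\<beta> k)" and ?e = "\<delta> 0 * W \<beta> k"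
    have vs: "?v w (Suc k) * \<sigma> k = scl ((- 1) ^ k) (\<sigma> k * ?v w 0) + \<delta> (Suc k) * \<sigma> (Suc k)"
      using s[of k] by (simp add: algebra_simps)
    have "scl (w (\<beta> k)) (\<sigma> k) = (?v w (Suc k) * ?h + ?h * ?v w (Suc k)) * \<sigma> k"
      using dsys_av[OF H b, of w k] idm_mult_dhom[OF d\<sigma>] by simp
    also have "\<dots> = ?v w (Suc k) * ?h * \<sigma> k + scl ((- 1) ^ k) (?h * \<sigma> k * ?v w 0) + ?h * \<delta> (Suc k) * \<sigma> (Suc k)"
      unfolding distrib_right mult.assoc vs by (simp add: distrib_left mult.assoc)
    also have "?h * \<delta> (Suc k) * \<sigma> (Suc k) = C k (\<beta> k) * \<sigma> (Suc k) + \<delta> (Suc k) * (?h' * \<sigma> (Suc k))"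
      by (simp add: C_def left_diff_distrib mult.assoc)
    finally have "?e * scl (w (\<beta> k)) (\<sigma> k) = ?e * (?v w (Suc k) * ?h * \<sigma> k) + scl ((- 1) ^ k) (?e * (?h * \<sigma> k * ?v w 0))
        + ?e * C k (\<beta> k) * \<sigma> (Suc k) + ?e * \<delta> (Suc k) * (?h' * \<sigma> (Suc k))"
      by (simp only: distrib_left scl_mult_right mult.assoc add.assoc)
    moreover have "?e * (?v w (Suc k) * ?h * \<sigma> k) = scl ((- 1) ^ k) (?v w 0 * (?e * ?h * \<sigma> k))"
    proof -
      have "?e * (?v w (Suc k) * ?h * \<sigma> k) = \<delta> 0 * (W \<beta> k * ?v w (Suc k)) * (?h * \<sigma> k)" by (simp only: mult.assoc)
      also have "\<dots> = scl ((- 1) ^ k) ((\<delta> 0 * ?v w 1) * W \<beta> k * (?h * \<sigma> k))"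
        unfolding Wv[OF b] by (simp add: mult.assoc)
      also have "\<delta> 0 * ?v w 1 = ?v w 0 * \<delta> 0" using mmor_av[OF \<delta>[of 0], of w] by simp
      finally show ?thesis by (simp only: mult.assoc)
    qed
    moreover have "\<delta> 0 * (W \<beta> k * (\<delta> (Suc k) * Z)) = 0" for Z
    proof -
      have "\<delta> 0 * (W \<beta> k * (\<delta> (Suc k) * Z)) = (\<delta> 0 * W \<beta> k * \<delta> (Suc k)) * Z" by (simp only: mult.assoc)
      then show ?thesis by (simp add: E)
    qed
    ultimately have "\<delta> 0 * W \<beta> (Suc k) * \<sigma> (Suc k) = scl (w (\<beta> k)) (?e * \<sigma> k) -
        scl ((- 1) ^ k) (?v w 0 * (?e * ?h * \<sigma> k) + (?e * ?h * \<sigma> k) * ?v w 0)"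
      by (simp add: WS mult.assoc scl_add algebra_simps)
    also have "\<dots> = scl (\<Prod>i<Suc k. w (\<beta> i)) (idm (G 0)) +
      (?v w 0 * (scl (w (\<beta> k)) \<kappa> - scl ((- 1) ^ k) (?e * ?h * \<sigma> k)) + (scl (w (\<beta> k)) \<kappa> - scl ((- 1) ^ k) (?e * ?h * \<sigma> k)) * ?v w 0)"
      unfolding \<kappa> by (simp add: scl_add scl_diff algebra_simps)
    finally show ?case by blast
  qed
  \<comment> \<open>D + 1 words exceed the number M * M of matrix entries between two terms of the
    resolution. D is at the same time the length of the words: word l consists of l letters 0
    followed by D - l letters 1.\<close>
  define D where "D = M * M"
  define \<beta> where "\<beta> j i = (if i < j then 0 else 1 :: nat)" for j i :: nat
  have \<beta>n: "\<beta> j i \<le> n" for j i using n by (simp add: \<beta>_def)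
  have "\<exists>c. (\<exists>l<D + 1. c l \<noteq> 0) \<and> (\<Sum>l<D + 1. scl (c l) (W (\<beta> l) D)) = 0"
  proof (rule dependent_matrices)
    show "finite (ix (G 1))" "finite (ix (G (Suc D)))" using mmodD(1)[OF G] by auto
    have "card (ix (G 1)) * card (ix (G (Suc D))) \<le> M * M" using bound[of 0] bound[of D] by (intro mult_mono) auto
    then show "card (ix (G 1)) * card (ix (G (Suc D))) < D + 1" by (simp add: D_def)
    fix l i j assume "ent (W (\<beta> l) D) i j \<noteq> 0"
    from dhomD[OF dW[of "\<beta> l" D, OF \<beta>n] this] show "i \<in> ix (G 1) \<and> j \<in> ix (G (Suc D))" by blast
  qed
  then obtain c where c: "\<exists>l<D + 1. c l \<noteq> 0" "(\<Sum>l<D + 1. scl (c l) (W (\<beta> l) D)) = 0" by blast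
  define p where "p = (\<Sum>l<D + 1. monom (c l) l)"
  have cp: "coeff p i = (if i < D + 1 then c i else 0)" for i unfolding p_def by (simp add: coeff_sum del: sum.lessThan_Suc)
  obtain l where "l < D + 1" "c l \<noteq> 0" using c(1) by blast
  then have "coeff p l \<noteq> 0" by (simp add: cp)
  then have "p \<noteq> 0" by auto
  then have "finite {x. poly p x = 0}" by (rule poly_roots_finite)
  \<comment> \<open>At w = (s, 1, 0, ...) word l has value s^l, so the linear relation between the
    words becomes the value at s of a nonzero polynomial. Away from its roots a nonzero multiple of
    the identity is null-homotopic.\<close>
  then obtain s where s: "poly p s \<noteq> 0" using inf ex_new_if_finite[of "{x. poly p x = 0}"] by auto
  define w where "w a = (if a = 0 then s else if a = 1 then 1 else 0 :: 'k)" for a :: nat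
  have prod: "(\<Prod>i<D. w (\<beta> l i)) = s ^ l" if "l < D + 1" for l
  proof -
    have "(\<Prod>i<D. w (\<beta> l i)) = (\<Prod>i<l. s)"
      by (rule prod.mono_neutral_cong_right) (use that in \<open>auto simp: w_def \<beta>_def\<close>)
    then show ?thesis by simp
  qed
  obtain \<sigma> where \<sigma>: "\<delta> 0 * \<sigma> 0 = idm (G 0)"
    "\<And>k. ?v w (Suc k) * \<sigma> k - scl ((- 1) ^ k) (\<sigma> k * ?v w 0) = \<delta> (Suc k) * \<sigma> (Suc k)"
    "\<And>k. dhom (int k) (G 0) (G (Suc k)) (\<sigma> k)" using \<sigma>_ex[of w] by blast
  have "\<exists>\<kappa>. \<delta> 0 * W (\<beta> l) D * \<sigma> D = scl (\<Prod>i<D. w (\<beta> l i)) (idm (G 0)) + (?v w 0 * \<kappa> + \<kappa> * ?v w 0)" for l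
    using key[where \<beta> = "\<beta> l" and k = D and w = w and \<sigma> = \<sigma>, OF \<beta>n \<sigma>] .
  then have "\<forall>l. \<exists>\<kappa>. \<delta> 0 * W (\<beta> l) D * \<sigma> D = scl (\<Prod>i<D. w (\<beta> l i)) (idm (G 0)) + (?v w 0 * \<kappa> + \<kappa> * ?v w 0)" ..
  from choice[OF this] obtain \<kappa> where \<kappa>: "\<And>l. \<delta> 0 * W (\<beta> l) D * \<sigma> D =
      scl (\<Prod>i<D. w (\<beta> l i)) (idm (G 0)) + (?v w 0 * \<kappa> l + \<kappa> l * ?v w 0)" by blast
  let ?k = "\<Sum>l<D + 1. scl (c l) (\<kappa> l)"
  have "0 = \<delta> 0 * (\<Sum>l<D + 1. scl (c l) (W (\<beta> l) D)) * \<sigma> D" unfolding c(2) by simp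
  also have "\<dots> = (\<Sum>l<D + 1. scl (c l) (\<delta> 0 * W (\<beta> l) D * \<sigma> D))"
    by (simp add: sum_distrib_left sum_distrib_right del: sum.lessThan_Suc)
  also have "\<dots> = (\<Sum>l<D + 1. scl (c l * s ^ l) (idm (G 0)) + (?v w 0 * scl (c l) (\<kappa> l) + scl (c l) (\<kappa> l) * ?v w 0))"
    by (rule sum.cong) (auto simp: \<kappa> prod scl_add)
  also have "\<dots> = scl (poly p s) (idm (G 0)) + (?v w 0 * ?k + ?k * ?v w 0)"
    by (simp only: sum.distrib scl_sum_left[symmetric] sum_distrib_left[symmetric] sum_distrib_right[symmetric])
      (simp add: p_def poly_sum poly_monom)
  finally have "scl (poly p s) (idm (G 0)) = - (?v w 0 * ?k + ?k * ?v w 0)"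
    by (simp only: eq_neg_iff_add_eq_0)
  then have e: "scl (poly p s) (idm (G 0)) = ?v w 0 * (- ?k) + (- ?k) * ?v w 0"
    by (simp only: mult_minus_left mult_minus_right minus_add_distrib)
  have "idm (G 0) = scl (1 / poly p s) (scl (poly p s) (idm (G 0)))" using s by simp
  also have "\<dots> = ?v w 0 * scl (1 / poly p s) (- ?k) + scl (1 / poly p s) (- ?k) * ?v w 0"
    unfolding e by (simp only: scl_add scl_mult_left scl_mult_right)
  finally have "exv n w (G 0)" by (intro exvI[OF G]) (rule sym)
  moreover have "\<exists>a\<le>n. w a \<noteq> 0" using n by (intro exI[of _ 1]) (simp add: w_def)
  ultimately show ?thesis by blast
qed

section \<open>Generalised inverses and free covers\<close>

text \<open>Pivoting: for a nonzero entry, the rank one map u makes F - F u F vanish on the pivot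
  column, so the index set shrinks. The generalised inverse of the remainder is corrected by the
  projections \<open>idm X - u * F\<close> and \<open>idm Y - F * u\<close>.\<close>

lemma vn_inverse:
  assumes "finite (ix X)" "dhom 0 X Y F"
  shows "\<exists>G. dhom 0 Y X G \<and> F * G * F = (F :: 'k::field mtx)"
  using assms
proof (induction "card (ix X)" arbitrary: X F)
  case 0
  then have "F = 0" by (intro mtx_eqI) (auto simp: dhom_def)
  then show ?case by (intro exI[of _ 0]) simp
next
  case (Suc m)
  show ?case
  proof (cases "F = 0")
    case True
    then show ?thesis by (intro exI[of _ 0]) simp
  next
    case False
    then obtain p q where pq: "ent F p q \<noteq> 0" by (metis mtx_eqI ent_simps(1))
    note d = dhomD[OF Suc.prems(2) pq]
    define u where "u = scl (1 / ent F p q) (unit q p)"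
    have du: "dhom 0 Y X u" unfolding u_def by (intro dhom_scl dhom_unit) (use d in auto)
    define F' where "F' = F - F * u * F"
    have dF': "dhom 0 X Y F'" unfolding F'_def
      by (intro dhom_diff Suc.prems(2) dhom_mult[OF dhom_mult[OF Suc.prems(2) du refl] Suc.prems(2)]) simp
    have z: "ent F' i q = 0" for i
    proof -
      have "ent (F * u * F) i q = (\<Sum>l\<in>{p}. ent (F * u) i l * ent F l q)"
        by (rule ent_times_gen) (auto simp: u_def ent_mult_unit split: if_splits)
      then show ?thesis using pq by (simp add: F'_def u_def ent_mult_unit)
    qed
    define X' where "X' = X\<lparr>ix := ix X - {q}\<rparr>"
    have "dhom 0 X' Y F'" using dF' z by (auto simp: dhom_def X'_def)
    moreover have "m = card (ix X')" "finite (ix X')" using Suc d by (auto simp: X'_def)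
    ultimately obtain G' where G': "dhom 0 Y X' G'" "F' * G' * F' = F'" using Suc.hyps(1) by blast
    have dG': "dhom 0 Y X G'" using G'(1) by (auto simp: dhom_def X'_def)
    define G where "G = u + (idm X - u * F) * G' * (idm Y - F * u)"
    have "dhom 0 X X (idm X - u * F)" "dhom 0 Y Y (idm Y - F * u)"
      by (intro dhom_diff dhom_idm dhom_mult[OF du Suc.prems(2)] dhom_mult[OF Suc.prems(2) du]; simp)+
    then have "dhom 0 Y X G" unfolding G_def
      by (intro dhom_add du dhom_mult[OF dhom_mult[OF _ dG' refl]]) auto
    moreover have "F * G * F = F"
    proof -
      have "F * (idm X - u * F) = F'" "(idm Y - F * u) * F = F'"
        using idm_mult_dhom[OF Suc.prems(2)] dhom_mult_idm[OF Suc.prems(2)]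
        by (simp_all add: F'_def left_diff_distrib right_diff_distrib mult.assoc)
      then have "F * G * F = F * u * F + F' * G' * F'"
        by (simp add: G_def distrib_left distrib_right mult.assoc) (simp add: mult.assoc[symmetric])
      then show ?thesis using G'(2) by (simp add: F'_def)
    qed
    ultimately show ?thesis by blast
  qed
qed

text \<open>The free module on U is grown one variable at a time: variable m doubles M to the
  extension of \<open>shm M\<close> by M whose cocycle is the identity in direction m. The
  generators lie in block 1, and x_m carries them to block 0. Each stage lowers the generators by
  one degree, so the start is raised by n + 1.\<close>

lemma free_cover_stage:
  assumes "finite (ix U)" "m \<le> Suc n"
  shows "\<exists>M \<iota> \<rho> H. mmod n M \<and> dhom (int (Suc n) - int m) U M \<iota> \<and> dhom (int m - int (Suc n)) M U \<rho> \<and> \<rho> * \<iota> = idm U \<and>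
     (\<forall>b<m. dhom (- 1) M M (H b) \<and> H b * \<iota> = 0 \<and>
        (\<forall>a\<le>n. ac M a * H b + H b * ac M a = (if a = b then idm M else (0 :: 'k::field mtx))))"
  using assms(2)
proof (induction m)
  case 0
  let ?M = "U\<lparr>dg := \<lambda>i. dg U i + int (Suc n), ac := \<lambda>_. 0\<rparr>"
  have "mmod n ?M" using assms(1) by (simp add: mmod_def)
  moreover have "dhom (int (Suc n) - int 0) U ?M (idm U)" "dhom (int 0 - int (Suc n)) ?M U (idm U)"
    by (auto simp: dhom_def ent_idm split: if_splits)
  ultimately show ?case by (intro exI[of _ ?M] exI[of _ "idm U"]) auto
next
  case (Suc m)
  then have m: "m \<le> n" by simp
  obtain M \<iota> \<rho> and H :: "nat \<Rightarrow> 'k mtx" where raw: "mmod n M \<and> dhom (int (Suc n) - int m) U M \<iota> \<and>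
      dhom (int m - int (Suc n)) M U \<rho> \<and> \<rho> * \<iota> = idm U \<and> (\<forall>b<m. dhom (- 1) M M (H b) \<and> H b * \<iota> = 0 \<and>
        (\<forall>a\<le>n. ac M a * H b + H b * ac M a = (if a = b then idm M else 0)))"
    using Suc.IH Suc_leD[OF Suc.prems] by blast
  have M: "mmod n M" and \<iota>: "dhom (int (Suc n) - int m) U M \<iota>"
    and \<rho>: "dhom (int m - int (Suc n)) M U \<rho>" and \<rho>\<iota>: "\<rho> * \<iota> = idm U"
    using raw by blast+
  have H: "dhom (- 1) M M (H b)" "H b * \<iota> = 0" "a \<le> n \<Longrightarrow> ac M a * H b + H b * ac M a = (if a = b then idm M else 0)"
    if "b < m" for a b
    using raw that by blast+
  define \<phi> where "\<phi> a = (if a = m then idm M else 0)" for a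
  define M' where "M' = extm M (shm M) \<phi>"
  have acM': "ac M' a = incl 0 * (ac M a * proj 0) + incl 0 * (\<phi> a * proj 1) - incl 1 * (ac M a * proj 1)" for a
    by (simp add: M'_def ac_extm)
  have ac\<phi>: "ac M a * \<phi> b = \<phi> b * ac M a" "\<phi> b * F = (if b = m then idm M * F else 0)" if "a \<le> n" for a b F
    using idm_mult_dhom[OF mmodD(2)[OF M that]] dhom_mult_idm[OF mmodD(2)[OF M that]] by (auto simp: \<phi>_def)
  have mM': "mmod n M'" unfolding M'_def
    by (rule mmod_extm[OF M mmod_shm[OF M]]) (auto simp: \<phi>_def dhom_shm dhom_idm
        idm_mult_dhom[OF mmodD(2)[OF M]] dhom_mult_idm[OF mmodD(2)[OF M]])
  define \<iota>' where "\<iota>' = incl 1 * \<iota>"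
  define \<rho>' where "\<rho>' = \<rho> * proj 1"
  \<comment> \<open>Contraction with the new variable leads from block 0 back to block 1; the older
    contractions act on both blocks, with a sign on the shifted one.\<close>
  define H' where "H' b = (if b = m then incl 1 * (idm M * proj 0) else incl 0 * (H b * proj 0) - incl 1 * (H b * proj 1))" for b
  have "dhom (int (Suc n) - int (Suc m)) U M' \<iota>'" unfolding \<iota>'_def M'_def
    using \<iota> by (intro dhom_extm) (simp add: dhom_shm algebra_simps)
  moreover have "dhom (int (Suc m) - int (Suc n)) M' U \<rho>'" unfolding \<rho>'_def M'_def
    using \<rho> by (intro dhom_extm) (simp add: dhom_shm algebra_simps)
  moreover have "\<rho>' * \<iota>' = idm U" using \<rho>\<iota> by (simp add: \<rho>'_def \<iota>'_def mult.assoc)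
  moreover have "dhom (- 1) M' M' (H' b)" if "b < Suc m" for b
  proof (cases "b = m")
    case True
    have "dhom (- 1) (extm M (shm M) \<phi>) (shm M) (idm M * proj 0)"
      by (simp add: dhom_shm dhom_extm(3) dhom_idm)
    from dhom_extm(2)[OF this] show ?thesis unfolding M'_def H'_def using True by simp
  next
    case False
    with that have "b < m" by simp
    from H(1)[OF this] have h: "dhom (- 1) M M (H b)" .
    have "dhom (- 1) (extm M (shm M) \<phi>) M (H b * proj 0)" by (rule dhom_extm(3)[OF h])
    note h0 = dhom_extm(1)[OF this]
    have "dhom (- 1) (shm M) (shm M) (H b)" using h by (simp add: dhom_shm)
    note h1 = dhom_extm(2)[OF dhom_extm(4)[OF this]]
    show ?thesis unfolding M'_def H'_def using dhom_diff[OF h0 h1] False by simp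
  qed
  moreover have "H' b * \<iota>' = 0" if "b < Suc m" for b
    using that H(2)[of b] by (auto simp: H'_def \<iota>'_def left_diff_distrib mult.assoc)
  moreover have "ac M' a * H' b + H' b * ac M' a = (if a = b then idm M' else 0)" if b: "b < Suc m" and a: "a \<le> n" for a b
  proof -
    have iM: "idm M' = incl 0 * (idm M * proj 0) + incl 1 * (idm M * proj 1)"
      by (simp add: M'_def idm_extm mult.assoc)
    have ia: "idm M * (ac M a * F) = ac M a * F" "ac M a * (idm M * F) = ac M a * F" for F
      using idm_mult_dhom[OF mmodD(2)[OF M a]] dhom_mult_idm[OF mmodD(2)[OF M a]] by (simp_all add: mult.assoc[symmetric])
    have ii: "idm M * (idm M * F) = idm M * F" for F by (simp add: mult.assoc[symmetric])
    show ?thesis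
    proof (cases "b = m")
      case True
      then show ?thesis unfolding iM
        by (simp add: H'_def acM' \<phi>_def distrib_left distrib_right left_diff_distrib right_diff_distrib mult.assoc ia ii)
    next
      case False
      with b have b': "b < m" by simp
      let ?S = "ac M a * H b + H b * ac M a"
      have \<phi>H: "\<phi> a * H b = H b * \<phi> a" using idm_mult_dhom[OF H(1)[OF b']] dhom_mult_idm[OF H(1)[OF b']] by (simp add: \<phi>_def)
      have "ac M' a * H' b + H' b * ac M' a = incl 0 * (?S * proj 0) + incl 1 * (?S * proj 1)
          + incl 0 * ((H b * \<phi> a - \<phi> a * H b) * proj 1)"
        using False by (simp add: H'_def acM' algebra_simps)
      also have "\<dots> = (if a = b then idm M' else 0)" unfolding \<phi>H H(3)[OF b' a] iM by simp
      finally show ?thesis .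
    qed
  qed
  ultimately show ?case using mM' by blast
qed

text \<open>The clause on \<open>f\<close> is for covers of kernels: when \<pi> projects onto the
  kernel of \<open>f\<close>, the cover does not leave that kernel.\<close>

lemma free_cover:
  assumes N: "mmod n N" and U: "finite (ix U)" and \<pi>: "dhom 0 U N \<pi>"
  shows "\<exists>P D \<iota>. mmod n P \<and> ffree n P \<and> mmor n P N D \<and> dhom 0 U P \<iota> \<and> D * \<iota> = \<pi> \<and>
     (\<forall>N' f. mmor n N N' f \<longrightarrow> f * \<pi> = 0 \<longrightarrow> f * D = (0 :: 'k::field mtx))"
proof -
  from free_cover_stage[OF U order.refl, where n = n, unfolded diff_self] obtain P \<iota> \<rho> and H :: "nat \<Rightarrow> 'k mtx" where P: "mmod n P" and \<iota>: "dhom 0 U P \<iota>"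
    and \<rho>: "dhom 0 P U \<rho>" and \<rho>\<iota>: "\<rho> * \<iota> = idm U"
    and H: "\<forall>b<Suc n. dhom (- 1) P P (H b) \<and> H b * \<iota> = 0 \<and>
        (\<forall>a\<le>n. ac P a * H b + H b * ac P a = (if a = b then idm P else 0))"
    by blast
  have ds: "dsys n P H" using H by (auto simp: dsys_def less_Suc_eq_le)
  have d: "dhom 0 P N (\<pi> * \<rho>)" by (rule dhom_mult[OF \<pi> \<rho>]) simp
  define D where "D = avg N P H (\<pi> * \<rho>) (Suc n)"
  have "mmor n P N D" unfolding D_def by (rule avg_mmor[OF N P ds d])
  moreover have "D * \<iota> = \<pi>"
  proof -
    have "D * \<iota> = \<pi> * \<rho> * \<iota>" unfolding D_def
      by (rule avg_fix[OF P ds d N _ idm_mult_dhom[OF \<iota>] order.refl]) (use H in auto)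
    then show ?thesis using \<rho>\<iota> dhom_mult_idm[OF \<pi>] by (simp add: mult.assoc)
  qed
  moreover have "f * D = 0" if "mmor n N N' f" "f * \<pi> = 0" for N' f
    unfolding D_def avg_natural[OF that(1) order.refl] using that(2) by (simp add: mult.assoc[symmetric] avg_0 del: avg.simps)
  moreover have "ffree n P" using ds by (auto simp: ffree_dsys)
  ultimately show ?thesis using P \<iota> by blast
qed

section \<open>The action of the exterior algebra\<close>

definition kk :: "'k::field \<Rightarrow> nat set \<Rightarrow> 'k" where "kk c = (\<lambda>S. if S = {} then c else 0)"

definition xmono :: "nat set \<Rightarrow> nat set \<Rightarrow> 'k::field" where "xmono T = (\<lambda>S. if S = T then 1 else 0)"

abbreviation EA :: "nat \<Rightarrow> (nat set \<Rightarrow> 'k::field) gring" where "EA \<equiv> exterior_algebra"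

lemma EA_carrier: "a \<in> carrier (EA n) \<longleftrightarrow> (\<forall>S. a S \<noteq> 0 \<longrightarrow> S \<subseteq> {..n})"
  by (simp add: exterior_algebra_simps)

lemma kk_carrier [simp]: "kk c \<in> carrier (EA n)" and kk_rcomp: "kk c \<in> rcomp (EA n) 0"
  by (auto simp: kk_def exterior_algebra_simps)

lemma indet_carrier: "i \<le> n \<Longrightarrow> indeterminate i \<in> carrier (EA n)"
  by (auto simp: indeterminate_def exterior_algebra_simps)

lemma mono_carrier: "S \<subseteq> {..n} \<Longrightarrow> xmono S \<in> carrier (EA n)"
  by (auto simp: xmono_def exterior_algebra_simps)

lemma kk_simps: "kk (c + d) = kk c \<oplus>\<^bsub>EA n\<^esub> kk d" "kk 1 = \<one>\<^bsub>EA n\<^esub>" "kk 0 = \<zero>\<^bsub>EA n\<^esub>"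
  by (auto simp: kk_def exterior_algebra_simps)

lemma mult_indet:
  "(a \<otimes>\<^bsub>EA n\<^esub> indeterminate t) U =
     (if t \<in> U \<and> finite U then shuffle_sign (U - {t}) {t} * a (U - {t}) else (0::'k::field))"
proof (cases "finite U")
  case True
  have "(a \<otimes>\<^bsub>EA n\<^esub> indeterminate t) U =
      (\<Sum>S\<in>Pow U. shuffle_sign S (U - S) * a S * (if U - S = {t} then 1 else 0))"
    by (simp only: exterior_algebra_simps indeterminate_def)
  also have "\<dots> = (\<Sum>S\<in>Pow U. if S = U - {t} then if t \<in> U then shuffle_sign (U - {t}) {t} * a (U - {t}) else 0 else 0)"
  proof (rule sum.cong[OF refl])
    fix S assume S: "S \<in> Pow U"
    show "shuffle_sign S (U - S) * a S * (if U - S = {t} then 1 else 0) =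
        (if S = U - {t} then if t \<in> U then shuffle_sign (U - {t}) {t} * a (U - {t}) else 0 else 0)"
    proof (cases "U - S = {t}")
      case True
      with S have S': "S = U - {t}" "t \<in> U" by blast+
      have "shuffle_sign S (U - S) * a S * (if U - S = {t} then 1 else 0) = shuffle_sign S {t} * a S"
        unfolding True by simp
      also have "\<dots> = shuffle_sign (U - {t}) {t} * a (U - {t})" unfolding S'(1) ..
      finally show ?thesis unfolding if_P[OF S'(1)] if_P[OF S'(2)] .
    next
      case False
      have n: "\<not> t \<in> U" if "S = U - {t}"
      proof
        assume "t \<in> U"
        with that have "U - S = {t}" by blast
        with False show False ..
      qed
      have "(if S = U - {t} then if t \<in> U then shuffle_sign (U - {t}) {t} * a (U - {t}) else 0 else 0) = 0"
      proof (cases "S = U - {t}")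
        case True
        show ?thesis unfolding if_P[OF True] if_not_P[OF n[OF True]] ..
      next
        case False
        show ?thesis unfolding if_not_P[OF False] ..
      qed
      then show ?thesis unfolding if_not_P[OF False] by (simp only: mult_zero_right)
    qed
  qed
  also have "\<dots> = (if t \<in> U then shuffle_sign (U - {t}) {t} * a (U - {t}) else 0)"
    using True by (subst sum.delta) (simp_all only: finite_Pow_iff Pow_iff Diff_subset if_True)
  finally show ?thesis using True by (simp only: simp_thms)
next
  case False
  then show ?thesis by (simp add: exterior_algebra_simps finite_Pow_iff)
qed

lemma kk_mult:
  assumes "a \<in> carrier (EA n)"
  shows "kk c \<otimes>\<^bsub>EA n\<^esub> a = (\<lambda>U. c * a U)" "a \<otimes>\<^bsub>EA n\<^esub> kk c = (\<lambda>U. c * (a U :: 'k::field))"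
proof -
  have inf: "a U = 0" if "infinite U" for U
    using assms that finite_subset[of U "{..n}"] by (auto simp: EA_carrier)
  show "kk c \<otimes>\<^bsub>EA n\<^esub> a = (\<lambda>U. c * a U)"
  proof
    fix U
    show "(kk c \<otimes>\<^bsub>EA n\<^esub> a) U = c * a U"
    proof (cases "finite U")
      case True
      have "(kk c \<otimes>\<^bsub>EA n\<^esub> a) U = (\<Sum>S\<in>Pow U. if S = {} then c * a U else 0)"
        unfolding exterior_algebra_simps kk_def by (rule sum.cong) auto
      then show ?thesis using True by simp
    qed (simp add: exterior_algebra_simps finite_Pow_iff inf)
  qed
  show "a \<otimes>\<^bsub>EA n\<^esub> kk c = (\<lambda>U. c * a U)"
  proof
    fix U
    show "(a \<otimes>\<^bsub>EA n\<^esub> kk c) U = c * a U"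
    proof (cases "finite U")
      case True
      have "(a \<otimes>\<^bsub>EA n\<^esub> kk c) U = (\<Sum>S\<in>Pow U. if S = U then c * a U else 0)"
        unfolding exterior_algebra_simps kk_def by (rule sum.cong) auto
      then show ?thesis using True by simp
    qed (simp add: exterior_algebra_simps finite_Pow_iff inf)
  qed
qed

lemma sign_less: "\<forall>s\<in>S. s < t \<Longrightarrow> shuffle_sign S {t} = (1 :: 'k::field)"
proof -
  assume "\<forall>s\<in>S. s < t"
  then have "{(s, u). s \<in> S \<and> u \<in> {t} \<and> u < s} = {}" by force
  then show ?thesis by (simp only: shuffle_sign_def card.empty power_0)
qed

lemma sign_insert:
  assumes "finite S" "m \<notin> S" "t < m"
  shows "shuffle_sign (insert m S) {t} = - (shuffle_sign S {t} :: 'k::field)"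
proof -
  have "{(s, u). s \<in> {m} \<and> u \<in> {t} \<and> u < s} = {(m, t)}" using assms by auto
  then have "shuffle_sign {m} {t} = (- 1 :: 'k)" by (simp add: shuffle_sign_def)
  then show ?thesis using shuffle_sign_Un_left[of "{m}" S "{t}", where 'k = 'k] assms by simp
qed

lemma mono_insert:
  assumes "finite S" "\<forall>s\<in>S. s < t"
  shows "xmono (insert t S) = (xmono S \<otimes>\<^bsub>EA n\<^esub> indeterminate t :: nat set \<Rightarrow> 'k::field)"
proof
  fix U :: "nat set"
  have t: "t \<notin> S" using assms(2) by blast
  have "t \<in> U \<and> U - {t} = S \<longleftrightarrow> U = insert t S" using t by auto
  then show "xmono (insert t S) U = (xmono S \<otimes>\<^bsub>EA n\<^esub> indeterminate t :: nat set \<Rightarrow> 'k) U"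
    unfolding mult_indet using assms(1) sign_less[OF assms(2), where 'k = 'k] t by (auto simp: xmono_def)
qed

text \<open>The scalars and indeterminates generate the algebra. A monomial is built by multiplying
  its indeterminates in increasing order from the left, where no sign arises.\<close>

lemma ext_induct [consumes 1, case_names scalar indet add mult]:
  assumes a: "a \<in> carrier (EA n)"
    and P: "\<And>c. P (kk c)" "\<And>i. i \<le> n \<Longrightarrow> P (indeterminate i)"
      "\<And>a b. a \<in> carrier (EA n) \<Longrightarrow> b \<in> carrier (EA n) \<Longrightarrow> P a \<Longrightarrow> P b \<Longrightarrow> P (a \<oplus>\<^bsub>EA n\<^esub> b)"
      "\<And>a b. a \<in> carrier (EA n) \<Longrightarrow> b \<in> carrier (EA n) \<Longrightarrow> P a \<Longrightarrow> P b \<Longrightarrow> P (a \<otimes>\<^bsub>EA n\<^esub> b)"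
  shows "P (a :: nat set \<Rightarrow> 'k::field)"
proof -
  have Pm: "P (xmono S)" if "S \<subseteq> {..n}" for S
  proof -
    have "finite S" using that finite_subset by blast
    then show ?thesis using that
    proof (induction S rule: finite_linorder_max_induct)
      case empty
      have "xmono {} = (kk 1 :: nat set \<Rightarrow> 'k)" by (auto simp: xmono_def kk_def)
      then show ?case using P(1)[of 1] by simp
    next
      case (insert t S)
      have e: "xmono (insert t S) = (xmono S \<otimes>\<^bsub>EA n\<^esub> indeterminate t :: nat set \<Rightarrow> 'k)"
        by (rule mono_insert[OF insert(1,2)])
      show ?case unfolding e by (intro P(4) P(2) mono_carrier indet_carrier) (use insert in auto)
    qed
  qed
  have "P (\<lambda>S. if S \<in> F then a S else 0)" if "F \<subseteq> Pow {..n}" for F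
  proof -
    have "finite F" using that by (rule finite_subset) simp
    then show ?thesis using that
    proof (induction F rule: finite_induct)
      case empty
      have "(\<lambda>S. if S \<in> {} then a S else 0) = kk 0" by (auto simp: kk_def)
      then show ?case using P(1)[of 0] by simp
    next
      case (insert T F)
      then have T: "T \<subseteq> {..n}" by simp
      have "(\<lambda>S. if S \<in> insert T F then a S else 0) =
          (\<lambda>S. if S \<in> F then a S else 0) \<oplus>\<^bsub>EA n\<^esub> (kk (a T) \<otimes>\<^bsub>EA n\<^esub> xmono T)"
        unfolding kk_mult(1)[OF mono_carrier[OF T]] using insert.hyps by (auto simp: exterior_algebra_simps xmono_def)
      moreover have "(kk (a T) \<otimes>\<^bsub>EA n\<^esub> xmono T) \<in> carrier (EA n)"
        unfolding kk_mult(1)[OF mono_carrier[OF T]] using T by (auto simp: EA_carrier xmono_def)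
      moreover have "(\<lambda>S. if S \<in> F then a S else 0) \<in> carrier (EA n)" using insert.prems by (auto simp: EA_carrier)
      ultimately show ?case using insert Pm[OF T] mono_carrier[OF T] by (auto intro!: P(3) P(4) P(1))
    qed
  qed
  from this[of "Pow {..n}"] have "P (\<lambda>S. if S \<in> Pow {..n} then a S else 0)" by simp
  moreover have "(\<lambda>S. if S \<in> Pow {..n} then a S else 0) = a"
    by (rule ext) (use a in \<open>auto simp: EA_carrier\<close>)
  ultimately show ?thesis by simp
qed

text \<open>The operator of the monomial x_S. The smallest index acts first, as it should for right
  modules.\<close>

definition XS :: "'k::field mm \<Rightarrow> nat set \<Rightarrow> 'k mtx" where
  "XS N S = fold (\<lambda>a Z. ac N a * Z) (sorted_list_of_set S) (idm N)"

lemma XS_empty [simp]: "XS N {} = idm N" by (simp add: XS_def)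

lemma XS_insert: assumes "finite S" "\<forall>s\<in>S. s < t"
  shows "XS N (insert t S) = ac N t * XS N S"
proof -
  have "sorted_list_of_set (insert t S) = sorted_list_of_set S @ [t]"
  proof (rule sorted_distinct_set_unique)
    show "sorted (sorted_list_of_set S @ [t])" using assms by (auto simp: sorted_append intro: less_imp_le)
    show "distinct (sorted_list_of_set S @ [t])" using assms by auto
    show "set (sorted_list_of_set (insert t S)) = set (sorted_list_of_set S @ [t])"
      using assms(1) set_sorted_list_of_set[of "insert t S"] by (simp del: sorted_list_of_set_insert_remove set_sorted_list_of_set) (simp add: assms(1))
  qed (rule sorted_sorted_list_of_set distinct_sorted_list_of_set)+
  then show ?thesis by (simp add: XS_def)
qed

lemma dhom_XS: assumes "mmod n N" "S \<subseteq> {..n}" shows "dhom (int (card S)) N N (XS N S)"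
proof -
  have "finite S" using assms(2) finite_subset by blast
  then show ?thesis using assms(2)
  proof (induction S rule: finite_linorder_max_induct)
    case empty
    then show ?case by (simp add: dhom_idm)
  next
    case (insert t S)
    then have "t \<notin> S" by blast
    then have c: "card (insert t S) = Suc (card S)" using insert by simp
    show ?case unfolding XS_insert[OF insert(1,2)] c
      by (rule dhom_mult[OF mmodD(2)[OF assms(1)] insert.IH]) (use insert.prems in auto)
  qed
qed

lemma ac_XS:
  assumes N: "mmod n N" and t: "t \<le> n" and "S \<subseteq> {..n}"
  shows "ac N t * XS N S = (if t \<in> S then 0 else scl (shuffle_sign S {t}) (XS N (insert t S)))"
proof -
  have "finite S" using assms(3) finite_subset by blast
  then show ?thesis using assms(3)
  proof (induction S rule: finite_linorder_max_induct)
    case empty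
    then show ?case by (simp add: XS_insert)
  next
    case (insert m S)
    then have S: "S \<subseteq> {..n}" and m: "m \<le> n" "m \<notin> S" by auto
    note less = insert(2)
    note Xm = XS_insert[OF insert(1) less, where N = N]
    consider "t > m" | "t = m" | "t < m" by linarith
    then show ?case
    proof cases
      case 1
      then have l: "\<forall>s\<in>insert m S. s < t" using less by fastforce
      then have "t \<notin> insert m S" by blast
      then show ?thesis using XS_insert[OF _ l, where N = N] insert(1) sign_less[OF l, where 'k = 'a] by simp
    next
      case 2
      then show ?thesis using mmodD(3)[OF N t] by (simp add: Xm mult.assoc[symmetric])
    next
      case 3
      have "ac N t * XS N (insert m S) = - (ac N m * (ac N t * XS N S))"
        unfolding Xm mult.assoc[symmetric] mmodD(4)[OF N t m(1)] by simp
      also have "\<dots> = (if t \<in> S then 0 else - scl (shuffle_sign S {t}) (ac N m * XS N (insert t S)))"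
        unfolding insert.IH[OF S] by simp
      also have "ac N m * XS N (insert t S) = XS N (insert m (insert t S))"
        using insert(1) less 3 by (intro XS_insert[symmetric]) auto
      finally show ?thesis using 3 sign_insert[OF insert(1) m(2) 3, where 'k = 'a] by (auto simp: insert_commute)
    qed
  qed
qed

definition rho :: "nat \<Rightarrow> 'k::field mm \<Rightarrow> (nat set \<Rightarrow> 'k) \<Rightarrow> 'k mtx" where
  "rho n N a = (\<Sum>S\<in>Pow {..n}. scl (a S) (XS N S))"

lemma rho_add: "rho n N (a \<oplus>\<^bsub>EA n\<^esub> b) = rho n N a + rho n N b"
  by (simp add: rho_def exterior_algebra_simps scl_add_left sum.distrib)

lemma rho_kk: "rho n N (kk c) = scl c (idm N)"
proof -
  have "rho n N (kk c) = (\<Sum>S\<in>Pow {..n}. if S = {} then scl c (idm N) else 0)"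
    unfolding rho_def kk_def by (rule sum.cong) auto
  then show ?thesis by simp
qed

lemma rho_indet:
  assumes N: "mmod n N" and t: "t \<le> n"
  shows "rho n N (indeterminate t) = ac N t"
proof -
  have "rho n N (indeterminate t) = (\<Sum>S\<in>Pow {..n}. if S = {t} then XS N {t} else 0)"
    unfolding rho_def indeterminate_def by (rule sum.cong) auto
  also have "\<dots> = XS N {t}" using t by simp
  finally show ?thesis using XS_insert[of "{}" t N] mmodD(2)[OF N t] by simp
qed

lemma rho_mult_indet:
  assumes N: "mmod n N" and t: "t \<le> n"
  shows "rho n N (a \<otimes>\<^bsub>EA n\<^esub> indeterminate t) = ac N t * rho n N a"
proof -
  have "ac N t * rho n N a = (\<Sum>S\<in>Pow {..n}. scl (a S) (ac N t * XS N S))"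
    by (simp add: rho_def sum_distrib_left)
  also have "\<dots> = (\<Sum>S\<in>Pow {..n}. if t \<in> S then 0 else scl (a S * shuffle_sign S {t}) (XS N (insert t S)))"
    by (rule sum.cong) (auto simp: ac_XS[OF N t])
  also have "\<dots> = (\<Sum>S\<in>{S. S \<subseteq> {..n} \<and> t \<notin> S}. scl (a S * shuffle_sign S {t}) (XS N (insert t S)))"
    by (rule sum.mono_neutral_cong_right) auto
  also have "\<dots> = (\<Sum>U\<in>{U. U \<subseteq> {..n} \<and> t \<in> U}. scl (shuffle_sign (U - {t}) {t} * a (U - {t})) (XS N U))"
    by (rule sum.reindex_bij_witness[of _ "\<lambda>U. U - {t}" "insert t"]) (use t in \<open>auto simp: insert_absorb mult.commute\<close>)
  also have "\<dots> = rho n N (a \<otimes>\<^bsub>EA n\<^esub> indeterminate t)"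
    unfolding rho_def mult_indet
    by (rule sum.mono_neutral_cong_left) (auto intro: finite_subset[of _ "{..n}"])
  finally show ?thesis ..
qed

text \<open>The factors are reversed because the modules are right modules while matrices act from
  the left. It suffices to treat one indeterminate on the right, where the signs are those of
  \<open>ac_XS\<close>.\<close>

lemma rho_mult:
  assumes N: "mmod n N" and "b \<in> carrier (EA n)"
  shows "a \<in> carrier (EA n) \<Longrightarrow> rho n N (a \<otimes>\<^bsub>EA n\<^esub> b) = rho n N b * rho n N a"
  using assms(2)
proof (induction b arbitrary: a rule: ext_induct)
  case (scalar c)
  have "dhom 0 N N 0 \<and> idm N * rho n N a = rho n N a"
    unfolding rho_def sum_distrib_left
    by (auto intro!: sum.cong simp: idm_mult_dhom[OF dhom_XS[OF N]])
  then show ?case unfolding kk_mult(2)[OF scalar] rho_kk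
    by (simp add: rho_def scl_sum[symmetric]) (simp add: scl_sum)
next
  case (indet i)
  then show ?case by (simp add: rho_mult_indet[OF N] rho_indet[OF N])
next
  case (add b c)
  interpret R: ring "EA n :: (nat set \<Rightarrow> 'a) gring" by (rule ring_exterior_algebra)
  show ?case using add by (simp add: R.r_distr rho_add distrib_right)
next
  case (mult b c)
  interpret R: ring "EA n :: (nat set \<Rightarrow> 'a) gring" by (rule ring_exterior_algebra)
  have "rho n N (a \<otimes>\<^bsub>EA n\<^esub> (b \<otimes>\<^bsub>EA n\<^esub> c)) = rho n N ((a \<otimes>\<^bsub>EA n\<^esub> b) \<otimes>\<^bsub>EA n\<^esub> c)"
    using mult by (simp add: R.m_assoc)
  also have "\<dots> = rho n N c * (rho n N b * rho n N a)" using mult by simp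
  also have "\<dots> = rho n N (b \<otimes>\<^bsub>EA n\<^esub> c) * rho n N a" using mult by (simp add: mult.assoc)
  finally show ?case .
qed

lemma dhom_rho:
  assumes N: "mmod n N" and a: "a \<in> rcomp (EA n) i"
  shows "dhom i N N (rho n N a)"
  unfolding rho_def
proof (rule dhom_sum)
  fix S assume S: "S \<in> Pow {..n}"
  show "dhom i N N (scl (a S) (XS N S))"
  proof (cases "a S = 0")
    case False
    with a have "int (card S) = i" by (auto simp: exterior_algebra_simps)
    then show ?thesis using dhom_scl[OF dhom_XS[OF N, of S]] S by auto
  qed simp
qed

section \<open>Coordinates of graded modules\<close>

definition vec :: "'k::field mm \<Rightarrow> (nat \<Rightarrow> 'k) set" where "vec N = {u. \<forall>j. j \<notin> ix N \<longrightarrow> u j = 0}"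

definition vecd :: "'k::field mm \<Rightarrow> int \<Rightarrow> (nat \<Rightarrow> 'k) set" where
  "vecd N i = {u. \<forall>j. u j \<noteq> 0 \<longrightarrow> j \<in> ix N \<and> dg N j = i}"

definition mv :: "'k::field mtx \<Rightarrow> (nat \<Rightarrow> 'k) \<Rightarrow> nat \<Rightarrow> 'k" where
  "mv F u = (\<lambda>i. \<Sum>j | ent F i j \<noteq> 0. ent F i j * u j)"

lemma mv_gen: "finite L \<Longrightarrow> {j. ent F i j \<noteq> 0 \<and> u j \<noteq> 0} \<subseteq> L \<Longrightarrow> mv F u i = (\<Sum>j\<in>L. ent F i j * u j)"
proof -
  assume L: "finite L" "{j. ent F i j \<noteq> 0 \<and> u j \<noteq> 0} \<subseteq> L"
  have "mv F u i = (\<Sum>j\<in>{j. ent F i j \<noteq> 0} \<union> L. ent F i j * u j)"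
    unfolding mv_def using L(1) finite_row[of F i] by (intro sum.mono_neutral_left) auto
  also have "\<dots> = (\<Sum>j\<in>L. ent F i j * u j)"
    using L finite_row[of F i] by (intro sum.mono_neutral_right) auto
  finally show ?thesis .
qed

lemma mv_mult: "mv (F * G) u = mv F (mv G u)"
proof
  fix i
  let ?L = "{l. ent F i l \<noteq> 0}"
  let ?J = "\<Union>l\<in>?L. {j. ent G l j \<noteq> 0}"
  have fJ: "finite ?J" by (auto simp: finite_row)
  have "mv (F * G) u i = (\<Sum>j\<in>?J. ent (F * G) i j * u j)"
    by (rule mv_gen[OF fJ]) (auto elim!: ent_mult_nz)
  also have "\<dots> = (\<Sum>j\<in>?J. (\<Sum>l\<in>?L. ent F i l * ent G l j) * u j)"
    by (intro sum.cong refl arg_cong2[of _ _ _ _ "(*)"] ent_times_gen) (auto simp: finite_row)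
  also have "\<dots> = (\<Sum>l\<in>?L. ent F i l * (\<Sum>j\<in>?J. ent G l j * u j))"
    by (simp add: sum_distrib_left sum_distrib_right mult.assoc) (rule sum.swap)
  also have "\<dots> = (\<Sum>l\<in>?L. ent F i l * mv G u l)"
    by (intro sum.cong refl arg_cong2[of _ _ _ _ "(*)"] mv_gen[symmetric] fJ) auto
  also have "\<dots> = mv F (mv G u) i" by (simp add: mv_def[of F])
  finally show "mv (F * G) u i = mv F (mv G u) i" .
qed

lemma mv_add_left: "mv (F + G) u = (\<lambda>i. mv F u i + mv G u i)"
proof
  fix i
  let ?L = "{l. ent F i l \<noteq> 0} \<union> {l. ent G i l \<noteq> 0}"
  have f: "finite ?L" by (simp add: finite_row)
  have "mv H u i = (\<Sum>j\<in>?L. ent H i j * u j)" if "H \<in> {F, G, F + G}" for H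
    by (rule mv_gen[OF f]) (use that in auto)
  then show "mv (F + G) u i = mv F u i + mv G u i" by (simp add: sum.distrib distrib_right)
qed

lemma mv_scl: "mv (scl c F) u = (\<lambda>i. c * mv F u i)"
proof
  fix i
  have "mv (scl c F) u i = (\<Sum>j | ent F i j \<noteq> 0. ent (scl c F) i j * u j)"
    by (rule mv_gen) (auto simp: finite_row)
  then show "mv (scl c F) u i = c * mv F u i" by (simp add: mv_def sum_distrib_left mult.assoc)
qed

lemma mv_add: "mv F (\<lambda>i. u i + v i) = (\<lambda>i. mv F u i + mv F v i)"
  by (simp add: mv_def distrib_left sum.distrib)

lemma mv_cmult: "mv F (\<lambda>i. c * u i) = (\<lambda>i. c * mv F u i)"
  by (simp add: mv_def sum_distrib_left mult_ac)

lemma mv_zero [simp]: "mv F (\<lambda>_. 0) = (\<lambda>_. 0)" "mv 0 u = (\<lambda>_. 0)"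
  by (simp_all add: mv_def)

lemma mv_idm: "u \<in> vec N \<Longrightarrow> mv (idm N) u = u"
proof
  fix i assume u: "u \<in> vec N"
  have "mv (idm N) u i = (\<Sum>j\<in>{i}. ent (idm N) i j * u j)" by (rule mv_gen) (auto simp: ent_idm)
  then show "mv (idm N) u i = u i" using u by (auto simp: ent_idm vec_def)
qed

lemma mv_vec: "dhom d X Y F \<Longrightarrow> mv F u \<in> vec Y"
  unfolding vec_def mv_def by (auto intro!: sum.neutral dest: dhomD)

lemma mv_vecd: "dhom d X Y F \<Longrightarrow> u \<in> vecd X i \<Longrightarrow> mv F u \<in> vecd Y (i + d)"
  unfolding vecd_def
proof (intro CollectI allI impI)
  fix j assume d: "dhom d X Y F" and u: "u \<in> {u. \<forall>j. u j \<noteq> 0 \<longrightarrow> j \<in> ix X \<and> dg X j = i}" and "mv F u j \<noteq> 0"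
  from this(3) have "(\<Sum>l | ent F j l \<noteq> 0. ent F j l * u l) \<noteq> 0" by (simp add: mv_def)
  from sum.not_neutral_contains_not_neutral[OF this] obtain l where "ent F j l \<noteq> 0" "u l \<noteq> 0" by auto
  with dhomD[OF d this(1)] u show "j \<in> ix Y \<and> dg Y j = i + d" by auto
qed

lemma vecd_vec: "vecd N i \<subseteq> vec N" by (auto simp: vecd_def vec_def)

definition bv :: "nat \<Rightarrow> nat \<Rightarrow> 'k::field" where "bv j = (\<lambda>i. if i = j then 1 else 0)"

lemma bv_vecd: "j \<in> ix N \<Longrightarrow> bv j \<in> vecd N (dg N j)" by (auto simp: bv_def vecd_def)

lemma mv_bv: "mv F (bv j) = (\<lambda>i. ent F i j)"
proof
  fix i
  have "mv F (bv j) i = (\<Sum>l\<in>{j}. ent F i l * bv j l)" by (rule mv_gen) (auto simp: bv_def)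
  then show "mv F (bv j) i = ent F i j" by (simp add: bv_def)
qed

lemma vec_closed: "u \<in> vec N \<Longrightarrow> v \<in> vec N \<Longrightarrow> (\<lambda>i. u i + v i) \<in> vec N"
  "u \<in> vec N \<Longrightarrow> (\<lambda>i. c * u i) \<in> vec N" "(\<lambda>_. 0) \<in> vec N"
  by (auto simp: vec_def)

lemma vecd_closed: "u \<in> vecd N d \<Longrightarrow> v \<in> vecd N d \<Longrightarrow> (\<lambda>i. u i + v i) \<in> vecd N d"
  "u \<in> vecd N d \<Longrightarrow> (\<lambda>i. c * u i) \<in> vecd N d" "(\<lambda>_. 0) \<in> vecd N d"
  by (auto simp: vecd_def) (metis add_0)+

lemma vec_induct [consumes 2, case_names zero step]:
  assumes "finite (ix N)" "u \<in> vec N" "P (\<lambda>_. 0)"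
    and step: "\<And>u c j. u \<in> vec N \<Longrightarrow> j \<in> ix N \<Longrightarrow> P u \<Longrightarrow> P (\<lambda>i. u i + c * bv j i)"
  shows "P u"
proof -
  have "P (\<lambda>i. if i \<in> J then u i else 0)" if "J \<subseteq> ix N" for J
  proof -
    have "finite J" using that assms(1) finite_subset by blast
    then show ?thesis using that
    proof (induction J rule: finite_induct)
      case empty
      then show ?case using assms(3) by simp
    next
      case (insert j J)
      have "(\<lambda>i. if i \<in> insert j J then u i else 0) = (\<lambda>i. (if i \<in> J then u i else 0) + u j * bv j i)"
        using insert.hyps by (auto simp: bv_def)
      moreover have "(\<lambda>i. if i \<in> J then u i else 0) \<in> vec N" using insert.prems by (auto simp: vec_def)
      ultimately show ?case using step[of "\<lambda>i. if i \<in> J then u i else 0" j "u j"] insert by simp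
    qed
  qed
  moreover have "(\<lambda>i. if i \<in> ix N then u i else 0) = u" using assms(2) by (auto simp: vec_def)
  ultimately show ?thesis by (metis order.refl)
qed

lemma mv_eqI:
  assumes "dhom d X Y F" "dhom e X Z G" "\<And>u. u \<in> vec X \<Longrightarrow> mv F u = mv G u"
  shows "F = G"
proof (rule mtx_eqI)
  fix i j
  show "ent F i j = ent G i j"
  proof (cases "j \<in> ix X")
    case True
    then have "mv F (bv j) = mv G (bv j)" using assms(3) bv_vecd vecd_vec by blast
    then show ?thesis by (simp add: mv_bv fun_eq_iff)
  next
    case False
    then show ?thesis using dhom_out[OF assms(1)] dhom_out[OF assms(2)] by simp
  qed
qed

section \<open>Coordinate systems, and morphisms as matrices\<close>

text \<open>B is the coordinate isomorphism from vectors on \<open>ix N\<close> to M. Linearity over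
  the field is expressed through the scalars \<open>kk c\<close> of the algebra, and only the
  indeterminates are mentioned; the action of all other elements follows in
  \<open>rep_smult\<close>.\<close>

definition rep :: "nat \<Rightarrow> (nat set \<Rightarrow> 'k::field, 'm) gmodule \<Rightarrow> 'k mm \<Rightarrow> ((nat \<Rightarrow> 'k) \<Rightarrow> 'm) \<Rightarrow> bool" where
  "rep n M N B \<longleftrightarrow> graded_right_module (EA n) M \<and> mmod n N \<and> bij_betw B (vec N) (carrier M) \<and>
     (\<forall>u\<in>vec N. \<forall>v\<in>vec N. B (\<lambda>i. u i + v i) = B u \<oplus>\<^bsub>M\<^esub> B v) \<and>
     (\<forall>c. \<forall>u\<in>vec N. kk c \<odot>\<^bsub>M\<^esub> B u = B (\<lambda>i. c * u i)) \<and>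
     (\<forall>i. B ` vecd N i = mcomp M i) \<and>
     (\<forall>a\<le>n. \<forall>u\<in>vec N. indeterminate a \<odot>\<^bsub>M\<^esub> B u = B (mv (ac N a) u))"

lemma repD: assumes "rep n M N B"
  shows "graded_right_module (EA n) M" "mmod n N" "bij_betw B (vec N) (carrier M)"
    "u \<in> vec N \<Longrightarrow> v \<in> vec N \<Longrightarrow> B (\<lambda>i. u i + v i) = B u \<oplus>\<^bsub>M\<^esub> B v"
    "u \<in> vec N \<Longrightarrow> kk c \<odot>\<^bsub>M\<^esub> B u = B (\<lambda>i. c * u i)"
    "B ` vecd N d = mcomp M d"
    "a \<le> n \<Longrightarrow> u \<in> vec N \<Longrightarrow> indeterminate a \<odot>\<^bsub>M\<^esub> B u = B (mv (ac N a) u)"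
    "u \<in> vec N \<Longrightarrow> B u \<in> carrier M"
    "u \<in> vec N \<Longrightarrow> v \<in> vec N \<Longrightarrow> B u = B v \<longleftrightarrow> u = v"
    "x \<in> carrier M \<Longrightarrow> \<exists>u\<in>vec N. x = B u"
proof -
  note r = assms[unfolded rep_def]
  show "graded_right_module (EA n) M" "mmod n N" and b: "bij_betw B (vec N) (carrier M)" using r by simp_all
  show "u \<in> vec N \<Longrightarrow> v \<in> vec N \<Longrightarrow> B (\<lambda>i. u i + v i) = B u \<oplus>\<^bsub>M\<^esub> B v" using r by simp
  show "u \<in> vec N \<Longrightarrow> kk c \<odot>\<^bsub>M\<^esub> B u = B (\<lambda>i. c * u i)" using r by simp
  show "B ` vecd N d = mcomp M d" using r by simp
  show "a \<le> n \<Longrightarrow> u \<in> vec N \<Longrightarrow> indeterminate a \<odot>\<^bsub>M\<^esub> B u = B (mv (ac N a) u)" using r by simp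
  show "u \<in> vec N \<Longrightarrow> B u \<in> carrier M" using bij_betwE[OF b] by simp
  show "u \<in> vec N \<Longrightarrow> v \<in> vec N \<Longrightarrow> B u = B v \<longleftrightarrow> u = v" using b by (auto simp: bij_betw_def inj_on_def)
  show "x \<in> carrier M \<Longrightarrow> \<exists>u\<in>vec N. x = B u" using b by (auto simp: bij_betw_def)
qed

lemma mv_rho_vec: assumes N: "mmod n N" shows "mv (rho n N a) u \<in> vec N"
  unfolding vec_def
proof (intro CollectI allI impI)
  fix i assume i: "i \<notin> ix N"
  have "ent (XS N S) i j = 0" if "S \<in> Pow {..n}" for S j
    using dhom_out[OF dhom_XS[OF N, of S], of i j] i that by simp
  then have "ent (rho n N a) i j = 0" for j by (auto simp: rho_def intro!: sum.neutral)
  then show "mv (rho n N a) u i = 0" by (simp add: mv_def)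
qed

lemma rep_smult: assumes "rep n M N B" "a \<in> carrier (EA n)"
  shows "u \<in> vec N \<Longrightarrow> a \<odot>\<^bsub>M\<^esub> B u = B (mv (rho n N a) u)"
  using assms(2)
proof (induction a arbitrary: u rule: ext_induct)
  case (scalar c)
  then show ?case using repD(5)[OF assms(1)] by (simp add: rho_kk mv_scl mv_idm)
next
  case (indet i)
  then show ?case using repD(7)[OF assms(1)] by (simp add: rho_indet[OF repD(2)[OF assms(1)]])
next
  case (add a b)
  interpret M: graded_right_module "EA n" M by (rule repD(1)[OF assms(1)])
  note N = repD(2)[OF assms(1)]
  show ?case using add repD(8)[OF assms(1) add.prems] repD(4)[OF assms(1) mv_rho_vec[OF N] mv_rho_vec[OF N]]
    by (simp add: M.smult_l_distr rho_add mv_add_left)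
next
  case (mult a b)
  interpret M: graded_right_module "EA n" M by (rule repD(1)[OF assms(1)])
  note N = repD(2)[OF assms(1)]
  show ?case using mult repD(8)[OF assms(1) mult.prems] mv_rho_vec[OF N]
    by (simp add: M.smult_assoc rho_mult[OF N] mv_mult)
qed

lemma rep_zero: assumes "rep n M N B" shows "B (\<lambda>_. 0) = \<zero>\<^bsub>M\<^esub>"
proof -
  interpret M: graded_right_module "EA n" M by (rule repD(1)[OF assms])
  have "B (\<lambda>_. 0) = B (\<lambda>_. 0) \<oplus>\<^bsub>M\<^esub> B (\<lambda>_. 0)" using repD(4)[OF assms vec_closed(3) vec_closed(3)] by simp
  then show ?thesis using repD(8)[OF assms vec_closed(3)] M.add.l_cancel_one by metis
qed

lemma ghomD: assumes "f \<in> ghom R M N"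
  shows "x \<in> carrier M \<Longrightarrow> f x \<in> carrier N" "x \<in> carrier M \<Longrightarrow> y \<in> carrier M \<Longrightarrow> f (x \<oplus>\<^bsub>M\<^esub> y) = f x \<oplus>\<^bsub>N\<^esub> f y"
    "a \<in> carrier R \<Longrightarrow> x \<in> carrier M \<Longrightarrow> f (a \<odot>\<^bsub>M\<^esub> x) = a \<odot>\<^bsub>N\<^esub> f x"
    "x \<in> mcomp M i \<Longrightarrow> f x \<in> mcomp N i" "f \<in> extensional (carrier M)"
proof -
  show "x \<in> mcomp M i \<Longrightarrow> f x \<in> mcomp N i" using assms unfolding ghom_def by blast
qed (use assms in \<open>auto simp: ghom_def PiE_def\<close>)

definition cod :: "'k::field mm \<Rightarrow> ((nat \<Rightarrow> 'k) \<Rightarrow> 'm) \<Rightarrow> ((nat \<Rightarrow> 'k) \<Rightarrow> 'm) \<Rightarrow> ('m \<Rightarrow> 'm) \<Rightarrow> 'k mtx \<Rightarrow> bool" where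
  "cod N B B' f F \<longleftrightarrow> (\<forall>u\<in>vec N. f (B u) = B' (mv F u))"

lemma ghom_mat:
  assumes M: "rep n M N B" and M': "rep n M' N' B'" and f: "f \<in> ghom (EA n) M M'"
  obtains F where "mmor n N N' F" "cod N B B' f F"
proof -
  define \<phi> where "\<phi> u = the_inv_into (vec N') B' (f (B u))" for u
  have inj: "inj_on B' (vec N')" using repD(3)[OF M'] by (simp add: bij_betw_def)
  have \<phi>: "\<phi> u \<in> vec N'" "B' (\<phi> u) = f (B u)" if "u \<in> vec N" for u
  proof -
    have "f (B u) \<in> B' ` vec N'" using ghomD(1)[OF f repD(8)[OF M that]] repD(3)[OF M'] by (simp add: bij_betw_def)
    then show "\<phi> u \<in> vec N'" "B' (\<phi> u) = f (B u)" unfolding \<phi>_def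
      using the_inv_into_into[OF inj _ order.refl] f_the_inv_into_f[OF inj] by blast+
  qed
  have fN: "finite (ix N)" "finite (ix N')" using mmodD(1) repD(2) M M' by blast+
  have bvv: "bv j \<in> vec N" if "j \<in> ix N" for j using bv_vecd[OF that] vecd_vec by blast
  define F where "F = mtx (\<lambda>i j. if j \<in> ix N then \<phi> (bv j) i else 0)"
  have eF: "ent F i j = (if j \<in> ix N then \<phi> (bv j) i else 0)" for i j unfolding F_def
  proof (subst ent_mtx)
    show "finite {j. (if j \<in> ix N then \<phi> (bv j) i else 0) \<noteq> 0}" for i
      by (rule finite_subset[OF _ fN(1)]) auto
    show "finite {i. (if j \<in> ix N then \<phi> (bv j) i else 0) \<noteq> 0}" for j
      by (rule finite_subset[OF _ fN(2)]) (use \<phi>(1)[OF bvv, of j] in \<open>auto simp: vec_def\<close>)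
  qed simp
  have mF: "mv F u \<in> vec N'" for u unfolding vec_def mv_def
    using \<phi>(1)[OF bvv] by (auto simp: eF vec_def intro!: sum.neutral)
  have \<phi>d: "\<phi> (bv j) \<in> vecd N' (dg N j)" if j: "j \<in> ix N" for j
  proof -
    have "B (bv j) \<in> mcomp M (dg N j)" using bv_vecd[OF j] repD(6)[OF M] by blast
    then have "f (B (bv j)) \<in> B' ` vecd N' (dg N j)" using ghomD(4)[OF f] repD(6)[OF M'] by simp
    then obtain v where v: "v \<in> vecd N' (dg N j)" "B' (\<phi> (bv j)) = B' v" using \<phi>(2)[OF bvv[OF j]] by auto
    then have "\<phi> (bv j) = v" using repD(9)[OF M' \<phi>(1)[OF bvv[OF j]]] vecd_vec by blast
    then show ?thesis using v by simp
  qed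
  have dF: "dhom 0 N N' F" unfolding dhom_def eF using \<phi>d by (auto simp: vecd_def split: if_splits)
  have eq: "f (B u) = B' (mv F u)" if "u \<in> vec N" for u
    using fN(1) that
  proof (induction u rule: vec_induct)
    case zero
    have "f (B (\<lambda>_. 0)) = f (kk 0 \<odot>\<^bsub>M\<^esub> B (\<lambda>_. 0))" using repD(5)[OF M vec_closed(3), of 0] by simp
    also have "\<dots> = kk 0 \<odot>\<^bsub>M'\<^esub> B' (\<phi> (\<lambda>_. 0))"
      using ghomD(3)[OF f kk_carrier repD(8)[OF M vec_closed(3)]] \<phi>(2)[OF vec_closed(3)] by simp
    also have "\<dots> = B' (\<lambda>_. 0)" using repD(5)[OF M' \<phi>(1)[OF vec_closed(3)], of 0] by simp
    finally show ?case by simp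
  next
    case (step u c j)
    note b = bvv[OF step(2)]
    have "f (B (\<lambda>i. u i + c * bv j i)) = f (B u \<oplus>\<^bsub>M\<^esub> kk c \<odot>\<^bsub>M\<^esub> B (bv j))"
      using repD(4)[OF M step(1) vec_closed(2)[OF b]] repD(5)[OF M b] by simp
    also have "\<dots> = f (B u) \<oplus>\<^bsub>M'\<^esub> kk c \<odot>\<^bsub>M'\<^esub> f (B (bv j))"
      using ghomD(2)[OF f repD(8)[OF M step(1)]] ghomD(3)[OF f kk_carrier repD(8)[OF M b]]
        repD(8)[OF M vec_closed(2)[OF b]] repD(5)[OF M b] by simp
    also have "\<dots> = B' (\<lambda>i. mv F u i + c * \<phi> (bv j) i)"
      using step(3) \<phi>[OF b] repD(5)[OF M' \<phi>(1)[OF b]] repD(4)[OF M' mF vec_closed(2)[OF \<phi>(1)[OF b]]] by simp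
    also have "\<phi> (bv j) = mv F (bv j)" by (simp add: mv_bv eF step(2))
    finally show ?case by (simp add: mv_add mv_cmult)
  qed
  have "F * ac N a = ac N' a * F" if a: "a \<le> n" for a
  proof (rule mv_eqI)
    show "dhom 1 N N' (F * ac N a)" by (rule dhom_mult[OF dF mmodD(2)[OF repD(2)[OF M] a]]) simp
    show "dhom 1 N N' (ac N' a * F)" by (rule dhom_mult[OF mmodD(2)[OF repD(2)[OF M'] a] dF]) simp
    fix u assume u: "u \<in> vec N"
    have mu: "mv (ac N a) u \<in> vec N" by (rule mv_vec[OF mmodD(2)[OF repD(2)[OF M] a]])
    have "B' (mv F (mv (ac N a) u)) = f (indeterminate a \<odot>\<^bsub>M\<^esub> B u)"
      using eq[OF mu] repD(7)[OF M a u] by simp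
    also have "\<dots> = indeterminate a \<odot>\<^bsub>M'\<^esub> B' (mv F u)"
      using ghomD(3)[OF f indet_carrier[OF a] repD(8)[OF M u]] eq[OF u] by simp
    also have "\<dots> = B' (mv (ac N' a) (mv F u))" by (rule repD(7)[OF M' a mF])
    finally show "mv (F * ac N a) u = mv (ac N' a * F) u"
      using repD(9)[OF M' mF mv_vec[OF mmodD(2)[OF repD(2)[OF M'] a]]] by (simp add: mv_mult)
  qed
  with dF have "mmor n N N' F" by (simp add: mmor_def)
  moreover have "cod N B B' f F" using eq by (simp add: cod_def)
  ultimately show thesis by (rule that)
qed

lemma mat_ghom:
  assumes M: "rep n M N B" and M': "rep n M' N' B'" and F: "mmor n N N' F"
  obtains f where "f \<in> ghom (EA n) M M'" "cod N B B' f F"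
proof -
  interpret M: graded_right_module "EA n" M by (rule repD(1)[OF M])
  note dF = mmorD(1)[OF F]
  define f where "f = restrict (\<lambda>x. B' (mv F (the_inv_into (vec N) B x))) (carrier M)"
  have inj: "inj_on B (vec N)" using repD(3)[OF M] by (simp add: bij_betw_def)
  have fB: "f (B u) = B' (mv F u)" if "u \<in> vec N" for u
    using that repD(8)[OF M that] by (simp add: f_def the_inv_into_f_f[OF inj])
  have mF: "mv F u \<in> vec N'" for u by (rule mv_vec[OF dF])
  have cl: "f x \<in> carrier M'" if "x \<in> carrier M" for x
    using repD(10)[OF M that] fB repD(8)[OF M' mF] by auto
  have lin: "f (a \<odot>\<^bsub>M\<^esub> x) = a \<odot>\<^bsub>M'\<^esub> f x" if "a \<in> carrier (EA n)" "x \<in> carrier M" for a x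
    using that
  proof (induction a arbitrary: x rule: ext_induct)
    case (scalar c)
    then obtain u where u: "u \<in> vec N" "x = B u" using repD(10)[OF M] by blast
    then show ?case using repD(5)[OF M u(1)] repD(5)[OF M' mF] fB[OF u(1)] fB[OF vec_closed(2)[OF u(1)]]
      by (simp add: mv_cmult)
  next
    case (indet a)
    then obtain u where u: "u \<in> vec N" "x = B u" using repD(10)[OF M] by blast
    have mu: "mv (ac N a) u \<in> vec N" by (rule mv_vec[OF mmodD(2)[OF repD(2)[OF M] indet(1)]])
    show ?case using u repD(7)[OF M indet(1) u(1)] repD(7)[OF M' indet(1) mF] fB[OF u(1)] fB[OF mu]
      mmorD(2)[OF F indet(1)] by (simp add: mv_mult[symmetric])
  next
    case (add a b)
    interpret M': graded_right_module "EA n" M' by (rule repD(1)[OF M'])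
    obtain u where u: "u \<in> vec N" "x = B u" using add.prems repD(10)[OF M] by blast
    have m: "mv (rho n N a) u \<in> vec N" for a by (rule mv_rho_vec[OF repD(2)[OF M]])
    have x: "x \<in> carrier M" by (rule add.prems)
    have rx: "a \<odot>\<^bsub>M\<^esub> x = B (mv (rho n N a) u)" if "a \<in> carrier (EA n)" for a
      using rep_smult[OF M that u(1)] u(2) by simp
    have "f ((a \<oplus>\<^bsub>EA n\<^esub> b) \<odot>\<^bsub>M\<^esub> x) = f (B (mv (rho n N a) u) \<oplus>\<^bsub>M\<^esub> B (mv (rho n N b) u))"
      by (simp only: M.smult_l_distr[OF add(1,2) x] rx[OF add(1)] rx[OF add(2)])
    also have "\<dots> = B' (\<lambda>i. mv F (mv (rho n N a) u) i + mv F (mv (rho n N b) u) i)"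
      unfolding repD(4)[OF M m m, symmetric] fB[OF vec_closed(1)[OF m m]] mv_add ..
    also have "\<dots> = f (B (mv (rho n N a) u)) \<oplus>\<^bsub>M'\<^esub> f (B (mv (rho n N b) u))"
      unfolding repD(4)[OF M' mF mF] fB[OF m] ..
    also have "\<dots> = f (a \<odot>\<^bsub>M\<^esub> x) \<oplus>\<^bsub>M'\<^esub> f (b \<odot>\<^bsub>M\<^esub> x)"
      by (simp only: rx[OF add(1)] rx[OF add(2)])
    also have "\<dots> = a \<odot>\<^bsub>M'\<^esub> f x \<oplus>\<^bsub>M'\<^esub> b \<odot>\<^bsub>M'\<^esub> f x" by (simp only: add.IH(1)[OF x] add.IH(2)[OF x])
    also have "\<dots> = (a \<oplus>\<^bsub>EA n\<^esub> b) \<odot>\<^bsub>M'\<^esub> f x" by (rule M'.smult_l_distr[OF add(1,2) cl[OF x], symmetric])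
    finally show ?case .
  next
    case (mult a b)
    interpret M': graded_right_module "EA n" M' by (rule repD(1)[OF M'])
    have x: "x \<in> carrier M" by (rule mult.prems)
    show ?case unfolding M.smult_assoc[OF mult(1,2) x] M'.smult_assoc[OF mult(1,2) cl[OF x]]
      mult.IH(2)[OF M.smult_closed[OF mult(1) x]] mult.IH(1)[OF x] ..
  qed
  have "f \<in> ghom (EA n) M M'" unfolding ghom_def
  proof (intro CollectI conjI ballI allI)
    show "f \<in> carrier M \<rightarrow>\<^sub>E carrier M'" by (rule PiE_I) (use cl in blast, simp add: f_def)
    fix x y assume "x \<in> carrier M" "y \<in> carrier M"
    then obtain u v where uv: "u \<in> vec N" "x = B u" "v \<in> vec N" "y = B v"
      using repD(10)[OF M, of x] repD(10)[OF M, of y] by blast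
    show "f (x \<oplus>\<^bsub>M\<^esub> y) = f x \<oplus>\<^bsub>M'\<^esub> f y"
      unfolding uv(2,4) repD(4)[OF M uv(1,3), symmetric] fB[OF uv(1)] fB[OF uv(3)] fB[OF vec_closed(1)[OF uv(1,3)]]
        repD(4)[OF M' mF mF, symmetric] mv_add ..
  next
    fix i show "f ` mcomp M i \<subseteq> mcomp M' i"
    proof
      fix y assume "y \<in> f ` mcomp M i"
      then have "y \<in> f ` B ` vecd N i" unfolding repD(6)[OF M] .
      then obtain u where u: "u \<in> vecd N i" "y = f (B u)" by (elim imageE) simp
      then have "u \<in> vec N" using vecd_vec by blast
      then have "y = B' (mv F u)" unfolding u(2) by (rule fB)
      moreover have "mv F u \<in> vecd N' i" using mv_vecd[OF dF u(1)] by simp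
      ultimately show "y \<in> mcomp M' i" unfolding repD(6)[OF M', symmetric] by (rule image_eqI)
    qed
  qed (rule lin)
  moreover have "cod N B B' f F" unfolding cod_def by (intro ballI fB)
  ultimately show thesis by (rule that)
qed

lemma cod_comp: assumes "cod N B B' f F" "cod N' B' B'' g G" "dhom 0 N N' F"
  shows "u \<in> vec N \<Longrightarrow> g (f (B u)) = B'' (mv (G * F) u)"
  using assms mv_vec[OF assms(3)] by (simp add: cod_def mv_mult)

lemma cod_eqD:
  assumes "rep n M N B" "rep n M' N' B'" "dhom 0 N N' F" "dhom 0 N N' G" "\<And>u. u \<in> vec N \<Longrightarrow> B' (mv F u) = B' (mv G u)"
  shows "F = G"
  by (rule mv_eqI[OF assms(3,4)]) (use repD(9)[OF assms(2) mv_vec[OF assms(3)] mv_vec[OF assms(4)]] assms(5) in blast)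

text \<open>Solving for each column separately ignores degrees; the homogeneous part of the result
  is still a solution because F and K are homogeneous.\<close>

lemma lift_columns:
  assumes Z: "finite (ix Z)" and F: "dhom 0 N N' F" and K: "dhom q Z N' K" and fN: "finite (ix N)"
    and ex: "\<And>j. j \<in> ix Z \<Longrightarrow> \<exists>u\<in>vec N. mv F u = mv K (bv j)"
  obtains K' where "dhom q Z N K'" "K = F * K'"
proof -
  obtain u where u: "\<And>j. j \<in> ix Z \<Longrightarrow> u j \<in> vec N \<and> mv F (u j) = mv K (bv j)" using ex by metis
  define K0 where "K0 = mtx (\<lambda>i j. if j \<in> ix Z then u j i else 0)"
  have e: "ent K0 i j = (if j \<in> ix Z then u j i else 0)" for i j unfolding K0_def
  proof (subst ent_mtx)
    show "finite {j. (if j \<in> ix Z then u j i else 0) \<noteq> 0}" for i by (rule finite_subset[OF _ Z]) auto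
    show "finite {i. (if j \<in> ix Z then u j i else 0) \<noteq> 0}" for j
      by (rule finite_subset[OF _ fN]) (use u[of j] in \<open>auto simp: vec_def\<close>)
  qed simp
  have "F * K0 = K"
  proof (rule mtx_eqI)
    fix i j
    have "ent (F * K0) i j = mv F (\<lambda>l. ent K0 l j) i"
      unfolding mv_bv[of K0 j, symmetric] mv_mult[symmetric] unfolding mv_bv ..
    also have "\<dots> = ent K i j"
    proof (cases "j \<in> ix Z")
      case True
      then show ?thesis using u[OF True] by (simp add: e mv_bv)
    next
      case False
      then show ?thesis using dhom_out[OF K, of i j] by (simp add: e)
    qed
    finally show "ent (F * K0) i j = ent K i j" .
  qed
  then have "K = F * hpart q Z N K0" using hpart_mult_left[OF F, of q Z K0] hpart_id[OF K] by simp
  then show thesis using that dhom_hpart by blast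
qed

section \<open>Realisation of matrix modules\<close>

text \<open>The structure of N transported along an arbitrary injection \<kappa> of its vectors into
  the universe.\<close>

definition realize :: "nat \<Rightarrow> 'k::field mm \<Rightarrow> ((nat \<Rightarrow> 'k) \<Rightarrow> 'm) \<Rightarrow> (nat set \<Rightarrow> 'k, 'm) gmodule" where
  "realize n N \<kappa> = \<lparr>carrier = \<kappa> ` vec N, monoid.mult = undefined, one = undefined,
     zero = \<kappa> (\<lambda>_. 0), add = (\<lambda>x y. \<kappa> (\<lambda>i. the_inv_into (vec N) \<kappa> x i + the_inv_into (vec N) \<kappa> y i)),
     module.smult = (\<lambda>a x. \<kappa> (mv (rho n N a) (the_inv_into (vec N) \<kappa> x))),
     mcomp = (\<lambda>i. \<kappa> ` vecd N i)\<rparr>"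

lemma rep_realize:
  assumes N: "mmod n N" and inj: "inj_on \<kappa> (vec N)"
  shows "rep n (realize n N \<kappa>) N \<kappa>"
proof -
  let ?M = "realize n N \<kappa>" and ?iv = "the_inv_into (vec N) \<kappa>"
  have iv [simp]: "?iv (\<kappa> u) = u" if "u \<in> vec N" for u by (rule the_inv_into_f_f[OF inj that])
  have car: "carrier ?M = \<kappa> ` vec N" and zero: "\<zero>\<^bsub>?M\<^esub> = \<kappa> (\<lambda>_. 0)" and comp: "mcomp ?M i = \<kappa> ` vecd N i" for i
    by (simp_all add: realize_def)
  have add: "\<kappa> u \<oplus>\<^bsub>?M\<^esub> \<kappa> v = \<kappa> (\<lambda>i. u i + v i)" if "u \<in> vec N" "v \<in> vec N" for u v
    using that by (simp add: realize_def)
  have sm: "a \<odot>\<^bsub>?M\<^esub> \<kappa> u = \<kappa> (mv (rho n N a) u)" if "u \<in> vec N" for a u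
    using that by (simp add: realize_def)
  note rv = mv_rho_vec[OF N]
  have grp: "abelian_group ?M"
  proof (rule abelian_groupI)
    fix x y z assume "x \<in> carrier ?M" "y \<in> carrier ?M" "z \<in> carrier ?M"
    then obtain u v w where uvw: "x = \<kappa> u" "y = \<kappa> v" "z = \<kappa> w" "u \<in> vec N" "v \<in> vec N" "w \<in> vec N" unfolding car by blast
    show "x \<oplus>\<^bsub>?M\<^esub> y \<oplus>\<^bsub>?M\<^esub> z = x \<oplus>\<^bsub>?M\<^esub> (y \<oplus>\<^bsub>?M\<^esub> z)"
      using uvw vec_closed(1)[OF uvw(4,5)] vec_closed(1)[OF uvw(5,6)] by (simp add: add add.assoc)
  next
    fix x y assume "x \<in> carrier ?M" "y \<in> carrier ?M"
    then obtain u v where uv: "x = \<kappa> u" "y = \<kappa> v" "u \<in> vec N" "v \<in> vec N" unfolding car by blast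
    show "x \<oplus>\<^bsub>?M\<^esub> y \<in> carrier ?M" "x \<oplus>\<^bsub>?M\<^esub> y = y \<oplus>\<^bsub>?M\<^esub> x" using uv vec_closed(1)[OF uv(3,4)] by (auto simp: add car add.commute)
  next
    fix x assume "x \<in> carrier ?M"
    then obtain u where u: "x = \<kappa> u" "u \<in> vec N" unfolding car by blast
    show "\<zero>\<^bsub>?M\<^esub> \<oplus>\<^bsub>?M\<^esub> x = x" using u add[OF vec_closed(3) u(2)] by (simp add: zero)
    have "(\<lambda>i. - u i) \<in> vec N" using vec_closed(2)[OF u(2), of "- 1"] by simp
    then show "\<exists>y\<in>carrier ?M. y \<oplus>\<^bsub>?M\<^esub> x = \<zero>\<^bsub>?M\<^esub>" using u add[of "\<lambda>i. - u i" u]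
      by (intro bexI[of _ "\<kappa> (\<lambda>i. - u i)"]) (auto simp: car zero)
  qed (use vec_closed(3) in \<open>auto simp: car zero\<close>)
  interpret G: abelian_group ?M by (rule grp)
  have fsum: "(\<Oplus>\<^bsub>?M\<^esub>i\<in>A. \<kappa> (g i)) = \<kappa> (\<lambda>j. \<Sum>i\<in>A. g i j)" "(\<lambda>j. \<Sum>i\<in>A. g i j) \<in> vec N"
    if "finite A" "\<And>i. i \<in> A \<Longrightarrow> g i \<in> vec N" for A :: "int set" and g
  proof -
    have v: "(\<lambda>j. \<Sum>i\<in>B. g i j) \<in> vec N" if "\<And>i. i \<in> B \<Longrightarrow> g i \<in> vec N" for B :: "int set"
      using that by (auto simp: vec_def intro!: sum.neutral)
    show "(\<lambda>j. \<Sum>i\<in>A. g i j) \<in> vec N" by (rule v) (rule that(2))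
    show "(\<Oplus>\<^bsub>?M\<^esub>i\<in>A. \<kappa> (g i)) = \<kappa> (\<lambda>j. \<Sum>i\<in>A. g i j)" using that
    proof (induction A rule: finite_induct)
      case empty
      then show ?case by (simp add: zero)
    next
      case (insert i A)
      have "(\<lambda>i. \<kappa> (g i)) \<in> A \<rightarrow> carrier ?M" "\<kappa> (g i) \<in> carrier ?M" using insert by (auto simp: car)
      then show ?case using insert v[of A] by (simp add: G.finsum_insert add)
    qed
  qed
  have grading: "internal_grading ?M (mcomp ?M)"
    unfolding internal_grading_def
  proof (intro conjI allI ballI)
    fix i
    show "subgroup (mcomp ?M i) (add_monoid ?M)"
    proof (rule group.subgroupI)
      show "group (add_monoid ?M)" by (rule G.add.is_group)
      show "mcomp ?M i \<subseteq> carrier (add_monoid ?M)" using vecd_vec by (auto simp: comp car)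
      show "mcomp ?M i \<noteq> {}" using vecd_closed(3) by (auto simp: comp)
      fix a assume "a \<in> mcomp ?M i"
      then obtain u where u: "u \<in> vecd N i" "a = \<kappa> u" by (auto simp: comp)
      then have uv: "u \<in> vec N" using vecd_vec by blast
      have m: "(\<lambda>i. - u i) \<in> vecd N i" using vecd_closed(2)[OF u(1), of "- 1"] by simp
      then have mv: "(\<lambda>i. - u i) \<in> vec N" using vecd_vec by blast
      have "\<ominus>\<^bsub>?M\<^esub> a = \<kappa> (\<lambda>i. - u i)" using uv mv add[OF mv uv] u(2)
        by (intro G.minus_equality) (auto simp: car zero)
      then have "inv\<^bsub>add_monoid ?M\<^esub> a = \<kappa> (\<lambda>i. - u i)" by (simp only: a_inv_def)
      then show "inv\<^bsub>add_monoid ?M\<^esub> a \<in> mcomp ?M i" using m by (auto simp: comp)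
      fix b assume "b \<in> mcomp ?M i"
      then obtain v where v: "v \<in> vecd N i" "b = \<kappa> v" by (auto simp: comp)
      then have "v \<in> vec N" using vecd_vec by blast
      then show "a \<otimes>\<^bsub>add_monoid ?M\<^esub> b \<in> mcomp ?M i" using uv u v add vecd_closed(1)[OF u(1) v(1)] by (auto simp: comp)
    qed
  next
    fix x assume "x \<in> carrier ?M"
    then obtain u where u: "x = \<kappa> u" "u \<in> vec N" unfolding car by blast
    define p where "p i j = (if dg N j = i then u j else 0)" for i j
    have pd: "p i \<in> vecd N i" for i using u(2) by (auto simp: p_def vecd_def vec_def)
    then have pv: "p i \<in> vec N" for i using vecd_vec by blast
    have k0: "\<kappa> v = \<zero>\<^bsub>?M\<^esub> \<longleftrightarrow> v = (\<lambda>_. 0)" if "v \<in> vec N" for v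
      using inj_on_eq_iff[OF inj that vec_closed(3)] by (simp add: zero)
    \<comment> \<open>In a sum of homogeneous vectors, coordinate j can only come from the summand
      of degree \<open>dg N j\<close>. Existence and uniqueness of the decomposition both
      follow.\<close>
    have sum_eq: "(\<Oplus>\<^bsub>?M\<^esub>i\<in>{i. \<kappa> (g i) \<noteq> \<zero>\<^bsub>?M\<^esub>}. \<kappa> (g i)) = \<kappa> (\<lambda>j. g (dg N j) j) \<and> (\<lambda>j. g (dg N j) j) \<in> vec N"
      if g: "\<And>i. g i \<in> vecd N i" and fin: "finite {i. \<kappa> (g i) \<noteq> \<zero>\<^bsub>?M\<^esub>}" for g
    proof -
      have gv: "g i \<in> vec N" for i using g vecd_vec by blast
      have "(\<lambda>j. \<Sum>i\<in>{i. \<kappa> (g i) \<noteq> \<zero>\<^bsub>?M\<^esub>}. g i j) = (\<lambda>j. g (dg N j) j)"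
      proof
        fix j
        have z: "g i j = 0" if "i \<noteq> dg N j" for i using g[of i] that by (auto simp: vecd_def)
        have "(\<Sum>i\<in>{i. \<kappa> (g i) \<noteq> \<zero>\<^bsub>?M\<^esub>}. g i j) = (\<Sum>i\<in>{i. \<kappa> (g i) \<noteq> \<zero>\<^bsub>?M\<^esub>} \<union> {dg N j}. g i j)"
          using fin k0[OF gv] by (intro sum.mono_neutral_left) auto
        also have "\<dots> = (\<Sum>i\<in>{dg N j}. g i j)" using fin z by (intro sum.mono_neutral_right) auto
        finally show "(\<Sum>i\<in>{i. \<kappa> (g i) \<noteq> \<zero>\<^bsub>?M\<^esub>}. g i j) = g (dg N j) j" by simp
      qed
      then show ?thesis using fsum[OF fin, of g] gv by simp
    qed
    have pf: "finite {i. \<kappa> (p i) \<noteq> \<zero>\<^bsub>?M\<^esub>}"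
    proof (rule finite_subset)
      show "{i. \<kappa> (p i) \<noteq> \<zero>\<^bsub>?M\<^esub>} \<subseteq> dg N ` ix N"
      proof
        fix i assume "i \<in> {i. \<kappa> (p i) \<noteq> \<zero>\<^bsub>?M\<^esub>}"
        then have "p i \<noteq> (\<lambda>_. 0)" using k0[OF pv] by simp
        then obtain j where "p i j \<noteq> 0" by auto
        then show "i \<in> dg N ` ix N" using pd[of i] by (auto simp: vecd_def)
      qed
      show "finite (dg N ` ix N)" using mmodD(1)[OF N] by simp
    qed
    show "\<exists>!f. (\<forall>i. f i \<in> mcomp ?M i) \<and> finite {i. f i \<noteq> \<zero>\<^bsub>?M\<^esub>} \<and> x = (\<Oplus>\<^bsub>?M\<^esub>i\<in>{i. f i \<noteq> \<zero>\<^bsub>?M\<^esub>}. f i)"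
    proof (rule ex1I[of _ "\<lambda>i. \<kappa> (p i)"])
      have "(\<lambda>j. p (dg N j) j) = u" by (simp add: p_def)
      then show "(\<forall>i. \<kappa> (p i) \<in> mcomp ?M i) \<and> finite {i. \<kappa> (p i) \<noteq> \<zero>\<^bsub>?M\<^esub>} \<and>
          x = (\<Oplus>\<^bsub>?M\<^esub>i\<in>{i. \<kappa> (p i) \<noteq> \<zero>\<^bsub>?M\<^esub>}. \<kappa> (p i))"
        using pd pf sum_eq[of p] u by (auto simp: comp)
    next
      fix f assume f: "(\<forall>i. f i \<in> mcomp ?M i) \<and> finite {i. f i \<noteq> \<zero>\<^bsub>?M\<^esub>} \<and> x = (\<Oplus>\<^bsub>?M\<^esub>i\<in>{i. f i \<noteq> \<zero>\<^bsub>?M\<^esub>}. f i)"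
      then have "\<forall>i. \<exists>g. g \<in> vecd N i \<and> f i = \<kappa> g" by (auto simp: comp)
      then obtain g where g: "\<And>i. g i \<in> vecd N i" "\<And>i. f i = \<kappa> (g i)" by metis
      have fg: "f = (\<lambda>i. \<kappa> (g i))" using g(2) by auto
      have "x = \<kappa> (\<lambda>j. g (dg N j) j) \<and> (\<lambda>j. g (dg N j) j) \<in> vec N" using f sum_eq[OF g(1)] unfolding fg by auto
      then have "u = (\<lambda>j. g (dg N j) j)" using u inj by (auto dest: inj_onD)
      then have "g i j = p i j" for i j using g(1)[of i] by (auto simp: p_def vecd_def)
      then have "g i = p i" for i by (rule ext)
      then show "f = (\<lambda>i. \<kappa> (p i))" unfolding fg by simp
    qed
  qed
  have "graded_right_module (EA n) ?M"
  proof (intro graded_right_module.intro graded_right_module_axioms.intro grp grading graded_ring_exterior_algebra)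
    interpret R: ring "EA n :: (nat set \<Rightarrow> 'a) gring" by (rule ring_exterior_algebra)
    fix a b :: "nat set \<Rightarrow> 'a" and x y i j
    show "a \<in> carrier (EA n) \<Longrightarrow> x \<in> carrier ?M \<Longrightarrow> a \<odot>\<^bsub>?M\<^esub> x \<in> carrier ?M"
      using rv by (auto simp: car sm)
    show "a \<in> carrier (EA n) \<Longrightarrow> b \<in> carrier (EA n) \<Longrightarrow> x \<in> carrier ?M \<Longrightarrow>
        (a \<oplus>\<^bsub>EA n\<^esub> b) \<odot>\<^bsub>?M\<^esub> x = a \<odot>\<^bsub>?M\<^esub> x \<oplus>\<^bsub>?M\<^esub> b \<odot>\<^bsub>?M\<^esub> x"
      using rv by (auto simp: car sm add rho_add mv_add_left)
    show "a \<in> carrier (EA n) \<Longrightarrow> x \<in> carrier ?M \<Longrightarrow> y \<in> carrier ?M \<Longrightarrow>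
        a \<odot>\<^bsub>?M\<^esub> (x \<oplus>\<^bsub>?M\<^esub> y) = a \<odot>\<^bsub>?M\<^esub> x \<oplus>\<^bsub>?M\<^esub> a \<odot>\<^bsub>?M\<^esub> y"
      using rv by (auto simp: car sm add mv_add vec_closed(1))
    show "a \<in> carrier (EA n) \<Longrightarrow> b \<in> carrier (EA n) \<Longrightarrow> x \<in> carrier ?M \<Longrightarrow>
        (a \<otimes>\<^bsub>EA n\<^esub> b) \<odot>\<^bsub>?M\<^esub> x = b \<odot>\<^bsub>?M\<^esub> (a \<odot>\<^bsub>?M\<^esub> x)"
      using rv by (auto simp: car sm rho_mult[OF N] mv_mult)
    show "x \<in> carrier ?M \<Longrightarrow> \<one>\<^bsub>EA n\<^esub> \<odot>\<^bsub>?M\<^esub> x = x"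
      by (auto simp: car sm kk_simps(2)[of n, symmetric] rho_kk mv_idm)
    show "a \<in> rcomp (EA n) i \<Longrightarrow> x \<in> mcomp ?M j \<Longrightarrow> a \<odot>\<^bsub>?M\<^esub> x \<in> mcomp ?M (j + i)"
      using vecd_vec[of N j] mv_vecd[OF dhom_rho[OF N]] by (auto simp: comp sm subset_iff)
  qed
  moreover have "bij_betw \<kappa> (vec N) (carrier ?M)" using inj by (simp add: bij_betw_def car)
  ultimately show ?thesis unfolding rep_def using N
    by (auto simp: add sm comp rho_kk mv_scl mv_idm rho_indet[OF N])
qed

lemma rep_fgmod: assumes "rep n M N B" shows "M \<in> fgmod (EA n)"
proof -
  interpret M: graded_right_module "EA n" M by (rule repD(1)[OF assms])
  note fN = mmodD(1)[OF repD(2)[OF assms]]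
  let ?S = "(\<lambda>j. B (bv j)) ` ix N"
  let ?P = "{a \<odot>\<^bsub>M\<^esub> x |a x. a \<in> carrier (EA n) \<and> x \<in> ?S}"
  have bvv: "bv j \<in> vec N" if "j \<in> ix N" for j using bv_vecd[OF that] vecd_vec by blast
  have S: "?S \<subseteq> carrier M" using repD(8)[OF assms bvv] by auto
  have "generate (add_monoid M) ?P \<subseteq> carrier M"
    using M.add.generate_incl[of ?P] S M.smult_closed by auto
  moreover have "B u \<in> generate (add_monoid M) ?P" if "u \<in> vec N" for u
    using fN that
  proof (induction u rule: vec_induct)
    case zero
    have "\<one>\<^bsub>add_monoid M\<^esub> \<in> generate (add_monoid M) ?P" by (rule generate.one)
    then show ?case by (simp add: rep_zero[OF assms])
  next
    case (step u c j)
    have "kk c \<odot>\<^bsub>M\<^esub> B (bv j) \<in> generate (add_monoid M) ?P" using step(2)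
      by (intro generate.incl CollectI exI conjI) (rule refl kk_carrier imageI | assumption)+
    from generate.eng[OF step(3) this] show ?case
      using repD(4)[OF assms step(1) vec_closed(2)[OF bvv[OF step(2)]]] repD(5)[OF assms bvv[OF step(2)]] by simp
  qed
  ultimately have "product_span M ?S (carrier (EA n)) = carrier M"
    unfolding product_span_def using repD(10)[OF assms] by blast
  then show ?thesis unfolding fgmod_def using M.graded_right_module_axioms S fN by blast
qed

section \<open>Homogeneous bases over the field\<close>

definition cmb :: "(nat set \<Rightarrow> 'k::field, 'm) gmodule \<Rightarrow> ('i \<Rightarrow> 'm) \<Rightarrow> 'i set \<Rightarrow> ('i \<Rightarrow> 'k) \<Rightarrow> 'm" where
  "cmb M b I u = (\<Oplus>\<^bsub>M\<^esub>i\<in>I. kk (u i) \<odot>\<^bsub>M\<^esub> b i)"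

locale ext_module = graded_right_module "exterior_algebra n" M
  for n :: nat and M :: "(nat set \<Rightarrow> 'k::field, 'm) gmodule"
begin

lemma kk_smult:
  assumes x: "x \<in> carrier M"
  shows "kk c \<odot>\<^bsub>M\<^esub> x \<in> carrier M" "kk (c + d) \<odot>\<^bsub>M\<^esub> x = kk c \<odot>\<^bsub>M\<^esub> x \<oplus>\<^bsub>M\<^esub> kk d \<odot>\<^bsub>M\<^esub> x"
    "kk c \<odot>\<^bsub>M\<^esub> (kk d \<odot>\<^bsub>M\<^esub> x) = kk (c * d) \<odot>\<^bsub>M\<^esub> x" "kk 1 \<odot>\<^bsub>M\<^esub> x = x" "kk 0 \<odot>\<^bsub>M\<^esub> x = \<zero>\<^bsub>M\<^esub>"
    "kk c \<odot>\<^bsub>M\<^esub> \<zero>\<^bsub>M\<^esub> = \<zero>\<^bsub>M\<^esub>" "kk (- 1) \<odot>\<^bsub>M\<^esub> x = \<ominus>\<^bsub>M\<^esub> x"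
    "a \<in> carrier (EA n) \<Longrightarrow> a \<odot>\<^bsub>M\<^esub> (kk c \<odot>\<^bsub>M\<^esub> x) = kk c \<odot>\<^bsub>M\<^esub> (a \<odot>\<^bsub>M\<^esub> x)"
proof -
  show cl: "kk c \<odot>\<^bsub>M\<^esub> x \<in> carrier M" for c by (rule smult_closed[OF kk_carrier x])
  show add: "kk (c + d) \<odot>\<^bsub>M\<^esub> x = kk c \<odot>\<^bsub>M\<^esub> x \<oplus>\<^bsub>M\<^esub> kk d \<odot>\<^bsub>M\<^esub> x" for c d
    unfolding kk_simps(1)[of c d n] by (rule smult_l_distr[OF kk_carrier kk_carrier x])
  have "kk d \<otimes>\<^bsub>EA n\<^esub> kk c = (kk (c * d) :: nat set \<Rightarrow> 'k)"
    unfolding kk_mult(1)[OF kk_carrier] by (auto simp: kk_def)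
  then show "kk c \<odot>\<^bsub>M\<^esub> (kk d \<odot>\<^bsub>M\<^esub> x) = kk (c * d) \<odot>\<^bsub>M\<^esub> x"
    using smult_assoc[OF kk_carrier kk_carrier x, of d c] by simp
  show one: "kk 1 \<odot>\<^bsub>M\<^esub> x = x" unfolding kk_simps(2)[of n] by (rule smult_one[OF x])
  have "kk 0 \<odot>\<^bsub>M\<^esub> x = kk 0 \<odot>\<^bsub>M\<^esub> x \<oplus>\<^bsub>M\<^esub> kk 0 \<odot>\<^bsub>M\<^esub> x" using add[of 0 0] by simp
  then show zero: "kk 0 \<odot>\<^bsub>M\<^esub> x = \<zero>\<^bsub>M\<^esub>" by (metis M.add.l_cancel_one cl)
  have z: "kk c \<odot>\<^bsub>M\<^esub> \<zero>\<^bsub>M\<^esub> \<in> carrier M" by (rule smult_closed[OF kk_carrier M.zero_closed])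
  have "kk c \<odot>\<^bsub>M\<^esub> \<zero>\<^bsub>M\<^esub> = kk c \<odot>\<^bsub>M\<^esub> \<zero>\<^bsub>M\<^esub> \<oplus>\<^bsub>M\<^esub> kk c \<odot>\<^bsub>M\<^esub> \<zero>\<^bsub>M\<^esub>"
    using smult_r_distr[OF kk_carrier M.zero_closed M.zero_closed, of c] by simp
  then show "kk c \<odot>\<^bsub>M\<^esub> \<zero>\<^bsub>M\<^esub> = \<zero>\<^bsub>M\<^esub>" by (metis M.add.l_cancel_one z)
  have "kk (- 1) \<odot>\<^bsub>M\<^esub> x \<oplus>\<^bsub>M\<^esub> x = \<zero>\<^bsub>M\<^esub>" using add[of "- 1" 1] one zero by simp
  then show "kk (- 1) \<odot>\<^bsub>M\<^esub> x = \<ominus>\<^bsub>M\<^esub> x" using M.minus_equality[OF _ x cl] by simp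
  assume a: "a \<in> carrier (EA n)"
  show "a \<odot>\<^bsub>M\<^esub> (kk c \<odot>\<^bsub>M\<^esub> x) = kk c \<odot>\<^bsub>M\<^esub> (a \<odot>\<^bsub>M\<^esub> x)"
    using smult_assoc[OF kk_carrier a x, of c] smult_assoc[OF a kk_carrier x, of c] kk_mult[OF a, of c] by simp
qed

lemma smult_zero: "a \<in> carrier (EA n) \<Longrightarrow> a \<odot>\<^bsub>M\<^esub> \<zero>\<^bsub>M\<^esub> = \<zero>\<^bsub>M\<^esub>"
  using kk_smult(8)[OF M.zero_closed, of a 0] kk_smult(5,6)[OF M.zero_closed] kk_smult(5)[OF smult_closed, OF _ M.zero_closed, of a]
  by simp

lemma smult_finsum:
  assumes "a \<in> carrier (EA n)" "finite I" "\<And>i. i \<in> I \<Longrightarrow> f i \<in> carrier M"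
  shows "a \<odot>\<^bsub>M\<^esub> (\<Oplus>\<^bsub>M\<^esub>i\<in>I. f i) = (\<Oplus>\<^bsub>M\<^esub>i\<in>I. a \<odot>\<^bsub>M\<^esub> f i)"
  using assms(2,3)
proof (induction I rule: finite_induct)
  case empty
  then show ?case by (simp add: smult_zero[OF assms(1)])
next
  case (insert j I)
  have f: "f j \<in> carrier M" "f \<in> I \<rightarrow> carrier M" "a \<odot>\<^bsub>M\<^esub> f j \<in> carrier M" "(\<lambda>i. a \<odot>\<^bsub>M\<^esub> f i) \<in> I \<rightarrow> carrier M"
    using insert.prems smult_closed[OF assms(1)] by auto
  show ?case
    unfolding M.finsum_insert[OF insert(1,2) f(2,1)] M.finsum_insert[OF insert(1,2) f(4,3)]
      smult_r_distr[OF assms(1) f(1) M.finsum_closed[OF f(2)]]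
    using insert by simp
qed

lemma comp: "x \<in> mcomp M i \<Longrightarrow> x \<in> carrier M" "x \<in> mcomp M i \<Longrightarrow> y \<in> mcomp M i \<Longrightarrow> x \<oplus>\<^bsub>M\<^esub> y \<in> mcomp M i"
  "\<zero>\<^bsub>M\<^esub> \<in> mcomp M i" "x \<in> mcomp M i \<Longrightarrow> kk c \<odot>\<^bsub>M\<^esub> x \<in> mcomp M i"
proof -
  have s: "subgroup (mcomp M i) (add_monoid M)" using module_grading by (simp add: internal_grading_def)
  show "x \<in> mcomp M i \<Longrightarrow> x \<in> carrier M" using subgroup.mem_carrier[OF s] by simp
  show "x \<in> mcomp M i \<Longrightarrow> y \<in> mcomp M i \<Longrightarrow> x \<oplus>\<^bsub>M\<^esub> y \<in> mcomp M i" using subgroup.m_closed[OF s] by simp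
  show "\<zero>\<^bsub>M\<^esub> \<in> mcomp M i" using subgroup.one_closed[OF s] by simp
  show "x \<in> mcomp M i \<Longrightarrow> kk c \<odot>\<^bsub>M\<^esub> x \<in> mcomp M i" using smult_comp[OF kk_rcomp, of x i] by simp
qed

lemma homogeneous_parts:
  assumes "x \<in> carrier M"
  obtains f T where "finite T" "\<And>i. f i \<in> mcomp M i" "x = (\<Oplus>\<^bsub>M\<^esub>i\<in>T. f i)"
proof -
  have "\<exists>f. (\<forall>i. f i \<in> mcomp M i) \<and> finite {i. f i \<noteq> \<zero>\<^bsub>M\<^esub>} \<and> x = (\<Oplus>\<^bsub>M\<^esub>i\<in>{i. f i \<noteq> \<zero>\<^bsub>M\<^esub>}. f i)"
    using module_grading assms unfolding internal_grading_def by (meson ex1_implies_ex)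
  then show thesis using that by blast
qed

lemma grading_unique:
  assumes T: "finite T" and g: "\<And>i. i \<in> T \<Longrightarrow> g i \<in> mcomp M i" and h: "\<And>i. i \<in> T \<Longrightarrow> h i \<in> mcomp M i"
    and e: "(\<Oplus>\<^bsub>M\<^esub>i\<in>T. g i) = (\<Oplus>\<^bsub>M\<^esub>i\<in>T. h i)" and i: "i \<in> T"
  shows "g i = h i"
proof -
  define ext where "ext f i = (if i \<in> T then f i else \<zero>\<^bsub>M\<^esub>)" for f i
  have *: "(\<forall>i. ext f i \<in> mcomp M i) \<and> finite {i. ext f i \<noteq> \<zero>\<^bsub>M\<^esub>} \<and>
      (\<Oplus>\<^bsub>M\<^esub>i\<in>T. f i) = (\<Oplus>\<^bsub>M\<^esub>i\<in>{i. ext f i \<noteq> \<zero>\<^bsub>M\<^esub>}. ext f i)" if f: "\<And>i. i \<in> T \<Longrightarrow> f i \<in> mcomp M i" for f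
  proof (intro conjI)
    show "\<forall>i. ext f i \<in> mcomp M i" using f comp(3) by (auto simp: ext_def)
    have s: "{i. ext f i \<noteq> \<zero>\<^bsub>M\<^esub>} \<subseteq> T" by (auto simp: ext_def)
    show "finite {i. ext f i \<noteq> \<zero>\<^bsub>M\<^esub>}" by (rule finite_subset[OF s T])
    show "(\<Oplus>\<^bsub>M\<^esub>i\<in>T. f i) = (\<Oplus>\<^bsub>M\<^esub>i\<in>{i. ext f i \<noteq> \<zero>\<^bsub>M\<^esub>}. ext f i)"
      by (rule M.add.finprod_mono_neutral_cong_left[OF T s, symmetric]) (use f comp(1) in \<open>auto simp: ext_def split: if_splits\<close>)
  qed
  have "(\<Oplus>\<^bsub>M\<^esub>i\<in>T. g i) \<in> carrier M" by (rule M.finsum_closed) (use g comp(1) in auto)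
  then have "\<exists>!f. (\<forall>i. f i \<in> mcomp M i) \<and> finite {i. f i \<noteq> \<zero>\<^bsub>M\<^esub>} \<and> (\<Oplus>\<^bsub>M\<^esub>i\<in>T. g i) = (\<Oplus>\<^bsub>M\<^esub>i\<in>{i. f i \<noteq> \<zero>\<^bsub>M\<^esub>}. f i)"
    using module_grading unfolding internal_grading_def by blast
  then have "ext g = ext h" using *[OF g] *[OF h] unfolding e by blast
  then have "ext g i = ext h i" by simp
  then show ?thesis using i by (simp add: ext_def)
qed

lemma cmb_closed: "b \<in> I \<rightarrow> carrier M \<Longrightarrow> cmb M b I u \<in> carrier M"
  unfolding cmb_def by (rule M.finsum_closed) (auto intro: kk_smult(1))

lemma cmb_insert:
  "finite I \<Longrightarrow> j \<notin> I \<Longrightarrow> b \<in> insert j I \<rightarrow> carrier M \<Longrightarrow> cmb M b (insert j I) u = kk (u j) \<odot>\<^bsub>M\<^esub> b j \<oplus>\<^bsub>M\<^esub> cmb M b I u"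
  unfolding cmb_def by (rule M.finsum_insert) (auto intro: kk_smult(1))

lemma cmb_cong: "b \<in> I \<rightarrow> carrier M \<Longrightarrow> (\<And>i. i \<in> I \<Longrightarrow> u i = v i) \<Longrightarrow> cmb M b I u = cmb M b I v"
  unfolding cmb_def by (rule M.finsum_cong') (auto intro: kk_smult(1))

lemma cmb_add: "b \<in> I \<rightarrow> carrier M \<Longrightarrow> cmb M b I (\<lambda>i. u i + v i) = cmb M b I u \<oplus>\<^bsub>M\<^esub> cmb M b I v"
proof -
  assume b: "b \<in> I \<rightarrow> carrier M"
  have "cmb M b I (\<lambda>i. u i + v i) = (\<Oplus>\<^bsub>M\<^esub>i\<in>I. kk (u i) \<odot>\<^bsub>M\<^esub> b i \<oplus>\<^bsub>M\<^esub> kk (v i) \<odot>\<^bsub>M\<^esub> b i)"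
    unfolding cmb_def by (rule M.finsum_cong') (use b in \<open>auto simp: Pi_iff kk_smult(1,2)\<close>)
  also have "\<dots> = cmb M b I u \<oplus>\<^bsub>M\<^esub> cmb M b I v"
    unfolding cmb_def by (rule M.finsum_addf) (use b kk_smult(1) in auto)
  finally show ?thesis .
qed

lemma cmb_scale:
  assumes "finite I" "b \<in> I \<rightarrow> carrier M"
  shows "kk c \<odot>\<^bsub>M\<^esub> cmb M b I u = cmb M b I (\<lambda>i. c * u i)"
proof -
  have "kk c \<odot>\<^bsub>M\<^esub> cmb M b I u = (\<Oplus>\<^bsub>M\<^esub>i\<in>I. kk c \<odot>\<^bsub>M\<^esub> (kk (u i) \<odot>\<^bsub>M\<^esub> b i))"
    unfolding cmb_def by (rule smult_finsum[OF kk_carrier assms(1)]) (use assms(2) kk_smult(1) in auto)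
  also have "\<dots> = cmb M b I (\<lambda>i. c * u i)"
    unfolding cmb_def by (rule M.finsum_cong') (use assms in \<open>auto simp: Pi_iff kk_smult(1,3)\<close>)
  finally show ?thesis .
qed

lemma cmb_zero: "b \<in> I \<rightarrow> carrier M \<Longrightarrow> (\<And>i. i \<in> I \<Longrightarrow> u i = 0) \<Longrightarrow> cmb M b I u = \<zero>\<^bsub>M\<^esub>"
  unfolding cmb_def by (rule M.add.finprod_one_eqI) (use kk_smult(5) in auto)

lemma cmb_single:
  assumes "finite I" "b \<in> I \<rightarrow> carrier M" "j \<in> I"
  shows "cmb M b I (\<lambda>i. if i = j then c else 0) = kk c \<odot>\<^bsub>M\<^esub> b j"
proof -
  have bj: "b j \<in> carrier M" using assms by auto
  have "cmb M b (insert j (I - {j})) (\<lambda>i. if i = j then c else 0) =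
      kk c \<odot>\<^bsub>M\<^esub> b j \<oplus>\<^bsub>M\<^esub> cmb M b (I - {j}) (\<lambda>i. if i = j then c else 0)"
    using assms by (subst cmb_insert) auto
  also have "cmb M b (I - {j}) (\<lambda>i. if i = j then c else 0) = \<zero>\<^bsub>M\<^esub>" by (rule cmb_zero) (use assms in auto)
  finally show ?thesis using assms(3) kk_smult(1)[OF bj] by (simp add: insert_absorb)
qed

lemma cmb_comp:
  assumes "finite I" "b \<in> I \<rightarrow> carrier M" "\<And>i. i \<in> I \<Longrightarrow> u i \<noteq> 0 \<Longrightarrow> b i \<in> mcomp M d"
  shows "cmb M b I u \<in> mcomp M d"
  using assms
proof (induction I rule: finite_induct)
  case empty
  then show ?case by (simp add: cmb_def comp(3))
next
  case (insert j I)
  have "kk (u j) \<odot>\<^bsub>M\<^esub> b j \<in> mcomp M d"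
    using insert.prems comp(3,4) kk_smult(5)[of "b j"] by (cases "u j = 0") auto
  then show ?case unfolding cmb_insert[OF insert(1,2) insert.prems(1)] using insert by (intro comp(2)) auto
qed

text \<open>The columns of the action matrices are the coordinates of the products of basis vectors
  with the variables; the relations of the algebra pass to the matrices because coordinates are
  unique.\<close>

lemma rep_of_basis:
  assumes I: "finite I" and b: "\<And>j. j \<in> I \<Longrightarrow> b j \<in> mcomp M (d j)"
    and span: "\<And>x. x \<in> carrier M \<Longrightarrow> \<exists>u. x = cmb M b I u"
    and indep: "\<And>u i. cmb M b I u = \<zero>\<^bsub>M\<^esub> \<Longrightarrow> i \<in> I \<Longrightarrow> u i = 0"
  obtains A where "rep n M \<lparr>ix = I, dg = d, ac = A\<rparr> (cmb M b I)"
proof -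
  define V where "V = {u :: nat \<Rightarrow> 'k. \<forall>j. j \<notin> I \<longrightarrow> u j = 0}"
  have bc: "b \<in> I \<rightarrow> carrier M" using b comp(1) by auto
  let ?S = "cmb M b I"
  have inj: "u = v" if "u \<in> V" "v \<in> V" "?S u = ?S v" for u v
  proof -
    have "?S (\<lambda>i. u i + - 1 * v i) = ?S u \<oplus>\<^bsub>M\<^esub> \<ominus>\<^bsub>M\<^esub> ?S v"
      unfolding cmb_add[OF bc] cmb_scale[OF I bc, symmetric] kk_smult(7)[OF cmb_closed[OF bc]] ..
    also have "\<dots> = \<zero>\<^bsub>M\<^esub>" using that(3) M.r_neg[OF cmb_closed[OF bc]] by simp
    finally have "u i + - 1 * v i = 0" if "i \<in> I" for i using indep[OF _ that] by blast
    then have "u i = v i" for i using that(1,2) by (cases "i \<in> I") (auto simp: V_def)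
    then show ?thesis by (rule ext)
  qed
  have sur: "\<exists>u\<in>V. x = ?S u" if x: "x \<in> carrier M" for x
  proof -
    obtain u where u: "x = ?S u" using span[OF x] by blast
    have "?S u = ?S (\<lambda>i. if i \<in> I then u i else 0)" by (rule cmb_cong[OF bc]) simp
    then show ?thesis using u by (intro bexI[of _ "\<lambda>i. if i \<in> I then u i else 0"]) (auto simp: V_def)
  qed
  \<comment> \<open>Coordinates of a homogeneous element are supported in its own degree: group the
    combination by degree and compare with the element itself as a one-term decomposition.\<close>
  have hom: "u j = 0" if u: "u \<in> V" and c: "?S u \<in> mcomp M i" and j: "d j \<noteq> i" for u i j
  proof -
    define p where "p T j = (if d j \<in> T then u j else 0)" for T j
    have pc: "?S (p {k}) \<in> mcomp M k" for k by (rule cmb_comp[OF I bc]) (use b in \<open>auto simp: p_def split: if_splits\<close>)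
    have parts: "?S (p T) = (\<Oplus>\<^bsub>M\<^esub>k\<in>T. ?S (p {k}))" if "finite T" for T
      using that
    proof (induction T rule: finite_induct)
      case empty
      have "?S (p {}) = \<zero>\<^bsub>M\<^esub>" by (rule cmb_zero[OF bc]) (simp add: p_def)
      then show ?case by simp
    next
      case (insert k T)
      have "p (insert k T) = (\<lambda>i. p {k} i + p T i)" using insert(2) by (auto simp: p_def)
      then have "?S (p (insert k T)) = ?S (p {k}) \<oplus>\<^bsub>M\<^esub> ?S (p T)" by (simp only: cmb_add[OF bc])
      moreover have "(\<Oplus>\<^bsub>M\<^esub>k\<in>insert k T. ?S (p {k})) = ?S (p {k}) \<oplus>\<^bsub>M\<^esub> (\<Oplus>\<^bsub>M\<^esub>k\<in>T. ?S (p {k}))"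
        by (rule M.finsum_insert[OF insert(1,2)]) (use pc comp(1) in auto)
      ultimately show ?case using insert.IH by (simp only:)
    qed
    let ?T = "insert i (d ` I)"
    have fT: "finite ?T" using I by simp
    have "?S u = ?S (p ?T)" by (rule cmb_cong[OF bc]) (simp add: p_def)
    moreover have "(\<Oplus>\<^bsub>M\<^esub>k\<in>?T. if i = k then ?S u else \<zero>\<^bsub>M\<^esub>) = ?S u"
      by (rule M.finsum_singleton) (use fT cmb_closed[OF bc] in auto)
    ultimately have "(\<Oplus>\<^bsub>M\<^esub>k\<in>?T. ?S (p {k})) = (\<Oplus>\<^bsub>M\<^esub>k\<in>?T. if i = k then ?S u else \<zero>\<^bsub>M\<^esub>)"
      using parts[OF fT] by simp
    moreover have "(if i = k then ?S u else \<zero>\<^bsub>M\<^esub>) \<in> mcomp M k" for k using c comp(3) by (cases "i = k") auto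
    ultimately have "?S (p {i}) = (if i = i then ?S u else \<zero>\<^bsub>M\<^esub>)" by (intro grading_unique[OF fT pc, of "\<lambda>k. if i = k then ?S u else \<zero>\<^bsub>M\<^esub>"]) auto
    then have "?S (p {i}) = ?S u" by simp
    moreover have "p {i} \<in> V" using u by (auto simp: p_def V_def)
    ultimately have "p {i} = u" using inj u by blast
    then show ?thesis using j by (metis p_def singletonD)
  qed
  define c where "c a j = (SOME u. u \<in> V \<and> indeterminate a \<odot>\<^bsub>M\<^esub> b j = ?S u)" for a j
  have c: "c a j \<in> V \<and> indeterminate a \<odot>\<^bsub>M\<^esub> b j = ?S (c a j)" if "a \<le> n" "j \<in> I" for a j
  proof -
    have "indeterminate a \<odot>\<^bsub>M\<^esub> b j \<in> carrier M" using indet_carrier[OF that(1)] bc that(2) by (auto intro: smult_closed)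
    then have "\<exists>u. u \<in> V \<and> indeterminate a \<odot>\<^bsub>M\<^esub> b j = ?S u" using sur by blast
    then show ?thesis unfolding c_def by (rule someI_ex)
  qed
  have cd: "d i = d j + 1" if "a \<le> n" "j \<in> I" "c a j i \<noteq> 0" for a j i
  proof (rule ccontr)
    assume "d i \<noteq> d j + 1"
    moreover have "?S (c a j) \<in> mcomp M (d j + 1)"
      using smult_comp[OF exterior_indeterminates(1)[OF that(1,1)] b[OF that(2)]] c[OF that(1,2)] by simp
    ultimately show False using hom[of "c a j"] c[OF that(1,2)] that(3) by blast
  qed
  define A where "A a = mtx (\<lambda>i j. if j \<in> I \<and> a \<le> n then c a j i else 0)" for a
  have eA: "ent (A a) i j = (if j \<in> I \<and> a \<le> n then c a j i else 0)" for a i j unfolding A_def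
  proof (subst ent_mtx)
    show "finite {j. (if j \<in> I \<and> a \<le> n then c a j i else 0) \<noteq> 0}" for i by (rule finite_subset[OF _ I]) auto
    show "finite {i. (if j \<in> I \<and> a \<le> n then c a j i else 0) \<noteq> 0}" for j
      by (rule finite_subset[OF _ I]) (use c in \<open>auto simp: V_def\<close>)
  qed simp
  define N where "N = \<lparr>ix = I, dg = d, ac = A\<rparr>"
  have N: "ix N = I" "dg N = d" "ac N = A" by (simp_all add: N_def)
  have VN: "vec N = V" by (simp add: vec_def V_def N)
  have dA: "dhom 1 N N (A a)" for a unfolding dhom_def eA N using c cd by (auto simp: V_def split: if_splits)
  have bvS: "?S (bv j) = b j" if "j \<in> I" for j
    using cmb_single[OF I bc that, of 1] kk_smult(4)[of "b j"] bc that by (auto simp: bv_def)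
  have act: "indeterminate a \<odot>\<^bsub>M\<^esub> ?S u = ?S (mv (A a) u)" if a: "a \<le> n" and u: "u \<in> vec N" for a u
    using I[folded N(1)] u
  proof (induction u rule: vec_induct)
    case zero
    show ?case using cmb_zero[OF bc, of "\<lambda>_. 0"] by (simp add: smult_zero[OF indet_carrier[OF a]])
  next
    case (step u e j)
    then have j: "j \<in> I" by (simp add: N)
    note ia = indet_carrier[OF a]
    note cl = cmb_closed[OF bc]
    have "indeterminate a \<odot>\<^bsub>M\<^esub> ?S (\<lambda>i. u i + e * bv j i) = indeterminate a \<odot>\<^bsub>M\<^esub> ?S u \<oplus>\<^bsub>M\<^esub> kk e \<odot>\<^bsub>M\<^esub> (indeterminate a \<odot>\<^bsub>M\<^esub> ?S (bv j))"
      unfolding cmb_add[OF bc] cmb_scale[OF I bc, symmetric] smult_r_distr[OF ia cl kk_smult(1)[OF cl]] kk_smult(8)[OF cl ia] ..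
    also have "indeterminate a \<odot>\<^bsub>M\<^esub> ?S u = ?S (mv (A a) u)" by (rule step(3))
    also have "indeterminate a \<odot>\<^bsub>M\<^esub> ?S (bv j) = ?S (mv (A a) (bv j))"
      using c[OF a j] j a by (simp add: bvS mv_bv eA)
    also have "?S (mv (A a) u) \<oplus>\<^bsub>M\<^esub> kk e \<odot>\<^bsub>M\<^esub> ?S (mv (A a) (bv j)) = ?S (mv (A a) (\<lambda>i. u i + e * bv j i))"
      unfolding mv_add mv_cmult cmb_add[OF bc] cmb_scale[OF I bc] ..
    finally show ?case .
  qed
  have mN: "mmod n N" unfolding mmod_def
  proof (intro conjI allI impI)
    show "finite (ix N)" using I by (simp add: N)
  next
    fix a show "dhom 1 N N (ac N a)" by (simp add: N(3) dA)
  next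
    have sum: "?S (mv (A a) (mv (A a') u)) = (indeterminate a' \<otimes>\<^bsub>EA n\<^esub> indeterminate a) \<odot>\<^bsub>M\<^esub> ?S u"
      if "a \<le> n" "a' \<le> n" "u \<in> vec N" for a a' u
      unfolding smult_assoc[OF indet_carrier indet_carrier cmb_closed[OF bc], OF that(2,1)]
        act[OF that(2,3)] act[OF that(1) mv_vec[OF dA]] ..
    have z: "v = (\<lambda>_. 0)" if "v \<in> vec N" "?S v = \<zero>\<^bsub>M\<^esub>" for v
      using inj[of v "\<lambda>_. 0"] that VN vec_closed(3)[of N] cmb_zero[OF bc, of "\<lambda>_. 0"] by simp
    have z0: "\<zero>\<^bsub>EA n\<^esub> \<odot>\<^bsub>M\<^esub> x = \<zero>\<^bsub>M\<^esub>" if "x \<in> carrier M" for x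
      using kk_smult(5)[OF that] unfolding kk_simps(3)[of n] .
    fix a assume a: "a \<le> n"
    show "ac N a * ac N a = 0" unfolding N(3)
    proof (rule mv_eqI)
      show "dhom 2 N N (A a * A a)" by (rule dhom_mult[OF dA dA]) simp
      show "dhom 2 N N 0" by simp
      fix u assume u: "u \<in> vec N"
      have "?S (mv (A a * A a) u) = \<zero>\<^bsub>M\<^esub>"
        unfolding mv_mult sum[OF a a u] exterior_indeterminates(2)[OF a a] by (rule z0[OF cmb_closed[OF bc]])
      then show "mv (A a * A a) u = mv 0 u" using z[OF mv_vec[OF dhom_mult[OF dA dA refl]]] by simp
    qed
    fix a' assume a': "a' \<le> n"
    show "ac N a * ac N a' + ac N a' * ac N a = 0" unfolding N(3)
    proof (rule mv_eqI)
      have d2: "dhom 2 N N (A a * A a')" for a a' by (rule dhom_mult[OF dA dA]) simp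
      show "dhom 2 N N (A a * A a' + A a' * A a)" "dhom 2 N N 0" by (intro d2 dhom_add dhom_0)+
      fix u assume u: "u \<in> vec N"
      note ia = indet_carrier[OF a] indet_carrier[OF a']
      have "?S (mv (A a * A a' + A a' * A a) u) = (indeterminate a' \<otimes>\<^bsub>EA n\<^esub> indeterminate a \<oplus>\<^bsub>EA n\<^esub> indeterminate a \<otimes>\<^bsub>EA n\<^esub> indeterminate a') \<odot>\<^bsub>M\<^esub> ?S u"
        unfolding mv_add_left cmb_add[OF bc] mv_mult sum[OF a a' u] sum[OF a' a u]
        by (rule smult_l_distr[OF R.m_closed R.m_closed cmb_closed[OF bc], OF ia(2,1,1,2), symmetric])
      also have "\<dots> = \<zero>\<^bsub>M\<^esub>"
        unfolding exterior_indeterminates(3)[OF a' a] R.l_neg[OF R.m_closed[OF ia]] by (rule z0[OF cmb_closed[OF bc]])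
      finally have "mv (A a * A a' + A a' * A a) u = (\<lambda>_. 0)"
        by (rule z[OF mv_vec[OF dhom_add[OF d2 d2]]])
      then show "mv (A a * A a' + A a' * A a) u = mv 0 u" by simp
    qed
  qed
  have "rep n M N ?S" unfolding rep_def
  proof (intro conjI allI ballI impI)
    show "graded_right_module (EA n) M" by (rule graded_right_module_axioms)
    show "mmod n N" by (rule mN)
    show "bij_betw ?S (vec N) (carrier M)" unfolding bij_betw_def inj_on_def VN using inj sur cmb_closed[OF bc] by blast
    show "?S (\<lambda>i. u i + v i) = ?S u \<oplus>\<^bsub>M\<^esub> ?S v" for u v by (rule cmb_add[OF bc])
    show "kk e \<odot>\<^bsub>M\<^esub> ?S u = ?S (\<lambda>i. e * u i)" for e u by (rule cmb_scale[OF I bc])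
    show "indeterminate a \<odot>\<^bsub>M\<^esub> ?S u = ?S (mv (ac N a) u)" if "a \<le> n" "u \<in> vec N" for a u
      using act[OF that] by (simp add: N)
    show "?S ` vecd N i = mcomp M i" for i
    proof
      show "?S ` vecd N i \<subseteq> mcomp M i"
      proof
        fix x assume "x \<in> ?S ` vecd N i"
        then obtain u where u: "u \<in> vecd N i" "x = ?S u" by blast
        show "x \<in> mcomp M i" unfolding u(2)
          by (rule cmb_comp[OF I bc]) (use u(1) b in \<open>auto simp: vecd_def N\<close>)
      qed
      show "mcomp M i \<subseteq> ?S ` vecd N i"
      proof
        fix x assume x: "x \<in> mcomp M i"
        obtain u where u: "u \<in> V" "x = ?S u" using sur[OF comp(1)[OF x]] by blast
        have "u \<in> vecd N i" using hom[OF u(1), of i] x u by (auto simp: vecd_def N V_def)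
        then show "x \<in> ?S ` vecd N i" using u(2) by blast
      qed
    qed
  qed
  then show thesis using that unfolding N_def by blast
qed

text \<open>Bases arise indexed by elements or by pairs, whereas matrices are indexed by natural
  numbers; h is the renumbering.\<close>

lemma rep_of_family:
  assumes I: "finite I" and b: "\<And>i. i \<in> I \<Longrightarrow> b i \<in> mcomp M (d i)"
    and span: "\<And>x. x \<in> carrier M \<Longrightarrow> \<exists>u. x = cmb M b I u"
    and indep: "\<And>u i. cmb M b I u = \<zero>\<^bsub>M\<^esub> \<Longrightarrow> i \<in> I \<Longrightarrow> u i = 0"
  obtains N h where "bij_betw h {..<card I} I" "ix N = {..<card I}" "\<And>j. dg N j = d (h j)"
    "rep n M N (cmb M (\<lambda>j. b (h j)) {..<card I})"
proof -
  obtain h where h: "bij_betw h {..<card I} I" using ex_bij_betw_nat_finite[OF I] by (auto simp: atLeast0LessThan)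
  define g where "g = the_inv_into {..<card I} h"
  have hg: "g i \<in> {..<card I}" "h (g i) = i" if "i \<in> I" for i
    unfolding g_def using bij_betwE[OF bij_betw_the_inv_into[OF h]] f_the_inv_into_f_bij_betw[OF h] that by auto
  have gh: "g (h j) = j" "h j \<in> I" if "j < card I" for j
    unfolding g_def using the_inv_into_f_f[OF bij_betw_imp_inj_on[OF h], of j] bij_betwE[OF h] that by auto
  have bc: "b \<in> I \<rightarrow> carrier M" using b comp(1) by auto
  have re: "cmb M (\<lambda>j. b (h j)) {..<card I} (\<lambda>j. u (h j)) = cmb M b I u" for u
  proof -
    have "(\<Oplus>\<^bsub>M\<^esub>i\<in>h ` {..<card I}. kk (u i) \<odot>\<^bsub>M\<^esub> b i) = (\<Oplus>\<^bsub>M\<^esub>j\<in>{..<card I}. kk (u (h j)) \<odot>\<^bsub>M\<^esub> b (h j))"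
      by (rule M.finsum_reindex) (use bc kk_smult(1) h in \<open>auto simp: bij_betw_def\<close>)
    then show ?thesis using h by (simp add: cmb_def bij_betw_def)
  qed
  obtain A where A: "rep n M \<lparr>ix = {..<card I}, dg = \<lambda>j. d (h j), ac = A\<rparr> (cmb M (\<lambda>j. b (h j)) {..<card I})"
  proof (rule rep_of_basis)
    show "finite {..<card I}" by simp
    show "b (h j) \<in> mcomp M (d (h j))" if "j \<in> {..<card I}" for j using b gh(2) that by simp
    show "\<exists>u. x = cmb M (\<lambda>j. b (h j)) {..<card I} u" if x: "x \<in> carrier M" for x
    proof -
      obtain u where u: "x = cmb M b I u" using span[OF x] by blast
      show ?thesis unfolding u re[symmetric] by (rule exI) (rule refl)
    qed
    fix u i assume e: "cmb M (\<lambda>j. b (h j)) {..<card I} u = \<zero>\<^bsub>M\<^esub>" and i: "i \<in> {..<card I}"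
    have "cmb M (\<lambda>j. b (h j)) {..<card I} u = cmb M (\<lambda>j. b (h j)) {..<card I} (\<lambda>j. u (g (h j)))"
      by (rule cmb_cong) (use bc gh in auto)
    then have "cmb M b I (\<lambda>i. u (g i)) = \<zero>\<^bsub>M\<^esub>" using e re[of "\<lambda>i. u (g i)"] by simp
    then have "u (g (h i)) = 0" using indep gh(2) i by blast
    then show "u i = 0" using gh(1) i by simp
  qed blast
  show thesis by (rule that[OF h _ _ A]) simp_all
qed

lemma mono_expand:
  assumes "finite F" "F \<subseteq> Pow {..n}" "x \<in> carrier M"
  shows "(\<lambda>S. if S \<in> F then a S else 0) \<odot>\<^bsub>M\<^esub> x = cmb M (\<lambda>S. xmono S \<odot>\<^bsub>M\<^esub> x) F a"
  using assms(1,2)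
proof (induction F rule: finite_induct)
  case empty
  have "(\<lambda>S. if S \<in> {} then a S else 0) = kk 0" by (auto simp: kk_def)
  then show ?case using kk_smult(5)[OF assms(3)] by (simp add: cmb_def)
next
  case (insert T F)
  then have T: "T \<subseteq> {..n}" and F: "F \<subseteq> Pow {..n}" by auto
  note mT = mono_carrier[OF T]
  have e: "(\<lambda>S. if S \<in> insert T F then a S else 0) =
      (xmono T \<otimes>\<^bsub>EA n\<^esub> kk (a T)) \<oplus>\<^bsub>EA n\<^esub> (\<lambda>S. if S \<in> F then a S else 0)"
    unfolding kk_mult(2)[OF mono_carrier[OF T]] using insert.hyps by (auto simp: exterior_algebra_simps xmono_def)
  have c1: "(\<lambda>S. if S \<in> F then a S else 0) \<in> carrier (EA n)" using F by (auto simp: EA_carrier)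
  have c2: "xmono T \<otimes>\<^bsub>EA n\<^esub> kk (a T) \<in> carrier (EA n)"
    unfolding kk_mult(2)[OF mono_carrier[OF T]] using T by (auto simp: EA_carrier xmono_def)
  have "(\<lambda>S. if S \<in> insert T F then a S else 0) \<odot>\<^bsub>M\<^esub> x =
      kk (a T) \<odot>\<^bsub>M\<^esub> (xmono T \<odot>\<^bsub>M\<^esub> x) \<oplus>\<^bsub>M\<^esub> cmb M (\<lambda>S. xmono S \<odot>\<^bsub>M\<^esub> x) F a"
    unfolding e smult_l_distr[OF c2 c1 assms(3)] smult_assoc[OF mT kk_carrier assms(3)] insert.IH[OF F] ..
  also have "\<dots> = cmb M (\<lambda>S. xmono S \<odot>\<^bsub>M\<^esub> x) (insert T F) a"
  proof (rule cmb_insert[symmetric, OF insert(1,2)])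
    show "(\<lambda>S. xmono S \<odot>\<^bsub>M\<^esub> x) \<in> insert T F \<rightarrow> carrier M"
    proof
      fix S assume "S \<in> insert T F"
      then have "S \<subseteq> {..n}" using insert.prems by auto
      then show "xmono S \<odot>\<^bsub>M\<^esub> x \<in> carrier M" by (intro smult_closed mono_carrier assms(3))
    qed
  qed
  finally show ?case .
qed

lemma mono_expand': "a \<in> carrier (EA n) \<Longrightarrow> x \<in> carrier M \<Longrightarrow> a \<odot>\<^bsub>M\<^esub> x = cmb M (\<lambda>S. xmono S \<odot>\<^bsub>M\<^esub> x) (Pow {..n}) a"
proof -
  assume a: "a \<in> carrier (EA n)" and x: "x \<in> carrier M"
  have "(\<lambda>S. if S \<in> Pow {..n} then a S else 0) = a" by (rule ext) (use a in \<open>auto simp: EA_carrier\<close>)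
  then show ?thesis using mono_expand[of "Pow {..n}" x a] x by simp
qed

lemma span_subgroup:
  assumes "finite E" "E \<subseteq> carrier M"
  shows "subgroup (range (cmb M (\<lambda>e. e) E)) (add_monoid M)"
proof (rule M.add.subgroupI)
  have b: "(\<lambda>e. e) \<in> E \<rightarrow> carrier M" using assms(2) by auto
  show "range (cmb M (\<lambda>e. e) E) \<subseteq> carrier M" using cmb_closed[OF b] by blast
  show "range (cmb M (\<lambda>e. e) E) \<noteq> {}" by blast
  fix x y assume xy: "x \<in> range (cmb M (\<lambda>e. e) E)" "y \<in> range (cmb M (\<lambda>e. e) E)"
  then obtain u v where "x = cmb M (\<lambda>e. e) E u" "y = cmb M (\<lambda>e. e) E v" by blast
  then have "x \<oplus>\<^bsub>M\<^esub> y = cmb M (\<lambda>e. e) E (\<lambda>i. u i + v i)" using cmb_add[OF b] by simp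
  then show "x \<oplus>\<^bsub>M\<^esub> y \<in> range (cmb M (\<lambda>e. e) E)" by (simp only: rangeI)
  obtain u where u: "x = cmb M (\<lambda>e. e) E u" using xy by blast
  have "\<ominus>\<^bsub>M\<^esub> x = cmb M (\<lambda>e. e) E (\<lambda>i. - 1 * u i)"
    unfolding u cmb_scale[OF assms(1) b, symmetric] kk_smult(7)[OF cmb_closed[OF b]] ..
  then show "\<ominus>\<^bsub>M\<^esub> x \<in> range (cmb M (\<lambda>e. e) E)" by blast
qed

end

text \<open>The products of the homogeneous parts of finitely many generators with the monomials
  span M over the field. A homogeneous spanning set of least size is a basis, since a dependence
  relation would allow one element to be dropped.\<close>

lemma fgmod_rep:
  assumes "M \<in> fgmod (EA n)"
  obtains N B where "rep n (M :: (nat set \<Rightarrow> 'k::field, 'm) gmodule) N B"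
proof -
  interpret graded_right_module "EA n" M using assms by (simp add: fgmod_def)
  interpret ext_module n M by unfold_locales
  obtain S where S: "finite S" "S \<subseteq> carrier M" "product_span M S (carrier (EA n)) = carrier M"
    using assms by (auto simp: fgmod_def)
  have "\<forall>s\<in>S. \<exists>f T. finite T \<and> (\<forall>i. f i \<in> mcomp M i) \<and> s = (\<Oplus>\<^bsub>M\<^esub>i\<in>T. f i)"
  proof
    fix s assume "s \<in> S"
    then have "s \<in> carrier M" using S(2) by blast
    then show "\<exists>f T. finite T \<and> (\<forall>i. f i \<in> mcomp M i) \<and> s = (\<Oplus>\<^bsub>M\<^esub>i\<in>T. f i)"
      by (rule homogeneous_parts) (intro exI conjI allI)
  qed
  then obtain f T where fT: "\<And>s. s \<in> S \<Longrightarrow> finite (T s) \<and> (\<forall>i. f s i \<in> mcomp M i) \<and> s = (\<Oplus>\<^bsub>M\<^esub>i\<in>T s. f s i)"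
    unfolding bchoice_iff by blast
  define C where "C = (\<Union>s\<in>S. f s ` T s)"
  have fC: "finite C" using S(1) fT by (simp add: C_def)
  have hC: "\<exists>i. c \<in> mcomp M i" if "c \<in> C" for c using that fT by (auto simp: C_def)
  have cC: "c \<in> carrier M" if "c \<in> C" for c using hC[OF that] comp(1) by blast
  let ?E = "(\<lambda>(U, c). xmono U \<odot>\<^bsub>M\<^esub> c) ` (Pow {..n} \<times> C)"
  let ?W = "\<lambda>E. range (cmb M (\<lambda>e. e) E)"
  let ?P = "\<lambda>E. finite E \<and> (\<forall>e\<in>E. \<exists>i. e \<in> mcomp M i) \<and> carrier M \<subseteq> ?W E"
  have fE: "finite ?E" using fC by simp
  have hE: "\<exists>i. e \<in> mcomp M i" if "e \<in> ?E" for e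
  proof -
    obtain U c where U: "U \<subseteq> {..n}" "c \<in> C" "e = xmono U \<odot>\<^bsub>M\<^esub> c" using \<open>e \<in> ?E\<close> by auto
    obtain i where "c \<in> mcomp M i" using hC[OF U(2)] by blast
    moreover have "xmono U \<in> rcomp (EA n) (int (card U))" using U(1) by (auto simp: xmono_def exterior_algebra_simps)
    ultimately show ?thesis using smult_comp U(3) by blast
  qed
  have cE: "?E \<subseteq> carrier M" using hE comp(1) by blast
  note sg = span_subgroup[OF fE cE]
  have fin: "(\<Oplus>\<^bsub>M\<^esub>i\<in>I. g i) \<in> ?W ?E" if "finite I" "\<And>i. i \<in> I \<Longrightarrow> g i \<in> ?W ?E" for I :: "'i set" and g
    using that
  proof (induction I rule: finite_induct)
    case empty
    then show ?case using subgroup.one_closed[OF sg] by simp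
  next
    case (insert i I)
    have "(\<Oplus>\<^bsub>M\<^esub>i\<in>insert i I. g i) = g i \<oplus>\<^bsub>M\<^esub> (\<Oplus>\<^bsub>M\<^esub>i\<in>I. g i)"
      by (rule M.finsum_insert[OF insert(1,2)]) (use insert.prems subgroup.subset[OF sg] in auto)
    then show ?case using subgroup.m_closed[OF sg] insert by simp
  qed
  have be: "(\<lambda>e. e) \<in> ?E \<rightarrow> carrier M" using cE by auto
  have aC: "a \<odot>\<^bsub>M\<^esub> c \<in> ?W ?E" if a: "a \<in> carrier (EA n)" and c: "c \<in> C" for a c
    unfolding mono_expand'[OF a cC[OF c]] cmb_def[of M "\<lambda>S. xmono S \<odot>\<^bsub>M\<^esub> c"]
  proof (rule fin)
    show "finite (Pow {..n})" by simp
    fix U assume "U \<in> Pow {..n}"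
    then have i: "xmono U \<odot>\<^bsub>M\<^esub> c \<in> ?E" using c by auto
    show "kk (a U) \<odot>\<^bsub>M\<^esub> (xmono U \<odot>\<^bsub>M\<^esub> c) \<in> ?W ?E" unfolding cmb_single[OF fE be i, symmetric] by (rule rangeI)
  qed
  have "{a \<odot>\<^bsub>M\<^esub> x |a x. a \<in> carrier (EA n) \<and> x \<in> S} \<subseteq> ?W ?E"
  proof safe
    fix a :: "nat set \<Rightarrow> 'k" and s assume a: "a \<in> carrier (EA n)" and s: "s \<in> S"
    have "a \<odot>\<^bsub>M\<^esub> s = a \<odot>\<^bsub>M\<^esub> (\<Oplus>\<^bsub>M\<^esub>i\<in>T s. f s i)" using fT[OF s] by simp
    also have "\<dots> = (\<Oplus>\<^bsub>M\<^esub>i\<in>T s. a \<odot>\<^bsub>M\<^esub> f s i)" by (rule smult_finsum[OF a]) (use fT[OF s] comp(1) in auto)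
    also have "\<dots> \<in> ?W ?E" 
    proof (rule fin)
      show "finite (T s)" using fT[OF s] by blast
      fix i assume "i \<in> T s"
      then have "f s i \<in> C" using s by (auto simp: C_def)
      then show "a \<odot>\<^bsub>M\<^esub> f s i \<in> ?W ?E" by (rule aC[OF a])
    qed
    finally show "a \<odot>\<^bsub>M\<^esub> s \<in> ?W ?E" .
  qed
  then have "carrier M \<subseteq> ?W ?E"
    using M.add.generate_subgroup_incl[OF _ sg] S(3) unfolding product_span_def by blast
  then have ex: "?P ?E" using fE hE by blast
  define E where "E = arg_min card ?P"
  have E: "?P E" and min: "\<And>E'. ?P E' \<Longrightarrow> card E \<le> card E'"
    unfolding E_def using arg_min_nat_lemma[of ?P ?E card, OF ex] by auto
  have cE': "(\<lambda>e. e) \<in> E \<rightarrow> carrier M" using E comp(1) by blast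
  have indep: "u e = 0" if z: "cmb M (\<lambda>e. e) E u = \<zero>\<^bsub>M\<^esub>" and e: "e \<in> E" for u e
  proof (rule ccontr)
    assume nz: "u e \<noteq> 0"
    have "carrier M \<subseteq> ?W (E - {e})"
    proof
      fix x assume "x \<in> carrier M"
      then obtain v where v: "x = cmb M (\<lambda>e. e) E v" using E by blast
      let ?v = "\<lambda>i. v i + - (v e / u e) * u i"
      have "cmb M (\<lambda>e. e) E ?v = x \<oplus>\<^bsub>M\<^esub> kk (- (v e / u e)) \<odot>\<^bsub>M\<^esub> \<zero>\<^bsub>M\<^esub>"
        unfolding cmb_add[OF cE'] z[symmetric] v cmb_scale[OF conjunct1[OF E] cE'] ..
      also have "\<dots> = x" using \<open>x \<in> carrier M\<close> kk_smult(6)[OF M.zero_closed] by simp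
      finally have "x = cmb M (\<lambda>e. e) (insert e (E - {e})) ?v" using e by (simp add: insert_absorb)
      also have "\<dots> = kk (?v e) \<odot>\<^bsub>M\<^esub> e \<oplus>\<^bsub>M\<^esub> cmb M (\<lambda>e. e) (E - {e}) ?v"
        by (rule cmb_insert) (use E cE' e in auto)
      also have "\<dots> = cmb M (\<lambda>e. e) (E - {e}) ?v"
      proof -
        have "e \<in> carrier M" using e cE' by auto
        moreover have "cmb M (\<lambda>e. e) (E - {e}) ?v \<in> carrier M" by (rule cmb_closed) (use cE' in auto)
        ultimately show ?thesis using nz kk_smult(5) by simp
      qed
      finally show "x \<in> ?W (E - {e})" by blast
    qed
    then have "card E \<le> card (E - {e})" using E by (intro min) auto
    moreover have "card (E - {e}) < card E" using E e by (intro psubset_card_mono) auto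
    ultimately show False by simp
  qed
  have "\<forall>e\<in>E. \<exists>i. e \<in> mcomp M i" using E by blast
  then obtain d where d: "\<And>e. e \<in> E \<Longrightarrow> e \<in> mcomp M (d e)" unfolding bchoice_iff by blast
  have span: "\<exists>u. x = cmb M (\<lambda>e. e) E u" if "x \<in> carrier M" for x using E that by blast
  obtain N h where "rep n M N (cmb M (\<lambda>j. h j) {..<card E})"
    by (rule rep_of_family[of E "\<lambda>e. e" d]) (use E d span indep in blast)+
  then show thesis by (rule that)
qed

lemma dhom_card:
  assumes "finite (ix N)" "finite (ix N')" "dhom 0 N N' F" "G * F = idm N"
  shows "card (ix N) \<le> card (ix N')"
proof (rule ccontr)
  assume "\<not> card (ix N) \<le> card (ix N')"
  then have "card (ix N') < card (ix N)" by simp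
  from dependent_family[OF assms(2,1) this, of "\<lambda>j s. ent F s j"] obtain c j0 where
    c: "j0 \<in> ix N" "c j0 \<noteq> 0" "\<And>s. s \<in> ix N' \<Longrightarrow> (\<Sum>j\<in>ix N. c j * ent F s j) = 0" by blast
  define u where "u j = (if j \<in> ix N then c j else 0)" for j
  have u: "u \<in> vec N" by (simp add: vec_def u_def)
  have "mv F u s = 0" for s
  proof (cases "s \<in> ix N'")
    case True
    have "mv F u s = (\<Sum>j\<in>ix N. ent F s j * u j)" by (rule mv_gen[OF assms(1)]) (auto simp: u_def)
    also have "\<dots> = (\<Sum>j\<in>ix N. c j * ent F s j)" by (rule sum.cong) (auto simp: u_def mult.commute)
    finally show ?thesis using c(3)[OF True] by simp
  next
    case False
    then show ?thesis using mv_vec[OF assms(3), of u] by (simp add: vec_def)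
  qed
  then have "mv F u = (\<lambda>_. 0)" by (rule ext)
  then have "mv (idm N) u = (\<lambda>_. 0)" by (simp add: assms(4)[symmetric] mv_mult)
  then have "u = (\<lambda>_. 0)" using mv_idm[OF u] by simp
  then show False using c(1,2) by (metis u_def)
qed

lemma ghom_id: assumes "graded_right_module R M" shows "restrict (\<lambda>x. x) (carrier M) \<in> ghom R M M"
proof -
  interpret graded_right_module R M by fact
  have s: "mcomp M i \<subseteq> carrier M" for i
    using module_grading subgroup.subset[of "mcomp M i" "add_monoid M"] by (simp add: internal_grading_def)
  show ?thesis unfolding ghom_def using smult_closed s by (auto simp: subset_iff)
qed

text \<open>Besides isomorphisms this covers, for the identity of M, the comparison of two
  coordinate systems of the same module.\<close>

lemma rep_bijective_inverse:
  assumes M: "rep n M N B" and M': "rep n M' N' B'" and f: "f \<in> ghom (EA n) M M'" "bij_betw f (carrier M) (carrier M')"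
  obtains F G where "mmor n N N' F" "mmor n N' N G" "G * F = idm N" "F * G = idm N'" "cod N B B' f F"
proof -
  note N = repD(2)[OF M] and N' = repD(2)[OF M']
  obtain F where F: "mmor n N N' F" "cod N B B' f F" by (rule ghom_mat[OF M M' f(1)])
  note dF = mmorD(1)[OF F(1)]
  have eq: "f (B u) = B' (mv F u)" if "u \<in> vec N" for u using F(2) that by (simp add: cod_def)
  have ex: "\<exists>u\<in>vec N. mv F u = mv (idm N') (bv j)" if j: "j \<in> ix N'" for j
  proof -
    have v: "bv j \<in> vec N'" using bv_vecd[OF j] vecd_vec by blast
    then have "B' (bv j) \<in> f ` carrier M" using f(2) repD(8)[OF M' v] by (simp add: bij_betw_def)
    then obtain u where u: "u \<in> vec N" "B' (bv j) = f (B u)" using repD(10)[OF M] by blast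
    then have "mv F u = bv j" using eq[OF u(1)] repD(9)[OF M' v mv_vec[OF dF, of u]] by simp
    then show ?thesis using u(1) mv_idm[OF v] by auto
  qed
  obtain G where G: "dhom 0 N' N G" "idm N' = F * G"
    by (rule lift_columns[OF mmodD(1)[OF N'] dF dhom_idm mmodD(1)[OF N] ex])
  have GF: "G * F = idm N"
  proof (rule mv_eqI)
    show "dhom 0 N N (G * F)" by (rule dhom_mult[OF G(1) dF]) simp
    show "dhom 0 N N (idm N)" by (rule dhom_idm)
    fix u assume u: "u \<in> vec N"
    have Gu: "mv (G * F) u \<in> vec N" unfolding mv_mult by (rule mv_vec[OF G(1)])
    have "F * (G * F) = F" unfolding mult.assoc[symmetric] G(2)[symmetric] by (rule idm_mult_dhom[OF dF])
    then have "mv F (mv (G * F) u) = mv F u" by (simp only: mv_mult[symmetric])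
    then have "f (B (mv (G * F) u)) = f (B u)" by (simp only: eq[OF u] eq[OF Gu])
    then have "B (mv (G * F) u) = B u" using f(2) repD(8)[OF M u] repD(8)[OF M Gu] by (auto simp: bij_betw_def dest: inj_onD)
    then show "mv (G * F) u = mv (idm N) u" using repD(9)[OF M Gu u] mv_idm[OF u] by simp
  qed
  have "G * ac N' a = ac N a * G" if a: "a \<le> n" for a
  proof -
    note d' = mmodD(2)[OF N' a] and d = mmodD(2)[OF N a]
    have "G * ac N' a = G * (ac N' a * (F * G))" unfolding G(2)[symmetric] by (simp add: dhom_mult_idm[OF d'])
    also have "\<dots> = G * (F * ac N a) * G" unfolding mmorD(2)[OF F(1) a] by (simp only: mult.assoc)
    also have "\<dots> = ac N a * G" unfolding mult.assoc[symmetric] GF by (simp add: idm_mult_dhom[OF d])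
    finally show ?thesis .
  qed
  then have "mmor n N' N G" using G(1) by (simp add: mmor_def)
  then show thesis using that F GF G(2) by simp
qed

lemma rep_card_unique:
  assumes "rep n M N B" "rep n M N' B'"
  shows "card (ix N) = card (ix N')"
proof -
  have "bij_betw (restrict (\<lambda>x. x) (carrier M)) (carrier M) (carrier M)" by (auto simp: bij_betw_def inj_on_def)
  from rep_bijective_inverse[OF assms ghom_id[OF repD(1)[OF assms(1)]] this] obtain F G where
    "mmor n N N' F" "mmor n N' N G" "G * F = idm N" "F * G = idm N'" by metis
  then show ?thesis using dhom_card mmorD(1) mmodD(1)[OF repD(2)[OF assms(1)]] mmodD(1)[OF repD(2)[OF assms(2)]]
    by (intro antisym) blast+
qed

section \<open>Graded free modules\<close>

lemma mono_mult_indet: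
  assumes "S \<subseteq> {..n}" and that: "t \<le> n"
  shows "xmono S \<otimes>\<^bsub>EA n\<^esub> indeterminate t =
    (if t \<in> S then kk 0 else xmono (insert t S) \<otimes>\<^bsub>EA n\<^esub> kk (shuffle_sign S {t}) :: nat set \<Rightarrow> 'k::field)"
proof -
  have f: "finite S" using assms finite_subset by blast
  have c: "insert t S \<subseteq> {..n}" using assms that by simp
  show ?thesis
  proof (rule ext)
    fix U
    have "t \<in> U \<and> U - {t} = S \<longleftrightarrow> t \<notin> S \<and> U = insert t S" by auto
    then show "(xmono S \<otimes>\<^bsub>EA n\<^esub> indeterminate t) U =
        (if t \<in> S then kk 0 else xmono (insert t S) \<otimes>\<^bsub>EA n\<^esub> kk (shuffle_sign S {t}) :: nat set \<Rightarrow> 'k) U"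
      unfolding mult_indet kk_mult(2)[OF mono_carrier[OF c]] using f by (auto simp: xmono_def kk_def)
  qed
qed

lemma shuffle_sign_square: "shuffle_sign S T * shuffle_sign S T = (1 :: 'k::field)"
  by (simp add: shuffle_sign_def power_mult_distrib[symmetric])

lemma shuffle_sign_swap: assumes "t \<noteq> c" shows "shuffle_sign {t} {c} * shuffle_sign {c} {t} = (- 1 :: 'k::field)"
proof -
  have s: "shuffle_sign {p} {q} = (if q < p then - 1 else 1 :: 'k)" for p q
  proof -
    have "{(s, t). s \<in> {p} \<and> t \<in> {q} \<and> t < s} = (if q < p then {(p, q)} else {})" by auto
    then show ?thesis by (simp add: shuffle_sign_def)
  qed
  show ?thesis unfolding s using assms by auto
qed

lemma mv_bv_eqI:
  assumes "dhom d X Y F" "dhom e X Z G" "\<And>j. j \<in> ix X \<Longrightarrow> mv F (bv j) = mv G (bv j)"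
  shows "F = G"
proof (rule mtx_eqI)
  fix i j
  show "ent F i j = ent G i j"
    using assms(3)[of j] dhom_out[OF assms(1), of i j] dhom_out[OF assms(2), of i j]
    by (cases "j \<in> ix X") (auto simp: mv_bv fun_eq_iff)
qed

text \<open>The products of the basis elements with the monomials x_S form a basis over the field.
  Contraction with the variable c removes c from S, with the sign of moving c to the last
  place.\<close>

lemma (in ext_module) free_basis_rep:
  assumes hb: "homogeneous_basis (EA n) M Bs"
  obtains N B where "rep n M N B" "ffree n N" "card (ix N) = card Bs * 2 ^ Suc n"
proof -
  have fB: "finite Bs" and hB: "\<forall>\<beta>\<in>Bs. \<exists>i. \<beta> \<in> mcomp M i" using hb by (auto simp: homogeneous_basis_def)
  have uq: "\<exists>!r. r \<in> Bs \<rightarrow>\<^sub>E carrier (EA n) \<and> x = (\<Oplus>\<^bsub>M\<^esub>\<beta>\<in>Bs. r \<beta> \<odot>\<^bsub>M\<^esub> \<beta>)" if "x \<in> carrier M" for x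
    using hb that unfolding homogeneous_basis_def by blast
  have cB: "\<beta> \<in> carrier M" if "\<beta> \<in> Bs" for \<beta> using hB that comp(1) by blast
  obtain d where d: "\<And>\<beta>. \<beta> \<in> Bs \<Longrightarrow> \<beta> \<in> mcomp M (d \<beta>)" using hB unfolding bchoice_iff by blast
  define I where "I = Pow {..n} \<times> Bs"
  define b where "b = (\<lambda>(S, \<beta>). xmono S \<odot>\<^bsub>M\<^esub> \<beta>)"
  define \<delta> where "\<delta> = (\<lambda>(S :: nat set, \<beta>). d \<beta> + int (card S))"
  have fI: "finite I" using fB by (simp add: I_def)
  have bd: "b i \<in> mcomp M (\<delta> i)" if iI: "i \<in> I" for i
  proof -
    obtain S \<beta> where i: "i = (S, \<beta>)" "S \<subseteq> {..n}" "\<beta> \<in> Bs" using iI by (auto simp: I_def)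
    have "xmono S \<in> rcomp (EA n) (int (card S))" using i(2) by (auto simp: xmono_def exterior_algebra_simps)
    then show ?thesis using smult_comp[OF _ d[OF i(3)]] by (simp add: b_def \<delta>_def i(1))
  qed
  have bc: "b \<in> I \<rightarrow> carrier M" using bd comp(1) by auto
  define r where "r u \<beta> S = (if S \<subseteq> {..n} then u (S, \<beta>) else 0)" for u :: "nat set \<times> 'm \<Rightarrow> 'k" and \<beta> S
  have rc: "r u \<beta> \<in> carrier (EA n)" for u \<beta> by (auto simp: r_def EA_carrier)
  have double: "cmb M b (Pow {..n} \<times> D) u = (\<Oplus>\<^bsub>M\<^esub>\<beta>\<in>D. r u \<beta> \<odot>\<^bsub>M\<^esub> \<beta>)" if "D \<subseteq> Bs" for D u
  proof -
    have "finite D" using that fB finite_subset by blast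
    then show ?thesis using that
    proof (induction D rule: finite_induct)
      case empty
      then show ?case by (simp add: cmb_def)
    next
      case (insert \<beta> D)
      let ?J = "(\<lambda>S. (S, \<beta>)) ` Pow {..n}"
      have cl: "kk (u i) \<odot>\<^bsub>M\<^esub> b i \<in> carrier M" if "i \<in> Pow {..n} \<times> Bs" for i
        using bc that kk_smult(1) by (auto simp: I_def)
      have bD: "\<beta> \<in> Bs" "D \<subseteq> Bs" using insert.prems by auto
      have "Pow {..n} \<times> insert \<beta> D = ?J \<union> Pow {..n} \<times> D" by auto
      then have "cmb M b (Pow {..n} \<times> insert \<beta> D) u = (\<Oplus>\<^bsub>M\<^esub>i\<in>?J \<union> Pow {..n} \<times> D. kk (u i) \<odot>\<^bsub>M\<^esub> b i)"
        by (simp add: cmb_def)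
      also have "\<dots> = (\<Oplus>\<^bsub>M\<^esub>i\<in>?J. kk (u i) \<odot>\<^bsub>M\<^esub> b i) \<oplus>\<^bsub>M\<^esub> cmb M b (Pow {..n} \<times> D) u"
        unfolding cmb_def by (rule M.finsum_Un_disjoint) (use insert.hyps bD cl in auto)
      also have "(\<Oplus>\<^bsub>M\<^esub>i\<in>?J. kk (u i) \<odot>\<^bsub>M\<^esub> b i) = (\<Oplus>\<^bsub>M\<^esub>S\<in>Pow {..n}. kk (u (S, \<beta>)) \<odot>\<^bsub>M\<^esub> b (S, \<beta>))"
        by (rule M.finsum_reindex) (use cl bD in \<open>auto simp: inj_on_def\<close>)
      also have "\<dots> = cmb M (\<lambda>S. xmono S \<odot>\<^bsub>M\<^esub> \<beta>) (Pow {..n}) (r u \<beta>)"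
        unfolding cmb_def by (rule M.finsum_cong') (auto simp: b_def r_def intro!: kk_smult(1) smult_closed mono_carrier cB[OF bD(1)])
      also have "\<dots> = r u \<beta> \<odot>\<^bsub>M\<^esub> \<beta>" by (rule mono_expand'[OF rc cB[OF bD(1)], symmetric])
      also have "cmb M b (Pow {..n} \<times> D) u = (\<Oplus>\<^bsub>M\<^esub>\<beta>\<in>D. r u \<beta> \<odot>\<^bsub>M\<^esub> \<beta>)" by (rule insert.IH[OF bD(2)])
      also have "r u \<beta> \<odot>\<^bsub>M\<^esub> \<beta> \<oplus>\<^bsub>M\<^esub> (\<Oplus>\<^bsub>M\<^esub>\<beta>\<in>D. r u \<beta> \<odot>\<^bsub>M\<^esub> \<beta>) = (\<Oplus>\<^bsub>M\<^esub>\<beta>\<in>insert \<beta> D. r u \<beta> \<odot>\<^bsub>M\<^esub> \<beta>)"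
        by (rule M.finsum_insert[symmetric, OF insert(1,2)]) (use bD cB rc smult_closed in auto)
      finally show ?case .
    qed
  qed
  note dbl = double[OF order.refl, folded I_def]
  have span: "\<exists>u. x = cmb M b I u" if x: "x \<in> carrier M" for x
  proof -
    obtain \<rho> where \<rho>: "\<rho> \<in> Bs \<rightarrow>\<^sub>E carrier (EA n)" "x = (\<Oplus>\<^bsub>M\<^esub>\<beta>\<in>Bs. \<rho> \<beta> \<odot>\<^bsub>M\<^esub> \<beta>)" using uq[OF x] by blast
    have "r (\<lambda>(S, \<beta>). \<rho> \<beta> S) \<beta> = \<rho> \<beta>" if "\<beta> \<in> Bs" for \<beta>
    proof
      fix S
      have "\<rho> \<beta> \<in> carrier (EA n)" using \<rho>(1) that by auto
      then show "r (\<lambda>(S, \<beta>). \<rho> \<beta> S) \<beta> S = \<rho> \<beta> S" by (auto simp: r_def EA_carrier)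
    qed
    then have "x = cmb M b I (\<lambda>(S, \<beta>). \<rho> \<beta> S)" unfolding dbl \<rho>(2)
      by (intro M.finsum_cong') (use rc cB \<rho>(1) in \<open>auto intro!: smult_closed simp: PiE_mem\<close>)
    then show ?thesis by blast
  qed
  have indep: "u i = 0" if z: "cmb M b I u = \<zero>\<^bsub>M\<^esub>" and i: "i \<in> I" for u i
  proof -
    let ?r = "\<lambda>u. restrict (r u) Bs"
    have e: "?r v \<in> Bs \<rightarrow>\<^sub>E carrier (EA n) \<and> cmb M b I v = (\<Oplus>\<^bsub>M\<^esub>\<beta>\<in>Bs. ?r v \<beta> \<odot>\<^bsub>M\<^esub> \<beta>)" for v
    proof
      show "?r v \<in> Bs \<rightarrow>\<^sub>E carrier (EA n)" using rc by auto
      show "cmb M b I v = (\<Oplus>\<^bsub>M\<^esub>\<beta>\<in>Bs. ?r v \<beta> \<odot>\<^bsub>M\<^esub> \<beta>)" unfolding dbl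
        by (rule M.finsum_cong') (use rc cB smult_closed in auto)
    qed
    have z0: "cmb M b I (\<lambda>_. 0) = \<zero>\<^bsub>M\<^esub>" by (rule cmb_zero[OF bc]) simp
    have "?r u = ?r (\<lambda>_. 0)" using uq[OF M.zero_closed] e[of u] e[of "\<lambda>_. 0"] unfolding z z0 by blast
    then have "?r u (snd i) = ?r (\<lambda>_. 0) (snd i)" by (rule fun_cong)
    moreover have i': "fst i \<subseteq> {..n}" "snd i \<in> Bs" using i by (auto simp: I_def)
    ultimately have "r u (snd i) (fst i) = r (\<lambda>_. 0) (snd i) (fst i)" by simp
    then show ?thesis using i' by (simp add: r_def)
  qed
  obtain N h where h: "bij_betw h {..<card I} I" and N: "ix N = {..<card I}" "\<And>j. dg N j = \<delta> (h j)"
    and rp: "rep n M N (cmb M (\<lambda>j. b (h j)) {..<card I})"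
    by (rule rep_of_family[of I b \<delta>]) (use fI bd span indep in blast)+
  let ?B = "cmb M (\<lambda>j. b (h j)) {..<card I}"
  note mN = repD(2)[OF rp]
  define g where "g = the_inv_into {..<card I} h"
  have hg: "g i \<in> ix N" "h (g i) = i" if "i \<in> I" for i
    unfolding g_def N using bij_betwE[OF bij_betw_the_inv_into[OF h]] f_the_inv_into_f_bij_betw[OF h] that by auto
  have gh: "g (h j) = j" "h j \<in> I" if "j \<in> ix N" for j
    unfolding g_def using the_inv_into_f_f[OF bij_betw_imp_inj_on[OF h], of j] bij_betwE[OF h] that N(1) by auto
  have bch: "(\<lambda>j. b (h j)) \<in> {..<card I} \<rightarrow> carrier M" using bc gh(2) N(1) by auto
  have Bbv: "?B (bv (g i)) = b i" if i: "i \<in> I" for i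
  proof -
    have "?B (bv (g i)) = kk 1 \<odot>\<^bsub>M\<^esub> b (h (g i))"
      unfolding bv_def by (rule cmb_single[OF finite_lessThan bch]) (use hg(1)[OF i] N(1) in simp)
    then show ?thesis using hg(2)[OF i] kk_smult(4)[of "b i"] bc i by auto
  qed
  have gv: "bv (g i) \<in> vec N" if "i \<in> I" for i using bv_vecd[OF hg(1)[OF that]] vecd_vec by blast
  have acb: "mv (ac N t) (bv (g (S, \<beta>))) = (\<lambda>i. (if t \<in> S then 0 else shuffle_sign S {t}) * bv (g (insert t S, \<beta>)) i)"
    if t: "t \<le> n" and S: "S \<subseteq> {..n}" and \<beta>: "\<beta> \<in> Bs" for t S \<beta>
  proof -
    have i: "(S, \<beta>) \<in> I" "(insert t S, \<beta>) \<in> I" using t S \<beta> by (auto simp: I_def)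
    have mc: "xmono S \<in> carrier (EA n)" "xmono (insert t S) \<in> carrier (EA n)" using mono_carrier S t by blast+
    have "?B (mv (ac N t) (bv (g (S, \<beta>)))) = indeterminate t \<odot>\<^bsub>M\<^esub> (xmono S \<odot>\<^bsub>M\<^esub> \<beta>)"
      using repD(7)[OF rp t gv[OF i(1)]] Bbv[OF i(1)] by (simp add: b_def)
    also have "\<dots> = (xmono S \<otimes>\<^bsub>EA n\<^esub> indeterminate t) \<odot>\<^bsub>M\<^esub> \<beta>"
      by (rule smult_assoc[OF mc(1) indet_carrier[OF t] cB[OF \<beta>], symmetric])
    also have "\<dots> = kk (if t \<in> S then 0 else shuffle_sign S {t}) \<odot>\<^bsub>M\<^esub> (xmono (insert t S) \<odot>\<^bsub>M\<^esub> \<beta>)"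
      unfolding mono_mult_indet[OF S t] using kk_smult(5)[OF cB[OF \<beta>]] kk_smult(5)[OF smult_closed[OF mc(2) cB[OF \<beta>]]]
        smult_assoc[OF mc(2) kk_carrier cB[OF \<beta>]] by simp
    also have "\<dots> = kk (if t \<in> S then 0 else shuffle_sign S {t}) \<odot>\<^bsub>M\<^esub> ?B (bv (g (insert t S, \<beta>)))"
      unfolding Bbv[OF i(2)] by (simp add: b_def)
    also have "\<dots> = ?B (\<lambda>i. (if t \<in> S then 0 else shuffle_sign S {t}) * bv (g (insert t S, \<beta>)) i)"
      by (rule repD(5)[OF rp gv[OF i(2)]])
    finally show ?thesis
      using repD(9)[OF rp mv_vec[OF mmodD(2)[OF mN t]] vec_closed(2)[OF gv[OF i(2)]]] by blast
  qed
  have "kil n (\<lambda>a. if a = c then 1 else 0) N" if c: "c \<le> n" for c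
  proof -
    define e where "e j = (if c \<in> fst (h j) then shuffle_sign (fst (h j) - {c}) {c} else 0 :: 'k)" for j
    define p where "p j = g (fst (h j) - {c}, snd (h j))" for j
    define H where "H = mtx (\<lambda>i j. if j \<in> ix N \<and> i = p j then e j else 0)"
    have fN: "finite (ix N)" by (simp add: N)
    have eH: "ent H i j = (if j \<in> ix N \<and> i = p j then e j else 0)" for i j unfolding H_def
    proof (subst ent_mtx)
      show "finite {j. (if j \<in> ix N \<and> i = p j then e j else 0) \<noteq> 0}" for i by (rule finite_subset[OF _ fN]) auto
      show "finite {i. (if j \<in> ix N \<and> i = p j then e j else 0) \<noteq> 0}" for j by (rule finite_subset[of _ "{p j}"]) auto
    qed simp
    have Hb: "mv H (bv (g (S, \<beta>))) = (\<lambda>i. (if c \<in> S then shuffle_sign (S - {c}) {c} else 0) * bv (g (S - {c}, \<beta>)) i)"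
      if S: "S \<subseteq> {..n}" and \<beta>: "\<beta> \<in> Bs" for S \<beta>
    proof -
      have i: "(S, \<beta>) \<in> I" using S \<beta> by (auto simp: I_def)
      show ?thesis unfolding mv_bv eH using hg[OF i] by (auto simp: bv_def p_def e_def)
    qed
    have dH: "dhom (- 1) N N H" unfolding dhom_def
    proof (intro allI impI)
      fix i j assume "ent H i j \<noteq> 0"
      then have j: "j \<in> ix N" "i = p j" and "e j \<noteq> 0" by (auto simp: eH split: if_splits)
      then have cS: "c \<in> fst (h j)" by (auto simp: e_def split: if_splits)
      obtain S \<beta> where s: "h j = (S, \<beta>)" "S \<subseteq> {..n}" "\<beta> \<in> Bs" using gh(2)[OF j(1)] by (auto simp: I_def)
      have i: "(S - {c}, \<beta>) \<in> I" using s by (auto simp: I_def)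
      have fS: "finite S" using s(2) finite_subset by blast
      have "int (card (S - {c})) = int (card S) - 1" using cS s(1) fS by (cases "card S") (auto simp: card_Diff_singleton_if)
      then show "i \<in> ix N \<and> j \<in> ix N \<and> dg N i = dg N j + - 1"
        using j hg[OF i] s(1) by (simp add: p_def N(2) \<delta>_def)
    qed
    have "ac N t * H + H * ac N t = scl (if t = c then 1 else 0) (idm N)" if t: "t \<le> n" for t
    proof (rule mv_bv_eqI)
      note da = mmodD(2)[OF mN t]
      show "dhom 0 N N (ac N t * H + H * ac N t)"
        by (rule dhom_add[OF dhom_mult[OF da dH] dhom_mult[OF dH da]]) simp_all
      show "dhom 0 N N (scl (if t = c then 1 else 0) (idm N))" by (rule dhom_scl[OF dhom_idm])
      fix j assume j: "j \<in> ix N"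
      obtain S \<beta> where s: "h j = (S, \<beta>)" "S \<subseteq> {..n}" "\<beta> \<in> Bs" using gh(2)[OF j] by (auto simp: I_def)
      have jg: "j = g (S, \<beta>)" using gh(1)[OF j] s(1) by simp
      have i: "(S, \<beta>) \<in> I" using s by (auto simp: I_def)
      have fS: "finite S" using s(2) finite_subset by blast
      define V where "V = S - {c}"
      have V: "finite V" "c \<notin> V" "V \<subseteq> {..n}" using fS s(2) by (auto simp: V_def)
      have l: "mv (ac N t) (mv H (bv j)) = (\<lambda>i. (if c \<in> S then shuffle_sign V {c} else 0) *
          ((if t \<in> V then 0 else shuffle_sign V {t}) * bv (g (insert t V, \<beta>)) i))"
        unfolding jg Hb[OF s(2,3)] V_def[symmetric] mv_cmult acb[OF t V(3) s(3)] ..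
      have tS: "insert t S \<subseteq> {..n}" using t s(2) by simp
      have r: "mv H (mv (ac N t) (bv j)) = (\<lambda>i. (if t \<in> S then 0 else shuffle_sign S {t}) *
          ((if c \<in> insert t S then shuffle_sign (insert t S - {c}) {c} else 0) * bv (g (insert t S - {c}, \<beta>)) i))"
        unfolding jg acb[OF t s(2,3)] mv_cmult Hb[OF tS s(3)] ..
      have "mv (ac N t * H + H * ac N t) (bv j) = (\<lambda>i. (if t = c then 1 else 0) * bv j i)"
      proof (cases "t = c")
        case True
        show ?thesis
        proof (cases "c \<in> S")
          case c: True
          then have "insert c V = S" by (auto simp: V_def)
          then show ?thesis unfolding mv_add_left mv_mult l r using c True V(2) by (simp add: jg mult.assoc[symmetric] shuffle_sign_square)
        next
          case c: False
          then have "V = S" by (auto simp: V_def)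
          then show ?thesis unfolding mv_add_left mv_mult l r using c True by (simp add: jg mult.assoc[symmetric] shuffle_sign_square)
        qed
      next
        case ne: False
        show ?thesis
        proof (cases "c \<in> S \<and> t \<notin> S")
          case True
          then have Sc: "S = V \<union> {c}" "insert t S - {c} = V \<union> {t}" "t \<notin> V" using ne by (auto simp: V_def)
          \<comment> \<open>Multiplying by x_t before or after removing c differs by the exchange of
            x_t and x_c, whence the factor - 1 of \<open>shuffle_sign_swap\<close>.\<close>
          have "shuffle_sign S {t} * shuffle_sign (insert t S - {c}) {c} =
              shuffle_sign V {t} * shuffle_sign V {c} * (shuffle_sign {t} {c} * shuffle_sign {c} {t} :: 'k)"
            unfolding Sc(2) unfolding Sc(1) using V Sc(3)
            by (simp only: shuffle_sign_Un_left[OF V(1) finite.insertI[OF finite.emptyI] finite.insertI[OF finite.emptyI]]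
              Int_insert_right Int_empty_right if_False mult_ac)
          then have sgn: "shuffle_sign S {t} * shuffle_sign (insert t S - {c}) {c} = - (shuffle_sign V {c} * shuffle_sign V {t} :: 'k)"
            unfolding shuffle_sign_swap[OF ne] by simp
          have st: "insert t S - {c} = insert t V" using Sc by simp
          have z: "shuffle_sign V {c} * (shuffle_sign V {t} * x) + shuffle_sign S {t} * (shuffle_sign (insert t V) {c} * x) = 0" for x :: 'k
            using sgn unfolding st mult.assoc[symmetric] by simp
          show ?thesis unfolding mv_add_left mv_mult l r st using True Sc(3) ne by (simp add: z)
        next
          case False
          then show ?thesis unfolding mv_add_left mv_mult l r using ne by (auto simp: V_def)
        qed
      qed
      also have "\<dots> = mv (scl (if t = c then 1 else 0) (idm N)) (bv j)"
        unfolding mv_scl using mv_idm[OF gv[OF i]] by (simp add: jg)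
      finally show "mv (ac N t * H + H * ac N t) (bv j) = mv (scl (if t = c then 1 else 0) (idm N)) (bv j)" .
    qed
    then show ?thesis unfolding kil_def using dH by blast
  qed
  then have "ffree n N" by (simp add: ffree_def)
  moreover have "card (ix N) = card Bs * 2 ^ Suc n" using fB by (simp add: N I_def card_cartesian_product card_Pow)
  ultimately show thesis using that rp by blast
qed

text \<open>Any two homogeneous bases yield coordinate systems of the same dimension, rank times
  2^(n+1). This makes \<open>free_rank\<close> well defined and turns bounds on ranks into bounds on
  dimensions.\<close>

lemma graded_free_rep:
  assumes "graded_free (EA n) F"
  obtains N B where "rep n F N B" "ffree n N" "card (ix N) = free_rank (EA n) F * 2 ^ Suc n"
proof -
  interpret graded_right_module "EA n" F using assms by (simp add: fgmod_def graded_free_def)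
  interpret ext_module n F by unfold_locales
  obtain Bs where Bs: "homogeneous_basis (EA n) F Bs" using assms by (auto simp: graded_free_def)
  obtain N B where N: "rep n F N B" "ffree n N" "card (ix N) = card Bs * 2 ^ Suc n" by (rule free_basis_rep[OF Bs])
  have "free_rank (EA n) F = card Bs" unfolding free_rank_def
  proof (rule the_equality)
    fix k assume "\<exists>B. homogeneous_basis (EA n) F B \<and> card B = k"
    then obtain Cs where Cs: "homogeneous_basis (EA n) F Cs" "card Cs = k" by blast
    obtain N' B' where N': "rep n F N' B'" "ffree n N'" "card (ix N') = card Cs * 2 ^ Suc n" by (rule free_basis_rep[OF Cs(1)])
    then show "k = card Bs" using rep_card_unique[OF N(1) N'(1)] N(3) Cs(2) by simp
  qed (use Bs in blast)
  then show thesis using that N by simp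
qed

section \<open>From graded modules to matrices\<close>

lemma cod_unique:
  assumes M: "rep n M N B" and M': "rep n M' N' B'" and F: "cod N B B' f F" and G: "cod N B B' g G"
    and d: "dhom 0 N N' F" "dhom 0 N N' G"
  shows "F = G \<longleftrightarrow> (\<forall>x\<in>carrier M. f x = g x)"
proof
  assume e: "F = G"
  show "\<forall>x\<in>carrier M. f x = g x"
  proof
    fix x assume "x \<in> carrier M"
    then obtain u where u: "u \<in> vec N" "x = B u" using repD(10)[OF M] by blast
    show "f x = g x" using F G u(1) unfolding cod_def u(2) e by simp
  qed
next
  assume e: "\<forall>x\<in>carrier M. f x = g x"
  show "F = G"
  proof (rule cod_eqD[OF M M' d])
    fix u assume u: "u \<in> vec N"
    have "f (B u) = g (B u)" using e repD(8)[OF M u] by blast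
    then show "B' (mv F u) = B' (mv G u)" using F G u unfolding cod_def by simp
  qed
qed

lemma cod_id: "cod N B B (\<lambda>x. x) (idm N)"
  by (simp add: cod_def mv_idm)

lemma cod_compose:
  assumes "cod N B B' f F" "cod N' B' B'' g G" "dhom 0 N N' F"
  shows "cod N B B'' (\<lambda>x. g (f x)) (G * F)"
  unfolding cod_def using cod_comp[OF assms] by blast

lemma split_mono_iff:
  assumes M: "rep n M N B" and M': "rep n M' N' B'" and F: "mmor n N N' F" "cod N B B' f F"
  shows "split_mono (EA n) M M' f \<longleftrightarrow> (\<exists>G. mmor n N' N G \<and> G * F = idm N)"
proof -
  note dF = mmorD(1)[OF F(1)]
  have *: "G * F = idm N \<longleftrightarrow> (\<forall>x\<in>carrier M. g (f x) = x)" if "dhom 0 N' N G" "cod N' B' B g G" for g G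
    by (rule cod_unique[OF M M cod_compose[OF F(2) that(2) dF] cod_id dhom_mult[OF that(1) dF] dhom_idm]) simp
  show ?thesis unfolding split_mono_def
  proof
    assume "\<exists>g\<in>ghom (EA n) M' M. \<forall>x\<in>carrier M. g (f x) = x"
    then obtain g where g: "g \<in> ghom (EA n) M' M" "\<forall>x\<in>carrier M. g (f x) = x" by blast
    obtain G where G: "mmor n N' N G" "cod N' B' B g G" by (rule ghom_mat[OF M' M g(1)])
    then show "\<exists>G. mmor n N' N G \<and> G * F = idm N" using *[OF mmorD(1)[OF G(1)] G(2)] g(2) by blast
  next
    assume "\<exists>G. mmor n N' N G \<and> G * F = idm N"
    then obtain G where G: "mmor n N' N G" "G * F = idm N" by blast
    obtain g where g: "g \<in> ghom (EA n) M' M" "cod N' B' B g G" by (rule mat_ghom[OF M' M G(1)])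
    then show "\<exists>g\<in>ghom (EA n) M' M. \<forall>x\<in>carrier M. g (f x) = x"
      using *[OF mmorD(1)[OF G(1)] g(2)] G(2) by blast
  qed
qed

lemma split_epi_iff:
  assumes M: "rep n M N B" and M': "rep n M' N' B'" and F: "mmor n N N' F" "cod N B B' f F"
  shows "split_epi (EA n) M M' f \<longleftrightarrow> (\<exists>G. mmor n N' N G \<and> F * G = idm N')"
proof -
  note dF = mmorD(1)[OF F(1)]
  have *: "F * G = idm N' \<longleftrightarrow> (\<forall>x\<in>carrier M'. f (g x) = x)" if "dhom 0 N' N G" "cod N' B' B g G" for g G
    by (rule cod_unique[OF M' M' cod_compose[OF that(2) F(2) that(1)] cod_id dhom_mult[OF dF that(1)] dhom_idm]) simp
  show ?thesis unfolding split_epi_def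
  proof
    assume "\<exists>g\<in>ghom (EA n) M' M. \<forall>x\<in>carrier M'. f (g x) = x"
    then obtain g where g: "g \<in> ghom (EA n) M' M" "\<forall>x\<in>carrier M'. f (g x) = x" by blast
    obtain G where G: "mmor n N' N G" "cod N' B' B g G" by (rule ghom_mat[OF M' M g(1)])
    then show "\<exists>G. mmor n N' N G \<and> F * G = idm N'" using *[OF mmorD(1)[OF G(1)] G(2)] g(2) by blast
  next
    assume "\<exists>G. mmor n N' N G \<and> F * G = idm N'"
    then obtain G where G: "mmor n N' N G" "F * G = idm N'" by blast
    obtain g where g: "g \<in> ghom (EA n) M' M" "cod N' B' B g G" by (rule mat_ghom[OF M' M G(1)])
    then show "\<exists>g\<in>ghom (EA n) M' M. \<forall>x\<in>carrier M'. f (g x) = x"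
      using *[OF mmorD(1)[OF G(1)] g(2)] G(2) by blast
  qed
qed

section \<open>A universe large enough for all modules\<close>

text \<open>An infinite field is equipotent with its square, so finitely many coordinates can be
  packed one by one into a single scalar.\<close>

lemma vec_embedding:
  fixes e :: "'k::field \<Rightarrow> 'm" and N :: "'k mm"
  assumes inf: "infinite (UNIV :: 'k set)" and e: "inj e" and fN: "finite (ix N)"
  obtains \<kappa> :: "(nat \<Rightarrow> 'k) \<Rightarrow> 'm" where "inj_on \<kappa> (vec N)"
proof -
  have "\<exists>p. bij_betw p (UNIV \<times> UNIV :: ('k \<times> 'k) set) (UNIV :: 'k set)"
    unfolding card_of_ordIso by (rule card_of_Times_same_infinite[OF inf])
  then obtain p :: "'k \<times> 'k \<Rightarrow> 'k" where p: "inj p" by (auto simp: bij_betw_def)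
  have "\<exists>g :: (nat \<Rightarrow> 'k) \<Rightarrow> 'k. inj_on g {u. \<forall>j. j \<notin> J \<longrightarrow> u j = 0}" if "finite J" for J
    using that
  proof (induction J rule: finite_induct)
    case empty
    show ?case by (rule exI[of _ "\<lambda>_. 0"]) (auto simp: inj_on_def)
  next
    case (insert j J)
    then obtain g :: "(nat \<Rightarrow> 'k) \<Rightarrow> 'k" where g: "inj_on g {u. \<forall>j. j \<notin> J \<longrightarrow> u j = 0}" by blast
    show ?case
    proof (rule exI[of _ "\<lambda>u. p (u j, g (u(j := 0)))"], rule inj_onI)
      fix u v :: "nat \<Rightarrow> 'k"
      assume u: "u \<in> {u. \<forall>i. i \<notin> insert j J \<longrightarrow> u i = 0}" and v: "v \<in> {u. \<forall>i. i \<notin> insert j J \<longrightarrow> u i = 0}"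
        and eq: "p (u j, g (u(j := 0))) = p (v j, g (v(j := 0)))"
      from eq have "(u j, g (u(j := 0))) = (v j, g (v(j := 0)))" by (rule injD[OF p])
      then have e: "u j = v j" "g (u(j := 0)) = g (v(j := 0))" by simp_all
      have uv: "u(j := 0) \<in> {u. \<forall>j. j \<notin> J \<longrightarrow> u j = 0}" "v(j := 0) \<in> {u. \<forall>j. j \<notin> J \<longrightarrow> u j = 0}"
        using u v by auto
      have eq: "u(j := 0) = v(j := 0)" using inj_on_eq_iff[OF g uv] e(2) by simp
      have "u i = v i" for i using e(1) fun_cong[OF eq, of i] by (cases "i = j") simp_all
      then show "u = v" by (rule ext)
    qed
  qed
  then obtain g :: "(nat \<Rightarrow> 'k) \<Rightarrow> 'k" where g: "inj_on g (vec N)" unfolding vec_def using fN by blast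
  have "inj_on (\<lambda>u. e (g u)) (vec N)" using g e by (auto simp: inj_on_def)
  then show thesis by (rule that)
qed

text \<open>Irreducibility and projective resolutions refer to modules with elements in
  \<open>'m\<close> only, while the constructions on matrices produce new modules; this condition
  brings those modules back into \<open>'m\<close>.\<close>

definition universal :: "nat \<Rightarrow> 'k::field itself \<Rightarrow> 'm itself \<Rightarrow> bool" where
  "universal n k m \<longleftrightarrow> (\<forall>N :: 'k mm. mmod n N \<longrightarrow> (\<exists>(M :: (nat set \<Rightarrow> 'k, 'm) gmodule) B. rep n M N B))"

lemma universalD:
  fixes N :: "'k::field mm"
  assumes "universal n TYPE('k) TYPE('m)" "mmod n N"
  obtains M :: "(nat set \<Rightarrow> 'k, 'm) gmodule" and B where "rep n M N B"
  using assms unfolding universal_def by blast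

text \<open>A nonzero module contains a line, hence a copy of the field inside
  \<open>'m\<close>.\<close>

lemma universalI:
  fixes M :: "(nat set \<Rightarrow> 'k::field, 'm) gmodule"
  assumes inf: "infinite (UNIV :: 'k set)" and M: "rep n M N B" and j: "j \<in> ix N"
  shows "universal n TYPE('k) TYPE('m)"
  unfolding universal_def
proof (intro allI impI)
  fix N' :: "'k mm" assume N': "mmod n N'"
  have v: "(\<lambda>i. c * bv j i) \<in> vec N" for c using vec_closed(2) bv_vecd[OF j] vecd_vec by blast
  have "inj (\<lambda>c. B (\<lambda>i. c * bv j i))"
  proof (rule injI)
    fix c d assume "B (\<lambda>i. c * bv j i) = B (\<lambda>i. d * bv j i)"
    then have "(\<lambda>i. c * bv j i) = (\<lambda>i. d * bv j i)" using repD(9)[OF M v v] by simp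
    then have "c * bv j j = d * bv j j" by (rule fun_cong)
    then show "c = d" by (simp add: bv_def)
  qed
  from vec_embedding[OF inf this mmodD(1)[OF N']] obtain \<kappa> :: "(nat \<Rightarrow> 'k) \<Rightarrow> 'm" where "inj_on \<kappa> (vec N')" by blast
  from rep_realize[OF N' this] show "\<exists>(M :: (nat set \<Rightarrow> 'k, 'm) gmodule) B. rep n M N' B" by blast
qed

lemma irreducible_mirr:
  fixes X Y :: "(nat set \<Rightarrow> 'k::field, 'm) gmodule"
  assumes U: "universal n TYPE('k) TYPE('m)" and X: "rep n X N B" and Y: "rep n Y N' B'"
    and irr: "irreducible_hom (EA n) X Y f"
  obtains F where "mirr n N N' F"
proof -
  have f: "f \<in> ghom (EA n) X Y" "\<not> split_mono (EA n) X Y f" "\<not> split_epi (EA n) X Y f"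
    and fac: "\<And>Z h g. Z \<in> fgmod (EA n) \<Longrightarrow> h \<in> ghom (EA n) X Z \<Longrightarrow> g \<in> ghom (EA n) Z Y \<Longrightarrow>
        \<forall>x\<in>carrier X. f x = g (h x) \<Longrightarrow> split_mono (EA n) X Z h \<or> split_epi (EA n) Z Y g"
    using irr unfolding irreducible_hom_def by auto
  obtain F where F: "mmor n N N' F" "cod N B B' f F" by (rule ghom_mat[OF X Y f(1)])
  have "mirr n N N' F" unfolding mirr_def
  proof (intro conjI allI impI)
    show "mmor n N N' F" by (rule F(1))
    show "\<not> (\<exists>g. mmor n N' N g \<and> g * F = idm N)" using f(2) split_mono_iff[OF X Y F] by blast
    show "\<not> (\<exists>g. mmor n N' N g \<and> F * g = idm N')" using f(3) split_epi_iff[OF X Y F] by blast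
    fix Z H G assume a: "mmod n Z \<and> mmor n N Z H \<and> mmor n Z N' G \<and> F = G * H"
    obtain M :: "(nat set \<Rightarrow> 'k, 'm) gmodule" and C where M: "rep n M Z C"
      by (rule universalD[OF U conjunct1[OF a]])
    have HG: "mmor n N Z H" "mmor n Z N' G" using a by blast+
    obtain h where h: "h \<in> ghom (EA n) X M" "cod N B C h H" by (rule mat_ghom[OF X M HG(1)])
    obtain g where g: "g \<in> ghom (EA n) M Y" "cod Z C B' g G" by (rule mat_ghom[OF M Y HG(2)])
    note dH = mmorD(1)[OF HG(1)] and dG = mmorD(1)[OF HG(2)]
    have "F = G * H" using a by blast
    then have "\<forall>x\<in>carrier X. f x = g (h x)"
      using cod_unique[OF X Y F(2) cod_compose[OF h(2) g(2) dH] mmorD(1)[OF F(1)] dhom_mult[OF dG dH]] by simp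
    from fac[OF rep_fgmod[OF M] h(1) g(1) this]
    show "(\<exists>r. mmor n Z N r \<and> r * H = idm N) \<or> (\<exists>s. mmor n N' Z s \<and> G * s = idm N')"
      unfolding split_mono_iff[OF X M HG(1) h(2)] split_epi_iff[OF M Y HG(2) g(2)] .
  qed
  then show thesis by (rule that)
qed

lemma ghom_zero: assumes "rep n M N B" "rep n M' N' B'" "f \<in> ghom (EA n) M M'" shows "f \<zero>\<^bsub>M\<^esub> = \<zero>\<^bsub>M'\<^esub>"
proof -
  obtain F where F: "mmor n N N' F" "cod N B B' f F" by (rule ghom_mat[OF assms])
  have "f (B (\<lambda>_. 0)) = B' (mv F (\<lambda>_. 0))" using F(2) vec_closed(3) unfolding cod_def by blast
  then show ?thesis unfolding mv_zero rep_zero[OF assms(1)] rep_zero[OF assms(2)] .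
qed

text \<open>Applied to idempotents, whose fixed points are their image. The homogeneous parts of a
  fixed point are fixed because p preserves degrees and the decomposition is unique.\<close>

lemma fixed_graded_submodule:
  fixes M :: "(nat set \<Rightarrow> 'k::field, 'm) gmodule"
  assumes M: "rep n M N B" and p: "p \<in> ghom (EA n) M M"
  shows "graded_submodule (EA n) M {x \<in> carrier M. p x = x}"
proof -
  interpret M: graded_right_module "EA n" M by (rule repD(1)[OF M])
  interpret X: ext_module n M by unfold_locales
  let ?A = "{x \<in> carrier M. p x = x}"
  let ?S = "M\<lparr>carrier := ?A, mcomp := \<lambda>i. ?A \<inter> mcomp M i\<rparr>"
  have A: "x \<in> carrier M" "p x = x" if "x \<in> ?A" for x using that by auto
  have add: "x \<oplus>\<^bsub>M\<^esub> y \<in> ?A" if "x \<in> ?A" "y \<in> ?A" for x y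
    using ghomD(2)[OF p A(1)[OF that(1)] A(1)[OF that(2)]] A(2)[OF that(1)] A(2)[OF that(2)] A(1)[OF that(1)] A(1)[OF that(2)] by simp
  have zero: "\<zero>\<^bsub>M\<^esub> \<in> ?A" using ghom_zero[OF M M p] by simp
  have sm: "a \<odot>\<^bsub>M\<^esub> x \<in> ?A" if "a \<in> carrier (EA n)" "x \<in> ?A" for a x
    using ghomD(3)[OF p that(1) A(1)[OF that(2)]] A(2)[OF that(2)] M.smult_closed[OF that(1) A(1)[OF that(2)]] by simp
  have neg: "\<ominus>\<^bsub>M\<^esub> x \<in> ?A" if "x \<in> ?A" for x
    unfolding X.kk_smult(7)[OF A(1)[OF that], symmetric] by (rule sm[OF kk_carrier that])
  have grp: "abelian_group ?S"
  proof (rule abelian_groupI)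
    fix x y z assume xyz: "x \<in> carrier ?S" "y \<in> carrier ?S" "z \<in> carrier ?S"
    then have c: "x \<in> carrier M" "y \<in> carrier M" "z \<in> carrier M" by auto
    show "x \<oplus>\<^bsub>?S\<^esub> y \<oplus>\<^bsub>?S\<^esub> z = x \<oplus>\<^bsub>?S\<^esub> (y \<oplus>\<^bsub>?S\<^esub> z)" using M.add.m_assoc[OF c] by simp
  next
    fix x y assume xy: "x \<in> carrier ?S" "y \<in> carrier ?S"
    then have c: "x \<in> carrier M" "y \<in> carrier M" by auto
    show "x \<oplus>\<^bsub>?S\<^esub> y \<in> carrier ?S" using add[of x y] xy by simp
    show "x \<oplus>\<^bsub>?S\<^esub> y = y \<oplus>\<^bsub>?S\<^esub> x" using M.add.m_comm[OF c] by simp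
  next
    fix x assume x: "x \<in> carrier ?S"
    then have xA: "x \<in> ?A" by simp
    show "\<zero>\<^bsub>?S\<^esub> \<oplus>\<^bsub>?S\<^esub> x = x" using M.l_zero[OF A(1)[OF xA]] by simp
    have "\<ominus>\<^bsub>M\<^esub> x \<oplus>\<^bsub>?S\<^esub> x = \<zero>\<^bsub>?S\<^esub>" using M.l_neg[OF A(1)[OF xA]] by simp
    then show "\<exists>y\<in>carrier ?S. y \<oplus>\<^bsub>?S\<^esub> x = \<zero>\<^bsub>?S\<^esub>" using neg[OF xA] by (intro bexI[of _ "\<ominus>\<^bsub>M\<^esub> x"]) simp_all
  qed (use zero in simp)
  interpret S: abelian_group ?S by (rule grp)
  have fs: "finsum ?S f I = finsum M f I" if "finite I" "\<And>i. i \<in> I \<Longrightarrow> f i \<in> ?A" for f and I :: "int set"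
    using that
  proof (induction I rule: finite_induct)
    case empty
    then show ?case by simp
  next
    case (insert i I)
    have c: "f \<in> I \<rightarrow> carrier ?S" "f i \<in> carrier ?S" "f \<in> I \<rightarrow> carrier M" "f i \<in> carrier M" using insert.prems by auto
    show ?case unfolding S.finsum_insert[OF insert(1,2) c(1,2)] M.finsum_insert[OF insert(1,2) c(3,4)]
      using insert.IH insert.prems by simp
  qed
  have pfs: "p (finsum M f I) = finsum M (\<lambda>i. p (f i)) I" if "finite I" "\<And>i. i \<in> I \<Longrightarrow> f i \<in> carrier M" for f and I :: "int set"
    using that
  proof (induction I rule: finite_induct)
    case empty
    then show ?case using ghom_zero[OF M M p] by simp
  next
    case (insert i I)
    have c: "f \<in> I \<rightarrow> carrier M" "f i \<in> carrier M" "(\<lambda>i. p (f i)) \<in> I \<rightarrow> carrier M" "p (f i) \<in> carrier M"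
      using insert.prems ghomD(1)[OF p] by auto
    show ?case unfolding M.finsum_insert[OF insert(1,2) c(1,2)] M.finsum_insert[OF insert(1,2) c(3,4)]
        ghomD(2)[OF p c(2) M.finsum_closed[OF c(1)]]
      using insert.IH insert.prems by simp
  qed
  have grading: "internal_grading ?S (mcomp ?S)" unfolding internal_grading_def
  proof (intro conjI allI ballI)
    fix i
    have s: "subgroup (mcomp M i) (add_monoid M)" using M.module_grading by (simp add: internal_grading_def)
    show "subgroup (mcomp ?S i) (add_monoid ?S)"
    proof (rule group.subgroupI)
      show "group (add_monoid ?S)" by (rule S.add.is_group)
      show "mcomp ?S i \<subseteq> carrier (add_monoid ?S)" by auto
      show "mcomp ?S i \<noteq> {}" using zero X.comp(3)[of i] by auto
      fix x assume "x \<in> mcomp ?S i"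
      then have x: "x \<in> ?A" "x \<in> mcomp M i" by auto
      have "\<ominus>\<^bsub>?S\<^esub> x = \<ominus>\<^bsub>M\<^esub> x"
        by (rule S.minus_equality) (use x neg[OF x(1)] M.l_neg[OF A(1)[OF x(1)]] in simp_all)
      then have e: "inv\<^bsub>add_monoid ?S\<^esub> x = \<ominus>\<^bsub>M\<^esub> x" by (simp only: a_inv_def)
      have "\<ominus>\<^bsub>M\<^esub> x \<in> mcomp M i" unfolding X.kk_smult(7)[OF A(1)[OF x(1)], symmetric] by (rule X.comp(4)[OF x(2)])
      then show "inv\<^bsub>add_monoid ?S\<^esub> x \<in> mcomp ?S i" unfolding e using neg[OF x(1)] by simp
      fix y assume "y \<in> mcomp ?S i"
      then have y: "y \<in> ?A" "y \<in> mcomp M i" by auto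
      show "x \<otimes>\<^bsub>add_monoid ?S\<^esub> y \<in> mcomp ?S i" using add[OF x(1) y(1)] X.comp(2)[OF x(2) y(2)] by simp
    qed
  next
    fix x assume "x \<in> carrier ?S"
    then have x: "x \<in> ?A" by simp
    let ?Q = "\<lambda>f. (\<forall>i. f i \<in> mcomp M i) \<and> finite {i. f i \<noteq> \<zero>\<^bsub>M\<^esub>} \<and> x = (\<Oplus>\<^bsub>M\<^esub>i\<in>{i. f i \<noteq> \<zero>\<^bsub>M\<^esub>}. f i)"
    have ex: "\<exists>!f. ?Q f" using M.module_grading A(1)[OF x] unfolding internal_grading_def by blast
    then obtain f where f: "?Q f" by blast
    let ?T = "{i. f i \<noteq> \<zero>\<^bsub>M\<^esub>}"
    have fc: "f i \<in> mcomp M i" for i using f by blast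
    have fix_f: "p (f i) = f i" for i
    proof (cases "i \<in> ?T")
      case True
      have "(\<Oplus>\<^bsub>M\<^esub>i\<in>?T. p (f i)) = p x" using pfs[of ?T f] f X.comp(1)[OF fc] by simp
      also have "\<dots> = (\<Oplus>\<^bsub>M\<^esub>i\<in>?T. f i)" using A(2)[OF x] f by simp
      finally show ?thesis by (intro X.grading_unique[of ?T "\<lambda>i. p (f i)" f i]) (use f fc ghomD(4)[OF p fc] True in blast)+
    next
      case False
      then show ?thesis using ghom_zero[OF M M p] by simp
    qed
    have fA: "f i \<in> ?A" for i using fix_f X.comp(1)[OF fc] by simp
    show "\<exists>!f. (\<forall>i. f i \<in> mcomp ?S i) \<and> finite {i. f i \<noteq> \<zero>\<^bsub>?S\<^esub>} \<and> x = (\<Oplus>\<^bsub>?S\<^esub>i\<in>{i. f i \<noteq> \<zero>\<^bsub>?S\<^esub>}. f i)"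
    proof (rule ex1I[of _ f])
      show "(\<forall>i. f i \<in> mcomp ?S i) \<and> finite {i. f i \<noteq> \<zero>\<^bsub>?S\<^esub>} \<and> x = (\<Oplus>\<^bsub>?S\<^esub>i\<in>{i. f i \<noteq> \<zero>\<^bsub>?S\<^esub>}. f i)"
      proof (intro conjI allI)
        show "f i \<in> mcomp ?S i" for i using fA[of i] fc[of i] by simp
        show "finite {i. f i \<noteq> \<zero>\<^bsub>?S\<^esub>}" using f by simp
        have "x = finsum M f ?T" using f by blast
        also have "\<dots> = finsum ?S f ?T" by (rule fs[symmetric]) (use f fA in blast)+
        finally show "x = (\<Oplus>\<^bsub>?S\<^esub>i\<in>{i. f i \<noteq> \<zero>\<^bsub>?S\<^esub>}. f i)" by simp
      qed
    next
      fix g assume g: "(\<forall>i. g i \<in> mcomp ?S i) \<and> finite {i. g i \<noteq> \<zero>\<^bsub>?S\<^esub>} \<and> x = (\<Oplus>\<^bsub>?S\<^esub>i\<in>{i. g i \<noteq> \<zero>\<^bsub>?S\<^esub>}. g i)"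
      then have gA: "g i \<in> ?A" "g i \<in> mcomp M i" for i by auto
      have fin: "finite {i. g i \<noteq> \<zero>\<^bsub>M\<^esub>}" using g by simp
      have "x = finsum ?S g {i. g i \<noteq> \<zero>\<^bsub>M\<^esub>}" using g by simp
      also have "\<dots> = finsum M g {i. g i \<noteq> \<zero>\<^bsub>M\<^esub>}" by (rule fs[OF fin gA(1)])
      finally have "?Q g" using gA(2) fin by blast
      then show "g = f" using ex f by blast
    qed
  qed
  have "graded_right_module (EA n) ?S"
  proof (intro graded_right_module.intro graded_right_module_axioms.intro grp grading graded_ring_exterior_algebra)
    fix a b :: "nat set \<Rightarrow> 'k" and x y i j
    assume a: "a \<in> carrier (EA n)"
    show "x \<in> carrier ?S \<Longrightarrow> a \<odot>\<^bsub>?S\<^esub> x \<in> carrier ?S" using sm[OF a, of x] by simp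
    show "b \<in> carrier (EA n) \<Longrightarrow> x \<in> carrier ?S \<Longrightarrow>
        (a \<oplus>\<^bsub>EA n\<^esub> b) \<odot>\<^bsub>?S\<^esub> x = a \<odot>\<^bsub>?S\<^esub> x \<oplus>\<^bsub>?S\<^esub> b \<odot>\<^bsub>?S\<^esub> x"
      using M.smult_l_distr[OF a, of b x] by simp
    show "x \<in> carrier ?S \<Longrightarrow> y \<in> carrier ?S \<Longrightarrow> a \<odot>\<^bsub>?S\<^esub> (x \<oplus>\<^bsub>?S\<^esub> y) = a \<odot>\<^bsub>?S\<^esub> x \<oplus>\<^bsub>?S\<^esub> a \<odot>\<^bsub>?S\<^esub> y"
      using M.smult_r_distr[OF a, of x y] by simp
    show "b \<in> carrier (EA n) \<Longrightarrow> x \<in> carrier ?S \<Longrightarrow> (a \<otimes>\<^bsub>EA n\<^esub> b) \<odot>\<^bsub>?S\<^esub> x = b \<odot>\<^bsub>?S\<^esub> (a \<odot>\<^bsub>?S\<^esub> x)"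
      using M.smult_assoc[OF a, of b x] by simp
  next
    fix x show "x \<in> carrier ?S \<Longrightarrow> \<one>\<^bsub>EA n\<^esub> \<odot>\<^bsub>?S\<^esub> x = x" using M.smult_one[of x] by simp
  next
    fix a :: "nat set \<Rightarrow> 'k" and x i j
    assume a: "a \<in> rcomp (EA n) i" and x: "x \<in> mcomp ?S j"
    have ac: "a \<in> carrier (EA n)" using a by (simp add: EA_carrier exterior_algebra_simps)
    show "a \<odot>\<^bsub>?S\<^esub> x \<in> mcomp ?S (j + i)" using sm[OF ac, of x] M.smult_comp[OF a, of x j] x by simp
  qed
  then show ?thesis unfolding graded_submodule_def by blast
qed

text \<open>An idempotent p decomposes the module into the fixed points of p and of 1 - p; if one of
  them is zero, so is the corresponding idempotent.\<close>

lemma indecomposable_indec: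
  assumes M: "rep n M N B" and ind: "indecomposable (EA n) M"
  shows "indec n N"
  unfolding indec_def
proof (intro conjI allI impI)
  note N = repD(2)[OF M]
  interpret M: graded_right_module "EA n" M by (rule repD(1)[OF M])
  show "ix N \<noteq> {}"
  proof
    assume "ix N = {}"
    then have v: "u = (\<lambda>_. 0)" if "u \<in> vec N" for u using that by (auto simp: vec_def)
    have "carrier M \<subseteq> {\<zero>\<^bsub>M\<^esub>}" using repD(10)[OF M] v rep_zero[OF M] by auto
    then have "carrier M = {\<zero>\<^bsub>M\<^esub>}" by auto
    then show False using ind by (simp add: indecomposable_def)
  qed
  fix p assume p: "mmor n N N p \<and> p * p = p"
  define q where "q = idm N - p"
  have pm: "mmor n N N p" and qm: "mmor n N N q" using p mmor_diff[OF mmor_idm[OF N]] by (auto simp: q_def)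
  note dp = mmorD(1)[OF pm] and dq = mmorD(1)[OF qm]
  have pp: "p * p = p" using p by blast
  have qp: "q * p = 0" "q * q = q" unfolding q_def left_diff_distrib right_diff_distrib idm_mult_dhom[OF dp]
    dhom_mult_idm[OF dp] pp by simp_all
  have sum: "p + q = idm N" by (simp add: q_def)
  obtain P where P: "P \<in> ghom (EA n) M M" "cod N B B P p" by (rule mat_ghom[OF M M pm])
  obtain Q where Q: "Q \<in> ghom (EA n) M M" "cod N B B Q q" by (rule mat_ghom[OF M M qm])
  let ?A = "{x \<in> carrier M. P x = x}" and ?B = "{x \<in> carrier M. Q x = x}"
  have PB: "P (B u) = B (mv p u)" "Q (B u) = B (mv q u)" if "u \<in> vec N" for u
    using P(2) Q(2) that by (auto simp: cod_def)
  have fixP: "B u \<in> ?A \<longleftrightarrow> mv p u = u" "B u \<in> ?B \<longleftrightarrow> mv q u = u" if "u \<in> vec N" for u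
    using PB[OF that] repD(8)[OF M that] repD(9)[OF M mv_vec[OF dp] that] repD(9)[OF M mv_vec[OF dq] that] by auto
  have uu: "mv p u i + mv q u i = u i" if "u \<in> vec N" for u i
    using fun_cong[OF mv_add_left[of p q u], of i] mv_idm[OF that] unfolding sum by simp
  have zero: "\<zero>\<^bsub>M\<^esub> \<in> ?A \<inter> ?B" using ghom_zero[OF M M P(1)] ghom_zero[OF M M Q(1)] by simp
  have "?A \<inter> ?B = {\<zero>\<^bsub>M\<^esub>}"
  proof
    show "?A \<inter> ?B \<subseteq> {\<zero>\<^bsub>M\<^esub>}"
    proof
      fix x assume x: "x \<in> ?A \<inter> ?B"
      then have "x \<in> carrier M" by blast
      then obtain u where u: "u \<in> vec N" "x = B u" using repD(10)[OF M] by blast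
      have "mv p u = u" "mv q u = u" using x fixP[OF u(1)] unfolding u(2) by blast+
      then have "u i + u i = u i" for i using uu[OF u(1), of i] by (simp only:)
      then have "u = (\<lambda>_. 0)" unfolding add_cancel_left_right by (rule ext)
      then show "x \<in> {\<zero>\<^bsub>M\<^esub>}" using u(2) rep_zero[OF M] by simp
    qed
  qed (use zero in blast)
  moreover have "?A <+>\<^bsub>M\<^esub> ?B = carrier M"
  proof
    show "?A <+>\<^bsub>M\<^esub> ?B \<subseteq> carrier M" by (auto simp: set_add_def')
    show "carrier M \<subseteq> ?A <+>\<^bsub>M\<^esub> ?B"
    proof
      fix x assume "x \<in> carrier M"
      then obtain u where u: "u \<in> vec N" "x = B u" using repD(10)[OF M] by blast
      have v: "mv p u \<in> vec N" "mv q u \<in> vec N" by (rule mv_vec[OF dp], rule mv_vec[OF dq])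
      have a: "B (mv p u) \<in> ?A" unfolding fixP(1)[OF v(1)] by (simp only: mv_mult[symmetric] pp)
      have b: "B (mv q u) \<in> ?B" unfolding fixP(2)[OF v(2)] by (simp only: mv_mult[symmetric] qp)
      have "x = B (mv p u) \<oplus>\<^bsub>M\<^esub> B (mv q u)" using repD(4)[OF M v] uu[OF u(1)] u(2) by simp
      then show "x \<in> ?A <+>\<^bsub>M\<^esub> ?B" unfolding set_add_def' using a b by blast
    qed
  qed
  ultimately have "?A = {\<zero>\<^bsub>M\<^esub>} \<or> ?B = {\<zero>\<^bsub>M\<^esub>}"
    using ind fixed_graded_submodule[OF M P(1)] fixed_graded_submodule[OF M Q(1)] unfolding indecomposable_def by blast
  moreover have "r = 0" if r: "dhom 0 N N r" "r * r = r" and z: "\<And>u. u \<in> vec N \<Longrightarrow> mv r u = u \<Longrightarrow> B u = \<zero>\<^bsub>M\<^esub>" for r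
  proof (rule mv_eqI[OF r(1) dhom_0])
    fix u assume "u \<in> vec N"
    have v: "mv r u \<in> vec N" by (rule mv_vec[OF r(1)])
    have "mv r (mv r u) = mv r u" by (simp only: mv_mult[symmetric] r(2))
    then have "B (mv r u) = B (\<lambda>_. 0)" using z[OF v] rep_zero[OF M] by simp
    then show "mv r u = mv 0 u" using repD(9)[OF M v vec_closed(3)] by simp
  qed
  ultimately have "p = 0 \<or> q = 0"
  proof (elim disjE)
    assume A: "?A = {\<zero>\<^bsub>M\<^esub>}"
    have "p = 0"
    proof (rule \<open>\<And>r. dhom 0 N N r \<Longrightarrow> r * r = r \<Longrightarrow> (\<And>u. u \<in> vec N \<Longrightarrow> mv r u = u \<Longrightarrow> B u = \<zero>\<^bsub>M\<^esub>) \<Longrightarrow> r = 0\<close>[OF dp pp])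
      fix u assume "u \<in> vec N" "mv p u = u"
      then have "B u \<in> ?A" using fixP(1) by blast
      then show "B u = \<zero>\<^bsub>M\<^esub>" unfolding A by simp
    qed
    then show ?thesis by simp
  next
    assume A: "?B = {\<zero>\<^bsub>M\<^esub>}"
    have "q = 0"
    proof (rule \<open>\<And>r. dhom 0 N N r \<Longrightarrow> r * r = r \<Longrightarrow> (\<And>u. u \<in> vec N \<Longrightarrow> mv r u = u \<Longrightarrow> B u = \<zero>\<^bsub>M\<^esub>) \<Longrightarrow> r = 0\<close>[OF dq qp(2)])
      fix u assume "u \<in> vec N" "mv q u = u"
      then have "B u \<in> ?B" using fixP(2) by blast
      then show "B u = \<zero>\<^bsub>M\<^esub>" unfolding A by simp
    qed
    then show ?thesis by simp
  qed
  then show "p = 0 \<or> p = idm N" by (auto simp: q_def)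
qed

lemma onto_mat:
  assumes M: "rep n M N B" and M': "rep n M' N' B'" and F: "mmor n N N' F" "cod N B B' f F"
    and onto: "f ` carrier M = carrier M'" and K: "dhom q Z N' K" "finite (ix Z)"
  obtains K' where "dhom q Z N K'" "K = F * K'"
proof -
  have ex: "\<exists>u\<in>vec N. mv F u = mv K (bv j)" for j
  proof -
    have v: "mv K (bv j) \<in> vec N'" by (rule mv_vec[OF K(1)])
    then have "B' (mv K (bv j)) \<in> f ` carrier M" using onto repD(8)[OF M'] by simp
    then obtain x where "x \<in> carrier M" "B' (mv K (bv j)) = f x" by blast
    then obtain u where u: "u \<in> vec N" "B' (mv K (bv j)) = f (B u)" using repD(10)[OF M, of x] by blast
    then have "B' (mv K (bv j)) = B' (mv F u)" using F(2) by (simp add: cod_def)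
    then have "mv F u = mv K (bv j)" using repD(9)[OF M' v mv_vec[OF mmorD(1)[OF F(1)], of u]] by simp
    then show ?thesis using u(1) by blast
  qed
  show thesis by (rule lift_columns[OF K(2) mmorD(1)[OF F(1)] K(1) mmodD(1)[OF repD(2)[OF M]] ex]) (rule that)
qed

lemma exact_mat:
  assumes M1: "rep n M1 N1 B1" and M2: "rep n M2 N2 B2" and M3: "rep n M3 N3 B3"
    and G: "mmor n N1 N2 G" "cod N1 B1 B2 g G" and F: "mmor n N2 N3 F" "cod N2 B2 B3 f F"
    and exact: "g ` carrier M1 = a_kernel M2 M3 f"
  shows "F * G = 0"
    and "dhom q Z N2 K \<Longrightarrow> finite (ix Z) \<Longrightarrow> F * K = 0 \<Longrightarrow> \<exists>K'. dhom q Z N1 K' \<and> K = G * K'"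
proof -
  note dG = mmorD(1)[OF G(1)] and dF = mmorD(1)[OF F(1)]
  have ker: "B2 v \<in> g ` carrier M1 \<longleftrightarrow> mv F v = (\<lambda>_. 0)" if v: "v \<in> vec N2" for v
  proof -
    have "f (B2 v) = B3 (mv F v)" using F(2) v by (simp add: cod_def)
    then show ?thesis unfolding exact a_kernel_def' rep_zero[OF M3, symmetric]
      using repD(8)[OF M2 v] repD(9)[OF M3 mv_vec[OF dF] vec_closed(3)] by simp
  qed
  have gB: "g (B1 u) = B2 (mv G u)" if "u \<in> vec N1" for u using G(2) that by (simp add: cod_def)
  show "F * G = 0"
  proof (rule mv_eqI)
    show "dhom 0 N1 N3 (F * G)" by (rule dhom_mult[OF dF dG]) simp
    show "dhom 0 N1 N3 0" by simp
    fix u assume u: "u \<in> vec N1"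
    have "B2 (mv G u) \<in> g ` carrier M1" unfolding gB[OF u, symmetric] by (rule imageI[OF repD(8)[OF M1 u]])
    then show "mv (F * G) u = mv 0 u" unfolding ker[OF mv_vec[OF dG]] mv_mult by simp
  qed
  assume K: "dhom q Z N2 K" "finite (ix Z)" "F * K = 0"
  have ex: "\<exists>u\<in>vec N1. mv G u = mv K (bv j)" for j
  proof -
    have v: "mv K (bv j) \<in> vec N2" by (rule mv_vec[OF K(1)])
    have "mv F (mv K (bv j)) = (\<lambda>_. 0)" unfolding mv_mult[symmetric] K(3) by simp
    then have "B2 (mv K (bv j)) \<in> g ` carrier M1" using ker[OF v] by blast
    then obtain x where x: "x \<in> carrier M1" "B2 (mv K (bv j)) = g x" by blast
    then obtain u where u: "u \<in> vec N1" "x = B1 u" using repD(10)[OF M1] by blast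
    have "B2 (mv K (bv j)) = B2 (mv G u)" using x(2) gB[OF u(1)] u(2) by simp
    then have "mv G u = mv K (bv j)" using repD(9)[OF M2 v mv_vec[OF dG, of u]] by simp
    then show ?thesis using u(1) by blast
  qed
  show "\<exists>K'. dhom q Z N1 K' \<and> K = G * K'"
    by (rule lift_columns[OF K(2) dG K(1) mmodD(1)[OF repD(2)[OF M1]] ex]) blast
qed

section \<open>Projective modules\<close>

text \<open>Lift linearly, then average: the averaging commutes with composition by G and leaves the
  morphism F unchanged, so the averaged lift is again a lift.\<close>

lemma ffree_projective:
  assumes P: "rep n P N B" and free: "ffree n N"
  shows "projective (EA n) P"
  unfolding projective_def
proof (intro conjI ballI impI)
  show "P \<in> fgmod (EA n)" by (rule rep_fgmod[OF P])
  note mN = repD(2)[OF P]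
  obtain H where H: "dsys n N H" using free by (auto simp: ffree_dsys)
  fix M M' g f assume M: "M \<in> fgmod (EA n)" "M' \<in> fgmod (EA n)" and g: "g \<in> ghom (EA n) M M'"
    and f: "f \<in> ghom (EA n) P M'" and onto: "g ` carrier M = carrier M'"
  obtain N1 B1 where N1: "rep n M N1 B1" by (rule fgmod_rep[OF M(1)])
  obtain N2 B2 where N2: "rep n M' N2 B2" by (rule fgmod_rep[OF M(2)])
  obtain G where G: "mmor n N1 N2 G" "cod N1 B1 B2 g G" by (rule ghom_mat[OF N1 N2 g])
  obtain F where F: "mmor n N N2 F" "cod N B B2 f F" by (rule ghom_mat[OF P N2 f])
  obtain s where s: "dhom 0 N N1 s" "F = G * s"
    by (rule onto_mat[OF N1 N2 G onto mmorD(1)[OF F(1)] mmodD(1)[OF mN]])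
  let ?S = "avg N1 N H s (Suc n)"
  have S: "mmor n N N1 ?S" by (rule avg_mmor[OF repD(2)[OF N1] mN H s(1)])
  have GS: "G * ?S = F" unfolding avg_natural[OF G(1) order.refl] s(2)[symmetric] by (rule avg_self[OF H F(1) order.refl])
  obtain h where h: "h \<in> ghom (EA n) P M" "cod N B B1 h ?S" by (rule mat_ghom[OF P N1 S])
  have "\<forall>x\<in>carrier P. g (h x) = f x"
    using cod_unique[OF P N2 cod_compose[OF h(2) G(2) mmorD(1)[OF S]] F(2) dhom_mult[OF mmorD(1)[OF G(1)] mmorD(1)[OF S]] mmorD(1)[OF F(1)]] GS
    by simp
  then show "\<exists>h\<in>ghom (EA n) P M. \<forall>x\<in>carrier P. g (h x) = f x" using h(1) by blast
qed

lemma complexity_one_exv: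
  fixes L :: "(nat set \<Rightarrow> 'k::field, 'm) gmodule"
  assumes n: "1 \<le> n" and inf: "infinite (UNIV :: 'k set)" and L: "complexity_one (EA n) L" and N: "rep n L N B"
  shows "\<not> ffree n N" "\<exists>w. (\<exists>a\<le>n. w a \<noteq> 0) \<and> exv n w N"
proof -
  show "\<not> ffree n N" using ffree_projective[OF N] L by (auto simp: complexity_one_def)
  obtain F d \<epsilon> c where res: "minimal_free_resolution (EA n) L F d \<epsilon>" and c: "\<And>i. free_rank (EA n) (F i) \<le> c"
    using L unfolding complexity_one_def by blast
  have free: "graded_free (EA n) (F i)" and \<epsilon>: "\<epsilon> \<in> ghom (EA n) (F 0) L" "\<epsilon> ` carrier (F 0) = carrier L"
    and d: "d i \<in> ghom (EA n) (F (Suc i)) (F i)" and ex0: "d 0 ` carrier (F 1) = a_kernel (F 0) L \<epsilon>"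
    and ex: "d (Suc i) ` carrier (F (Suc (Suc i))) = a_kernel (F (Suc i)) (F i) (d i)" for i
    using res by (simp_all add: minimal_free_resolution_def)
  have "\<exists>N B H. rep n (F i) N B \<and> dsys n N H \<and> card (ix N) \<le> c * 2 ^ Suc n" for i
  proof -
    obtain N B where N: "rep n (F i) N B" "ffree n N" "card (ix N) = free_rank (EA n) (F i) * 2 ^ Suc n"
      by (rule graded_free_rep[OF free])
    moreover have "card (ix N) \<le> c * 2 ^ Suc n" unfolding N(3) by (rule mult_le_mono1[OF c])
    ultimately show ?thesis by (auto simp: ffree_dsys)
  qed
  then have "\<forall>i. \<exists>N B H. rep n (F i) N B \<and> dsys n N H \<and> card (ix N) \<le> c * 2 ^ Suc n" by (rule allI)
  then have "\<exists>N' B' H. \<forall>i. rep n (F i) (N' i) (B' i) \<and> dsys n (N' i) (H i) \<and> card (ix (N' i)) \<le> c * 2 ^ Suc n"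
    unfolding choice_iff .
  then obtain N' B' H where R: "\<And>i. rep n (F i) (N' i) (B' i)" "\<And>i. dsys n (N' i) (H i)" "\<And>i. card (ix (N' i)) \<le> c * 2 ^ Suc n"
    by blast
  \<comment> \<open>The module is prepended to its resolution, so that the augmentation becomes the
    differential with index 0.\<close>
  define X where "X k = (case k of 0 \<Rightarrow> L | Suc i \<Rightarrow> F i)" for k
  define G where "G k = (case k of 0 \<Rightarrow> N | Suc i \<Rightarrow> N' i)" for k
  define C where "C k = (case k of 0 \<Rightarrow> B | Suc i \<Rightarrow> B' i)" for k
  define e where "e k = (case k of 0 \<Rightarrow> \<epsilon> | Suc i \<Rightarrow> d i)" for k
  have rp: "rep n (X k) (G k) (C k)" for k using N R(1) by (cases k) (simp_all add: X_def G_def C_def)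
  have e: "e k \<in> ghom (EA n) (X (Suc k)) (X k)" for k using \<epsilon>(1) d by (cases k) (simp_all add: X_def e_def)
  have exact: "e (Suc k) ` carrier (X (Suc (Suc k))) = a_kernel (X (Suc k)) (X k) (e k)" for k
    using ex0 ex by (cases k) (simp_all add: X_def e_def)
  have "\<forall>k. \<exists>D. mmor n (G (Suc k)) (G k) D \<and> cod (G (Suc k)) (C (Suc k)) (C k) (e k) D"
  proof
    fix k
    show "\<exists>D. mmor n (G (Suc k)) (G k) D \<and> cod (G (Suc k)) (C (Suc k)) (C k) (e k) D"
      by (rule ghom_mat[OF rp[of "Suc k"] rp[of k] e[of k]]) (intro exI conjI)
  qed
  then have "\<exists>\<delta>. \<forall>k. mmor n (G (Suc k)) (G k) (\<delta> k) \<and> cod (G (Suc k)) (C (Suc k)) (C k) (e k) (\<delta> k)"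
    unfolding choice_iff .
  then obtain \<delta> where \<delta>: "\<And>k. mmor n (G (Suc k)) (G k) (\<delta> k)" "\<And>k. cod (G (Suc k)) (C (Suc k)) (C k) (e k) (\<delta> k)"
    by blast
  have em1: "\<delta> k * \<delta> (Suc k) = 0" for k
    by (rule exact_mat(1)[OF rp[of "Suc (Suc k)"] rp[of "Suc k"] rp[of k] \<delta>[of "Suc k"] \<delta>[of k] exact[of k]])
  have fG: "finite (ix (G k))" for k by (rule mmodD(1)[OF repD(2)[OF rp]])
  show "\<exists>w. (\<exists>a\<le>n. w a \<noteq> 0) \<and> exv n w N"
  proof -
    have "\<exists>w. (\<exists>a\<le>n. w a \<noteq> 0) \<and> exv n w (G 0)"
    proof (rule resolution_exv[where G = G and \<delta> = \<delta> and H = H and M = "c * 2 ^ Suc n" and n = n])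
      show "1 \<le> n" by (rule n)
      show "infinite (UNIV :: 'k set)" by (rule inf)
      show "mmor n (G (Suc k)) (G k) (\<delta> k)" for k by (rule \<delta>(1))
      show "\<delta> k * \<delta> (Suc k) = 0" for k by (rule em1)
      show "mmod n (G k)" for k by (rule repD(2)[OF rp])
      have o0: "e 0 ` carrier (X (Suc 0)) = carrier (X 0)" using \<epsilon>(2) by (simp add: X_def e_def)
      show "\<exists>\<sigma>. dhom 0 (G 0) (G 1) \<sigma> \<and> \<delta> 0 * \<sigma> = idm (G 0)"
        unfolding One_nat_def
        by (rule onto_mat[OF rp[of "Suc 0"] rp[of 0] \<delta>[of 0] o0 dhom_idm fG]) (intro exI conjI, assumption, simp only:)
      show "\<exists>K'. dhom q (G 0) (G (Suc (Suc k))) K' \<and> K = \<delta> (Suc k) * K'"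
        if "dhom q (G 0) (G (Suc k)) K" "\<delta> k * K = 0" for k q K
        by (rule exact_mat(2)[OF rp[of "Suc (Suc k)"] rp[of "Suc k"] rp[of k] \<delta>[of "Suc k"] \<delta>[of k] exact[of k] that(1) fG that(2)])
      show "dsys n (G (Suc k)) (H k)" for k using R(2) by (simp add: G_def)
      show "card (ix (G (Suc k))) \<le> c * 2 ^ Suc n" for k using R(3)[of k] by (simp add: G_def)
    qed
    then show ?thesis by (simp add: G_def)
  qed
qed

section \<open>Vanishing of self-extensions\<close>

lemma mat_exact:
  assumes M1: "rep n M1 N1 B1" and M2: "rep n M2 N2 B2" and M3: "rep n M3 N3 B3"
    and G: "mmor n N1 N2 G" "cod N1 B1 B2 g G" and F: "mmor n N2 N3 F" "cod N2 B2 B3 f F"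
    and z: "F * G = 0" and ex: "\<And>v. v \<in> vec N2 \<Longrightarrow> mv F v = (\<lambda>_. 0) \<Longrightarrow> \<exists>u\<in>vec N1. v = mv G u"
  shows "g ` carrier M1 = a_kernel M2 M3 f"
proof -
  note dG = mmorD(1)[OF G(1)] and dF = mmorD(1)[OF F(1)]
  have gB: "g (B1 u) = B2 (mv G u)" if "u \<in> vec N1" for u using G(2) that by (simp add: cod_def)
  have ker: "B2 v \<in> a_kernel M2 M3 f \<longleftrightarrow> mv F v = (\<lambda>_. 0)" if v: "v \<in> vec N2" for v
  proof -
    have "f (B2 v) = B3 (mv F v)" using F(2) v by (simp add: cod_def)
    then show ?thesis unfolding a_kernel_def' rep_zero[OF M3, symmetric]
      using repD(8)[OF M2 v] repD(9)[OF M3 mv_vec[OF dF] vec_closed(3)] by simp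
  qed
  show ?thesis
  proof
    show "g ` carrier M1 \<subseteq> a_kernel M2 M3 f"
    proof
      fix y assume "y \<in> g ` carrier M1"
      then obtain x where x: "x \<in> carrier M1" "y = g x" by blast
      then obtain u where u: "u \<in> vec N1" "x = B1 u" using repD(10)[OF M1] by blast
      have "mv F (mv G u) = (\<lambda>_. 0)" unfolding mv_mult[symmetric] z by simp
      then show "y \<in> a_kernel M2 M3 f" unfolding x(2) u(2) gB[OF u(1)] ker[OF mv_vec[OF dG]] .
    qed
    show "a_kernel M2 M3 f \<subseteq> g ` carrier M1"
    proof
      fix y assume y: "y \<in> a_kernel M2 M3 f"
      then have "y \<in> carrier M2" by (simp add: a_kernel_def')
      then obtain v where v: "v \<in> vec N2" "y = B2 v" using repD(10)[OF M2] by blast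
      then have "mv F v = (\<lambda>_. 0)" using y ker[OF v(1)] by simp
      then obtain u where u: "u \<in> vec N1" "v = mv G u" using ex[OF v(1)] by blast
      have "y = g (B1 u)" using v(2) u(2) gB[OF u(1)] by simp
      then show "y \<in> g ` carrier M1" using repD(8)[OF M1 u(1)] by blast
    qed
  qed
qed

text \<open>A generalised inverse g of q gives the linear projection 1 - g q onto the kernel. The
  free cover built on this projection maps into the kernel and reaches all of it.\<close>

lemma kernel_cover:
  assumes N: "mmod n N" and q: "mmor n N N' q"
  shows "\<exists>P D. mmod n P \<and> ffree n P \<and> mmor n P N D \<and> q * D = 0 \<and>
    (\<forall>v\<in>vec N. mv q v = (\<lambda>_. 0) \<longrightarrow> (\<exists>u\<in>vec P. v = mv D u))"
proof -
  note dq = mmorD(1)[OF q]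
  obtain g where g: "dhom 0 N' N g" "q * g * q = q" using vn_inverse[OF mmodD(1)[OF N] dq] by blast
  define \<pi> where "\<pi> = idm N - g * q"
  have d\<pi>: "dhom 0 N N \<pi>" unfolding \<pi>_def by (rule dhom_diff[OF dhom_idm dhom_mult[OF g(1) dq]]) simp
  have q\<pi>: "q * \<pi> = 0" unfolding \<pi>_def right_diff_distrib dhom_mult_idm[OF dq] mult.assoc[symmetric] g(2) by simp
  obtain P D \<iota> where P: "mmod n P" "ffree n P" "mmor n P N D" "dhom 0 N P \<iota>" "D * \<iota> = \<pi>"
    and kill: "\<And>N' f. mmor n N N' f \<Longrightarrow> f * \<pi> = 0 \<Longrightarrow> f * D = 0"
    using free_cover[OF N mmodD(1)[OF N] d\<pi>] by blast
  have "\<exists>u\<in>vec P. v = mv D u" if v: "v \<in> vec N" and z: "mv q v = (\<lambda>_. 0)" for v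
  proof (rule bexI)
    show "mv \<iota> v \<in> vec P" by (rule mv_vec[OF P(4)])
    have "mv (\<pi> + g * q) v = v" unfolding \<pi>_def using mv_idm[OF v] by simp
    then have "mv \<pi> v = v" unfolding mv_add_left mv_mult z by simp
    then show "v = mv D (mv \<iota> v)" unfolding mv_mult[symmetric] P(5) by simp
  qed
  then show ?thesis using P kill[OF q q\<pi>] by blast
qed

text \<open>\<open>Ext\<close> takes its resolution from a choice operator, so its value carries
  information only once some resolution is known to exist in the given universe.\<close>

lemma projective_resolution_exists:
  fixes Y :: "(nat set \<Rightarrow> 'k::field, 'm) gmodule"
  assumes U: "universal n TYPE('k) TYPE('m)" and Y: "rep n Y N B"
  shows "\<exists>P d \<epsilon>. projective_resolution (EA n) Y P d \<epsilon>"
proof -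
  \<comment> \<open>A state consists of a term, the target of its differential, and the
    differential. Starting from the zero map on N makes all of N the first kernel, so the first
    cover is the augmentation.\<close>
  let ?Q = "\<lambda>(A :: 'k mm, T :: 'k mm, q). mmod n A \<and> mmod n T \<and> mmor n A T q"
  let ?R = "\<lambda>(A :: 'k mm, T :: 'k mm, q) (A', T', q'). T' = A \<and> ffree n A' \<and> q * q' = 0 \<and>
      (\<forall>v\<in>vec A. mv q v = (\<lambda>_. 0) \<longrightarrow> (\<exists>u\<in>vec A'. v = mv q' u))"
  note mN = repD(2)[OF Y]
  have "\<exists>f. \<forall>k. (?Q (f k) \<and> (k = 0 \<longrightarrow> f k = (N, N, 0))) \<and> ?R (f k) (f (Suc k))"
  proof (rule dependent_nat_choice)
    show "\<exists>x. ?Q x \<and> ((0::nat) = 0 \<longrightarrow> x = (N, N, 0))" using mN mmor_0 by (intro exI[of _ "(N, N, 0)"]) simp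
    fix x :: "'k mm \<times> 'k mm \<times> 'k mtx" and k :: nat
    assume x: "?Q x \<and> (k = 0 \<longrightarrow> x = (N, N, 0))"
    obtain A T q where xe: "x = (A, T, q)" by (cases x)
    have A: "mmod n A" "mmor n A T q" using x unfolding xe by auto
    obtain P D where "mmod n P \<and> ffree n P \<and> mmor n P A D \<and> q * D = 0 \<and>
        (\<forall>v\<in>vec A. mv q v = (\<lambda>_. 0) \<longrightarrow> (\<exists>u\<in>vec P. v = mv D u))" using kernel_cover[OF A] by blast
    then show "\<exists>y. (?Q y \<and> (Suc k = 0 \<longrightarrow> y = (N, N, 0))) \<and> ?R x y"
      unfolding xe using A by (intro exI[of _ "(P, A, D)"]) simp
  qed
  then obtain f where f: "\<And>k. (?Q (f k) \<and> (k = 0 \<longrightarrow> f k = (N, N, 0))) \<and> ?R (f k) (f (Suc k))" by blast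
  define A where "A k = fst (f k)" for k
  define T where "T k = fst (snd (f k))" for k
  define q where "q k = snd (snd (f k))" for k
  have fe: "f k = (A k, T k, q k)" for k by (simp add: A_def T_def q_def)
  have f0: "f 0 = (N, N, 0)" using f[of 0] by simp
  have A0: "A 0 = N" "q 0 = 0" by (simp_all add: A_def q_def f0)
  have mA: "mmod n (A k)" for k using f[of k] unfolding fe[of k] by simp
  have st: "T (Suc k) = A k \<and> ffree n (A (Suc k)) \<and> q k * q (Suc k) = 0 \<and>
      (\<forall>v\<in>vec (A k). mv (q k) v = (\<lambda>_. 0) \<longrightarrow> (\<exists>u\<in>vec (A (Suc k)). v = mv (q (Suc k)) u))" for k
    using f[of k] unfolding fe[of k] fe[of "Suc k"] by simp
  have mq: "mmor n (A (Suc k)) (A k) (q (Suc k))" for k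
    using f[of "Suc k"] st[of k] unfolding fe[of "Suc k"] by simp
  have "\<forall>k. \<exists>x. rep n (fst x :: (nat set \<Rightarrow> 'k, 'm) gmodule) (A k) (snd x) \<and> (k = 0 \<longrightarrow> x = (Y, B))"
  proof
    fix k
    show "\<exists>x. rep n (fst x :: (nat set \<Rightarrow> 'k, 'm) gmodule) (A k) (snd x) \<and> (k = 0 \<longrightarrow> x = (Y, B))"
    proof (cases k)
      case 0
      then show ?thesis using Y A0 by (intro exI[of _ "(Y, B)"]) simp
    next
      case (Suc i)
      obtain M :: "(nat set \<Rightarrow> 'k, 'm) gmodule" and C where "rep n M (A k) C" by (rule universalD[OF U mA])
      then show ?thesis using Suc by (intro exI[of _ "(M, C)"]) simp
    qed
  qed
  then obtain x where x: "\<And>k. rep n (fst (x k) :: (nat set \<Rightarrow> 'k, 'm) gmodule) (A k) (snd (x k)) \<and> (k = 0 \<longrightarrow> x k = (Y, B))"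
    unfolding choice_iff by (elim exE) blast
  define M where "M k = fst (x k)" for k
  define C where "C k = snd (x k)" for k
  have rp: "rep n (M k) (A k) (C k)" for k using x by (simp add: M_def C_def)
  have M0: "M 0 = Y" using x[of 0] by (simp add: M_def)
  have "\<forall>k. \<exists>e. e \<in> ghom (EA n) (M (Suc k)) (M k) \<and> cod (A (Suc k)) (C (Suc k)) (C k) e (q (Suc k))"
  proof
    fix k
    show "\<exists>e. e \<in> ghom (EA n) (M (Suc k)) (M k) \<and> cod (A (Suc k)) (C (Suc k)) (C k) e (q (Suc k))"
      by (rule mat_ghom[OF rp[of "Suc k"] rp[of k] mq[of k]]) (intro exI conjI)
  qed
  then have "\<exists>e. \<forall>k. e k \<in> ghom (EA n) (M (Suc k)) (M k) \<and> cod (A (Suc k)) (C (Suc k)) (C k) (e k) (q (Suc k))"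
    unfolding choice_iff .
  then obtain e where e: "\<And>k. e k \<in> ghom (EA n) (M (Suc k)) (M k)"
    "\<And>k. cod (A (Suc k)) (C (Suc k)) (C k) (e k) (q (Suc k))"
    by blast
  have ex: "e (Suc k) ` carrier (M (Suc (Suc k))) = a_kernel (M (Suc k)) (M k) (e k)" for k
    by (rule mat_exact[OF rp[of "Suc (Suc k)"] rp[of "Suc k"] rp[of k] mq[of "Suc k"] e(2)[of "Suc k"] mq[of k] e(2)[of k]])
      (use st[of "Suc k"] in blast)+
  have onto: "e 0 ` carrier (M (Suc 0)) = carrier (M 0)"
  proof
    show "e 0 ` carrier (M (Suc 0)) \<subseteq> carrier (M 0)" using ghomD(1)[OF e(1)] by blast
    show "carrier (M 0) \<subseteq> e 0 ` carrier (M (Suc 0))"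
    proof
      fix y assume "y \<in> carrier (M 0)"
      then obtain v where v: "v \<in> vec (A 0)" "y = C 0 v" using repD(10)[OF rp] by blast
      have "mv (q 0) v = (\<lambda>_. 0)" by (simp add: A0)
      then obtain u where u: "u \<in> vec (A (Suc 0))" "v = mv (q (Suc 0)) u" using st[of 0] v(1) by blast
      have "e 0 (C (Suc 0) u) = y" using e(2)[of 0] u v(2) by (simp add: cod_def)
      then show "y \<in> e 0 ` carrier (M (Suc 0))" using repD(8)[OF rp u(1)] by blast
    qed
  qed
  have "projective_resolution (EA n) Y (\<lambda>k. M (Suc k)) (\<lambda>k. e (Suc k)) (e 0)"
    unfolding projective_resolution_def
  proof (intro conjI allI)
    show "projective (EA n) (M (Suc k))" for k by (rule ffree_projective[OF rp]) (use st[of k] in blast)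
    show "e 0 \<in> ghom (EA n) (M (Suc 0)) Y" using e(1)[of 0] by (simp only: M0)
    show "e (Suc k) \<in> ghom (EA n) (M (Suc (Suc k))) (M (Suc k))" for k by (rule e(1))
    show "e 0 ` carrier (M (Suc 0)) = carrier Y" using onto by (simp only: M0)
    show "e (Suc 0) ` carrier (M (Suc 1)) = a_kernel (M (Suc 0)) Y (e 0)" using ex[of 0] by (simp only: M0 One_nat_def)
    show "e (Suc (Suc k)) ` carrier (M (Suc (Suc (Suc k)))) = a_kernel (M (Suc (Suc k))) (M (Suc k)) (e (Suc k))" for k
      by (rule ex)
  qed
  then show ?thesis by blast
qed

text \<open>The zero map is a coboundary, so a cocycle lies in its own coset; in a quotient with a
  single element this coset is the group of coboundaries.\<close>

lemma Ext_trivialD: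
  assumes ex: "\<exists>P d \<epsilon>. projective_resolution (EA n) Y P d \<epsilon>" and N: "rep n Y N B"
    and triv: "carrier (Ext (EA n) 1 Y Y) = {\<one>\<^bsub>Ext (EA n) 1 Y Y\<^esub>}"
  obtains P d \<epsilon> where "projective_resolution (EA n) Y P d \<epsilon>"
    "\<forall>f. f \<in> ghom (EA n) (P 1) Y \<longrightarrow> (\<forall>x\<in>carrier (P 2). f (d 1 x) = \<zero>\<^bsub>Y\<^esub>) \<longrightarrow>
       (\<exists>g\<in>ghom (EA n) (P 0) Y. \<forall>x\<in>carrier (P 1). f x = g (d 0 x))"
proof -
  define t where "t = (SOME (P, d, \<epsilon>). projective_resolution (EA n) Y P d \<epsilon>)"
  obtain P d \<epsilon> where t: "t = (P, d, \<epsilon>)" by (cases t)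
  have "case t of (P, d, \<epsilon>) \<Rightarrow> projective_resolution (EA n) Y P d \<epsilon>"
    unfolding t_def by (rule someI_ex) (use ex in auto)
  then have res: "projective_resolution (EA n) Y P d \<epsilon>" by (simp add: t)
  define G where "G = (Hom_group (EA n) (P 1) Y)\<lparr>carrier := cocycles (EA n) P d Y 1\<rparr>"
  define W where "W = coboundaries (EA n) P d Y 1"
  have E: "Ext (EA n) 1 Y Y = G Mod W"
    unfolding Ext_def t_def[symmetric] t by (simp add: G_def W_def)
  interpret Y: graded_right_module "EA n" Y by (rule repD(1)[OF N])
  have d: "d i \<in> ghom (EA n) (P (Suc i)) (P i)" and pr: "projective (EA n) (P i)" for i
    using res by (simp_all add: projective_resolution_def)
  have fg: "P i \<in> fgmod (EA n)" for i using pr by (simp add: projective_def)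
  obtain N0 B0 where N0: "rep n (P 0) N0 B0" by (rule fgmod_rep[OF fg])
  obtain z where z: "z \<in> ghom (EA n) (P 0) Y" "cod N0 B0 B z 0" by (rule mat_ghom[OF N0 N mmor_0])
  have z0: "z x = \<zero>\<^bsub>Y\<^esub>" if x: "x \<in> carrier (P 0)" for x
  proof -
    obtain u where "u \<in> vec N0" "x = B0 u" using repD(10)[OF N0 x] by blast
    then show ?thesis using z(2) rep_zero[OF N] by (simp add: cod_def)
  qed
  have zW: "(\<lambda>x\<in>carrier (P 1). \<zero>\<^bsub>Y\<^esub>) \<in> W"
  proof -
    have "coboundary P d 0 z \<in> W" using z(1) by (simp add: W_def coboundaries_def Hom_group_def)
    moreover have "coboundary P d 0 z = (\<lambda>x\<in>carrier (P 1). \<zero>\<^bsub>Y\<^esub>)"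
      using ghomD(1)[OF d[of 0]] z0 by (auto simp: coboundary_def compose_def restrict_def fun_eq_iff)
    ultimately show ?thesis by simp
  qed
  show thesis
  proof (rule that[OF res], intro allI impI)
    fix f assume f: "f \<in> ghom (EA n) (P 1) Y" and c: "\<forall>x\<in>carrier (P 2). f (d 1 x) = \<zero>\<^bsub>Y\<^esub>"
    have "coboundary P d 1 f = (\<lambda>x\<in>carrier (P (Suc 1)). \<zero>\<^bsub>Y\<^esub>)"
      using c by (auto simp: coboundary_def compose_def restrict_def fun_eq_iff numeral_2_eq_2)
    then have "f \<in> carrier G" using f by (simp add: G_def cocycles_def kernel_def Hom_group_def)
    then have "W #>\<^bsub>G\<^esub> f \<in> carrier (G Mod W)" unfolding carrier_FactGroup by blast
    then have "W #>\<^bsub>G\<^esub> f = W" using triv unfolding E by simp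
    moreover have "(\<lambda>x\<in>carrier (P 1). \<zero>\<^bsub>Y\<^esub>) \<otimes>\<^bsub>G\<^esub> f = f"
    proof
      fix x
      show "((\<lambda>x\<in>carrier (P 1). \<zero>\<^bsub>Y\<^esub>) \<otimes>\<^bsub>G\<^esub> f) x = f x"
        using ghomD(1)[OF f, of x] ghomD(5)[OF f] by (cases "x \<in> carrier (P 1)") (auto simp: G_def Hom_group_def extensional_def)
    qed
    ultimately have "f \<in> W" using zW unfolding r_coset_def by (metis (no_types, lifting) UN_I insertI1)
    then obtain g where g: "g \<in> ghom (EA n) (P 0) Y" "f = coboundary P d 0 g"
      by (auto simp: W_def coboundaries_def Hom_group_def)
    have "f x = g (d 0 x)" if "x \<in> carrier (P 1)" for x using that unfolding g(2) by (simp add: coboundary_def compose_def)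
    then show "\<exists>g\<in>ghom (EA n) (P 0) Y. \<forall>x\<in>carrier (P 1). f x = g (d 0 x)" using g(1) by blast
  qed
qed

text \<open>The matrices \<phi> define an extension E of N by N. Lifting the augmentation e through
  E gives a linear map \<beta> whose composite with the first differential D0 is a cocycle. If it
  equals \<Gamma> D0 for a morphism \<Gamma>, then \<beta> - \<Gamma> kills the kernel of e and
  factors as D e; the defect of \<beta> becomes the commutator of D with the variables.\<close>

lemma Ext_trivial_rigid:
  fixes Y :: "(nat set \<Rightarrow> 'k::field, 'm) gmodule"
  assumes U: "universal n TYPE('k) TYPE('m)" and Y: "rep n Y N B"
    and triv: "carrier (Ext (EA n) 1 Y Y) = {\<one>\<^bsub>Ext (EA n) 1 Y Y\<^esub>}"
  shows "rigid n N"
  unfolding rigid_def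
proof (intro allI impI)
  fix \<phi> assume \<phi>: "(\<forall>a\<le>n. dhom 1 N N (\<phi> a)) \<and> (\<forall>a\<le>n. \<forall>b\<le>n. ac N a * \<phi> b + \<phi> b * ac N a = 0)"
  note mN = repD(2)[OF Y]
  obtain P d \<epsilon> where res: "projective_resolution (EA n) Y P d \<epsilon>"
    and cob: "\<forall>f. f \<in> ghom (EA n) (P 1) Y \<longrightarrow> (\<forall>x\<in>carrier (P 2). f (d 1 x) = \<zero>\<^bsub>Y\<^esub>) \<longrightarrow>
       (\<exists>g\<in>ghom (EA n) (P 0) Y. \<forall>x\<in>carrier (P 1). f x = g (d 0 x))"
    by (rule Ext_trivialD[OF projective_resolution_exists[OF U Y] Y triv])
  have pr: "projective (EA n) (P i)" and \<epsilon>: "\<epsilon> \<in> ghom (EA n) (P 0) Y" "\<epsilon> ` carrier (P 0) = carrier Y"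
    and d: "d i \<in> ghom (EA n) (P (Suc i)) (P i)" and ex0: "d 0 ` carrier (P 1) = a_kernel (P 0) Y \<epsilon>"
    and ex: "d (Suc i) ` carrier (P (Suc (Suc i))) = a_kernel (P (Suc i)) (P i) (d i)" for i
    using res by (simp_all add: projective_resolution_def)
  have fg: "P i \<in> fgmod (EA n)" for i using pr by (simp add: projective_def)
  obtain N0 B0 where N0: "rep n (P 0) N0 B0" by (rule fgmod_rep[OF fg])
  obtain N1 B1 where N1: "rep n (P 1) N1 B1" by (rule fgmod_rep[OF fg])
  have d0: "d 0 \<in> ghom (EA n) (P 1) (P 0)" using d[of 0] by simp
  obtain e where e: "mmor n N0 N e" "cod N0 B0 B \<epsilon> e" by (rule ghom_mat[OF N0 Y \<epsilon>(1)])
  obtain D0 where D0: "mmor n N1 N0 D0" "cod N1 B1 B0 (d 0) D0" by (rule ghom_mat[OF N1 N0 d0])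
  note em = exact_mat[OF N1 N0 Y D0 e ex0]
  note de = mmorD(1)[OF e(1)] and dD0 = mmorD(1)[OF D0(1)]
  note f0 = mmodD(1)[OF repD(2)[OF N0]] and fN = mmodD(1)[OF mN]
  let ?E = "extm N N \<phi>"
  have mE: "mmod n ?E"
  proof (rule mmod_extm[OF mN mN])
    show "dhom 1 N N (\<phi> a)" if "a \<le> n" for a using \<phi> that by blast
    have c: "ac N a * \<phi> b + \<phi> b * ac N a = 0" if "a \<le> n" "b \<le> n" for a b using \<phi> that by blast
    show "ac N a * \<phi> a + \<phi> a * ac N a = 0" if "a \<le> n" for a using c that by blast
    show "ac N a * \<phi> b + \<phi> a * ac N b + (ac N b * \<phi> a + \<phi> b * ac N a) = 0" if "a \<le> n" "b \<le> n" for a b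
    proof -
      have "ac N a * \<phi> b + \<phi> a * ac N b + (ac N b * \<phi> a + \<phi> b * ac N a) =
          (ac N a * \<phi> b + \<phi> b * ac N a) + (ac N b * \<phi> a + \<phi> a * ac N b)" by (simp only: add_ac)
      then show ?thesis using c that by simp
    qed
  qed
  obtain M :: "(nat set \<Rightarrow> 'k, 'm) gmodule" and C where M: "rep n M ?E C" by (rule universalD[OF U mE])
  define p where "p = idm N * proj 1"
  have dp: "dhom 0 ?E N p" unfolding p_def by (rule dhom_extm(4)[OF dhom_idm])
  have dN: "dhom 1 N N (ac N a)" if "a \<le> n" for a by (rule mmodD(2)[OF mN that])
  have pa: "p * ac ?E a = ac N a * proj 1" "ac N a * p = ac N a * proj 1" if a: "a \<le> n" for a
  proof -
    show "p * ac ?E a = ac N a * proj 1"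
      unfolding p_def ac_extm mult.assoc by (simp add: distrib_left mult.assoc[symmetric] idm_mult_dhom[OF dN[OF a]])
    show "ac N a * p = ac N a * proj 1"
      unfolding p_def mult.assoc[symmetric] dhom_mult_idm[OF dN[OF a]] ..
  qed
  have pm: "mmor n ?E N p" unfolding mmor_def using dp pa by simp
  obtain \<pi> where \<pi>: "\<pi> \<in> ghom (EA n) M Y" "cod ?E C B \<pi> p" by (rule mat_ghom[OF M Y pm])
  have "\<pi> ` carrier M = carrier Y"
  proof
    show "\<pi> ` carrier M \<subseteq> carrier Y" using ghomD(1)[OF \<pi>(1)] by blast
    show "carrier Y \<subseteq> \<pi> ` carrier M"
    proof
      fix y assume "y \<in> carrier Y"
      then obtain v where v: "v \<in> vec N" "y = B v" using repD(10)[OF Y] by blast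
      have di: "dhom 0 N ?E (incl 1 * idm N)" by (rule dhom_extm(2)[OF dhom_idm])
      have "p * (incl 1 * idm N) = idm N" unfolding p_def by (simp add: mult.assoc)
      then have "mv p (mv (incl 1 * idm N) v) = v" using mv_idm[OF v(1)] by (simp only: mv_mult[symmetric])
      moreover have "mv (incl 1 * idm N) v \<in> vec ?E" by (rule mv_vec[OF di])
      ultimately have "\<pi> (C (mv (incl 1 * idm N) v)) = y" "C (mv (incl 1 * idm N) v) \<in> carrier M"
        using \<pi>(2) repD(8)[OF M] v(2) by (simp_all add: cod_def)
      then show "y \<in> \<pi> ` carrier M" by blast
    qed
  qed
  then obtain h where h: "h \<in> ghom (EA n) (P 0) M" "\<forall>x\<in>carrier (P 0). \<pi> (h x) = \<epsilon> x"
    using pr[of 0] rep_fgmod[OF M] rep_fgmod[OF Y] \<pi>(1) \<epsilon>(1) unfolding projective_def by blast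
  obtain \<eta> where \<eta>: "mmor n N0 ?E \<eta>" "cod N0 B0 C h \<eta>" by (rule ghom_mat[OF N0 M h(1)])
  note d\<eta> = mmorD(1)[OF \<eta>(1)]
  have "p * \<eta> = e"
    using cod_unique[OF N0 Y cod_compose[OF \<eta>(2) \<pi>(2) d\<eta>] e(2) dhom_mult[OF dp d\<eta>] de] h(2) by simp
  then have pe: "proj 1 * \<eta> = e" unfolding p_def using idm_mult_dhom[OF dhom_extm(8)[OF d\<eta>]] by (simp add: mult.assoc)
  \<comment> \<open>The submodule coordinate of the lift. It fails to be a morphism by
    \<open>\<phi> a * e\<close>, and this failure disappears after composition with D0.\<close>
  define \<beta> where "\<beta> = proj 0 * \<eta>"
  have d\<beta>: "dhom 0 N0 N \<beta>" unfolding \<beta>_def by (rule dhom_extm(7)[OF d\<eta>])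
  have \<beta>x: "\<beta> * ac N0 a = ac N a * \<beta> + \<phi> a * e" if a: "a \<le> n" for a
  proof -
    have "\<beta> * ac N0 a = proj 0 * (ac ?E a * \<eta>)" unfolding \<beta>_def mult.assoc mmorD(2)[OF \<eta>(1) a] ..
    also have "\<dots> = (proj 0 * ac ?E a) * \<eta>" by (simp only: mult.assoc)
    also have "proj 0 * ac ?E a = ac N a * proj 0 + \<phi> a * proj 1" unfolding ac_extm by (simp add: distrib_left)
    also have "(ac N a * proj 0 + \<phi> a * proj 1) * \<eta> = ac N a * \<beta> + \<phi> a * e"
      unfolding distrib_right mult.assoc pe \<beta>_def ..
    finally show ?thesis .
  qed
  have \<gamma>: "mmor n N1 N (\<beta> * D0)" unfolding mmor_def
  proof (intro conjI allI impI)
    show "dhom 0 N1 N (\<beta> * D0)" by (rule dhom_mult[OF d\<beta> dD0]) simp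
    fix a assume a: "a \<le> n"
    have "\<beta> * D0 * ac N1 a = \<beta> * ac N0 a * D0" unfolding mult.assoc mmorD(2)[OF D0(1) a] ..
    also have "\<dots> = ac N a * (\<beta> * D0) + \<phi> a * (e * D0)" unfolding \<beta>x[OF a] by (simp only: distrib_right mult.assoc)
    finally show "\<beta> * D0 * ac N1 a = ac N a * (\<beta> * D0)" using em(1) by simp
  qed
  obtain f where f: "f \<in> ghom (EA n) (P 1) Y" "cod N1 B1 B f (\<beta> * D0)" by (rule mat_ghom[OF N1 Y \<gamma>])
  have "f (d 1 x) = \<zero>\<^bsub>Y\<^esub>" if x: "x \<in> carrier (P 2)" for x
  proof -
    have "d 1 x \<in> d (Suc 0) ` carrier (P (Suc (Suc 0)))" using x by (simp add: numeral_2_eq_2)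
    then have k: "d 1 x \<in> carrier (P 1)" "d 0 (d 1 x) = \<zero>\<^bsub>P 0\<^esub>" unfolding ex[of 0] by (auto simp: a_kernel_def')
    obtain u where u: "u \<in> vec N1" "d 1 x = B1 u" using repD(10)[OF N1 k(1)] by blast
    have "B0 (mv D0 u) = B0 (\<lambda>_. 0)" using D0(2) u k(2) rep_zero[OF N0] by (simp add: cod_def)
    then have "mv D0 u = (\<lambda>_. 0)" using repD(9)[OF N0 mv_vec[OF dD0] vec_closed(3)] by blast
    then have "f (B1 u) = B (\<lambda>_. 0)" using f(2) u(1) by (simp add: cod_def mv_mult)
    then show ?thesis using u(2) rep_zero[OF Y] by simp
  qed
  then obtain g where g: "g \<in> ghom (EA n) (P 0) Y" "\<forall>x\<in>carrier (P 1). f x = g (d 0 x)"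
    using cob f(1) by blast
  obtain \<Gamma> where \<Gamma>: "mmor n N0 N \<Gamma>" "cod N0 B0 B g \<Gamma>" by (rule ghom_mat[OF N0 Y g(1)])
  note d\<Gamma> = mmorD(1)[OF \<Gamma>(1)]
  have "\<beta> * D0 = \<Gamma> * D0"
    using cod_unique[OF N1 Y f(2) cod_compose[OF D0(2) \<Gamma>(2) dD0] mmorD(1)[OF \<gamma>] dhom_mult[OF d\<Gamma> dD0]] g(2) by simp
  then have diff: "(\<beta> - \<Gamma>) * D0 = 0" by (simp add: left_diff_distrib)
  have d\<theta>: "dhom 0 N0 N (\<beta> - \<Gamma>)" by (rule dhom_diff[OF d\<beta> d\<Gamma>])
  obtain \<sigma> where \<sigma>: "dhom 0 N N0 \<sigma>" "idm N = e * \<sigma>" by (rule onto_mat[OF N0 Y e \<epsilon>(2) dhom_idm fN])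
  \<comment> \<open>\<sigma> is only a linear section of e, but the choice does not matter, since
    \<beta> - \<Gamma> vanishes on the kernel of e; hence D e = \<beta> - \<Gamma>.\<close>
  define D where "D = (\<beta> - \<Gamma>) * \<sigma>"
  have dD: "dhom 0 N N D" unfolding D_def by (rule dhom_mult[OF d\<theta> \<sigma>(1)]) simp
  have De: "D * e = \<beta> - \<Gamma>"
  proof -
    have dK: "dhom 0 N0 N0 (idm N0 - \<sigma> * e)" by (rule dhom_diff[OF dhom_idm dhom_mult[OF \<sigma>(1) de]]) simp
    have "e * (idm N0 - \<sigma> * e) = 0"
      unfolding right_diff_distrib dhom_mult_idm[OF de] mult.assoc[symmetric] \<sigma>(2)[symmetric] idm_mult_dhom[OF de] by simp
    from em(2)[OF dK f0 this] obtain K where K: "idm N0 - \<sigma> * e = D0 * K" by blast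
    have "(\<beta> - \<Gamma>) * (idm N0 - \<sigma> * e) = 0" unfolding K mult.assoc[symmetric] diff by simp
    then show ?thesis unfolding right_diff_distrib dhom_mult_idm[OF d\<theta>] D_def by (simp add: mult.assoc)
  qed
  have "D * ac N a - ac N a * D = \<phi> a" if a: "a \<le> n" for a
  proof -
    have d\<phi>: "dhom 1 N N (\<phi> a)" using \<phi> a by blast
    have t: "z * e * \<sigma> = z" if "dhom q N N z" for z and q unfolding mult.assoc \<sigma>(2)[symmetric] by (rule dhom_mult_idm[OF that])
    have "D * ac N a * e = D * e * ac N0 a" unfolding mult.assoc mmorD(2)[OF e(1) a] ..
    also have "\<dots> = (\<beta> * ac N0 a) - \<Gamma> * ac N0 a" unfolding De left_diff_distrib ..
    also have "\<dots> = ac N a * (\<beta> - \<Gamma>) + \<phi> a * e" unfolding \<beta>x[OF a] mmorD(2)[OF \<Gamma>(1) a] by (simp add: right_diff_distrib)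
    also have "\<dots> = (ac N a * D + \<phi> a) * e" unfolding De[symmetric] distrib_right mult.assoc ..
    finally have "D * ac N a * e * \<sigma> = (ac N a * D + \<phi> a) * e * \<sigma>" by simp
    then have "D * ac N a = ac N a * D + \<phi> a"
      unfolding t[OF dhom_mult[OF dD dN[OF a] refl]] t[OF dhom_add[OF dhom_mult[OF dN[OF a] dD refl, unfolded add_0_right] d\<phi>]] .
    then show ?thesis by simp
  qed
  then show "\<exists>D. dhom 0 N N D \<and> (\<forall>a\<le>n. D * ac N a - ac N a * D = \<phi> a)" using dD by blast
qed

section \<open>Auslander-Reiten components\<close>

text \<open>The invariant carried along the component. Non-freeness belongs to it because the
  transfer of exactness starts from a coordinate class that does not kill the module, and
  \<open>free_not_adjacent\<close> passes it on.\<close>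

definition exact_at :: "nat \<Rightarrow> (nat \<Rightarrow> 'k::field) \<Rightarrow> (nat set \<Rightarrow> 'k, 'm) gmodule \<Rightarrow> bool" where
  "exact_at n w M \<longleftrightarrow> (\<exists>N B. rep n M N B \<and> indec n N \<and> exv n w N \<and> \<not> ffree n N)"

lemma exact_at_iso:
  assumes w: "exact_at n w M" and M': "M' \<in> fgmod (EA n)" and iso: "giso (EA n) M M' \<or> giso (EA n) M' M"
  shows "exact_at n w M'"
proof -
  obtain N B where N: "rep n M N B" "indec n N" "exv n w N" "\<not> ffree n N" using w by (auto simp: exact_at_def)
  obtain N' B' where N': "rep n M' N' B'" by (rule fgmod_rep[OF M'])
  have "\<exists>F G. mmor n N N' F \<and> mmor n N' N G \<and> G * F = idm N \<and> F * G = idm N'"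
    using iso unfolding giso_def
  proof (elim disjE bexE)
    fix f assume "f \<in> ghom (EA n) M M'" "bij_betw f (carrier M) (carrier M')"
    then show ?thesis by (rule rep_bijective_inverse[OF N(1) N']) blast
  next
    fix f assume "f \<in> ghom (EA n) M' M" "bij_betw f (carrier M') (carrier M)"
    then show ?thesis by (rule rep_bijective_inverse[OF N' N(1)]) blast
  qed
  then obtain F G where F: "mmor n N N' F" and G: "mmor n N' N G" and GF: "G * F = idm N" and FG: "F * G = idm N'" by blast
  note dF = mmorD(1)[OF F] and dG = mmorD(1)[OF G]
  have GFu: "mv G (mv F u) = u" if "u \<in> vec N" for u unfolding mv_mult[symmetric] GF by (rule mv_idm[OF that])
  have FGu: "mv F (mv G u) = u" if "u \<in> vec N'" for u unfolding mv_mult[symmetric] FG by (rule mv_idm[OF that])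
  \<comment> \<open>The same matrix module serves both modules with a changed coordinate map, so its
    properties need no transport.\<close>
  have "rep n M' N (\<lambda>u. B' (mv F u))" unfolding rep_def
  proof (intro conjI allI ballI impI)
    show "graded_right_module (EA n) M'" by (rule repD(1)[OF N'])
    show "mmod n N" by (rule repD(2)[OF N(1)])
    have "bij_betw (mv F) (vec N) (vec N')"
      by (rule bij_betw_byWitness[where f' = "mv G"]) (use GFu FGu mv_vec[OF dF] mv_vec[OF dG] in auto)
    from bij_betw_trans[OF this repD(3)[OF N']]
    show "bij_betw (\<lambda>u. B' (mv F u)) (vec N) (carrier M')" by (simp add: comp_def)
    show "B' (mv F (\<lambda>i. u i + v i)) = B' (mv F u) \<oplus>\<^bsub>M'\<^esub> B' (mv F v)" for u v
      unfolding mv_add by (rule repD(4)[OF N' mv_vec[OF dF] mv_vec[OF dF]])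
    show "kk c \<odot>\<^bsub>M'\<^esub> B' (mv F u) = B' (mv F (\<lambda>i. c * u i))" for c u
      unfolding mv_cmult by (rule repD(5)[OF N' mv_vec[OF dF]])
    show "(\<lambda>u. B' (mv F u)) ` vecd N i = mcomp M' i" for i
    proof -
      have F0: "mv F u \<in> vecd N' i" if "u \<in> vecd N i" for u using mv_vecd[OF dF that] by simp
      have G0: "mv G u \<in> vecd N i" if "u \<in> vecd N' i" for u using mv_vecd[OF dG that] by simp
      have "mv F ` vecd N i = vecd N' i"
      proof
        show "mv F ` vecd N i \<subseteq> vecd N' i" using F0 by blast
        show "vecd N' i \<subseteq> mv F ` vecd N i"
        proof
          fix u assume u: "u \<in> vecd N' i"
          then have "u = mv F (mv G u)" using FGu vecd_vec by fastforce
          then show "u \<in> mv F ` vecd N i" using G0[OF u] by (rule image_eqI)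
        qed
      qed
      then have "B' ` mv F ` vecd N i = mcomp M' i" using repD(6)[OF N'] by simp
      then show ?thesis by (simp only: image_image)
    qed
    show "indeterminate a \<odot>\<^bsub>M'\<^esub> B' (mv F u) = B' (mv F (mv (ac N a) u))" if a: "a \<le> n" for a u
      unfolding repD(7)[OF N' a mv_vec[OF dF]] mv_mult[symmetric] mmorD(2)[OF F a] ..
  qed
  then show ?thesis unfolding exact_at_def using N by blast
qed

lemma exact_at_arrow:
  fixes X Y :: "(nat set \<Rightarrow> 'k::field, 'm) gmodule"
  assumes U: "universal n TYPE('k) TYPE('m)" and w: "a0 \<le> n" "w a0 \<noteq> 0"
    and X: "X \<in> fgmod (EA n)" "indecomposable (EA n) X" and Y: "Y \<in> fgmod (EA n)" "indecomposable (EA n) Y"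
    and irr: "irreducible_hom (EA n) X Y f"
  shows "exact_at n w X \<longleftrightarrow> exact_at n w Y"
proof
  assume "exact_at n w X"
  then obtain N B where N: "rep n X N B" "indec n N" "exv n w N" "\<not> ffree n N" by (auto simp: exact_at_def)
  obtain N' B' where N': "rep n Y N' B'" by (rule fgmod_rep[OF Y(1)])
  obtain F where F: "mirr n N N' F" by (rule irreducible_mirr[OF U N(1) N' irr])
  obtain b where b: "\<not> kil n (\<lambda>a. if a = b then 1 else 0) N" using N(4) by (auto simp: ffree_def)
  note m = repD(2)[OF N(1)] and m' = repD(2)[OF N'] and i' = indecomposable_indec[OF N' Y(2)]
  have "exv n w N'" by (rule exv_forward[OF m N(2) m' F b N(3)])
  moreover have "\<not> ffree n N'" using free_not_adjacent[OF m N(2) m' i' F N(3) w] by blast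
  ultimately show "exact_at n w Y" unfolding exact_at_def using N' i' by blast
next
  assume "exact_at n w Y"
  then obtain N' B' where N': "rep n Y N' B'" "indec n N'" "exv n w N'" "\<not> ffree n N'" by (auto simp: exact_at_def)
  obtain N B where N: "rep n X N B" by (rule fgmod_rep[OF X(1)])
  obtain F where F: "mirr n N N' F" by (rule irreducible_mirr[OF U N N'(1) irr])
  obtain b where b: "\<not> kil n (\<lambda>a. if a = b then 1 else 0) N'" using N'(4) by (auto simp: ffree_def)
  note m = repD(2)[OF N] and m' = repD(2)[OF N'(1)] and i = indecomposable_indec[OF N X(2)]
  have "exv n w N" by (rule exv_backward[OF m m' N'(2) F b N'(3)])
  \<comment> \<open>The dual of a free module is free, and transposition turns an arrow out of N
    into an arrow into its dual, the situation of \<open>free_not_adjacent\<close>.\<close>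
  moreover have "\<not> ffree n N"
  proof
    assume "ffree n N"
    then have "ffree n (tpm N)" using kil_tpm by (auto simp: ffree_def)
    then show False
      by (rule free_not_adjacent[OF mmod_tpm[OF m'] indec_tpm[OF N'(2)] mmod_tpm[OF m] indec_tpm[OF i] mirr_tpm[OF F] exv_tpm[OF N'(3)] w])
  qed
  ultimately show "exact_at n w X" unfolding exact_at_def using N i by blast
qed

lemma rep_shift:
  assumes M: "rep n M N B" and s: "graded_right_module (EA n) (shift M i)"
  shows "rep n (shift M i) (N\<lparr>dg := \<lambda>j. dg N j - i\<rparr>) B"
proof -
  let ?N = "N\<lparr>dg := \<lambda>j. dg N j - i\<rparr>"
  have dh: "dhom d ?N ?N F" if "dhom d N N F" for d F using that by (auto simp: dhom_def)
  have v: "vec ?N = vec N" by (simp add: vec_def)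
  have vd: "vecd ?N j = vecd N (i + j)" for j by (auto simp: vecd_def)
  have m: "mmod n ?N" using repD(2)[OF M] dh by (auto simp: mmod_def)
  show ?thesis unfolding rep_def v vd
    using s m repD(3)[OF M] repD(4)[OF M] repD(5)[OF M] repD(6)[OF M] repD(7)[OF M] by (simp add: shift_def)
qed

lemma shift_free_exv:
  "ffree n (N\<lparr>dg := \<lambda>j. dg N j - i\<rparr>) \<Longrightarrow> ffree n N"
  "exv n w N \<Longrightarrow> exv n w (N\<lparr>dg := \<lambda>j. dg N j - i\<rparr>)"
proof -
  let ?N = "N\<lparr>dg := \<lambda>j. dg N j - i\<rparr>"
  have "x - i = y - i + d \<longleftrightarrow> x = y + d" for x y d :: int by auto
  then have dh: "dhom d ?N ?N F \<longleftrightarrow> dhom d N N F" for d F by (simp add: dhom_def)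
  have id: "idm ?N = idm N" and av: "av n w ?N = av n w N" by (simp_all add: idm_def av_def)
  show "ffree n ?N \<Longrightarrow> ffree n N" unfolding ffree_def kil_def dh id by simp
  show "exv n w N \<Longrightarrow> exv n w ?N" unfolding exv_def dh id av .
qed

lemma ar_vertex:
  assumes v: "v \<in> ar_vertices (EA n)"
  shows "M \<in> v \<Longrightarrow> M \<in> fgmod (EA n) \<and> indecomposable (EA n) M"
    and "M \<in> v \<Longrightarrow> M' \<in> v \<Longrightarrow> exact_at n w M \<Longrightarrow> exact_at n w M'"
proof -
  let ?I = "{M \<in> fgmod (EA n). indecomposable (EA n) M}"
  let ?r = "{(M, N). M \<in> ?I \<and> N \<in> ?I \<and> giso (EA n) M N}"
  have "v \<in> ?I // ?r" using v unfolding ar_vertices_def Let_def .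
  then obtain Z where Z: "v = ?r `` {Z}" by (rule quotientE)
  have in_v: "Z \<in> ?I \<and> A \<in> ?I \<and> giso (EA n) Z A" if "A \<in> v" for A using that unfolding Z by blast
  show "M \<in> v \<Longrightarrow> M \<in> fgmod (EA n) \<and> indecomposable (EA n) M" using in_v by blast
  assume M: "M \<in> v" "M' \<in> v" "exact_at n w M"
  have "exact_at n w Z" by (rule exact_at_iso[OF M(3)]) (use in_v[OF M(1)] in blast)+
  then show "exact_at n w M'" by (rule exact_at_iso) (use in_v[OF M(2)] in blast)+
qed

lemma component_vertex:
  assumes C: "C \<in> ar_components R"
  obtains v0 where "C = (ar_arrows R \<union> (ar_arrows R)\<inverse>)\<^sup>* `` {v0}" "\<forall>v\<in>C. v \<in> ar_vertices R"
proof -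
  let ?r = "ar_arrows R \<union> (ar_arrows R)\<inverse>"
  obtain v0 where v0: "C = ?r\<^sup>* `` {v0}" "v0 \<in> ar_vertices R" using C unfolding ar_components_def by (rule quotientE)
  have "v \<in> ar_vertices R" if "v \<in> C" for v
  proof -
    have "(v0, v) \<in> ?r\<^sup>*" using that v0(1) by blast
    then show ?thesis using v0(2) by induction (auto simp: ar_arrows_def)
  qed
  then show thesis using that v0(1) by blast
qed

lemma exact_at_component:
  fixes C :: "(nat set \<Rightarrow> 'k::field, 'm) gmodule set set"
  assumes U: "universal n TYPE('k) TYPE('m)" and w: "a0 \<le> n" "w a0 \<noteq> 0"
    and C: "C \<in> ar_components (EA n)" and X: "X \<in> \<Union>C" "exact_at n w X" and Y: "Y \<in> \<Union>C"
  shows "exact_at n w Y"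
proof -
  let ?r = "ar_arrows (EA n) \<union> (ar_arrows (EA n))\<inverse> :: ((nat set \<Rightarrow> 'k, 'm) gmodule set \<times> _) set"
  obtain v0 where v0: "C = ?r\<^sup>* `` {v0}" and VC: "\<forall>v\<in>C. v \<in> ar_vertices (EA n)"
    by (rule component_vertex[OF C])
  have V: "v \<in> ar_vertices (EA n)" if "v \<in> C" for v using VC that by blast
  obtain v1 where v1: "v1 \<in> C" "X \<in> v1" using X(1) by (rule UnionE)
  obtain v2 where v2: "v2 \<in> C" "Y \<in> v2" using Y by (rule UnionE)
  have p: "(v0, v1) \<in> ?r\<^sup>*" "(v0, v2) \<in> ?r\<^sup>*" using v1(1) v2(1) unfolding v0 by simp_all
  \<comment> \<open>The component is presented from a base vertex \<open>v0\<close>, but exactness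
    is known at \<open>v1\<close>; symmetry lets the path start there.\<close>
  have "sym ?r" by (auto simp: sym_def)
  then have "sym (?r\<^sup>*)" by (rule sym_rtrancl)
  then have "(v1, v0) \<in> ?r\<^sup>*" using p(1) by (rule symD)
  then have "(v1, v2) \<in> ?r\<^sup>*" using p(2) by (rule rtrancl_trans)
  then have "v2 \<in> ar_vertices (EA n) \<and> (\<forall>M\<in>v2. exact_at n w M)"
  proof induction
    case base
    show ?case
    proof (intro conjI ballI)
      show "v1 \<in> ar_vertices (EA n)" by (rule V[OF v1(1)])
      fix M assume "M \<in> v1"
      then show "exact_at n w M" by (rule ar_vertex(2)[OF V[OF v1(1)] v1(2) _ X(2)])
    qed
  next
    case (step u u')
    have "(u, u') \<in> ar_arrows (EA n) \<or> (u', u) \<in> ar_arrows (EA n)" using step.hyps(2) by simp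
    then have "u \<in> ar_vertices (EA n) \<and> u' \<in> ar_vertices (EA n) \<and>
        (\<exists>A\<in>u. \<exists>A'\<in>u'. \<exists>f. irreducible_hom (EA n) A A' f \<or> irreducible_hom (EA n) A' A f)"
      unfolding ar_arrows_def mem_Collect_eq prod.case by blast
    then obtain A A' f where uu: "u \<in> ar_vertices (EA n)" "u' \<in> ar_vertices (EA n)" and AA: "A \<in> u" "A' \<in> u'"
      and f: "irreducible_hom (EA n) A A' f \<or> irreducible_hom (EA n) A' A f" by blast
    have uA: "exact_at n w A" using step.IH AA(1) by blast
    have A: "A \<in> fgmod (EA n)" "indecomposable (EA n) A" using ar_vertex(1)[OF uu(1) AA(1)] by blast+
    have A': "A' \<in> fgmod (EA n)" "indecomposable (EA n) A'" using ar_vertex(1)[OF uu(2) AA(2)] by blast+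
    have "exact_at n w A'"
      using f
    proof
      assume "irreducible_hom (EA n) A A' f"
      from exact_at_arrow[where w = w, OF U w A A' this] uA show ?thesis by simp
    next
      assume "irreducible_hom (EA n) A' A f"
      from exact_at_arrow[where w = w, OF U w A' A this] uA show ?thesis by simp
    qed
    then have "exact_at n w M" if "M \<in> u'" for M using ar_vertex(2)[OF uu(2) AA(2) that] by blast
    then show ?case using uu(2) by blast
  qed
  then show ?thesis using v2(2) by blast
qed

theorem corollary3p5:
  fixes n :: nat
    and C :: "(nat set \<Rightarrow> 'k::alg_closed_field, 'm) gmodule set set"
    and L Y :: "(nat set \<Rightarrow> 'k, 'm) gmodule"
    and i :: int
  assumes "n \<ge> 1"
    and "C \<in> ar_components (exterior_algebra n)"
    and "linear_module (exterior_algebra n) L"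
    and "complexity_one (exterior_algebra n) L"
    and "shift L i \<in> \<Union>C"
    and "Y \<in> \<Union>C"
  shows "carrier (Ext (exterior_algebra n) 1 Y Y) \<noteq> {\<one>\<^bsub>Ext (exterior_algebra n) 1 Y Y\<^esub>}"
proof
  assume triv: "carrier (Ext (EA n) 1 Y Y) = {\<one>\<^bsub>Ext (EA n) 1 Y Y\<^esub>}"
  note inf = infinite_alg_closed[where 'k = 'k]
  have vert: "M \<in> fgmod (EA n) \<and> indecomposable (EA n) M" if M: "M \<in> \<Union>C" for M
  proof -
    obtain v where v: "v \<in> C" "M \<in> v" using M by (rule UnionE)
    have "v \<in> ar_vertices (EA n)" by (rule component_vertex[OF assms(2)]) (use v(1) in blast)
    then show ?thesis using ar_vertex(1) v(2) by blast
  qed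
  obtain N B where N: "rep n L N B" by (rule fgmod_rep[of L n]) (use assms(4) in \<open>auto simp: complexity_one_def\<close>)
  obtain w a0 where w: "a0 \<le> n" "w a0 \<noteq> 0" "exv n w N" using complexity_one_exv(2)[OF assms(1) inf assms(4) N] by blast
  have sL: "shift L i \<in> fgmod (EA n)" "indecomposable (EA n) (shift L i)" using vert[OF assms(5)] by blast+
  have gs: "graded_right_module (EA n) (shift L i)" using sL(1) by (simp add: fgmod_def)
  note rs = rep_shift[OF N gs]
  note ind = indecomposable_indec[OF rs sL(2)]
  have nf: "\<not> ffree n (N\<lparr>dg := \<lambda>j. dg N j - i\<rparr>)"
    using shift_free_exv(1) complexity_one_exv(1)[OF assms(1) inf assms(4) N] by blast
  have good: "exact_at n w (shift L i)" unfolding exact_at_def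
    using rs ind shift_free_exv(2)[OF w(3)] nf by blast
  \<comment> \<open>Indecomposability makes the shifted module nonzero, and this one nonzero module
    guarantees that \<open>'m\<close> has room for all the others.\<close>
  obtain j where "j \<in> ix (N\<lparr>dg := \<lambda>j. dg N j - i\<rparr>)" using ind by (auto simp: indec_def)
  then have U: "universal n TYPE('k) TYPE('m)" by (rule universalI[OF inf rs])
  have "exact_at n w Y" by (rule exact_at_component[OF U w(1,2) assms(2,5) good assms(6)])
  then obtain N' B' where Y: "rep n Y N' B'" "exv n w N'" "\<not> ffree n N'" by (auto simp: exact_at_def)
  have "rigid n N'" by (rule Ext_trivial_rigid[OF U Y(1) triv])
  then have "exv n w' N'" if "\<exists>a\<le>n. w' a \<noteq> 0" for w'
    using rigid_exv[OF repD(2)[OF Y(1)] _ Y(2)] that by blast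
  then have "ffree n N'" by (rule exact_imp_free[OF repD(2)[OF Y(1)]])
  then show False using Y(3) by blast
qed

end
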